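(* Let $N\ge 3$, $k>0$, $\alpha>\frac{N+1}{2}$, and let $f:\mathbb{R}^N\times\mathbb{C}\to\mathbb{C}$ be a continuous function satisfying $$\sup_{|u|\le M,\,x\in\mathbb{R}^N}\langle x\rangle^\alpha|f(x,u)|<\infty\qquad\text{for all } M>0.$$ Suppose that one of the following assumptions is satisfied: $(f_1)$ $f(x,u)=a(x)u+b(x,u)$ with $a\in L^\infty_\alpha(\mathbb{R}^N,\mathbb{R})$ and $$\sup_{|u|\le M,\,x\in\mathbb{R}^N}\langle x\rangle^\alpha|b(x,u)|=o(M)\qquad\text{as } M\to+\infty.$$ $(f_2)$ There exist $Q,b\in L^\infty_\alpha(\mathbb{R}^N,\mathbb{R})$ with $\|Q\|_{L^\infty_\alpha}<\frac{1}{\kappa_\alpha}$ and $$|f(x,u)|\le Q(x)|u|+b(x)\qquad\text{for all }(x,u)\in\mathbb{R}^N\times\mathbb{C}.$$ Then, for any given solution $\varphi\in L^\infty(\mathbb{R}^N)$ of the homogeneous Helmholtz equation $\Delta\varphi+k^2\varphi=0$, the equation $$u=\mathcal{R}_k(N_f(u))+\varphi$$ admits a solution $u\in L^\infty(\mathbb{R}^N)$.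
   Context: $L^\infty(\mathbb{R}^N)$ consists of complex-valued functions, and $\langle x\rangle=(1+|x|^2)^{1/2}$. For $\alpha\in\mathbb{R}$, $L^\infty_\alpha(\mathbb{R}^N)$ is the space of measurable $w:\mathbb{R}^N\to\mathbb{C}$ with $\|w\|_{L^\infty_\alpha}:=\|\langle\cdot\rangle^\alpha w\|_{L^\infty(\mathbb{R}^N)}<\infty$; $L^\infty_\alpha(\mathbb{R}^N,\mathbb{R})$ is its subspace of real-valued functions. The outgoing fundamental solution is $$\Phi_k(x)=\frac{i}{4}\Big(\frac{k}{2\pi|x|}\Big)^{\frac{N-2}{2}}H^{(1)}_{\frac{N-2}{2}}(k|x|),\qquad x\in\mathbb{R}^N\setminus\{0\},$$ where $H^{(1)}_\nu$ is the Hankel function of the first kind of order $\nu$, and $\mathcal{R}_kf=\Phi_k*f$. $N_f$ is the substitution operator $N_f(u)(x)=f(x,u(x))$. For $\alpha>\frac{N+1}{2}$ set $\tau(\alpha)=\alpha-\frac{N+1}{2}$ if $\frac{N+1}{2}<\alpha<N$ and $\tau(\alpha)=\frac{N-1}{2}$ if $\alpha\ge N$, and $$\kappa_\alpha:=\sup\Big\{\big\||\Phi_k|*w\big\|_{L^\infty_{\tau(\alpha)}}:\ w\in L^\infty_\alpha(\mathbb{R}^N),\ \|w\|_{L^\infty_\alpha}=1\Big\}.$$ *)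

theory Defs
  imports "HOL-Analysis.Analysis" "HOL-Probability.Essential_Supremum"
begin

definition japanese_bracket :: "'a::real_normed_vector \<Rightarrow> real" where
  "japanese_bracket x = sqrt (1 + (norm x)\<^sup>2)"

text \<open>Elements of \<open>L\<^sup>\<infinity>\<close> are represented by functions; identities between them hold almost
  everywhere. Norms are extended reals, so that an essentially unbounded function has norm \<open>\<infinity>\<close>
  (and so has, by the convention of \<^const>\<open>esssup\<close>, a function whose norm is not measurable).\<close>

definition Linf_norm :: "(real^'n \<Rightarrow> 'b::real_normed_vector) \<Rightarrow> ereal" where
  "Linf_norm w = esssup lebesgue (\<lambda>x. ereal (norm (w x)))"

definition Linf :: "(real^'n \<Rightarrow> 'b::real_normed_vector) set" where
  "Linf = {w. w \<in> borel_measurable lebesgue \<and> Linf_norm w < \<infinity>}"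

definition wLinf_norm :: "real \<Rightarrow> (real^'n \<Rightarrow> 'b::real_normed_vector) \<Rightarrow> ereal" where
  "wLinf_norm \<alpha> w = Linf_norm (\<lambda>x. (japanese_bracket x powr \<alpha>) *\<^sub>R w x)"

definition wLinf :: "real \<Rightarrow> (real^'n \<Rightarrow> 'b::real_normed_vector) set" where
  "wLinf \<alpha> = {w. w \<in> borel_measurable lebesgue \<and> wLinf_norm \<alpha> w < \<infinity>}"

text \<open>Bessel functions of real order at an argument \<open>x > 0\<close>. Using the reciprocal Gamma function,
  the terms of the series at poles of Gamma vanish, so the series also defines \<open>J\<^sub>\<nu>\<close> for
  negative integers \<open>\<nu>\<close>.\<close>

definition bessel_J :: "real \<Rightarrow> real \<Rightarrow> real" where
  "bessel_J \<nu> x =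
    (\<Sum>m. (-1) ^ m * rGamma (real m + \<nu> + 1) / fact m * (x / 2) powr (2 * real m + \<nu>))"

definition bessel_Y :: "real \<Rightarrow> real \<Rightarrow> real" where
  "bessel_Y \<nu> x =
    (let g = (\<lambda>\<mu>. (bessel_J \<mu> x * cos (\<mu> * pi) - bessel_J (- \<mu>) x) / sin (\<mu> * pi))
     in if \<nu> \<in> \<int> then Lim (at \<nu>) g else g \<nu>)"

definition hankel1 :: "real \<Rightarrow> real \<Rightarrow> complex" where
  "hankel1 \<nu> x = Complex (bessel_J \<nu> x) (bessel_Y \<nu> x)"

text \<open>The value at the singularity \<open>x = 0\<close> is irrelevant: \<open>{0}\<close> is a null set and the function is
  only used under integrals.\<close>

definition fund_sol :: "real \<Rightarrow> real^'n \<Rightarrow> complex" where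
  "fund_sol k x =
    (let \<nu> = (real CARD('n) - 2) / 2
     in \<i> / 4 * complex_of_real ((k / (2 * pi * norm x)) powr \<nu>) * hankel1 \<nu> (k * norm x))"

definition convolution ::
    "(real^'n \<Rightarrow> complex) \<Rightarrow> (real^'n \<Rightarrow> complex) \<Rightarrow> real^'n \<Rightarrow> complex" where
  "convolution g w x = (LINT y|lebesgue. g (x - y) * w y)"

definition resolvent :: "real \<Rightarrow> (real^'n \<Rightarrow> complex) \<Rightarrow> real^'n \<Rightarrow> complex" where
  "resolvent k h = convolution (fund_sol k) h"

definition subst_op ::
    "(real^'n \<Rightarrow> complex \<Rightarrow> complex) \<Rightarrow> (real^'n \<Rightarrow> complex) \<Rightarrow> real^'n \<Rightarrow> complex" where
  "subst_op f u x = f x (u x)"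

text \<open>Only meaningful for \<open>\<alpha> > (N + 1) / 2\<close>.\<close>

definition tau :: "nat \<Rightarrow> real \<Rightarrow> real" where
  "tau N \<alpha> = (if \<alpha> < real N then \<alpha> - (real N + 1) / 2 else (real N - 1) / 2)"

definition kappa :: "'n::finite itself \<Rightarrow> real \<Rightarrow> real \<Rightarrow> ereal" where
  "kappa (_ :: 'n itself) k \<alpha> =
    (SUP w \<in> {w :: real^'n \<Rightarrow> complex. w \<in> wLinf \<alpha> \<and> wLinf_norm \<alpha> w = 1}.
       wLinf_norm (tau CARD('n) \<alpha>)
         (convolution (\<lambda>x. complex_of_real (cmod (fund_sol k x))) w))"

definition partial_deriv :: "'n \<Rightarrow> (real^'n \<Rightarrow> complex) \<Rightarrow> real^'n \<Rightarrow> complex" where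
  "partial_deriv i \<psi> x = vector_derivative (\<lambda>t. \<psi> (x + t *\<^sub>R axis i 1)) (at 0)"

definition laplacian :: "(real^'n \<Rightarrow> complex) \<Rightarrow> real^'n \<Rightarrow> complex" where
  "laplacian \<psi> x = (\<Sum>i\<in>UNIV. partial_deriv i (partial_deriv i \<psi>) x)"

text \<open>\<open>C\<^sup>\<infinity>\<close>: iterated partial derivatives of every order exist and are continuous.\<close>

definition smooth :: "(real^'n \<Rightarrow> complex) \<Rightarrow> bool" where
  "smooth \<psi> \<longleftrightarrow>
    (\<forall>is. continuous_on UNIV (foldr partial_deriv is \<psi>) \<and>
      (\<forall>i x. (\<lambda>t::real. foldr partial_deriv is \<psi> (x + t *\<^sub>R axis i 1)) differentiable (at 0)))"

definition test_function :: "(real^'n \<Rightarrow> complex) \<Rightarrow> bool" where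
  "test_function \<psi> \<longleftrightarrow> smooth \<psi> \<and> compact (closure {x. \<psi> x \<noteq> 0})"

text \<open>\<open>\<Delta>\<phi> + k\<^sup>2 \<phi> = 0\<close> in the sense of distributions on \<open>\<real>\<^sup>N\<close>, the meaning of the equation for
  \<open>\<phi> \<in> L\<^sup>\<infinity>\<close>.\<close>

definition helmholtz_solution :: "real \<Rightarrow> (real^'n \<Rightarrow> complex) \<Rightarrow> bool" where
  "helmholtz_solution k \<phi> \<longleftrightarrow>
    (\<forall>\<psi>. test_function \<psi> \<longrightarrow>
      (LINT x|lebesgue. \<phi> x * (laplacian \<psi> x + complex_of_real (k\<^sup>2) * \<psi> x)) = 0)"

text \<open>\<open>sup {\<langle>x\<rangle>\<^sup>\<alpha> |g(x,u)| : x \<in> \<real>\<^sup>N, |u| \<le> M}\<close>; an extended real, since a real-valued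
  supremum of an unbounded set would be a meaningless finite number.\<close>

definition growth :: "real \<Rightarrow> (real^'n \<Rightarrow> complex \<Rightarrow> complex) \<Rightarrow> real \<Rightarrow> ereal" where
  "growth \<alpha> g M =
    (SUP (x, u) \<in> {(x, u). cmod u \<le> M}. ereal (japanese_bracket x powr \<alpha> * cmod (g x u)))"

end

theory Submission
  imports Defs "HOL-Complex_Analysis.Great_Picard"
begin

text \<open>The solutions are the fixed points of a compact map on the bounded continuous functions, so by
 Schaefer's theorem it suffices to bound all solutions of \<open>v = c R\<^sub>k(f(\<cdot>, v + \<phi>))\<close>, \<open>0 \<le> c \<le> 1\<close>.
 Compactness of \<open>R\<^sub>k\<close> comes from the decay of its values and from the continuity of translation of the
 kernel. Under \<open>(f\<^sub>2)\<close> the bound is a contraction estimate with the factor \<open>\<kappa>\<^sub>\<alpha> \<parallel>Q\<parallel>\<close>. Under \<open>(f\<^sub>1)\<close>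
 normalised unbounded solutions converge to a nonzero bounded solution of \<open>u = R\<^sub>k(au)\<close> with \<open>a\<close> real, which
 cannot exist: since the imaginary part of \<open>\<Phi>\<^sub>k\<close> is an average of plane waves, it is positive
 semidefinite, and testing with \<open>au\<close> gives \<open>Im \<Phi>\<^sub>k * (au) = 0\<close>; this
 cancels the leading far field of \<open>\<Phi>\<^sub>k\<close>, so that \<open>u\<close> decays faster; finally a virial (Carleman) inequality
 with a bounded radial weight, applied to mollifications of \<open>u\<close>, yields \<open>u = 0\<close>. No regularity theory
 for the Helmholtz equation is needed, since only \<open>(\<Delta> + k\<^sup>2) (\<eta> * u) = c \<eta> * (au)\<close> is used.\<close>

text \<open>The kernel decays only like |x|^(-(N-1)/2), so a bounded solution of u = R_k(au) need
  not a priori be square integrable, and quadratic identities on the whole space are out of reach.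
  Decay of order (N+1)/2 removes the obstacle: it makes u square integrable and makes the flux of
  the virial field, which contains x times quadratic terms, vanish at infinity. The missing power is
  won because the far field of Re Phi_k agrees, up to an error of order (N+1)/2, with a combination
  of Im Phi_k and its radial derivative. The Carleman weight is bounded because u decays only
  polynomially; its strength is a free parameter because \<open>a\<close> may be large, and it can
  absorb \<open>a\<close> because alpha > 2 when N >= 3. The unknown is v = u - phi, which is
  continuous although phi is only bounded and measurable. Under (f1) the coefficient
  \<open>a\<close> is itself continuous, as a uniform limit of f(x,n)/n, and the parameter c of
  Schaefer's theorem merely rescales it by a real factor.\<close>

abbreviation (input) cont where "cont f == continuous_on UNIV f"
abbreviation (input) bmeas where "bmeas == borel_measurable borel"
abbreviation (input) lmeas where "lmeas == borel_measurable lborel"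
abbreviation (input) Lmeas where "Lmeas == borel_measurable lebesgue"
abbreviation (input) intble where "intble f == integrable lborel f"
abbreviation (input) seq_tendsto (infixr "---->" 60) where "X ----> L == X \<longlonglongrightarrow> L"
notation (input) inner (infix "*." 70)
notation (input) scaleR (infixr "*R" 75)
lemmas L1_bound = Bochner_Integration.integrable_bound and L1_add = Bochner_Integration.integrable_add
  and L1_diff = Bochner_Integration.integrable_diff and L1_sum = Bochner_Integration.integrable_sum
  and Lint_add = Bochner_Integration.integral_add and Lint_cong = Bochner_Integration.integral_cong
  and Lint_diff = Bochner_Integration.integral_diff and Lint_nonneg = Bochner_Integration.integral_nonneg
  and Lint_norm_bound_integral = Bochner_Integration.integral_norm_bound_integral and Lint_sum = Bochner_Integration.integral_sum
abbreviation (input) cor where "cor == complex_of_real"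
abbreviation (input) Phi where "Phi == fund_sol"
abbreviation (input) resolvent_decay where "resolvent_decay (_ :: 'n::finite itself) k aa g C ==
 ALL (w :: real^'n => complex) A x. w : Lmeas --> (ALL y. norm (w y) <= A * japanese_bracket y powr (- aa)) -->
  integrable lebesgue (%y. Phi k (x - y) * w y) & norm (resolvent k w x) <= C * A * japanese_bracket x powr (- g)"
abbreviation (input) bcf where "bcf == apply_bcontfun"

section \<open>Schaefer's fixed point theorem\<close>

text \<open>Kuhn's labelling argument: a cell of a fine grid that carries both labels in every
  coordinate has corners where a given component of g(x) - x is nonnegative and corners where it is
  nonpositive, so uniform continuity makes that component small. Points are functions on
  \<open>nat\<close> because the dimension will be the size of a finite net and cannot be a
  type.\<close>

lemma approximate_fixpoint_cube:
 fixes g :: "(nat => real) => nat => real" and n :: nat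
 defines "Q == {x. ALL i<n. 0 <= x i & x i <= 1}"
 assumes maps: "!!x i. x : Q ==> i < n ==> 0 <= g x i & g x i <= 1"
  and uc: "!!e. e > 0 ==> EX d>0. ALL x:Q. ALL y:Q. (ALL i<n. abs (x i - y i) <= d) --> (ALL i<n. abs (g x i - g y i) < e)"
  and e: "e > 0"
 shows "EX x:Q. ALL i<n. abs (g x i - x i) <= e"
proof -
 obtain d where d: "d > 0" and dd: "!!x y i. x : Q ==> y : Q ==> (ALL i<n. abs (x i - y i) <= d) ==> i < n ==> abs (g x i - g y i) < e / 2"
  using uc[of "e/2"] e by (metis half_gt_zero)
 \<comment> \<open>With this mesh a move inside a cell changes g by less than e/2 and the point
   itself by less than e/2, hence the displacement by at most e.\<close>
 obtain p :: nat where p: "p > 0" "1 / real p < min d (e / 2)" using reals_Archimedean[of "min d (e/2)"] d e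
  by (metis half_gt_zero inverse_eq_divide min_less_iff_conj zero_less_Suc)
 define X where "X q = (%i. real (q i) / real p)" for q :: "nat => nat"
 have XQ: "X q : Q" if "ALL i<n. q i <= p" for q using that p by (auto simp: X_def Q_def divide_le_eq)
 \<comment> \<open>The first two cases force the boundary labels that \<open>kuhn_lemma\<close> asks
   for; they are compatible with the sign of the displacement because g maps the cube into
   itself.\<close>
 define label :: "(nat => nat) => nat => nat" where
  "label q i = (if q i = 0 then 0 else if q i = p then 1 else if g (X q) i >= X q i then 0 else 1)" for q i
 obtain q where q: "ALL i<n. q i < p" and rs: "ALL i<n. EX r s. (ALL j<n. q j <= r j & r j <= q j + 1) & (ALL j<n. q j <= s j & s j <= q j + 1) & label r i ~= label s i"
  by (rule kuhn_lemma[of p n label]) (use p in "auto simp: label_def")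
 have qQ: "X q : Q" using q by (intro XQ) auto
 have near: "(ALL i<n. abs (X r i - X q i) <= 1 / real p) & X r : Q" if r: "ALL j<n. q j <= r j & r j <= q j + 1" for r
 proof
  show "ALL i<n. abs (X r i - X q i) <= 1 / real p"
  proof (intro allI impI)
   fix i assume "i < n"
   hence "abs (real (r i) - real (q i)) <= 1" using r by (fastforce simp: abs_le_iff)
   thus "abs (X r i - X q i) <= 1 / real p"
    unfolding X_def using p by (simp add: diff_divide_distrib[symmetric] abs_divide divide_right_mono)
  qed
  show "X r : Q" using r q by (intro XQ) (metis Suc_eq_plus1 Suc_leI le_trans)
 qed
 have low: "g (X r) i - X r i >= 0" if "label r i = 0" "ALL j<n. q j <= r j & r j <= q j + 1" "i < n" for r i
  using that near[of r] maps[of "X r" i] p unfolding label_def by (auto simp: X_def split: if_splits)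
 have high: "g (X r) i - X r i <= 0" if "label r i ~= 0" "ALL j<n. q j <= r j & r j <= q j + 1" "i < n" for r i
  using that near[of r] maps[of "X r" i] p unfolding label_def by (auto simp: X_def split: if_splits)
 have cmp: "abs ((g (X r) i - X r i) - (g (X q) i - X q i)) <= e" if "ALL j<n. q j <= r j & r j <= q j + 1" "i < n" for r i
 proof -
  have "abs (X r i - X q i) < e / 2" using near[OF that(1)] that(2) p by force
  moreover have "abs (g (X r) i - g (X q) i) < e / 2" using near[OF that(1)] that(2) p qQ by (intro dd) force+
  ultimately show ?thesis by linarith
 qed
 have "abs (g (X q) i - X q i) <= e" if i: "i < n" for i
 proof -
  obtain r s where r: "ALL j<n. q j <= r j & r j <= q j + 1" and s: "ALL j<n. q j <= s j & s j <= q j + 1"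
   and "label r i ~= label s i" using rs i by blast
  moreover have "label r i <= 1" "label s i <= 1" by (simp_all add: label_def)
  ultimately consider "label r i = 0 & label s i ~= 0" | "label s i = 0 & label r i ~= 0" by linarith
  thus ?thesis using low[OF _ r i] high[OF _ s i] low[OF _ s i] high[OF _ r i] cmp[OF r i] cmp[OF s i]
   by cases (simp; linarith)+
 qed
 thus ?thesis using qQ by blast
qed

text \<open>The set is an iterated Minkowski sum of segments; building it this way avoids a topology
  on \<open>nat => real\<close>. Its compactness will supply the uniform continuity of the partition
  functions.\<close>

lemma compact_unit_coefficient_sums:
 fixes y :: "nat => 'a::real_normed_vector"
 shows "compact {(SUM j<m. x j *R y j) | x. ALL i<m. 0 <= x i & x i <= (1::real)}"
proof (induction m)
 case 0
 thus ?case by simp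
next
 case (Suc m)
 let ?C = "%m. {(SUM j<m. x j *R y j) | x. ALL i<m. 0 <= x i & x i <= (1::real)}"
 have "?C (Suc m) = {u + v | u v. u : ?C m & v : (%t. t *R y m) ` {0..1}}" (is "_ = ?R")
 proof
  show "?C (Suc m) \<subseteq> ?R" by (fastforce simp: less_Suc_eq)
  show "?R \<subseteq> ?C (Suc m)"
  proof clarify
   fix x :: "nat => real" and t :: real assume "ALL i<m. 0 <= x i & x i <= 1" "t : {0..1}"
   thus "EX x'. (SUM j<m. x j *R y j) + t *R y m = (SUM j<Suc m. x' j *R y j) & (ALL i<Suc m. 0 <= x' i & x' i <= 1)"
    by (intro exI[of _ "x(m := t)"]) (auto simp: less_Suc_eq intro!: sum.cong)
  qed
 qed
 moreover have "compact ((%t. t *R y m) ` {0..1::real})" by (intro compact_continuous_image continuous_intros) auto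
 ultimately show ?case using compact_sums[OF Suc] by simp
qed

definition radial_retraction :: "real => 'a::real_normed_vector => 'a" where
 "radial_retraction R v = (R / max R (norm v)) *R v"

lemma radial_retraction:
 fixes v :: "'a::real_normed_vector"
 assumes "R > 0"
 shows "norm (radial_retraction R v) <= R"
  and "norm v <= R ==> radial_retraction R v = v"
  and "cont (radial_retraction R :: 'a => 'a)"
proof -
 show "norm (radial_retraction R v) <= R"
 proof -
  have "norm v <= max R (norm v)" by simp
  thus ?thesis using assms by (simp add: radial_retraction_def abs_of_pos divide_le_eq max_def mult.commute)
 qed
 show "norm v <= R ==> radial_retraction R v = v" using assms by (simp add: radial_retraction_def max_def)
 have "max R (norm u) ~= 0" for u :: 'a using assms by (metis less_max_iff_disj order_less_irrefl)
 thus "cont (radial_retraction R :: 'a => 'a)" unfolding radial_retraction_def by (intro continuous_intros ballI) simp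
qed

text \<open>Schauder projection: a partition of unity for an e/2-net of K replaces T by finitely
  many weights. The weights at the combination S x define a self-map of the coefficient cube, and an
  approximate fixed point x of that map yields v = S x. Coefficients range over the whole cube, not
  over a simplex, which fits Kuhn's lemma.\<close>

lemma compact_map_approximate_fixpoint:
 fixes T :: "'a::real_normed_vector => 'a"
 assumes cont: "cont T" and K: "compact K" "range T \<subseteq> K" and e: "e > 0"
 shows "EX v. norm (v - T v) <= e"
proof -
 obtain Y where Y: "Y \<subseteq> K" "finite Y" "K \<subseteq> (\<Union>x\<in>Y. ball x (e/2))"
  using compactE_image[OF K(1), of K "%x. ball x (e/2)"] e by (metis UN_I centre_in_ball half_gt_zero open_ball subsetI)
 obtain y :: "nat => 'a" and m where y: "Y = y ` {..<m}"
  using finite_imp_nat_seg_image_inj_on[OF Y(2)] by (metis lessThan_def)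
 \<comment> \<open>Tent functions of radius e/2: only net points close to T u receive
   weight.\<close>
 define w where "w i u = max 0 (e/2 - norm (T u - y i))" for i u
 define W where "W u = (SUM i<m. w i u)" for u
 have w0: "w i u >= 0" for i u by (simp add: w_def)
 have Wpos: "W u > 0" for u
 proof -
  obtain i where i: "i < m" "norm (T u - y i) < e/2" using Y(3) K(2) y by (force simp: dist_norm norm_minus_commute)
  hence "w i u > 0" by (simp add: w_def)
  thus ?thesis unfolding W_def using i w0 by (intro sum_pos2[of _ i]) auto
 qed
 define h where "h u i = w i u / W u" for u i
 have h0: "h u i >= 0" for u i using w0 Wpos[of u] by (simp add: h_def)
 have hsum: "(SUM i<m. h u i) = 1" for u using Wpos[of u] by (simp add: h_def W_def sum_divide_distrib[symmetric])
 have h1: "h u i <= 1" if "i < m" for u i using member_le_sum[of i "{..<m}" "h u"] h0 hsum[of u] that by auto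
 have hcont: "cont (%u. h u i)" for i unfolding h_def w_def W_def
  by (intro continuous_intros cont) (use Wpos in "auto simp: W_def w_def less_imp_neq[THEN not_sym]")
 define Q where "Q = {x::nat=>real. ALL i<m. 0 <= x i & x i <= 1}"
 define S where "S x = (SUM j<m. x j *R y j)" for x
 \<comment> \<open>A Lipschitz constant of S for the maximum norm of the coefficients; the summand 1
   keeps it positive in degenerate cases.\<close>
 define B where "B = 1 + (SUM j<m. norm (y j))"
 have B: "B > 0" unfolding B_def by (simp add: add_pos_nonneg sum_nonneg)
 have Slip: "norm (S x - S x') <= d * B" if "ALL i<m. abs (x i - x' i) <= d" "d >= 0" for x x' d
 proof -
  have "norm (S x - S x') = norm (SUM j<m. (x j - x' j) *R y j)" by (simp add: S_def sum_subtractf scaleR_diff_left)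
  also have "... <= (SUM j<m. d * norm (y j))" using that by (intro sum_norm_le) (auto intro!: mult_right_mono)
  also have "... <= d * B" using that by (simp add: B_def sum_distrib_left[symmetric] mult_left_mono)
  finally show ?thesis .
 qed
 have "EX x:Q. ALL i<m. abs (h (S x) i - x i) <= e / (2 * B)" unfolding Q_def
 proof (rule approximate_fixpoint_cube, goal_cases)
  case (2 e')
  define C where "C = {S x | x. x : Q}"
  have C: "compact C" using compact_unit_coefficient_sums[where m = m and y = y] unfolding C_def S_def Q_def by auto
  have "EX d>0. ALL u:C. ALL v:C. dist u v < d --> abs (h u i - h v i) < e'" for i
   using compact_uniformly_continuous[OF continuous_on_subset[OF hcont] C, of i] 2
   unfolding uniformly_continuous_on_def by (metis dist_commute dist_real_def subset_UNIV)
  then obtain d where d: "!!i. d i > 0" "!!i u v. u : C ==> v : C ==> dist u v < d i ==> abs (h u i - h v i) < e'" by metis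
  define D where "D = Min (insert 1 (d ` {..<m}))"
  have D: "D > 0" "!!i. i < m ==> D <= d i" using d(1) by (auto simp: D_def)
  show ?case
  proof (intro exI[of _ "D / (2 * B)"] conjI ballI impI allI)
   show "D / (2 * B) > 0" using D B by simp
   fix x x' i assume x: "x : {x. ALL i<m. 0 <= x i & x i <= 1}" "x' : {x. ALL i<m. 0 <= x i & x i <= 1}"
    "ALL i<m. abs (x i - x' i) <= D / (2 * B)" and i: "i < m"
   have "dist (S x) (S x') <= D / 2" using Slip[of x x' "D / (2 * B)"] x(3) D(1) B by (simp add: dist_norm)
   hence "dist (S x) (S x') < d i" using D i by fastforce
   thus "abs (h (S x) i - h (S x') i) < e'" using x by (intro d(2)) (auto simp: C_def Q_def)
  qed
 qed (use h0 h1 e B in auto)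
 then obtain x where x: "x : Q" "ALL i<m. abs (h (S x) i - x i) <= e / (2 * B)" by blast
 define v where "v = S x"
 have "norm (S (h v) - v) <= e / 2" using Slip[of "h v" x "e / (2*B)"] x(2) e B unfolding v_def by simp
 moreover have "norm (S (h v) - T v) <= e / 2"
 proof -
  \<comment> \<open>Because the weights sum to 1, the difference is an average of the vectors y j -
    T v, and those with positive weight have norm at most e/2.\<close>
  have "S (h v) - T v = (SUM j<m. h v j *R (y j - T v))"
   by (simp add: S_def scaleR_diff_right sum_subtractf scaleR_sum_left[symmetric] hsum)
  also have "norm ... <= (SUM j<m. h v j * (e/2))"
  proof (intro sum_norm_le)
   fix j assume "j : {..<m}"
   show "norm (h v j *R (y j - T v)) <= h v j * (e/2)"
   proof (cases "norm (T v - y j) <= e/2")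
    case True thus ?thesis using mult_left_mono[OF True h0[of v j]] by (simp add: norm_minus_commute abs_of_nonneg[OF h0])
   next
    case False hence "h v j = 0" by (simp add: h_def w_def)
    thus ?thesis by simp
   qed
  qed
  also have "... = (SUM j<m. h v j) * (e/2)" by (rule sum_distrib_right[symmetric])
  also have "... = e/2" by (simp only: hsum mult_1)
  finally show ?thesis .
 qed
 ultimately have "norm (v - T v) <= e" using norm_triangle_ineq4[of "S (h v) - T v" "S (h v) - v"] by simp
 thus ?thesis by blast
qed

text \<open>Composing T with the retraction onto the ball of radius R gives a map with relatively
  compact range. If a fixed point l of the composition had norm above R, its retraction z would lie
  on the sphere and satisfy z = c T z with c = R / norm l < 1, against the a priori bound.
  Compactness is stated through subsequences, the form that the Arzela-Ascoli theorem
  delivers.\<close>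

theorem schaefer_fixpoint:
 fixes T :: "'a::real_normed_vector => 'a"
 assumes cont: "cont T" and comp: "!!v M. ALL n::nat. norm (v n) <= M ==> EX r l. strict_mono r & (%n. T (v (r n))) ----> l"
  and apriori: "!!v c. 0 <= c ==> c <= 1 ==> v = c *R T v ==> norm v < R"
 shows "EX v. v = T v"
proof -
 have R: "R > 0" using apriori[of 0 0] by simp
 define F where "F = T o radial_retraction R"
 have Fcont: "cont F" unfolding F_def
  by (rule continuous_on_compose[OF radial_retraction(3)[OF R] continuous_on_subset[OF cont]]) simp
 have seq: "EX r l. strict_mono r & (%n. F (v (r n))) ----> l" for v :: "nat => 'a"
  unfolding F_def comp_def by (rule comp[of "%n. radial_retraction R (v n)" R]) (simp add: radial_retraction(1)[OF R])
 have K: "compact (closure (range F))" unfolding compact_def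
 proof (intro allI impI)
  fix f :: "nat => 'a" assume f: "ALL n. f n : closure (range F)"
  have "EX v. dist (F v) (f n) < inverse (Suc n)" for n using f[rule_format, of n] unfolding closure_approachable
   by (elim allE[of _ "inverse (real (Suc n))"]) auto
  then obtain v where v: "!!n. dist (F (v n)) (f n) < inverse (Suc n)" by metis
  obtain r l where r: "strict_mono r" "(%n. F (v (r n))) ----> l" using seq[of v] by blast
  have "(%n. f n - F (v n)) ----> 0" by (rule Lim_null_comparison[OF _ LIMSEQ_inverse_real_of_nat])
    (use v in "auto simp: dist_norm norm_minus_commute intro!: always_eventually less_imp_le")
  hence "(%n. f (r n) - F (v (r n))) ----> 0" using LIMSEQ_subseq_LIMSEQ[OF _ r(1)] by (auto simp: comp_def)
  from tendsto_add[OF this r(2)] have "(f o r) ----> l" by (simp add: comp_def)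
  moreover from this have "l : closure (range F)" using f closed_sequentially[of "closure (range F)" "f o r" l] by auto
  ultimately show "EX l:closure (range F). EX r. strict_mono r & (f o r) ----> l" using r(1) by blast
 qed
 have "EX v. norm (v - F v) <= inverse (real (Suc n))" for n
  by (rule compact_map_approximate_fixpoint[OF Fcont K closure_subset]) simp
 then obtain v where v: "!!n. norm (v n - F (v n)) <= inverse (real (Suc n))" by metis
 obtain r l where r: "strict_mono r" "(%n. F (v (r n))) ----> l" using seq[of v] by blast
 have "(%n. v n - F (v n)) ----> 0" by (rule Lim_null_comparison[OF _ LIMSEQ_inverse_real_of_nat]) (use v in auto)
 hence "(%n. v (r n) - F (v (r n))) ----> 0" using LIMSEQ_subseq_LIMSEQ[OF _ r(1)] by (auto simp: comp_def)
 from tendsto_add[OF this r(2)] have vl: "(%n. v (r n)) ----> l" by simp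
 have "(%n. F (v (r n))) ----> F l" using continuous_on_tendsto_compose[OF Fcont vl] by simp
 hence l: "l = F l" using r(2) LIMSEQ_unique by blast
 define z where "z = radial_retraction R l"
 have Tz: "T z = l" using l by (simp add: F_def z_def)
 have "norm l <= R"
 proof (rule ccontr)
  assume "~ norm l <= R"
  hence *: "z = (R / norm l) *R T z" "norm z = R" using R Tz by (auto simp: z_def radial_retraction_def max_def)
  have "norm z < R" by (rule apriori[OF _ _ *(1)]) (use `~ norm l <= R` R in "auto simp: divide_le_eq")
  thus False using * by simp
 qed
 hence "z = l" by (simp add: z_def radial_retraction(2)[OF R])
 thus ?thesis using Tz by metis
qed

section \<open>Bessel functions\<close>

text \<open>The shape of a Bessel series in the variable s = x^2/4 once the power of x is split off.
  The coefficients stay abstract because the same calculus is needed for 1/Gamma and for its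
  derivative.\<close>

definition fact_series :: "(nat => real) => real => real" where
 "fact_series a s = (\<Sum>m. a m / fact m * (- s) ^ m)"

lemma summable_fact_series_abs:
 fixes s B :: real
 assumes "!!m. abs (a m) <= B"
 shows "summable (%m. a m / fact m * s ^ m)"
proof (rule summable_comparison_test')
 show "summable (%m. B * (abs s ^ m / fact m))"
  using summable_exp[of "abs s"] by (intro summable_mult) (simp add: divide_inverse mult.commute)
 show "norm (a m / fact m * s ^ m) <= B * (abs s ^ m / fact m)" if "m >= 0" for m
  using assms[of m] by (simp add: abs_mult power_abs divide_right_mono mult_right_mono)
qed

lemma DERIV_fact_series:
 assumes "!!m. abs (a m) <= B"
 shows "DERIV (fact_series a) s :> - fact_series (%m. a (Suc m)) s"
proof -
 have "DERIV (%x. \<Sum>m. a m / fact m * x ^ m) (- s) :> (\<Sum>m. diffs (%m. a m / fact m) m * (-s) ^ m)"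
  by (rule termdiffs_strong_converges_everywhere) (rule summable_fact_series_abs[OF assms])
 also have "diffs (%m. a m / fact m) = (%m. a (Suc m) / fact m)"
  by (auto simp: diffs_def fun_eq_iff field_simps simp del: of_nat_Suc)
 finally have "DERIV (%x. \<Sum>m. a m / fact m * x ^ m) (- s) :> fact_series (%m. a (Suc m)) s"
  by (simp add: fact_series_def)
 hence "DERIV ((%x. \<Sum>m. a m / fact m * x ^ m) o uminus) s :> fact_series (%m. a (Suc m)) s * (- 1)"
  by (intro DERIV_chain) (auto intro!: derivative_eq_intros)
 thus ?thesis unfolding fact_series_def comp_def by simp
qed

text \<open>Since m / m! = 1 / (m-1)!, a factor m in the coefficients becomes multiplication by -s
  together with an index shift. This turns the functional equation of 1/Gamma into three-term
  recurrences.\<close>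

lemma fact_series_of_nat_mult:
 assumes "!!m. abs (b m) <= B"
 shows "(%m. (real m * b m) / fact m * (- s) ^ m) sums (- s * fact_series (%m. b (Suc m)) s)"
proof -
 have "(%m. - s * (b (Suc m) / fact m * (- s) ^ m)) sums (- s * fact_series (%m. b (Suc m)) s)"
  unfolding fact_series_def using summable_fact_series_abs[of "%m. b (Suc m)" B] assms
  by (intro sums_mult summable_sums) auto
 also have "(%m. - s * (b (Suc m) / fact m * (- s) ^ m)) = (%m. (real (Suc m) * b (Suc m)) / fact (Suc m) * (- s) ^ Suc m)"
  by (auto simp: fun_eq_iff field_simps simp del: of_nat_Suc)
 finally show ?thesis by (subst (asm) sums_Suc_iff) simp
qed

section \<open>Bounds for the reciprocal Gamma function and its derivative\<close>

definition drGamma :: "real => real" where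
 "drGamma z = deriv rGamma z"

lemma DERIV_rGamma: "DERIV rGamma z :> drGamma z" for z :: real
 unfolding drGamma_def using has_field_derivative_rGamma[of z UNIV] DERIV_deriv_iff_has_field_derivative by blast

lemma drGamma_rec: "drGamma z = rGamma (z + 1) + z * drGamma (z + 1)"
proof -
 have "DERIV (%z. z * rGamma (z + 1)) z :> rGamma (z + 1) + z * drGamma (z + 1)"
 proof -
  have "DERIV (%z. rGamma (z + 1)) z :> drGamma (z + 1) * 1"
   by (rule DERIV_chain2[OF DERIV_rGamma]) (auto intro!: derivative_eq_intros)
  from DERIV_mult[OF DERIV_ident this] show ?thesis by (simp add: mult.commute)
 qed
 moreover have "(%z::real. z * rGamma (z + 1)) = rGamma" by (simp add: fun_eq_iff rGamma_plus1)
 ultimately show ?thesis using DERIV_unique[OF DERIV_rGamma[of z]] by simp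
qed

text \<open>The Digamma function enters only on this pole-free interval; the functional equations
  carry the bounds to all half-lines.\<close>

lemma rGamma_bounded_unit:
 "EX B>=0. ALL z:{1..2::real}. abs (rGamma z) <= B & abs (drGamma z) <= B"
proof -
 have "drGamma z = - rGamma z * Digamma z" if "z : {1..2}" for z unfolding drGamma_def
  by (rule DERIV_imp_deriv, rule has_field_derivative_rGamma_no_nonpos_int) (use that in "auto elim!: nonpos_Ints_cases")
 moreover have "continuous_on {1..2::real} (%z. - rGamma z * Digamma z)"
  by (intro continuous_intros continuous_on_Polygamma) (auto elim!: nonpos_Ints_cases)
 ultimately have "continuous_on {1..2::real} drGamma" by (subst continuous_on_cong[OF refl]) auto
 hence "compact (drGamma ` {1..2})" by (intro compact_continuous_image) auto
 then obtain B1 where B1: "!!z. z : {1..2} ==> abs (drGamma z) <= B1"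
  using compact_imp_bounded[THEN bounded_pos[THEN iffD1]] by (metis image_eqI real_norm_def)
 have "compact ((rGamma :: real => real) ` {1..2})" by (intro compact_continuous_image continuous_intros) auto
 then obtain B2 where B2: "!!z. z : {1..2::real} ==> abs (rGamma z) <= B2"
  using compact_imp_bounded[THEN bounded_pos[THEN iffD1]] by (metis image_eqI real_norm_def)
 show ?thesis using B1 B2 by (intro exI[of _ "max 0 (max B1 B2)"]) (auto simp: le_max_iff_disj)
qed

text \<open>From one unit interval to the next the functional equation divides by y >= 1, so bounds
  do not deteriorate.\<close>

lemma rGamma_bounded_above:
 "EX B>=0. ALL z>=1. abs (rGamma z) <= B & abs (drGamma z) <= B"
proof -
 obtain B where B: "B >= 0" "!!z. z : {1..2::real} ==> abs (rGamma z) <= B & abs (drGamma z) <= B"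
  using rGamma_bounded_unit by blast
 \<comment> \<open>The constant 2 * B for the derivative reproduces itself: starting from y in [1,2]
   the recurrence gives B + B, and from y >= 2 it gives at most (2 * B + B) / 2.\<close>
 have step: "abs (rGamma z) <= B & abs (drGamma z) <= 2 * B & (z >= 2 --> abs (rGamma (z + 1)) <= B / 2 & abs (drGamma z) <= 2 * B)"
  if "z : {1 + real n..2 + real n}" for z n using that
 proof (induction n arbitrary: z)
  case 0
  have "abs (rGamma z) = z * abs (rGamma (z + 1))" using rGamma_plus1[of z] 0 by (metis abs_mult abs_of_nonneg atLeastAtMost_iff le_add_same_cancel1 of_nat_0_le_iff order_trans zero_le_one)
  thus ?case using B(2)[of z] 0 B(1) by auto
 next
  case (Suc n)
  define y where "y = z - 1"
  have y: "y >= 1" "y : {1 + real n..2 + real n}" using Suc.prems by (auto simp: y_def)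
  note IH = Suc.IH[OF y(2)]
  have rg: "y * rGamma z = rGamma y" using rGamma_plus1[of y] by (simp add: y_def)
  have dr: "y * drGamma z = drGamma y - rGamma z" using drGamma_rec[of y] by (simp add: y_def)
  have "abs (rGamma z) <= y * abs (rGamma z)" using y by (simp add: mult_right_le_one_le mult_le_cancel_right1)
  hence r: "abs (rGamma z) <= B" using IH rg y by (metis abs_mult abs_of_nonneg order_trans zero_le_one)
  have r1: "abs (rGamma (z + 1)) <= B / 2"
  proof -
   have "2 * abs (rGamma (z + 1)) <= z * abs (rGamma (z + 1))" using y by (intro mult_right_mono) (auto simp: y_def)
   also have "... = abs (rGamma z)" using rGamma_plus1[of z] y
    by (metis abs_mult abs_of_nonneg add_increasing diff_add_cancel order_trans y_def zero_le_one)
   finally show ?thesis using r by simp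
  qed
  have d: "abs (drGamma z) <= 2 * B"
  proof (cases "y >= 2")
   case True
   have "2 * abs (drGamma z) <= y * abs (drGamma z)" using True by (intro mult_right_mono) auto
   also have "... = abs (drGamma y - rGamma z)" using dr y by (metis abs_mult abs_of_nonneg order_trans zero_le_one)
   finally show ?thesis using IH r True B(1) by linarith
  next
   case False
   have "abs (drGamma z) <= y * abs (drGamma z)" using y by (simp add: mult_le_cancel_right1)
   also have "... = abs (drGamma y - rGamma z)" using dr y by (metis abs_mult abs_of_nonneg order_trans zero_le_one)
   finally show ?thesis using B(2)[of y] False y(1) r B(1) by auto
  qed
  show ?case using r r1 d by simp
 qed
 show ?thesis
 proof (intro exI[of _ "2 * B"] conjI allI impI)
  fix z :: real assume z: "z >= 1"
  define n where "n = nat \<lfloor>z - 1\<rfloor>"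
  have "z : {1 + real n..2 + real n}" using z unfolding n_def by (auto) linarith+
  from step[OF this] show "abs (rGamma z) <= 2 * B" "abs (drGamma z) <= 2 * B" using B(1) by auto
 qed (use B in auto)
qed

text \<open>Downwards the functional equations multiply by at most L + 1 per unit step, so the
  constant grows with L but stays finite on every half-line.\<close>

lemma rGamma_bounded_below:
 "EX B>=0. ALL z>=- real L. abs (rGamma z) <= B & abs (drGamma z) <= B"
proof -
 have "EX B>=0. ALL z>=1 - real L. abs (rGamma z) <= B & abs (drGamma z) <= B" for L
 proof (induction L)
  case 0 thus ?case using rGamma_bounded_above by simp
 next
  case (Suc L)
  then obtain B where B: "B >= 0" "!!z. z >= 1 - real L ==> abs (rGamma z) <= B & abs (drGamma z) <= B" by blast
  show ?case
  proof (intro exI[of _ "B + (real L + 1) * B"] allI impI conjI)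
   show "B + (real L + 1) * B >= 0" using B(1) by simp
   fix z assume z: "z >= 1 - real (Suc L)"
   have "abs (rGamma z) <= B + (real L + 1) * B & abs (drGamma z) <= B + (real L + 1) * B"
   proof (cases "z >= 1 - real L")
    case True
    thus ?thesis using B(2)[of z] B(1) by (smt (verit) mult_nonneg_nonneg of_nat_0_le_iff)
   next
    case False
    hence az: "abs z <= real L + 1" using z by auto
    have b: "abs (rGamma (z+1)) <= B" "abs (drGamma (z+1)) <= B" using B(2)[of "z+1"] z by auto
    have "abs (z * rGamma (z+1)) <= (real L + 1) * B" "abs (z * drGamma (z+1)) <= (real L + 1) * B"
     unfolding abs_mult by (intro mult_mono az b; simp)+
    thus ?thesis using rGamma_plus1[of z] drGamma_rec[of z] b B(1) by linarith
   qed
   thus "abs (rGamma z) <= B + (real L + 1) * B" "abs (drGamma z) <= B + (real L + 1) * B" by auto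
  qed
 qed
 from this[of "Suc L"] show ?thesis by simp
qed

text \<open>Uniformity in the index and in the order is what justifies termwise differentiation in
  the order.\<close>

lemma rGamma_shift_bounded:
 "EX B. ALL m. ALL mu>=M. abs (rGamma (real m + mu + 1)) <= B & abs (drGamma (real m + mu + 1)) <= B"
proof -
 obtain B where "ALL z>=- real (nat \<lceil>abs M\<rceil>). abs (rGamma z) <= B & abs (drGamma z) <= B"
  using rGamma_bounded_below by blast
 moreover have "- real (nat \<lceil>abs M\<rceil>) <= real m + mu + 1" if "mu >= M" for m mu using that by linarith
 ultimately show ?thesis by blast
qed

section \<open>Entire Bessel profiles and their derivative in the order\<close>

definition bessel_E :: "real => real => real" where
 "bessel_E mu = fact_series (%m. rGamma (real m + mu + 1))"

text \<open>\<open>bessel_E\<close> is the Bessel-Clifford function: J_mu(x) is (x/2)^mu times its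
  value at x^2/4. \<open>bessel_D\<close> is its derivative in the order mu, which Y at integer
  orders requires.\<close>

definition bessel_D :: "real => real => real" where
 "bessel_D mu = fact_series (%m. drGamma (real m + mu + 1))"

lemma DERIV_bessel_E: "DERIV (bessel_E mu) s :> - bessel_E (mu + 1) s"
 and DERIV_bessel_D: "DERIV (bessel_D mu) s :> - bessel_D (mu + 1) s"
proof -
 obtain B where B: "!!m. abs (rGamma (real m + mu + 1)) <= B" "!!m. abs (drGamma (real m + mu + 1)) <= B"
  using rGamma_shift_bounded[of mu] by blast
 show "DERIV (bessel_E mu) s :> - bessel_E (mu + 1) s"
  using DERIV_fact_series[where a = "%m. rGamma (real m + mu + 1)" and s = s, OF B(1)] unfolding bessel_E_def by (simp add: algebra_simps)
 show "DERIV (bessel_D mu) s :> - bessel_D (mu + 1) s"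
  using DERIV_fact_series[where a = "%m. drGamma (real m + mu + 1)" and s = s, OF B(2)] unfolding bessel_D_def by (simp add: algebra_simps)
qed

text \<open>Coefficientwise this is the functional equation of 1/Gamma and its derivative. Since
  differentiation in s raises the order by one and changes the sign, the first recurrence is
  Bessel's equation in disguise, and the second is the same equation with a source term produced by
  differentiating the factor mu + 1.\<close>

lemma bessel_E_rec: "bessel_E mu s = (mu + 1) * bessel_E (mu + 1) s - s * bessel_E (mu + 2) s"
 and bessel_D_rec: "bessel_D mu s = bessel_E (mu + 1) s + (mu + 1) * bessel_D (mu + 1) s - s * bessel_D (mu + 2) s"
proof -
 obtain B where B: "!!m. abs (rGamma (real m + (mu + 1) + 1)) <= B" "!!m. abs (drGamma (real m + (mu + 1) + 1)) <= B"
  using rGamma_shift_bounded[of "mu + 1"] by blast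
 have e: "rGamma (real m + mu + 1) = (real m + (mu + 1)) * rGamma (real m + (mu + 1) + 1)" for m
  using rGamma_plus1[of "real m + mu + 1"] by (simp add: algebra_simps)
 have d: "drGamma (real m + mu + 1) = rGamma (real m + (mu + 1) + 1) + (real m + (mu + 1)) * drGamma (real m + (mu + 1) + 1)" for m
  using drGamma_rec[of "real m + mu + 1"] by (simp add: algebra_simps)
 have sE: "(%m. rGamma (real m + (mu + 1) + 1) / fact m * (- s) ^ m) sums bessel_E (mu + 1) s"
  unfolding bessel_E_def fact_series_def by (intro summable_sums summable_fact_series_abs[OF B(1)])
 have sD: "(%m. drGamma (real m + (mu + 1) + 1) / fact m * (- s) ^ m) sums bessel_D (mu + 1) s"
  unfolding bessel_D_def fact_series_def by (intro summable_sums summable_fact_series_abs[OF B(2)])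
 have mE: "(%m. real m * rGamma (real m + (mu + 1) + 1) / fact m * (- s) ^ m) sums (- s * bessel_E (mu + 2) s)"
  using fact_series_of_nat_mult[where b = "%m. rGamma (real m + (mu + 1) + 1)" and s = s, OF B(1)] unfolding bessel_E_def by (simp add: algebra_simps)
 have mD: "(%m. real m * drGamma (real m + (mu + 1) + 1) / fact m * (- s) ^ m) sums (- s * bessel_D (mu + 2) s)"
  using fact_series_of_nat_mult[where b = "%m. drGamma (real m + (mu + 1) + 1)" and s = s, OF B(2)] unfolding bessel_D_def by (simp add: algebra_simps)
 have "(%m. rGamma (real m + mu + 1) / fact m * (- s) ^ m) sums ((mu + 1) * bessel_E (mu + 1) s + (- s * bessel_E (mu + 2) s))"
  using sums_add[OF sums_mult[OF sE, of "mu + 1"] mE] unfolding e by (simp add: field_simps)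
 thus "bessel_E mu s = (mu + 1) * bessel_E (mu + 1) s - s * bessel_E (mu + 2) s"
  unfolding bessel_E_def fact_series_def by (simp add: sums_iff)
 have "(%m. drGamma (real m + mu + 1) / fact m * (- s) ^ m) sums (bessel_E (mu + 1) s + ((mu + 1) * bessel_D (mu + 1) s + (- s * bessel_D (mu + 2) s)))"
  using sums_add[OF sE sums_add[OF sums_mult[OF sD, of "mu + 1"] mD]] unfolding d by (simp add: field_simps)
 thus "bessel_D mu s = bessel_E (mu + 1) s + (mu + 1) * bessel_D (mu + 1) s - s * bessel_D (mu + 2) s"
  unfolding bessel_D_def fact_series_def by (simp add: sums_iff)
qed

lemma DERIV_bessel_E_order: "DERIV (%mu. bessel_E mu s) (mu) :> bessel_D mu s"
proof -
 obtain B where B: "!!m et. et >= mu - 1 ==> abs (rGamma (real m + et + 1)) <= B & abs (drGamma (real m + et + 1)) <= B"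
  using rGamma_shift_bounded[of "mu - 1"] by blast
 have "((%et. \<Sum>m. rGamma (real m + et + 1) / fact m * (- s) ^ m) has_field_derivative
   (\<Sum>m. drGamma (real m + mu + 1) / fact m * (- s) ^ m)) (at mu)"
 proof (rule has_field_derivative_series'[where S = "{mu - 1..mu + 1}" and ?x0.0 = mu])
  fix m et
  show "((%et. rGamma (real m + et + 1) / fact m * (- s) ^ m) has_field_derivative
    drGamma (real m + et + 1) / fact m * (- s) ^ m) (at et within {mu - 1..mu + 1})"
  proof -
   have "DERIV (%et. rGamma (real m + et + 1)) (et) :> drGamma (real m + et + 1) * 1"
    by (rule DERIV_chain2[OF DERIV_rGamma]) (auto intro!: derivative_eq_intros)
   from DERIV_cmult_right[OF DERIV_cdivide[OF this]] show ?thesis by (auto intro: has_field_derivative_at_within)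
  qed
 next
  show "uniformly_convergent_on {mu - 1..mu + 1} (%n et. SUM m<n. drGamma (real m + et + 1) / fact m * (- s) ^ m)"
  proof (rule Weierstrass_m_test')
   show "summable (%m. B / fact m * abs s ^ m)" by (rule summable_fact_series_abs[of "%_. B" "abs B"]) simp
   show "norm (drGamma (real m + et + 1) / fact m * (- s) ^ m) <= B / fact m * abs s ^ m"
    if "et : {mu - 1..mu + 1}" for m et
    using B[of et m] that by (simp add: abs_mult power_abs divide_right_mono mult_right_mono)
  qed
  show "summable (%m. rGamma (real m + mu + 1) / fact m * (- s) ^ m)"
   by (rule summable_fact_series_abs[of _ B]) (use B in auto)
 qed auto
 thus ?thesis unfolding bessel_E_def bessel_D_def fact_series_def .
qed

text \<open>The first n coefficients at order -n vanish because 1/Gamma is zero at nonpositive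
  integers; shifting the index by n turns the rest into the series at order n.\<close>

lemma bessel_E_minus_nat: "bessel_E (- real n) s = (- s) ^ n * bessel_E (real n) s"
proof -
 obtain B where B: "!!m. abs (rGamma (real m + real n + 1)) <= B" using rGamma_shift_bounded[of "real n"] by blast
 have 0: "rGamma (real m - real n + 1) = 0" if "m < n" for m
 proof -
  have "real m - real n + 1 = - real (n - m - 1)" using that by simp
  thus ?thesis by (simp only: rGamma_eq_zero_iff minus_of_nat_in_nonpos_Ints)
 qed
 have f: "rGamma (real m + 1) = 1 / fact m" for m using rGamma_of_int[of "int m + 1"] by (simp add: divide_inverse)
 have "(%m. (- s) ^ n * (rGamma (real m + real n + 1) / fact m * (- s) ^ m)) sums ((- s) ^ n * bessel_E (real n) s)"
  unfolding bessel_E_def fact_series_def by (intro sums_mult summable_sums summable_fact_series_abs[OF B])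
 also have "(%m. (- s) ^ n * (rGamma (real m + real n + 1) / fact m * (- s) ^ m))
   = (%m. rGamma (real (m + n) - real n + 1) / fact (m + n) * (- s) ^ (m + n))"
  using f f[of "_ + n"] by (auto simp: fun_eq_iff power_add add.assoc mult.commute)
 finally have "(%m. rGamma (real m - real n + 1) / fact m * (- s) ^ m) sums ((- s) ^ n * bessel_E (real n) s)"
  using sums_iff_shift[of "%m. rGamma (real m - real n + 1) / fact m * (- s) ^ m" n] by (simp add: 0)
 thus ?thesis unfolding bessel_E_def fact_series_def by (simp add: sums_iff)
qed

section \<open>Bessel's equation for the profiles and its singular solution\<close>

lemma bessel_J_eq:
 assumes "x > 0"
 shows "bessel_J mu x = (x / 2) powr mu * bessel_E mu (x^2 / 4)"
proof -
 obtain B where B: "!!m. abs (rGamma (real m + mu + 1)) <= B" using rGamma_shift_bounded[of mu] by blast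
 have *: "(x / 2) powr (2 * real m + mu) = (x / 2) powr mu * (x^2 / 4) ^ m" for m
 proof -
  have "(x / 2) powr (2 * real m) = (x / 2) ^ (2 * m)" using assms powr_realpow[of "x/2" "2*m"] by simp
  thus ?thesis by (simp add: powr_add power_mult power_divide)
 qed
 have "(%m. (x / 2) powr mu * (rGamma (real m + mu + 1) / fact m * (- (x^2 / 4)) ^ m)) sums ((x / 2) powr mu * bessel_E mu (x^2 / 4))"
  unfolding bessel_E_def fact_series_def by (intro sums_mult summable_sums summable_fact_series_abs[OF B])
 thus ?thesis unfolding bessel_J_def * by (simp add: sums_iff power_minus[of "x^2/4"] mult_ac)
qed

text \<open>With s = (k|x|)^2/4 this is the Helmholtz equation for radial functions in dimension 2
  nu + 2, equivalently Bessel's equation for x^nu F(x^2/4). The derivatives are named functions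
  because F2 itself is estimated near zero later.\<close>

definition radial_ode :: "real => (real => real) => (real => real) => (real => real) => bool" where
 "radial_ode nu F F1 F2 \<longleftrightarrow> (ALL s>0. DERIV F s :> F1 s & DERIV F1 s :> F2 s
   & s * F2 s + (nu + 1) * F1 s + F s = 0)"

lemma radial_ode_bessel_E:
 "radial_ode nu (bessel_E nu) (%s. - bessel_E (nu + 1) s) (bessel_E (nu + 2))" unfolding radial_ode_def
proof (intro allI impI conjI)
 fix s :: real
 show "DERIV (bessel_E nu) s :> - bessel_E (nu + 1) s" by (rule DERIV_bessel_E)
 show "s * bessel_E (nu + 2) s + (nu + 1) * - bessel_E (nu + 1) s + bessel_E nu s = 0" by (subst bessel_E_rec[of nu]) simp
 show "DERIV (%s. - bessel_E (nu + 1) s) s :> bessel_E (nu + 2) s"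
  using DERIV_minus[OF DERIV_bessel_E[of "nu + 1" s]] by (simp add: add.assoc)
qed

lemma DERIV_powr_minus_mult:
 fixes s a :: real
 assumes "s > 0" "DERIV Z s :> Z1"
 shows "DERIV (%s. s powr a * Z s) s :> s powr a * (Z1 + a * Z s / s)"
proof -
 have "DERIV (%s. s powr a) s :> a * s powr (a - 1)" using has_real_derivative_powr[OF assms(1), of a] by simp
 from DERIV_mult[OF this assms(2)] show ?thesis using assms(1) by (simp add: field_simps powr_diff)
qed

text \<open>Multiplication by s^(-nu) carries the equation of order -nu into that of order nu, so
  the solution singular at 0 comes from a regular one. The third claim keeps the residual, because
  for integer orders the factor solves its equation only up to a source.\<close>

lemma powr_mult_radial:
 fixes Z Z1 Z2 :: "real => real" and nu :: real
 assumes "!!s. s > 0 ==> DERIV Z s :> Z1 s" "!!s. s > 0 ==> DERIV Z1 s :> Z2 s"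
  and "s > 0"
 defines "F1 == %s. s powr (-nu) * (Z1 s - nu * Z s / s)"
  and "F2 == %s. s powr (-nu) * (Z2 s - 2 * nu * Z1 s / s + nu * (nu + 1) * Z s / s^2)"
 shows "DERIV (%s. s powr (-nu) * Z s) s :> F1 s"
  and "DERIV F1 s :> F2 s"
  and "s * F2 s + (nu + 1) * F1 s + s powr (-nu) * Z s = s powr (-nu) * (s * Z2 s + (1 - nu) * Z1 s + Z s)"
proof -
 show "DERIV (%s. s powr (-nu) * Z s) s :> F1 s"
  using DERIV_powr_minus_mult[OF `s > 0` assms(1)[OF `s > 0`], of "-nu"] by (simp add: F1_def)
 have "DERIV (%s. Z1 s - nu * Z s / s) s :> Z2 s - nu * (Z1 s * s - Z s) / (s * s)"
  using DERIV_diff[OF assms(2)[OF `s > 0`] DERIV_cmult[OF DERIV_divide[OF assms(1)[OF `s > 0`] DERIV_ident], of nu]] `s > 0`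
  by simp
 note D = DERIV_powr_minus_mult[OF `s > 0` this, of "-nu"]
 have "Z2 s - nu * (Z1 s * s - Z s) / (s * s) + (-nu) * (Z1 s - nu * Z s / s) / s
   = Z2 s - 2 * nu * Z1 s / s + nu * (nu + 1) * Z s / s^2"
  using `s > 0` by (simp add: divide_simps power2_eq_square) (simp add: algebra_simps)
 hence "s powr (-nu) * (Z2 s - nu * (Z1 s * s - Z s) / (s * s) + (-nu) * (Z1 s - nu * Z s / s) / s) = F2 s"
  unfolding F2_def by (rule arg_cong)
 with D show "DERIV F1 s :> F2 s" unfolding F1_def by simp
 show "s * F2 s + (nu + 1) * F1 s + s powr (-nu) * Z s = s powr (-nu) * (s * Z2 s + (1 - nu) * Z1 s + Z s)"
 proof -
  have "s * (Z2 s - 2 * nu * Z1 s / s + nu * (nu + 1) * Z s / s^2) + (nu + 1) * (Z1 s - nu * Z s / s) + Z s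
    = s * Z2 s + (1 - nu) * Z1 s + Z s"
   using `s > 0` by (simp add: divide_simps power2_eq_square) (simp add: algebra_simps)
  hence "s powr (-nu) * (s * (Z2 s - 2 * nu * Z1 s / s + nu * (nu + 1) * Z s / s^2) + (nu + 1) * (Z1 s - nu * Z s / s) + Z s)
    = s powr (-nu) * (s * Z2 s + (1 - nu) * Z1 s + Z s)" by (rule arg_cong)
  thus ?thesis unfolding F1_def F2_def by (simp only: distrib_left mult.left_commute)
 qed
qed

lemma radial_ode_lin:
 assumes "radial_ode nu F F1 F2" "radial_ode nu G G1 G2"
 shows "radial_ode nu (%s. a * F s + b * G s) (%s. a * F1 s + b * G1 s) (%s. a * F2 s + b * G2 s)"
proof -
 have "s * (a * F2 s + b * G2 s) + (nu + 1) * (a * F1 s + b * G1 s) + (a * F s + b * G s)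
   = a * (s * F2 s + (nu + 1) * F1 s + F s) + b * (s * G2 s + (nu + 1) * G1 s + G s)" for s
  by (simp add: algebra_simps)
 thus ?thesis using assms unfolding radial_ode_def by (simp add: DERIV_add DERIV_cmult)
qed

lemma radial_ode_second:
 "EX F1 F2. radial_ode nu (%s. s powr (-nu) * bessel_E (-nu) s) F1 F2"
proof -
 have d1: "DERIV (bessel_E (-nu)) s :> - bessel_E (1 - nu) s" for s using DERIV_bessel_E[of "-nu" s] by simp
 have d2: "DERIV (%s. - bessel_E (1 - nu) s) s :> bessel_E (2 - nu) s" for s
  using DERIV_minus[OF DERIV_bessel_E[of "1 - nu" s]] by simp
 have r: "s * bessel_E (2 - nu) s + (1 - nu) * - bessel_E (1 - nu) s + bessel_E (-nu) s = 0" for s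
  using bessel_E_rec[of "-nu" s] by simp
 show ?thesis unfolding radial_ode_def
  by (intro exI allI impI conjI, erule powr_mult_radial(1)[OF d1 d2], erule powr_mult_radial(2)[OF d1 d2])
   (simp only: powr_mult_radial(3)[OF d1 d2] r mult_zero_right)
qed

lemma bounded_near_0:
 fixes f :: "real => real"
 assumes "!!s. DERIV f s :> f' s"
 shows "EX C>=0. ALL s:{0..1}. abs (f s) <= C"
proof -
 have "continuous_on {0..1} f" using assms by (meson DERIV_isCont continuous_at_imp_continuous_on)
 hence "bounded (f ` {0..1})" by (intro compact_imp_bounded compact_continuous_image) auto
 then obtain C where "!!s. s : {0..1} ==> abs (f s) <= C" unfolding bounded_iff by (metis image_eqI real_norm_def)
 thus ?thesis by (intro exI[of _ "max 0 C"]) (auto simp: le_max_iff_disj)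
qed

lemma bessel_Y_radial_nonint:
 assumes "nu ~: \<int>" "nu > 0"
 shows "EX W W1 W2 C. radial_ode nu W W1 W2 & (ALL s:{0<..1}. abs (W s) <= C * s powr (-nu))
  & (ALL x>0. bessel_Y nu x = (x / 2) powr nu * W (x^2 / 4))"
proof -
 define a b where "a = cos (nu * pi) / sin (nu * pi)" and "b = - 1 / sin (nu * pi)"
 define W where "W s = a * bessel_E nu s + b * (s powr (-nu) * bessel_E (-nu) s)" for s
 obtain W1 W2 where ode: "radial_ode nu W W1 W2"
  using radial_ode_second[of nu] radial_ode_lin[OF radial_ode_bessel_E] unfolding W_def by blast
 obtain C1 where C1: "C1 >= 0" "!!s. s : {0..1} ==> abs (bessel_E nu s) <= C1" using bounded_near_0[OF DERIV_bessel_E] by blast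
 obtain C2 where C2: "C2 >= 0" "!!s. s : {0..1} ==> abs (bessel_E (-nu) s) <= C2" using bounded_near_0[OF DERIV_bessel_E] by blast
 have bd: "abs (W s) <= (abs a * C1 + abs b * C2) * s powr (-nu)" if s: "s : {0<..1}" for s
 proof -
  have p: "1 <= s powr (-nu)" using s assms(2) powr_mono2'[of "-nu" s 1] by simp
  have "abs (W s) <= abs a * abs (bessel_E nu s) + abs b * (s powr (-nu) * abs (bessel_E (-nu) s))"
   unfolding W_def by (rule order_trans[OF abs_triangle_ineq]) (simp add: abs_mult)
  also have "... <= abs a * (C1 * s powr (-nu)) + abs b * (s powr (-nu) * C2)"
   using C1(2)[of s] C2(2)[of s] s mult_left_mono[OF p C1(1)] by (intro add_mono mult_left_mono) auto
  finally show ?thesis by (simp add: algebra_simps)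
 qed
 have Y: "bessel_Y nu x = (x / 2) powr nu * W (x^2 / 4)" if x: "x > 0" for x
 proof -
  have "(x / 2) powr (-nu) = (x/2) powr nu * (x/2) powr (2 * (-nu))" by (simp add: powr_add[symmetric])
  also have "(x/2) powr (2 * (-nu)) = (x^2/4) powr (-nu)" using x powr_powr[of "x/2" 2 "-nu"] by (simp add: power_divide)
  finally have e: "(x / 2) powr (-nu) = (x/2) powr nu * (x^2/4) powr (-nu)" .
  have "bessel_Y nu x = (bessel_J nu x * cos (nu * pi) - bessel_J (- nu) x) / sin (nu * pi)"
   using assms by (simp add: bessel_Y_def Let_def)
  thus ?thesis unfolding bessel_J_eq[OF x] e W_def a_def b_def by (simp add: diff_divide_distrib algebra_simps)
 qed
 show ?thesis using ode bd Y by blast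
qed

text \<open>At an integer order n, Y is a quotient 0/0 whose limit is a derivative in the order. It
  yields a profile made of ln s E_n, D_n and s^(-n) D_(-n). Each of the three solves the radial
  equation only up to a source, and the sources 2 E' + n E / s, -E' and -(n E + s E') / s
  cancel.\<close>

lemma bessel_Y_radial_int:
 assumes n: "n >= 1"
 defines "nu == real n"
 shows "EX W W1 W2 C. radial_ode nu W W1 W2 & (ALL s:{0<..1}. abs (W s) <= C * s powr (-nu))
  & (ALL x>0. bessel_Y nu x = (x / 2) powr nu * W (x^2 / 4))"
proof -
 define W where "W s = 1 / pi * (ln s * bessel_E nu s + bessel_D nu s + (-1) ^ n * (s powr (-nu) * bessel_D (-nu) s))" for s
 define E1 where "E1 = (%s. - bessel_E (nu + 1) s)"
 have E: "DERIV (bessel_E nu) s :> E1 s" "DERIV E1 s :> bessel_E (nu + 2) s"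
  "s * bessel_E (nu + 2) s + (nu + 1) * E1 s + bessel_E nu s = 0" if "s > 0" for s
  using radial_ode_bessel_E[of nu] that unfolding radial_ode_def E1_def by auto
 define D1 where "D1 = (%s. - bessel_D (nu + 1) s)"
 have D: "DERIV (bessel_D nu) s :> D1 s" "DERIV D1 s :> bessel_D (nu + 2) s"
  "s * bessel_D (nu + 2) s + (nu + 1) * D1 s + bessel_D nu s = - E1 s" for s
  using DERIV_bessel_D[of nu s] DERIV_minus[OF DERIV_bessel_D[of "nu + 1" s]] bessel_D_rec[of nu s]
  by (auto simp: D1_def E1_def add.assoc)
 define M1 where "M1 = (%s. - bessel_D (1 - nu) s)"
 have M: "DERIV (bessel_D (-nu)) s :> M1 s" "DERIV M1 s :> bessel_D (2 - nu) s"
  "s * bessel_D (2 - nu) s + (1 - nu) * M1 s + bessel_D (-nu) s = bessel_E (1 - nu) s" for s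
  using DERIV_bessel_D[of "-nu" s] DERIV_minus[OF DERIV_bessel_D[of "1 - nu" s]] bessel_D_rec[of "-nu" s]
  by (auto simp: M1_def)
 define P1 where "P1 = (%s. s powr (-nu) * (M1 s - nu * bessel_D (-nu) s / s))"
 define P2 where "P2 = (%s. s powr (-nu) * (bessel_D (2 - nu) s - 2 * nu * M1 s / s + nu * (nu + 1) * bessel_D (-nu) s / s^2))"
 note P = powr_mult_radial[OF M(1,2), where nu = nu, folded P1_def P2_def]
 \<comment> \<open>The source produced by the term with D_(-n). Its order is 1 - n = -(n - 1), so
   the reflection formula for negative integer orders expresses it through E_n.\<close>
 have EM: "(-1) ^ n * (s powr (-nu) * bessel_E (1 - nu) s) = - ((nu * bessel_E nu s + s * E1 s) / s)" if s: "s > 0" for s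
 proof -
  have "1 - nu = - real (n - 1)" using n by (simp add: nu_def of_nat_diff)
  hence 1: "bessel_E (1 - nu) s = (- s) ^ (n - 1) * bessel_E (nu - 1) s"
   using bessel_E_minus_nat[of "n - 1" s] n by (simp add: nu_def of_nat_diff)
  have 2: "bessel_E (nu - 1) s = nu * bessel_E nu s + s * E1 s"
   using bessel_E_rec[of "nu - 1" s] by (simp add: E1_def add.commute)
  have 3: "s powr (-nu) = 1 / s ^ n" using s by (simp add: nu_def powr_minus powr_realpow divide_inverse)
  have 4: "(-1) ^ n * (- s) ^ (n - 1) / s ^ n = - 1 / s"
  proof -
   obtain m where m: "n = Suc m" using n by (cases n) auto
   have "(-1) ^ n * (- s) ^ (n - 1) = - ((-1) ^ m * (- s) ^ m)" by (simp add: m)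
   also have "... = - (s ^ m)" by (simp flip: power_mult_distrib)
   finally show ?thesis using s by (simp add: m)
  qed
  have "(-1) ^ n * (s powr (-nu) * bessel_E (1 - nu) s) = ((-1) ^ n * (- s) ^ (n - 1) / s ^ n) * bessel_E (nu - 1) s"
   unfolding 1 3 by simp
  thus ?thesis unfolding 4 2 by simp
 qed
 define W1 where "W1 s = 1 / pi * (bessel_E nu s / s + ln s * E1 s + D1 s + (-1) ^ n * P1 s)" for s
 define W2 where "W2 s = 1 / pi * (2 * E1 s / s - bessel_E nu s / s^2 + ln s * bessel_E (nu + 2) s + bessel_D (nu + 2) s + (-1) ^ n * P2 s)" for s
 have ode: "radial_ode nu W W1 W2" unfolding radial_ode_def
 proof (intro allI impI conjI)
  fix s :: real assume s: "s > 0"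
  show "DERIV W s :> W1 s" unfolding W_def W1_def
   using DERIV_cmult[OF DERIV_add[OF DERIV_add[OF DERIV_mult[OF DERIV_ln[OF s] E(1)[OF s]] D(1)] DERIV_cmult[OF P(1)[OF s], of "(-1) ^ n"]], of "1 / pi"]
   by (simp add: P1_def divide_inverse algebra_simps)
  show "DERIV W1 s :> W2 s" unfolding W1_def
  proof (rule DERIV_cong[OF DERIV_cmult[OF DERIV_add[OF DERIV_add[OF DERIV_add[OF DERIV_divide[OF E(1)[OF s] DERIV_ident]
     DERIV_mult[OF DERIV_ln[OF s] E(2)[OF s]]] D(2)] DERIV_cmult[OF P(2)[OF s], of "(-1) ^ n"]], of "1 / pi", folded P1_def]])
   have q: "(E1 s * s - bessel_E nu s * 1) / (s * s) = E1 s / s - bessel_E nu s / s^2"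
    using s by (simp add: diff_divide_distrib power2_eq_square)
   show "1 / pi * ((E1 s * s - bessel_E nu s * 1) / (s * s) + (inverse s * E1 s + bessel_E (nu + 2) s * ln s) + bessel_D (nu + 2) s
     + (-1) ^ n * (s powr (-nu) * (bessel_D (2 - nu) s - 2 * nu * M1 s / s + nu * (nu + 1) * bessel_D (-nu) s / s^2))) = W2 s"
    unfolding q W2_def P2_def by (simp add: divide_inverse algebra_simps)
  qed (use s in simp)
  have "pi * (s * W2 s + (nu + 1) * W1 s + W s)
    = ln s * (s * bessel_E (nu + 2) s + (nu + 1) * E1 s + bessel_E nu s)
    + (s * bessel_D (nu + 2) s + (nu + 1) * D1 s + bessel_D nu s)
    + (-1)^n * (s * P2 s + (nu + 1) * P1 s + s powr (-nu) * bessel_D (-nu) s)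
    + 2 * E1 s + nu * bessel_E nu s / s"
  proof -
   have "s * (bessel_E nu s / s^2) = bessel_E nu s / s" using s by (simp add: power2_eq_square)
   hence "pi * (s * W2 s) = 2 * E1 s - bessel_E nu s / s + ln s * (s * bessel_E (nu + 2) s) + s * bessel_D (nu + 2) s + (-1) ^ n * (s * P2 s)"
    unfolding W2_def using s by (simp add: algebra_simps)
   moreover have "pi * W1 s = bessel_E nu s / s + ln s * E1 s + D1 s + (-1) ^ n * P1 s"
    "pi * W s = ln s * bessel_E nu s + bessel_D nu s + (-1) ^ n * (s powr (-nu) * bessel_D (-nu) s)"
    unfolding W_def W1_def by simp_all
   moreover have "pi * (s * W2 s + (nu + 1) * W1 s + W s) = pi * (s * W2 s) + (nu + 1) * (pi * W1 s) + pi * W s"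
    by (simp add: algebra_simps)
   ultimately show ?thesis by (simp add: algebra_simps add_divide_distrib)
  qed
  also have "... = - E1 s + (-1)^n * (s powr (-nu) * bessel_E (1 - nu) s) + 2 * E1 s + nu * bessel_E nu s / s"
   using P(3)[OF s] unfolding E(3)[OF s] D(3) M(3) P1_def P2_def by simp
  also have "... = 0" unfolding EM[OF s] using s by (simp add: field_simps)
  finally show "s * W2 s + (nu + 1) * W1 s + W s = 0" by simp
 qed
 obtain C1 where C1: "C1 >= 0" "!!s. s : {0..1} ==> abs (bessel_E nu s) <= C1" using bounded_near_0[OF DERIV_bessel_E] by blast
 obtain C2 where C2: "C2 >= 0" "!!s. s : {0..1} ==> abs (bessel_D nu s) <= C2" using bounded_near_0[OF DERIV_bessel_D] by blast
 obtain C3 where C3: "C3 >= 0" "!!s. s : {0..1} ==> abs (bessel_D (-nu) s) <= C3" using bounded_near_0[OF DERIV_bessel_D] by blast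
 have bd: "abs (W s) <= (1 / pi * (C1 + C2 + C3)) * s powr (-nu)" if s: "s : {0<..1}" for s
 proof -
  have p: "1 <= s powr (-nu)" using s powr_mono2'[of "-nu" s 1] by (simp add: nu_def)
  \<comment> \<open>The logarithm is dominated by s^(-n) on (0,1] because n >= 1.\<close>
  have "abs (ln s) = ln (1 / s)" using s by (simp add: ln_div)
  also have "... <= 1 / s" using s ln_le_minus_one[of "1/s"] by simp
  also have "... = s powr (-1)" using s by (simp add: powr_minus divide_inverse)
  also have "... <= s powr (-nu)" using s n by (intro powr_mono') (auto simp: nu_def)
  finally have l: "abs (ln s) <= s powr (-nu)" .
  have "abs (ln s * bessel_E nu s) <= s powr (-nu) * C1" unfolding abs_mult using s by (intro mult_mono l C1) auto
  moreover have "abs (bessel_D nu s) <= s powr (-nu) * C2" using C2(2)[of s] mult_right_mono[OF p C2(1)] s by auto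
  moreover have "abs ((-1) ^ n * (s powr (-nu) * bessel_D (-nu) s)) <= s powr (-nu) * C3"
   using s C3(2)[of s] by (auto simp: abs_mult power_abs intro!: mult_left_mono)
  ultimately have "abs (ln s * bessel_E nu s + bessel_D nu s + (-1) ^ n * (s powr (-nu) * bessel_D (-nu) s)) <= (C1 + C2 + C3) * s powr (-nu)"
   unfolding mult.commute[of "C1 + C2 + C3"] distrib_left by linarith
  thus ?thesis unfolding W_def abs_mult by (simp add: field_simps)
 qed
 have Y: "bessel_Y nu x = (x / 2) powr nu * W (x^2 / 4)" if x: "x > 0" for x
 proof -
  define s where "s = x^2 / 4"
  have s: "s > 0" using x by (simp add: s_def)
  have ln2: "ln (x / 2) = ln s / 2" using x ln_realpow[of "x/2" 2] by (simp add: s_def power_divide)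
  have "(x / 2) powr (-nu) = (x/2) powr nu * (x/2) powr (2 * (-nu))" by (simp add: powr_add[symmetric])
  also have "(x/2) powr (2 * (-nu)) = s powr (-nu)" using x powr_powr[of "x/2" 2 "-nu"] by (simp add: power_divide s_def)
  finally have e: "(x / 2) powr (-nu) = (x/2) powr nu * s powr (-nu)" .
  have sn: "s powr (-nu) * bessel_E (-nu) s = (-1) ^ n * bessel_E nu s"
   using s bessel_E_minus_nat[of n s] by (simp add: nu_def powr_minus powr_realpow power_minus[of s] field_simps)
  \<comment> \<open>The numerator in the definition of Y as a function of the order. It vanishes at
    nu since J_(-n) = (-1)^n J_n, so the limit of the quotient is the ratio of the derivatives of
    numerator and sine.\<close>
  define A where "A mu = (x/2) powr mu * bessel_E mu s * cos (mu * pi) - (x/2) powr (-mu) * bessel_E (-mu) s" for mu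
  have cn: "cos (nu * pi) = (-1) ^ n" "sin (nu * pi) = 0" by (simp_all add: nu_def)
  have A0: "A nu = 0" unfolding A_def e cn using sn by (simp add: mult.assoc)
  have chain: "DERIV (%mu. bessel_E (- mu) s) (mu) :> bessel_D (-mu) s * (- 1)" for mu
   by (rule DERIV_chain2[OF DERIV_bessel_E_order]) (auto intro!: derivative_eq_intros)
  have dA: "DERIV A (nu) :> (x/2) powr nu * (-1) ^ n * pi * W s"
  proof -
   have "DERIV A (nu) :> ((x/2) powr nu * ln (x/2) * bessel_E nu s + (x/2) powr nu * bessel_D nu s) * (-1) ^ n
     + ((x/2) powr (-nu) * ln (x/2) * bessel_E (-nu) s + (x/2) powr (-nu) * bessel_D (-nu) s)"
    unfolding A_def using x
    by (auto intro!: derivative_eq_intros DERIV_bessel_E_order chain simp: cn cn[unfolded mult.commute[of nu]] algebra_simps)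
   also have "((x/2) powr nu * ln (x/2) * bessel_E nu s + (x/2) powr nu * bessel_D nu s) * (-1) ^ n
     + ((x/2) powr (-nu) * ln (x/2) * bessel_E (-nu) s + (x/2) powr (-nu) * bessel_D (-nu) s)
     = (x/2) powr nu * (ln (x/2) * ((-1) ^ n * bessel_E nu s + s powr (-nu) * bessel_E (-nu) s) + (-1) ^ n * bessel_D nu s + s powr (-nu) * bessel_D (-nu) s)"
    unfolding e by (simp add: algebra_simps)
   also have "... = (x/2) powr nu * (-1) ^ n * pi * W s"
   proof -
    have sq: "((-1) ^ n * (-1) ^ n :: real) = 1" by (simp add: power_mult_distrib[symmetric])
    have "(-1) ^ n * (pi * W s) = (-1) ^ n * (ln s * bessel_E nu s) + (-1)^n * bessel_D nu s + ((-1) ^ n * (-1) ^ n) * (s powr (-nu) * bessel_D (-nu) s)"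
     unfolding W_def by (simp add: algebra_simps)
    hence "ln (x/2) * ((-1) ^ n * bessel_E nu s + s powr (-nu) * bessel_E (-nu) s) + (-1) ^ n * bessel_D nu s + s powr (-nu) * bessel_D (-nu) s
      = (-1) ^ n * (pi * W s)"
     unfolding sn ln2 sq by (simp add: algebra_simps)
    thus ?thesis by (simp only: mult.assoc)
   qed
   finally show ?thesis .
  qed
  have dS: "DERIV (%mu. sin (mu * pi)) (nu) :> pi * (-1) ^ n" by (auto intro!: derivative_eq_intros simp: cn)
  have "((%mu. ((A mu - A nu) / (mu - nu)) / ((sin (mu * pi) - sin (nu * pi)) / (mu - nu))) \<longlongrightarrow> ((x/2) powr nu * (-1) ^ n * pi * W s) / (pi * (-1) ^ n)) (at nu)"
   using dA dS by (intro tendsto_divide) (auto simp: has_field_derivative_iff)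
  hence "((%mu. A mu / sin (mu * pi)) \<longlongrightarrow> ((x/2) powr nu * (-1) ^ n * pi * W s) / (pi * (-1) ^ n)) (at nu)"
   by (rule Lim_transform_eventually) (auto simp: A0 cn eventually_at intro!: exI[of _ 1])
  hence "((%mu. A mu / sin (mu * pi)) \<longlongrightarrow> (x/2) powr nu * W s) (at nu)" by simp
  hence "Lim (at nu) (%mu. A mu / sin (mu * pi)) = (x/2) powr nu * W s" by (intro tendsto_Lim) auto
  moreover have "bessel_Y nu x = Lim (at nu) (%mu. A mu / sin (mu * pi))"
   unfolding bessel_Y_def A_def Let_def s_def by (simp add: bessel_J_eq[OF x] nu_def)
  ultimately show ?thesis by (simp add: s_def)
 qed
 show ?thesis using ode bd Y by blast
qed

lemma bessel_Y_radial:
 assumes "nu > 0"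
 shows "EX W W1 W2 C. radial_ode nu W W1 W2 & (ALL s:{0<..1}. abs (W s) <= C * s powr (-nu))
  & (ALL x>0. bessel_Y nu x = (x / 2) powr nu * W (x^2 / 4))"
proof (cases "nu : \<int>")
 case True
 then obtain z where "nu = of_int z" by (elim Ints_cases)
 hence "nu = real (nat z)" "nat z >= 1" using assms by auto
 thus ?thesis using bessel_Y_radial_int[of "nat z"] by simp
qed (use bessel_Y_radial_nonint assms in blast)

text \<open>In divergence form the equation reads (s^(nu+1) F')' = - s^nu F with bounded right side,
  so s^(nu+1) F' is Lipschitz and has a limit at 0, which the equation passes on to F''. This limit
  will determine the strength of the point source at the origin.\<close>

lemma radial_ode_near_0:
 assumes ode: "radial_ode nu F F1 F2" and bd: "!!s. s : {0<..1} ==> abs (F s) <= C * s powr (-nu)"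
 shows "EX l. ((%s. s powr (nu + 2) * F2 s) \<longlongrightarrow> l) (at_right 0)"
proof -
 define H where "H s = s powr (nu + 1) * F1 s" for s
 have dH: "DERIV H s :> - (s powr nu * F s)" if s: "s > 0" for s
 proof -
  have F1: "DERIV F1 s :> F2 s" and eq: "s * F2 s + (nu + 1) * F1 s + F s = 0" using ode s unfolding radial_ode_def by auto
  have "DERIV (%s. s powr (nu + 1)) s :> (nu + 1) * s powr nu" using has_real_derivative_powr[OF s, of "nu + 1"] by simp
  from DERIV_mult[OF this F1] have "DERIV H s :> (nu + 1) * s powr nu * F1 s + F2 s * s powr (nu + 1)" unfolding H_def .
  moreover have "(nu + 1) * s powr nu * F1 s + F2 s * s powr (nu + 1) = s powr nu * (s * F2 s + (nu + 1) * F1 s)"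
   using s by (simp add: powr_add algebra_simps)
  moreover have "s * F2 s + (nu + 1) * F1 s = - F s" using eq by linarith
  ultimately show ?thesis by simp
 qed
 have bF: "abs (s powr nu * F s) <= C" if s: "s : {0<..1}" for s
 proof -
  have "abs (s powr nu * F s) <= s powr nu * (C * s powr (-nu))" using bd[OF s] by (simp add: abs_mult mult_left_mono)
  also have "... = C" using s by (simp add: powr_minus)
  finally show ?thesis .
 qed
 have C0: "C >= 0" using bF[of 1] by simp
 have "C-lipschitz_on {0<..1} H"
 proof (rule bounded_derivative_imp_lipschitz)
  show "(H has_derivative (*) (- (s powr nu * F s))) (at s within {0<..1})" if "s : {0<..1}" for s
   using dH[of s] that by (auto simp: has_field_derivative_def intro: has_derivative_at_withinI)
  show "onorm ((*) (- (s powr nu * F s))) <= C" if "s : {0<..1}" for s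
   using bF[OF that] by (intro onorm_le) (simp add: abs_mult mult_right_mono)
 qed (use C0 in auto)
 hence "uniformly_continuous_on {0<..1} H" by (rule lipschitz_on_uniformly_continuous)
 then obtain g where g: "uniformly_continuous_on (closure {0<..1}) g" "!!s. s : {0<..1} ==> H s = g s"
  by (rule uniformly_continuous_on_extension_on_closure) blast
 have cl: "closure {0<..1::real} = {0..1}" by (rule closure_greaterThanAtMost) simp
 have "(g \<longlongrightarrow> g 0) (at 0 within {0..1})"
  using uniformly_continuous_imp_continuous[OF g(1)] unfolding cl continuous_on_def by auto
 hence "(g \<longlongrightarrow> g 0) (at 0 within {0<..1})" by (rule tendsto_within_subset) auto
 hence "(H \<longlongrightarrow> g 0) (at 0 within {0<..1})"
  by (rule Lim_transform_eventually) (use g(2) in "auto simp: eventually_at intro!: exI[of _ 1]")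
 also have "at 0 within {0<..1} = at_right (0::real)" by (rule at_within_nhd[of _ "{..<1}"]) auto
 finally have H: "(H \<longlongrightarrow> g 0) (at_right 0)" .
 have Fz: "((%s. s powr (nu + 1) * F s) \<longlongrightarrow> 0) (at_right 0)"
 proof (rule Lim_null_comparison)
  show "\<forall>\<^sub>F s in at_right 0. norm (s powr (nu + 1) * F s) <= C * s" unfolding eventually_at_right_field
  proof (intro exI[of _ 1] conjI allI impI)
   fix s :: real assume s: "0 < s" "s < 1"
   have "norm (s powr (nu + 1) * F s) = s * abs (s powr nu * F s)" using s by (simp add: powr_add abs_mult)
   also have "... <= s * C" using bF[of s] s by (intro mult_left_mono) auto
   finally show "norm (s powr (nu + 1) * F s) <= C * s" by (simp add: mult.commute)
  qed simp
  show "((%s. C * s) \<longlongrightarrow> 0) (at_right 0)" by (auto intro!: tendsto_eq_intros)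
 qed
 have "((%s. - (nu + 1) * H s - s powr (nu + 1) * F s) \<longlongrightarrow> - (nu + 1) * g 0 - 0) (at_right 0)"
  by (intro tendsto_intros H Fz)
 moreover have "\<forall>\<^sub>F s in at_right 0. - (nu + 1) * H s - s powr (nu + 1) * F s = s powr (nu + 2) * F2 s"
  unfolding eventually_at_right_field
 proof (intro exI[of _ 1] conjI allI impI)
  fix s :: real assume s: "0 < s" "s < 1"
  have eq: "s * F2 s + (nu + 1) * F1 s + F s = 0" using ode s unfolding radial_ode_def by auto
  define P where "P = s powr (nu + 1)"
  have "s powr (nu + 2) = P * s" unfolding P_def using s powr_add[of s "nu + 1" 1] by (simp add: add.assoc)
  moreover have "P * s * F2 s - (- (nu + 1) * (P * F1 s) - P * F s) = P * (s * F2 s + (nu + 1) * F1 s + F s)"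
   by (simp add: algebra_simps)
  ultimately show "- (nu + 1) * H s - s powr (nu + 1) * F s = s powr (nu + 2) * F2 s"
   unfolding H_def P_def[symmetric] eq by simp
 qed simp
 ultimately have "((%s. s powr (nu + 2) * F2 s) \<longlongrightarrow> - (nu + 1) * g 0 - 0) (at_right 0)"
  by (rule Lim_transform_eventually)
 thus ?thesis by blast
qed

section \<open>Asymptotics of solutions at infinity\<close>

lemma oscillator_energy:
 fixes y y1 :: "real => real"
 assumes x0: "x0 > 0" and d: "!!x. x >= x0 ==> DERIV y x :> y1 x"
   "!!x. x >= x0 ==> DERIV y1 x :> - (1 - c / x^2) * y x" and x: "x >= x0"
 defines "E == %x. (y x)^2 + (y1 x)^2"
 shows "E x <= E x0 * exp (abs c / x0)" "E x0 * exp (- abs c / x0) <= E x"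
proof -
 have dE: "DERIV E x :> 2 * c / x^2 * (y x * y1 x)" if "x >= x0" for x unfolding E_def using d[OF that] that x0
  by (auto intro!: derivative_eq_intros simp: field_simps power2_eq_square)
 \<comment> \<open>The energy changes at the relative rate |c| / x^2, which is integrable; the
   factors exp(|c|/x) and exp(-|c|/x) below make it monotone.\<close>
 have bE: "abs (2 * c / x^2 * (y x * y1 x)) <= abs c / x^2 * E x" for x
 proof -
  have "2 * abs (y x * y1 x) <= E x" using sum_squares_bound[of "abs (y x)" "abs (y1 x)"] by (simp add: E_def abs_mult)
  hence "abs c / x^2 * (2 * abs (y x * y1 x)) <= abs c / x^2 * E x" by (intro mult_left_mono) auto
  thus ?thesis by (simp add: abs_mult mult_ac)
 qed
 have dx: "DERIV (%x. exp (b / x)) x :> - (b / x^2) * exp (b / x)" if "x >= x0" for b x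
  using that x0 by (auto intro!: derivative_eq_intros simp: field_simps power2_eq_square)
 have E0: "E x >= 0" for x by (simp add: E_def)
 have "E x * exp (abs c / x) <= E x0 * exp (abs c / x0)"
 proof (rule DERIV_nonpos_imp_nonincreasing[OF x])
  fix z assume z: "x0 <= z" "z <= x"
  have "((%x. E x * exp (abs c / x)) has_field_derivative
    (2 * c / z^2 * (y z * y1 z)) * exp (abs c / z) + (- (abs c / z^2) * exp (abs c / z)) * E z) (at z)"
   by (rule DERIV_mult[OF dE[OF z(1)] dx[OF z(1)]])
  moreover have "(2 * c / z^2 * (y z * y1 z)) * exp (abs c / z) + (- (abs c / z^2) * exp (abs c / z)) * E z
   = (2 * c / z^2 * (y z * y1 z) - abs c / z^2 * E z) * exp (abs c / z)" by (simp add: algebra_simps)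
  moreover have "... <= 0" using abs_le_D1[OF bE[of z]] by (intro mult_nonpos_nonneg) auto
  ultimately show "EX w. DERIV (%x. E x * exp (abs c / x)) z :> w & w <= 0" by metis
 qed
 moreover have "E x * 1 <= E x * exp (abs c / x)" using E0 x x0 by (intro mult_left_mono) auto
 ultimately show "E x <= E x0 * exp (abs c / x0)" by simp
 have "E x0 * exp (- abs c / x0) <= E x * exp (- abs c / x)"
 proof (rule DERIV_nonneg_imp_nondecreasing[OF x])
  fix z assume z: "x0 <= z" "z <= x"
  have "((%x. E x * exp (- abs c / x)) has_field_derivative
    (2 * c / z^2 * (y z * y1 z)) * exp (- abs c / z) + (- (- abs c / z^2) * exp (- abs c / z)) * E z) (at z)"
   by (rule DERIV_mult[OF dE[OF z(1)] dx[OF z(1)]])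
  moreover have "(2 * c / z^2 * (y z * y1 z)) * exp (- abs c / z) + (- (- abs c / z^2) * exp (- abs c / z)) * E z
   = (2 * c / z^2 * (y z * y1 z) + abs c / z^2 * E z) * exp (- abs c / z)" by (simp add: algebra_simps)
  moreover have "... >= 0" using abs_le_D2[OF bE[of z]] by (intro mult_nonneg_nonneg) auto
  ultimately show "EX w. DERIV (%x. E x * exp (- abs c / x)) z :> w & w >= 0" by metis
 qed
 moreover have "E x * exp (- abs c / x) <= E x * 1" using E0 x x0 by (intro mult_left_mono) auto
 ultimately show "E x0 * exp (- abs c / x0) <= E x" by simp
qed

text \<open>f - K/x increases and f + K/x decreases, which squeezes a limit together with its rate
  of approach.\<close>

lemma limit_of_integrable_derivative:
 fixes f f' :: "real => real"
 assumes x0: "x0 > 0" and d: "!!x. x >= x0 ==> DERIV f x :> f' x" and bd: "!!x. x >= x0 ==> abs (f' x) <= K / x^2"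
 shows "EX A. ALL x>=x0. abs (f x - A) <= K / x"
proof -
 define g h where "g x = f x - K / x" and "h x = f x + K / x" for x
 have dK: "DERIV (%x. K / x) x :> - (K / x^2)" if "x >= x0" for x
  using that x0 by (auto intro!: derivative_eq_intros simp: power2_eq_square)
 have g: "g x <= g z" if "x0 <= x" "x <= z" for x z
 proof (rule DERIV_nonneg_imp_nondecreasing[OF that(2)])
  fix t assume t: "x <= t" "t <= z"
  show "EX w. DERIV g t :> w & w >= 0"
   unfolding g_def using DERIV_diff[OF d dK, of t] bd[of t] t that(1) by (intro exI[of _ "f' t - - (K / t^2)"]) auto
 qed
 have h: "h z <= h x" if "x0 <= x" "x <= z" for x z
 proof (rule DERIV_nonpos_imp_nonincreasing[OF that(2)])
  fix t assume t: "x <= t" "t <= z"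
  show "EX w. DERIV h t :> w & w <= 0"
   unfolding h_def using DERIV_add[OF d dK, of t] bd[of t] t that(1) by (intro exI[of _ "f' t + - (K / t^2)"]) auto
 qed
 have K0: "K >= 0" using order_trans[OF abs_ge_zero bd[of x0]] x0 by (simp add: zero_le_divide_iff)
 have gh: "g x <= h z" if "x >= x0" "z >= x0" for x z
 proof -
  have "g x <= g (max x z)" using that by (intro g) auto
  also have "... <= h (max x z)" unfolding g_def h_def using K0 that x0 by auto
  also have "... <= h z" using that by (intro h) auto
  finally show ?thesis .
 qed
 define A where "A = Sup (g ` {x0..})"
 have "g x <= A & A <= h x" if x: "x >= x0" for x
  unfolding A_def using gh x by (intro conjI cSup_upper cSup_least bdd_aboveI2[of _ _ "h x0"]) auto
 hence "abs (f x - A) <= K / x" if "x >= x0" for x using that unfolding g_def h_def abs_le_iff by (smt (verit))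
 thus ?thesis by blast
qed

text \<open>(p, p') serves as a moving frame: q = (U/E) p + (V/E) p' with the scalar product U, the
  Wronskian V and the energy E, which p x0 ~= 0 keeps away from zero. For c = 0 the coefficients
  would be constant; here their derivatives are O(1/x^2), so they converge with error
  O(1/x).\<close>

lemma oscillator_solution_basis:
 fixes p p1 q q1 :: "real => real"
 assumes x0: "x0 > 0" and p: "!!x. x >= x0 ==> DERIV p x :> p1 x"
   "!!x. x >= x0 ==> DERIV p1 x :> - (1 - c / x^2) * p x" and q: "!!x. x >= x0 ==> DERIV q x :> q1 x"
   "!!x. x >= x0 ==> DERIV q1 x :> - (1 - c / x^2) * q x" and nz: "p x0 ~= 0"
 shows "EX A B K. ALL x>=x0. abs (q x - A * p x - B * p1 x) <= K / x"
proof -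
 define E where "E x = (p x)^2 + (p1 x)^2" for x
 define Eq where "Eq x = (q x)^2 + (q1 x)^2" for x
 define e0 where "e0 = E x0 * exp (- abs c / x0)"
 define M where "M = max (E x0 * exp (abs c / x0)) (Eq x0 * exp (abs c / x0))"
 have e0: "e0 > 0" using nz by (simp add: e0_def E_def add_pos_nonneg)
 have Elow: "E x >= e0" if "x >= x0" for x using oscillator_energy(2)[OF x0 p that] by (simp add: E_def e0_def)
 have Eup: "E x <= M" "Eq x <= M" if "x >= x0" for x
  using oscillator_energy(1)[OF x0 p that] oscillator_energy(1)[OF x0 q that]
  by (auto simp: E_def Eq_def M_def le_max_iff_disj)
 have prod: "abs (a * b) <= M" if "a^2 <= M" "b^2 <= M" for a b :: real
  using sum_squares_bound[of "abs a" "abs b"] that by (simp add: abs_mult)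
 have sq: "(p x)^2 <= M" "(p1 x)^2 <= M" "(q x)^2 <= M" "(q1 x)^2 <= M" if "x >= x0" for x
  using Eup[OF that] unfolding E_def Eq_def by (smt (verit) zero_le_power2)+
 define U where "U x = q x * p x + q1 x * p1 x" for x
 define V where "V x = q x * p1 x - q1 x * p x" for x
 define R where "R x = c / x^2" for x
 have dE: "DERIV E x :> 2 * R x * (p x * p1 x)" if "x >= x0" for x unfolding E_def R_def using p[OF that] that x0
  by (auto intro!: derivative_eq_intros simp: field_simps power2_eq_square)
 have dU: "DERIV U x :> R x * (q x * p1 x + q1 x * p x)" if "x >= x0" for x unfolding U_def R_def using p[OF that] q[OF that]
  by (auto intro!: derivative_eq_intros simp: algebra_simps)
 have dV: "DERIV V x :> 0" if "x >= x0" for x unfolding V_def using p[OF that] q[OF that]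
  by (auto intro!: derivative_eq_intros simp: algebra_simps)
 have M0: "M > 0" using Elow[of x0] Eup(1)[of x0] e0 by auto
 have quot: "EX K. ALL x>=x0. abs ((f' x * E x - f x * (2 * R x * (p x * p1 x))) / (E x * E x)) <= K / x^2"
  if f: "!!x. x >= x0 ==> abs (f x) <= 2 * M" "!!x. x >= x0 ==> abs (f' x) <= abs (R x) * (2 * M)" for f f' :: "real => real"
 proof (intro exI allI impI)
  fix x assume x: "x >= x0"
  have "abs (f' x * E x) <= (abs (R x) * (2 * M)) * M"
   unfolding abs_mult using f(2)[OF x] Eup(1)[OF x] Elow[OF x] e0 by (intro mult_mono) auto
  moreover have "abs (f x * (2 * R x * (p x * p1 x))) <= (2 * M) * (2 * abs (R x) * M)"
   using prod[OF sq(1,2)[OF x]] f(1)[OF x] M0 unfolding abs_mult[of _ "_ * _"] abs_mult[of "2 * _"] abs_mult[of 2]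
   by (intro mult_mono) auto
  ultimately have "abs (f' x * E x - f x * (2 * R x * (p x * p1 x))) <= 6 * M * M * abs (R x)" by (simp add: algebra_simps)
  hence "abs (f' x * E x - f x * (2 * R x * (p x * p1 x))) / (E x * E x) <= (6 * M * M * abs (R x)) / (e0 * e0)"
   using Elow[OF x] e0 by (intro frac_le mult_mono mult_pos_pos) auto
  also have "... = (6 * M * M * abs c / (e0 * e0)) / x^2" by (simp add: R_def)
  finally show "abs ((f' x * E x - f x * (2 * R x * (p x * p1 x))) / (E x * E x)) <= (6 * M * M * abs c / (e0 * e0)) / x^2"
   by (simp add: abs_mult)
 qed
 have Enz: "E x ~= 0" if "x >= x0" for x using Elow[OF that] e0 by auto
 have "abs (U x) <= 2 * M" if "x >= x0" for x using prod[OF sq(3,1)[OF that]] prod[OF sq(4,2)[OF that]] by (simp add: U_def)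
 moreover have "abs (R x * (q x * p1 x + q1 x * p x)) <= abs (R x) * (2 * M)" if "x >= x0" for x
  unfolding abs_mult[of "R x"] using prod[OF sq(3,2)[OF that]] prod[OF sq(4,1)[OF that]] by (intro mult_left_mono) auto
 ultimately obtain K1 where K1: "!!x. x >= x0 ==>
   abs ((R x * (q x * p1 x + q1 x * p x) * E x - U x * (2 * R x * (p x * p1 x))) / (E x * E x)) <= K1 / x^2"
  using quot[of U "%x. R x * (q x * p1 x + q1 x * p x)"] by blast
 have "abs (V x) <= 2 * M" if "x >= x0" for x using prod[OF sq(3,2)[OF that]] prod[OF sq(4,1)[OF that]] by (simp add: V_def)
 then obtain K2 where K2: "!!x. x >= x0 ==>
   abs ((0 * E x - V x * (2 * R x * (p x * p1 x))) / (E x * E x)) <= K2 / x^2"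
  using quot[of V "%x. 0"] M0 by auto
 obtain A where A: "!!x. x >= x0 ==> abs (U x / E x - A) <= K1 / x"
  using limit_of_integrable_derivative[OF x0 DERIV_divide[OF dU dE Enz] K1] by blast
 obtain B where B: "!!x. x >= x0 ==> abs (V x / E x - B) <= K2 / x"
  using limit_of_integrable_derivative[OF x0 DERIV_divide[OF dV dE Enz] K2] by blast
 have "abs (q x - A * p x - B * p1 x) <= ((K1 + K2) * sqrt M) / x" if x: "x >= x0" for x
 proof -
  have "q x * E x = U x * p x + V x * p1 x" unfolding U_def V_def E_def by (simp add: algebra_simps power2_eq_square)
  hence "q x = (U x / E x) * p x + (V x / E x) * p1 x" using Enz[OF x] by (simp add: field_simps)
  hence e: "q x - A * p x - B * p1 x = (U x / E x - A) * p x + (V x / E x - B) * p1 x" by (simp add: algebra_simps)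
  have r: "abs (p x) <= sqrt M" "abs (p1 x) <= sqrt M" using sq[OF x] by (simp_all add: real_le_rsqrt)
  have "abs (q x - A * p x - B * p1 x) <= abs (U x / E x - A) * abs (p x) + abs (V x / E x - B) * abs (p1 x)"
   unfolding e by (rule order_trans[OF abs_triangle_ineq]) (simp add: abs_mult)
  also have "... <= (K1 / x) * sqrt M + (K2 / x) * sqrt M" using A[OF x] B[OF x] r M0 by (intro add_mono mult_mono) auto
  finally show ?thesis by (simp add: algebra_simps add_divide_distrib)
 qed
 thus ?thesis by blast
qed

text \<open>Liouville's transformation: the factor x^(nu+1/2) removes the first-order term of
  Bessel's equation and leaves an oscillator whose potential differs from 1 by an integrable
  amount.\<close>

lemma radial_ode_oscillator:
 assumes ode: "radial_ode nu F F1 F2" and x: "x > 0"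
 defines "a == nu + 1 / 2"
 defines "y == %x. x powr a * F (x^2 / 4)"
  and "y1 == %x. x powr a * (a * F (x^2 / 4) / x + x / 2 * F1 (x^2 / 4))"
 shows "DERIV y x :> y1 x"
  and "DERIV y1 x :> - (1 - (nu^2 - 1/4) / x^2) * y x"
proof -
 have F: "DERIV F (x^2/4) :> F1 (x^2/4)" "DERIV F1 (x^2/4) :> F2 (x^2/4)"
  and eq: "x^2/4 * F2 (x^2/4) + (nu + 1) * F1 (x^2/4) + F (x^2/4) = 0"
  using ode[unfolded radial_ode_def, rule_format, of "x^2/4"] x by auto
 have sq: "DERIV (%x. x^2 / 4) x :> x / 2" by (auto intro!: derivative_eq_intros)
 have dF: "DERIV (%x. F (x^2/4)) x :> F1 (x^2/4) * (x / 2)" and dF1: "DERIV (%x. F1 (x^2/4)) x :> F2 (x^2/4) * (x / 2)"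
  by (rule DERIV_chain2[OF F(1) sq], rule DERIV_chain2[OF F(2) sq])
 have pw: "DERIV (%x. x powr a) x :> a * x powr a / x" using has_real_derivative_powr[OF x, of a] x by (simp add: powr_diff)
 show "DERIV y x :> y1 x" unfolding y_def y1_def by (rule DERIV_cong[OF DERIV_mult[OF pw dF]]) (simp add: algebra_simps)
 have dG: "((%x. a * F (x^2/4) / x + x / 2 * F1 (x^2/4)) has_field_derivative
   (a * (F1 (x^2/4) * (x/2)) * x - a * F (x^2/4) * 1) / (x * x) + (1 / 2 * F1 (x^2/4) + F2 (x^2/4) * (x/2) * (x / 2))) (at x)"
  by (rule DERIV_add[OF DERIV_divide[OF DERIV_cmult[OF dF] DERIV_ident] DERIV_mult[OF DERIV_cdivide[OF DERIV_ident] dF1]])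
   (use x in simp)
 show "DERIV y1 x :> - (1 - (nu^2 - 1/4) / x^2) * y x" unfolding y1_def
 proof (rule DERIV_cong[OF DERIV_mult[OF pw dG]])
  have F2: "F2 (x^2/4) * (x/2) * (x / 2) = - (nu + 1) * F1 (x^2/4) - F (x^2/4)"
   using eq by (simp add: power2_eq_square algebra_simps)
  have "a / x * (a * F (x^2/4) / x + x / 2 * F1 (x^2/4)) + ((a * (F1 (x^2/4) * (x/2)) * x - a * F (x^2/4) * 1) / (x * x) + (1 / 2 * F1 (x^2/4) + (- (nu + 1) * F1 (x^2/4) - F (x^2/4))))
    = - (1 - (nu^2 - 1/4) / x^2) * F (x^2/4)"
   using x unfolding a_def by (simp add: divide_simps power2_eq_square) (simp add: algebra_simps)
  hence "x powr a * (a / x * (a * F (x^2/4) / x + x / 2 * F1 (x^2/4)) + ((a * (F1 (x^2/4) * (x/2)) * x - a * F (x^2/4) * 1) / (x * x) + (1 / 2 * F1 (x^2/4) + F2 (x^2/4) * (x/2) * (x/2))))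
    = - (1 - (nu^2 - 1/4) / x^2) * y x"
   unfolding F2 y_def by (metis mult.left_commute)
  thus "a * x powr a / x * (a * F (x^2 / 4) / x + x / 2 * F1 (x^2 / 4)) +
   ((a * (F1 (x^2 / 4) * (x / 2)) * x - a * F (x^2 / 4) * 1) / (x * x) + (1 / 2 * F1 (x^2 / 4) + F2 (x^2 / 4) * (x / 2) * (x / 2))) * x powr a
   = - (1 - (nu^2 - 1/4) / x^2) * y x"
   by (simp only: distrib_left mult.commute[of _ "x powr a"] times_divide_eq_right mult.assoc) (use x in "simp add: mult_ac")
 qed
qed

lemma radial_ode_far:
 assumes ode: "radial_ode nu F F1 F2" and x0: "x0 > 0"
 shows "EX C. ALL x>=x0. abs (F (x^2/4)) <= C * x powr (-(nu + 1/2)) & abs (x / 2 * F1 (x^2/4)) <= C * x powr (-(nu + 1/2))"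
proof -
 define a where "a = nu + 1 / 2"
 define y where "y = (%x. x powr a * F (x^2 / 4))"
 define y1 where "y1 = (%x. x powr a * (a * F (x^2 / 4) / x + x / 2 * F1 (x^2 / 4)))"
 have osc: "DERIV y x :> y1 x" "DERIV y1 x :> - (1 - (nu^2 - 1/4) / x^2) * y x"
  if "x >= x0" for x using radial_ode_oscillator[OF ode, of x] that x0 unfolding y_def y1_def a_def by auto
 define M where "M = sqrt (((y x0)^2 + (y1 x0)^2) * exp (abs (nu^2 - 1/4) / x0))"
 have bd: "abs (y x) <= M & abs (y1 x) <= M" if x: "x >= x0" for x
 proof -
  have "(y x)^2 + (y1 x)^2 <= ((y x0)^2 + (y1 x0)^2) * exp (abs (nu^2 - 1/4) / x0)"
   by (rule oscillator_energy(1)[OF x0 osc x])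
  thus ?thesis unfolding M_def by (auto intro!: real_le_rsqrt simp: ) (smt (verit) zero_le_power2)+
 qed
 have M0: "M >= 0" using bd[of x0] by auto
 show ?thesis
 proof (intro exI[of _ "M + abs a * M / x0"] allI impI)
  fix x assume x: "x >= x0"
  have xp: "x > 0" using x x0 by simp
  have F: "F (x^2/4) = y x * x powr (-a)" using xp by (simp add: y_def powr_minus field_simps)
  have 1: "abs (F (x^2/4)) <= M * x powr (-a)" unfolding F abs_mult using bd[OF x] by (simp add: mult_right_mono)
  have G: "x / 2 * F1 (x^2/4) = (y1 x - a * y x / x) * x powr (-a)" using xp by (simp add: y_def y1_def powr_minus field_simps)
  have "abs (a * y x / x) <= abs a * M / x0"
   unfolding abs_mult abs_divide using bd[OF x] x x0 M0 by (intro frac_le mult_mono mult_nonneg_nonneg) auto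
  hence 2: "abs (y1 x - a * y x / x) <= M + abs a * M / x0" using bd[OF x] by linarith
  have 3: "abs (x / 2 * F1 (x^2/4)) <= (M + abs a * M / x0) * x powr (-a)"
   unfolding G abs_mult using 2 by (simp add: mult_right_mono)
  have "M * x powr (-a) <= (M + abs a * M / x0) * x powr (-a)" using M0 x0 by (intro mult_right_mono) auto
  thus "abs (F (x^2/4)) <= (M + abs a * M / x0) * x powr (-(nu + 1/2)) & abs (x / 2 * F1 (x^2/4)) <= (M + abs a * M / x0) * x powr (-(nu + 1/2))"
   using 1 3 unfolding a_def by linarith
 qed
qed

text \<open>To be used with the profile of J as F and that of Y as G. The oscillator frame (p, p')
  is replaced by F and its radial derivative; the part a F / x of p' that is left over is of the
  same order as the error.\<close>

lemma radial_ode_combination: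
 assumes F: "radial_ode nu F F1 F2" and G: "radial_ode nu G G1 G2" and x0: "0 < x0" "F (x0^2/4) ~= 0"
 shows "EX A B C. ALL x>=x0. abs (G (x^2/4) - A * F (x^2/4) - B * (x / 2 * F1 (x^2/4))) <= C * x powr (-(nu + 3/2))"
proof -
 define a where "a = nu + 1 / 2"
 define p where "p = (%x. x powr a * F (x^2 / 4))"
 define p1 where "p1 = (%x. x powr a * (a * F (x^2 / 4) / x + x / 2 * F1 (x^2 / 4)))"
 define q where "q = (%x. x powr a * G (x^2 / 4))"
 define q1 where "q1 = (%x. x powr a * (a * G (x^2 / 4) / x + x / 2 * G1 (x^2 / 4)))"
 have p: "DERIV p x :> p1 x" "DERIV p1 x :> - (1 - (nu^2 - 1/4) / x^2) * p x"
  if "x >= x0" for x using radial_ode_oscillator[OF F, of x] that x0 unfolding p_def p1_def a_def by auto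
 have q: "DERIV q x :> q1 x" "DERIV q1 x :> - (1 - (nu^2 - 1/4) / x^2) * q x"
  if "x >= x0" for x using radial_ode_oscillator[OF G, of x] that x0 unfolding q_def q1_def a_def by auto
 have "EX A B K. ALL x>=x0. abs (q x - A * p x - B * p1 x) <= K / x"
  by (rule oscillator_solution_basis[OF x0(1) p q]) (use x0 in "auto simp: p_def")
 then obtain A B K where K: "!!x. x >= x0 ==> abs (q x - A * p x - B * p1 x) <= K / x" by blast
 obtain C where C: "!!x. x >= x0 ==> abs (F (x^2/4)) <= C * x powr (-a)"
  using radial_ode_far[OF F x0(1)] unfolding a_def by blast
 have "abs (G (x^2/4) - A * F (x^2/4) - B * (x / 2 * F1 (x^2/4))) <= (K + abs (B * a) * C) * x powr (-(nu + 3/2))"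
  if x: "x >= x0" for x
 proof -
  have xp: "x > 0" using x x0 by simp
  have e: "G (x^2/4) - A * F (x^2/4) - B * (x / 2 * F1 (x^2/4))
    = (q x - A * p x - B * p1 x) * x powr (-a) + B * a * F (x^2/4) / x"
   using xp unfolding p_def q_def p1_def by (simp add: powr_minus field_simps)
  have pe: "x powr (-(nu + 3/2)) = x powr (-a) / x"
  proof -
   have "-(nu + 3/2) = - a - 1" by (simp add: a_def)
   thus ?thesis using xp by (simp only: powr_diff) simp
  qed
  have "abs ((q x - A * p x - B * p1 x) * x powr (-a)) <= K / x * x powr (-a)"
   using mult_right_mono[OF K[OF x], of "x powr (-a)"] by (simp add: abs_mult)
  moreover have "abs (B * a * F (x^2/4) / x) <= abs (B * a) * (C * x powr (-a)) / x"
   unfolding abs_divide abs_mult[of "B * a"] using C[OF x] xp by (simp add: divide_right_mono mult_left_mono)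
  ultimately have "abs ((q x - A * p x - B * p1 x) * x powr (-a) + B * a * F (x^2/4) / x)
    <= K / x * x powr (-a) + abs (B * a) * (C * x powr (-a)) / x" by linarith
  also have "... = (K + abs (B * a) * C) * (x powr (-a) / x)" by (simp add: distrib_right mult.assoc add_divide_distrib)
  finally show ?thesis unfolding e pe .
 qed
 thus ?thesis by blast
qed

section \<open>Decay of convolutions\<close>

abbreviation jb :: "'a::real_normed_vector => real" where "jb == japanese_bracket"

lemma jb_ge_1: "jb x >= 1"
 by (simp add: japanese_bracket_def)

lemma jb_pos: "jb x > 0"
 using jb_ge_1[of x] by linarith

lemma jb_nonzero [simp]: "jb x ~= 0"
 using jb_pos[of x] by linarith

abbreviation (input) jp where "jp x s == jb x powr (- s)"

lemma bnd0: "abs y <= A * jb x powr s ==> 0 <= A"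
 using order_trans[OF abs_ge_zero, of y "A * jb x powr s"] by (simp add: zero_le_mult_iff)

lemma nbnd0: "norm y <= A * jb x powr s ==> 0 <= A"
 using order_trans[OF norm_ge_zero, of y "A * jb x powr s"] by (simp add: zero_le_mult_iff)

lemma norm_le_jb: "norm x <= jb x"
 by (simp add: japanese_bracket_def real_le_rsqrt)

lemma jb_minus: "jb (- x) = jb x"
 by (simp add: japanese_bracket_def)

lemma jb_square: "(jb x)^2 = 1 + (norm x)^2"
 by (simp add: japanese_bracket_def)

lemma jb_le: "jb x <= 1 + norm x"
proof -
 have "(jb x)^2 <= (1 + norm x)^2" unfolding jb_square by (simp add: power2_eq_square algebra_simps)
 thus ?thesis by (rule power2_le_imp_le) simp
qed

lemma jb_triangle: "jb (x + y) <= jb x + jb y"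
proof -
 have "(jb (x + y))^2 <= 1 + (norm x + norm y)^2" unfolding jb_square by (simp add: norm_triangle_ineq power_mono)
 also have "... <= (jb x)^2 + (jb y)^2 + 2 * (norm x * norm y)"
  unfolding jb_square by (simp add: power2_eq_square algebra_simps)
 also have "... <= (jb x)^2 + (jb y)^2 + 2 * (jb x * jb y)"
  using mult_mono[OF norm_le_jb[of x] norm_le_jb[of y]] jb_pos[of x] by simp
 also have "... = (jb x + jb y)^2" by (simp add: power2_eq_square algebra_simps)
 finally show ?thesis by (rule power2_le_imp_le) (simp add: add_nonneg_nonneg less_imp_le[OF jb_pos])
qed

lemma jb_triangle': "jb x <= jb (x - y) + jb y"
 using jb_triangle[of "x - y" y] by simp

lemma jb_peetre: "jb x <= 2 * jb (x - y) * jb y"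
proof -
 have "jb (x - y) * 1 <= jb (x - y) * jb y" "1 * jb y <= jb (x - y) * jb y"
  using jb_ge_1[of y] jb_ge_1[of "x - y"] by (intro mult_left_mono mult_right_mono; simp)+
 thus ?thesis using jb_triangle'[of x y] by linarith
qed

lemma continuous_on_jb [continuous_intros]:
 "continuous_on A f ==> continuous_on A (%x. jb (f x))" unfolding japanese_bracket_def by (intro continuous_intros)

lemma continuous_on_jb_powr [continuous_intros]:
 "continuous_on A f ==> continuous_on A (%x. jb (f x) powr a)" by (intro continuous_intros) auto

lemma measurable_jb [measurable]: "jb : bmeas"
 by (intro borel_measurable_continuous_onI continuous_intros)

lemma jb_powr_antimono: "a <= b ==> jp x b <= jp x a"
 using jb_ge_1[of x] by (intro powr_mono) auto

lemma lborel_reflect: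
 fixes f :: "'a::euclidean_space => 'b::{banach, second_countable_topology}"
 assumes "intble f"
 shows "intble (%y. f (x - y))" "(LBINT y. f (x - y)) = (LBINT y. f y)"
proof -
 have eq: "lborel = distr lborel borel (%y::'a. x - y)" using lborel_affine[of "-1" x] by (simp add: density_1)
 have m: "(%y. x - y) : measurable lborel borel" by simp
 have f: "f : bmeas" using assms by auto
 show "intble (%y. f (x - y))" using assms by (subst (asm) eq) (simp add: integrable_distr_eq[OF m f])
 show "(LBINT y. f (x - y)) = (LBINT y. f y)" by (subst (2) eq) (simp add: integral_distr[OF m f])
qed

lemma lborel_translate:
 fixes f :: "'a::euclidean_space => 'b::{banach, second_countable_topology}"
 assumes "intble f"
 shows "intble (%y. f (y + x))" "(LBINT y. f (y + x)) = (LBINT y. f y)"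
proof -
 have eq: "lborel = distr lborel borel (%y::'a. y + x)" using lborel_affine[of "1" x] by (simp add: density_1 add.commute)
 have m: "(%y. y + x) : measurable lborel borel" by simp
 have f: "f : bmeas" using assms by auto
 show "intble (%y. f (y + x))" using assms by (subst (asm) eq) (simp add: integrable_distr_eq[OF m f])
 show "(LBINT y. f (y + x)) = (LBINT y. f y)" by (subst (2) eq) (simp add: integral_distr[OF m f])
qed

lemma suminf_geometric_ennreal:
 fixes a c :: real assumes "a >= 0" "0 <= c" "c < 1"
 shows "(\<Sum>k. ennreal (a * c ^ k)) < \<infinity>"
proof -
 have "summable (%k. a * c ^ k)" using assms by (intro summable_mult summable_geometric) auto
 hence "(\<Sum>k. ennreal (a * c ^ k)) = ennreal (\<Sum>k. a * c ^ k)" using assms by (intro suminf_ennreal2) auto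
 thus ?thesis by simp
qed

text \<open>Comparison with a sum over balls of radius r^k. With r = 2 it handles decay at infinity
  and with r = 1/2 a singularity at the origin, through one geometric series.\<close>

lemma integrable_dyadic:
 fixes f :: "'a::euclidean_space => real"
 assumes [measurable]: "f : bmeas" and bd: "!!x. x ~= 0 ==> f x = 0 | (EX k. norm x <= r ^ k & abs (f x) <= A * b ^ k)"
  and "A >= 0" "b >= 0" "r > 0" "b * r ^ DIM('a) < 1"
 shows "intble f"
proof (rule integrableI_bounded)
 have "(\<integral>\<^sup>+x. ennreal (norm (f x)) \<partial>lborel) <= (\<integral>\<^sup>+x. (\<Sum>k. ennreal (A * b ^ k) * indicator (cball (0::'a) (r ^ k)) x) \<partial>lborel)"
 proof (rule nn_integral_mono_AE)
  show "AE x in lborel. ennreal (norm (f x)) <= (\<Sum>k. ennreal (A * b ^ k) * indicator (cball (0::'a) (r ^ k)) x)"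
   using AE_lborel_singleton[of 0]
  proof eventually_elim
   case (elim x)
   from bd[OF elim] show ?case
   proof
    assume "EX k. norm x <= r ^ k & abs (f x) <= A * b ^ k"
    then obtain k where k: "norm x <= r ^ k" "abs (f x) <= A * b ^ k" by blast
    define h where "h = (%k. ennreal (A * b ^ k) * indicator (cball (0::'a) (r ^ k)) x)"
    have "ennreal (norm (f x)) <= h k" using k by (simp add: ennreal_leI indicator_def h_def)
    also have "h k = sum h {k}" by simp
    also have "... <= (\<Sum>k. h k)" by (rule sum_le_suminf) auto
    finally show ?thesis unfolding h_def .
   qed simp
  qed
 qed
 also have "... = (\<Sum>k. (\<integral>\<^sup>+x. ennreal (A * b ^ k) * indicator (cball (0::'a) (r ^ k)) x \<partial>lborel))"
  by (rule nn_integral_suminf) (intro borel_measurable_times_ennreal borel_measurable_indicator; simp)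
 also have "... = (\<Sum>k. ennreal ((A * unit_ball_vol DIM('a)) * (b * r ^ DIM('a)) ^ k))"
 proof (rule suminf_cong)
  fix k
  have "(\<integral>\<^sup>+x. ennreal (A * b ^ k) * indicator (cball (0::'a) (r ^ k)) x \<partial>lborel)
    = ennreal (A * b ^ k) * ennreal (unit_ball_vol DIM('a) * (r ^ k) ^ DIM('a))"
   using assms by (simp add: nn_integral_cmult_indicator emeasure_cball)
  also have "... = ennreal ((A * b ^ k) * (unit_ball_vol DIM('a) * (r ^ k) ^ DIM('a)))"
   using assms by (simp add: ennreal_mult unit_ball_vol_nonneg)
  also have "(A * b ^ k) * (unit_ball_vol DIM('a) * (r ^ k) ^ DIM('a)) = (A * unit_ball_vol DIM('a)) * (b * r ^ DIM('a)) ^ k"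
   by (simp add: power_mult_distrib power_mult[symmetric] mult_ac)
  finally show "(\<integral>\<^sup>+x. ennreal (A * b ^ k) * indicator (cball (0::'a) (r ^ k)) x \<partial>lborel)
    = ennreal ((A * unit_ball_vol DIM('a)) * (b * r ^ DIM('a)) ^ k)" .
 qed
 also have "... < \<infinity>" using assms by (intro suminf_geometric_ennreal) (auto simp: unit_ball_vol_nonneg)
 finally show "(\<integral>\<^sup>+x. ennreal (norm (f x)) \<partial>lborel) < \<infinity>" .
qed simp

lemma integrable_jb_powr:
 assumes "s > real DIM('a::euclidean_space)"
 shows "intble (%x::'a. jp x s)"
proof (rule integrable_dyadic[where r = 2 and b = "2 powr (-s)" and A = "2 powr s"])
 show "2 powr (-s) * 2 ^ DIM('a) < (1::real)"
 proof -
  have "2 powr (-s) * 2 ^ DIM('a) = (2::real) powr (real DIM('a) - s)"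
   by (simp add: powr_realpow[symmetric] powr_add[symmetric])
  also have "... < 2 powr 0" using assms by (intro powr_less_mono) auto
  finally show ?thesis by simp
 qed
 fix x :: 'a
 \<comment> \<open>The smallest dyadic ball that contains x, so that the bracket of x is at least
   half its radius.\<close>
 define k where "k = (LEAST k. norm x <= 2 ^ k)"
 have ex: "EX k. norm x <= 2 ^ k" using real_arch_pow[of 2 "norm x"] less_imp_le by auto
 have k: "norm x <= 2 ^ k" unfolding k_def by (rule LeastI_ex[OF ex])
 have "jb x >= 2 ^ k / 2"
 proof (cases k)
  case 0 thus ?thesis using jb_ge_1[of x] by simp
 next
  case (Suc m)
  hence "~ norm x <= 2 ^ m" using not_less_Least[of m "%k. norm x <= 2 ^ k"] by (simp add: k_def)
  thus ?thesis using norm_le_jb[of x] Suc by simp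
 qed
 hence "jp x s <= (2 ^ k / 2) powr (-s)" using assms by (intro powr_mono2') auto
 also have "(2 ^ k / 2) powr (-s) = 2 powr s * (2 powr (-s)) ^ k"
 proof -
  have "(2 ^ k) powr (-s) = (2 powr (-s)) ^ k" by (simp add: powr_realpow[symmetric] powr_powr mult.commute)
  moreover have "2 powr (-s) = inverse (2 powr s :: real)" by (rule powr_minus)
  moreover have "(2 ^ k / 2) powr (-s) = (2 ^ k) powr (-s) / (2 powr (-s) :: real)" by (rule powr_divide)
  ultimately show ?thesis by (simp only: divide_inverse inverse_inverse_eq mult.commute)
 qed
 finally show "jp x s = 0 | (EX k. norm x <= 2 ^ k & abs (jp x s) <= 2 powr s * (2 powr (-s)) ^ k)" using k by auto
qed auto

text \<open>The Newtonian singularity cut off at distance 1. Together with a power of the bracket,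
  as in \<open>maj\<close>, it dominates every singular kernel below.\<close>

definition loc_kernel :: "'a::euclidean_space => real" where
 "loc_kernel x = indicator (cball 0 1) x * norm x powr (- (real DIM('a) - 2))"

abbreviation (input) maj where "maj s z == loc_kernel z + jp z s"

lemma loc_kernel_nonneg: "loc_kernel x >= 0"
 by (simp add: loc_kernel_def)

lemma measurable_loc_kernel [measurable]: "loc_kernel : bmeas"
 unfolding loc_kernel_def by (intro borel_measurable_times borel_measurable_indicator powr_real_measurable) auto

lemma integrable_loc_kernel:
 assumes "DIM('a::euclidean_space) >= 3"
 shows "intble (loc_kernel :: 'a => real)"
proof (rule integrable_dyadic[where r = "1/2" and b = "2 powr (real DIM('a) - 2)" and A = "2 powr (real DIM('a) - 2)"])
 let ?m = "real DIM('a) - 2"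
 show "2 powr ?m * (1 / 2) ^ DIM('a) < (1::real)"
 proof -
  have "2 powr ?m * (1 / 2) ^ DIM('a) = (2::real) powr (?m - real DIM('a))"
   by (simp add: powr_realpow[symmetric] powr_diff powr_minus power_divide)
  also have "... < 2 powr 0" by (intro powr_less_mono) auto
  finally show ?thesis by simp
 qed
 fix x :: 'a assume x: "x ~= 0"
 show "loc_kernel x = 0 | (EX k. norm x <= (1/2) ^ k & abs (loc_kernel x) <= 2 powr ?m * (2 powr ?m) ^ k)"
 proof (cases "norm x <= 1")
  case True
  define k where "k = (LEAST k. (1/2) ^ Suc k < norm x)"
  obtain j where j: "(1/2::real) ^ j < norm x" using real_arch_pow_inv[of "norm x" "1/2"] x by auto
  have "(1/2::real) ^ Suc j <= (1/2) ^ j" by simp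
  hence ex: "EX k. (1/2::real) ^ Suc k < norm x" using j by (intro exI[of _ j]) linarith
  have k: "(1/2) ^ Suc k < norm x" unfolding k_def by (rule LeastI_ex[OF ex])
  have k': "norm x <= (1/2) ^ k"
  proof (cases k)
   case 0 thus ?thesis using True by simp
  next
   case (Suc m)
   hence "~ (1/2) ^ Suc m < norm x" using not_less_Least[of m "%k. (1/2) ^ Suc k < norm x"] by (simp add: k_def)
   thus ?thesis using Suc by simp
  qed
  have "norm x powr (-?m) <= ((1/2) ^ Suc k) powr (-?m)" using k assms by (intro powr_mono2') auto
  also have "... = 2 powr ?m * (2 powr ?m) ^ k"
  proof -
   have "2 powr (- real (Suc k)) = inverse (2 ^ Suc k :: real)" by (simp only: powr_minus powr_realpow zero_less_numeral)
   hence "(1/2::real) ^ Suc k = 2 powr (- real (Suc k))" by (metis power_one_over inverse_eq_divide)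
   hence "((1/2::real) ^ Suc k) powr (-?m) = 2 powr (- real (Suc k) * -?m)" by (simp only: powr_powr)
   also have "- real (Suc k) * -?m = ?m * real (Suc k)" by (simp only: minus_mult_minus mult.commute)
   also have "2 powr (?m * real (Suc k)) = (2 powr ?m) powr real (Suc k)" by (simp only: powr_powr)
   also have "... = (2 powr ?m) ^ Suc k" by (rule powr_realpow) simp
   finally show ?thesis by simp
  qed
  finally show ?thesis using k' True by (intro disjI2 exI[of _ k]) (auto simp: loc_kernel_def)
 qed (simp add: loc_kernel_def)
qed auto

text \<open>Bounding both brackets below by their minimum charges the whole exponent p + q to a
  single bracket.\<close>

lemma integrable_jb_conv:
 fixes x :: "'a::euclidean_space"
 assumes "p >= 0" "q >= 0" "p + q > real DIM('a)"
 shows "intble (%y. jp (x - y) p * jp y q)"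
  "(LBINT y. jp (x - y) p * jp y q) <= 2 * (LBINT y. jp (y::'a) (p+q))"
proof -
 have i: "intble (%y::'a. jp y (p+q))" by (rule integrable_jb_powr[OF assms(3)])
 have i2: "intble (%y::'a. jp (x - y) (p+q) + jp y (p+q))" using lborel_reflect(1)[OF i] i by (rule L1_add)
 have le: "jp (x - y) p * jp y q <= jp (x - y) (p+q) + jp y (p+q)" for y
 proof -
  define m where "m = min (jb (x - y)) (jb y)"
  have m: "m > 0" "m <= jb (x - y)" "m <= jb y" using jb_pos by (auto simp: m_def)
  have "jp (x - y) p * jp y q <= m powr (-p) * m powr (-q)" using m assms by (intro mult_mono powr_mono2') auto
  also have "... = m powr (-(p+q))" by (simp add: powr_add[symmetric])
  also have "... <= jp (x - y) (p+q) + jp y (p+q)" by (auto simp: m_def min_def)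
  finally show ?thesis .
 qed
 show int: "intble (%y. jp (x - y) p * jp y q)" by (rule L1_bound[OF i2]) (use le in "auto simp: abs_mult")
 have "(LBINT y. jp (x - y) p * jp y q) <= (LBINT y. jp (x - y) (p+q) + jp y (p+q))"
  by (rule integral_mono[OF int i2]) (use le in auto)
 also have "... = 2 * (LBINT y. jp (y::'a) (p+q))" using lborel_reflect[OF i, of x] i by simp
 finally show "(LBINT y. jp (x - y) p * jp y q) <= 2 * (LBINT y. jp (y::'a) (p+q))" .
qed

text \<open>By the triangle inequality the larger of the two brackets is at least half that of x, so
  the decay g can be extracted from whichever factor is large; what remains is integrable because p
  + b - g exceeds the dimension.\<close>

lemma jb_conv_decay:
 assumes "0 <= g" "g <= p" "g <= b" "p + b - g > real DIM('a::euclidean_space)"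
 shows "EX C>=0. ALL x::'a. intble (%y. jp (x - y) p * jp y b)
   & (LBINT y. jp (x - y) p * jp y b) <= C * jp x g"
proof -
 define I where "I = (LBINT y. jp (y::'a) (p+b-g))"
 show ?thesis
 proof (intro exI[of _ "2 powr g * (4 * I)"] conjI allI)
  show "0 <= 2 powr g * (4 * I)" unfolding I_def by (intro mult_nonneg_nonneg Lint_nonneg) auto
  fix x :: 'a
  show int: "intble (%y. jp (x - y) p * jp y b)" by (rule integrable_jb_conv) (use assms in auto)
  have eq: "p - g + b = p + b - g" "p + (b - g) = p + b - g" by simp_all
  have i1: "intble (%y. jp (x - y) (p-g) * jp y b)"
   "(LBINT y. jp (x - y) (p-g) * jp y b) <= 2 * I"
   unfolding I_def using integrable_jb_conv[of "p-g" b x, unfolded eq] assms by auto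
  have i2: "intble (%y. jp (x - y) p * jp y (b-g))"
   "(LBINT y. jp (x - y) p * jp y (b-g)) <= 2 * I"
   unfolding I_def using integrable_jb_conv[of p "b-g" x, unfolded eq] assms by auto
  have le: "jp (x - y) p * jp y b <= 2 powr g * jp x g *
    (jp (x - y) (p-g) * jp y b + jp (x - y) p * jp y (b-g))" for y
  proof -
   define m where "m = max (jb (x - y)) (jb y)"
   have "jb x <= 2 * m" using jb_triangle'[of x y] unfolding m_def by linarith
   hence "jb x powr g <= (2 * m) powr g" using assms jb_pos[of x] by (intro powr_mono2) auto
   also have "... = 2 powr g * m powr g" using jb_pos[of y] by (intro powr_mult)
   also have "... <= 2 powr g * (jb (x - y) powr g + jb y powr g)" by (intro mult_left_mono) (auto simp: m_def max_def)
   finally have "jb x powr g <= 2 powr g * (jb (x - y) powr g + jb y powr g)" .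
   hence 1: "1 <= 2 powr g * jp x g * (jb (x - y) powr g + jb y powr g)"
    using jb_pos[of x] by (simp add: powr_minus field_simps)
   have "1 * (jp (x - y) p * jp y b) <= (2 powr g * jp x g * (jb (x - y) powr g + jb y powr g)) * (jp (x - y) p * jp y b)"
    by (rule mult_right_mono[OF 1]) simp
   also have "... = 2 powr g * jp x g * ((jb (x - y) powr g * jp (x - y) p) * jp y b + jp (x - y) p * (jb y powr g * jp y b))"
    by (simp add: algebra_simps)
   finally show ?thesis by (simp add: powr_add[symmetric])
  qed
  have "(LBINT y. jp (x - y) p * jp y b) <= (LBINT y. 2 powr g * jp x g *
    (jp (x - y) (p-g) * jp y b + jp (x - y) p * jp y (b-g)))"
   by (rule integral_mono[OF int]) (use le i1 i2 in auto)
  also have "... = 2 powr g * jp x g * ((LBINT y. jp (x - y) (p-g) * jp y b) + (LBINT y. jp (x - y) p * jp y (b-g)))"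
   using i1 i2 by simp
  also have "... <= 2 powr g * jp x g * (2 * I + 2 * I)" by (intro mult_left_mono add_mono i1 i2) auto
  finally show "(LBINT y. jp (x - y) p * jp y b) <= 2 powr g * (4 * I) * jp x g" by (simp add: mult_ac)
 qed
qed

lemma loc_kernel_conv_decay:
 assumes dim: "DIM('a::euclidean_space) >= 3" and b: "0 <= b"
 shows "EX C>=0. ALL x::'a. intble (%y. loc_kernel (x - y) * jp y b)
   & (LBINT y. loc_kernel (x - y) * jp y b) <= C * jp x b"
proof -
 define I where "I = (LBINT y. loc_kernel (y::'a))"
 note i0 = integrable_loc_kernel[OF dim]
 show ?thesis
 proof (intro exI[of _ "4 powr b * I"] conjI allI)
  show "0 <= 4 powr b * I" unfolding I_def by (intro mult_nonneg_nonneg Lint_nonneg loc_kernel_nonneg) auto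
  fix x :: 'a
  have le: "loc_kernel (x - y) * jp y b <= (4 powr b * jp x b) * loc_kernel (x - y)" for y
  proof (cases "norm (x - y) <= 1")
   case True
   have "jb (x - y) <= 2" using jb_le[of "x - y"] True by simp
   hence "jb x <= 4 * jb y" using jb_peetre[of x y] mult_right_mono[of "jb (x - y)" 2 "jb y"] jb_pos[of y] by linarith
   hence "jb x powr b <= (4 * jb y) powr b" using b jb_pos[of x] by (intro powr_mono2) auto
   also have "... = 4 powr b * jb y powr b" by (rule powr_mult)
   finally have "jp y b <= 4 powr b * jp x b" using jb_pos[of x] jb_pos[of y] by (simp add: powr_minus field_simps)
   thus ?thesis using loc_kernel_nonneg[of "x - y"] by (simp add: mult_left_mono mult.commute)
  qed (simp add: loc_kernel_def)
  have i: "intble (%y. (4 powr b * jp x b) * loc_kernel (x - y))" using lborel_reflect(1)[OF i0, of x] by simp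
  show int: "intble (%y. loc_kernel (x - y) * jp y b)"
   by (rule L1_bound[OF i]) (use le in "auto simp: abs_mult loc_kernel_nonneg")
  have "(LBINT y. loc_kernel (x - y) * jp y b) <= (LBINT y. (4 powr b * jp x b) * loc_kernel (x - y))"
   by (rule integral_mono[OF int i]) (use le in auto)
  also have "... = 4 powr b * I * jp x b" using lborel_reflect[OF i0, of x] by (simp add: I_def mult_ac)
  finally show "(LBINT y. loc_kernel (x - y) * jp y b) <= 4 powr b * I * jp x b" .
 qed
qed

section \<open>The fundamental solution\<close>

abbreviation order_of :: "'n::finite itself => real" where
 "order_of _ == (real CARD('n) - 2) / 2"

text \<open>What is left of (k / (2 pi r))^nu (k r / 2)^nu / 4 after the powers of r cancel.\<close>

definition kernel_const :: "real => real => real" where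
 "kernel_const nu k = (k^2 / (4 * pi)) powr nu / 4"

definition RePhi :: "real => real^'n => real" where
 "RePhi k x = Re (Phi k x)"

text \<open>Defined through the entire profile, not as an imaginary part, so that it is continuous
  at the origin as well; elsewhere it agrees with the imaginary part of
  \<open>fund_sol\<close>.\<close>

definition ImPhi :: "real => real^'n => real" where
 "ImPhi k x = kernel_const (order_of TYPE('n)) k * bessel_E (order_of TYPE('n)) (k^2 * (x *. x) / 4)"

abbreviation (input) Re_conv where "Re_conv k w x == LBINT y. RePhi k (x - y) * w y"
abbreviation (input) Im_conv where "Im_conv k w x == LBINT y. ImPhi k (x - y) * w y"
abbreviation (input) abs_conv where "abs_conv k w x == LINT y|lebesgue. cmod (Phi k (x - y)) * abs (w y)"

text \<open>The gradient of \<^const>\<open>ImPhi\<close> at \<open>x\<close> is the multiple \<open>im_slope k x\<close> of \<open>x\<close>.\<close>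

definition im_slope :: "real => real^'n => real" where
 "im_slope k x = - kernel_const (order_of TYPE('n)) k * (k^2 / 2) * bessel_E (order_of TYPE('n) + 1) (k^2 * (x *. x) / 4)"

lemma kernel_const_pos: "k > 0 ==> kernel_const nu k > 0"
 by (simp add: kernel_const_def)

text \<open>Since i (J + i Y) = -Y + i J, the regular profile is the imaginary part and the singular
  profile, with a minus sign, the real part.\<close>

lemma fund_sol_radial:
 fixes k :: real
 assumes N: "CARD('n::finite) >= 3" and k: "k > 0"
 defines "nu == order_of TYPE('n)"
 shows "EX W W1 W2 C. radial_ode nu W W1 W2 & (ALL s:{0<..1}. abs (W s) <= C * s powr (-nu))
  & (ALL x::real^'n. x ~= 0 --> Phi k x = Complex (- kernel_const nu k * W (k^2 * (x *. x) / 4)) (ImPhi k x))"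
proof -
 have nu: "nu > 0" using N by (simp add: nu_def)
 obtain W W1 W2 C where W: "radial_ode nu W W1 W2" "ALL s:{0<..1}. abs (W s) <= C * s powr (-nu)"
  and Y: "!!x. x > 0 ==> bessel_Y nu x = (x / 2) powr nu * W (x^2 / 4)" using bessel_Y_radial[OF nu] by blast
 have "fund_sol k x = Complex (- kernel_const nu k * W (k^2 * (x *. x) / 4)) (ImPhi k x)" if x: "x ~= 0" for x :: "real^'n"
 proof -
  define r where "r = norm x"
  have r: "r > 0" using x by (simp add: r_def)
  have s: "k^2 * (x *. x) / 4 = (k * r)^2 / 4" by (simp add: r_def power_mult_distrib power2_norm_eq_inner)
  have "(k / (2 * pi * r)) powr nu * (k * r / 2) powr nu = (k / (2 * pi * r) * (k * r / 2)) powr nu"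
   by (rule powr_mult[symmetric])
  also have "k / (2 * pi * r) * (k * r / 2) = k^2 / (4 * pi)" using r by (simp add: field_simps power2_eq_square)
  finally have P: "(k / (2 * pi * r)) powr nu * (k * r / 2) powr nu = 4 * kernel_const nu k" by (simp add: kernel_const_def)
  have J: "bessel_J nu (k * r) = (k * r / 2) powr nu * bessel_E nu ((k * r)^2 / 4)" using bessel_J_eq[of "k * r" nu] k r by simp
  have Y': "bessel_Y nu (k * r) = (k * r / 2) powr nu * W ((k * r)^2 / 4)" using Y[of "k * r"] k r by simp
  have "fund_sol k x = \<i> / 4 * cor ((k / (2 * pi * r)) powr nu) * hankel1 nu (k * r)"
   by (simp add: fund_sol_def nu_def r_def Let_def)
  also have "... = Complex (- (((k / (2 * pi * r)) powr nu * (k * r / 2) powr nu) * W ((k * r)^2 / 4)) / 4)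
    ((((k / (2 * pi * r)) powr nu * (k * r / 2) powr nu) * bessel_E nu ((k * r)^2 / 4)) / 4)"
   unfolding hankel1_def J Y' by (simp add: complex_eq_iff)
  finally show ?thesis unfolding P s ImPhi_def nu_def[symmetric] by simp
 qed
 thus ?thesis using W by blast
qed

lemma continuous_im_kernel: "cont (ImPhi k :: real^'n::finite => real)"
 and continuous_im_slope: "cont (im_slope k :: real^'n::finite => real)"
proof -
 have E: "cont (bessel_E mu)" for mu using DERIV_isCont[OF DERIV_bessel_E] by (simp add: continuous_at_imp_continuous_on)
 note c = continuous_on_compose2[OF E]
 show "cont (ImPhi k :: real^'n => real)" unfolding ImPhi_def by (intro continuous_intros c) auto
 show "cont (im_slope k :: real^'n => real)" unfolding im_slope_def by (intro continuous_intros c) auto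
qed

lemma re_kernel_even: "RePhi k (- x) = RePhi k x"
 by (simp add: RePhi_def fund_sol_def Let_def)

lemma im_kernel_DERIV:
 "DERIV (%t. ImPhi k (x + t *R b)) t :> im_slope k (x + t *R b) * ((x + t *R b) *. b)"
proof -
 have sq: "DERIV (%t. k^2 * ((x + t *R b) *. (x + t *R b)) / 4) t :> k^2 / 2 * ((x + t *R b) *. b)"
  by (auto intro!: derivative_eq_intros simp: inner_add_left inner_add_right inner_commute algebra_simps power2_eq_square)
 show ?thesis unfolding ImPhi_def im_slope_def
  by (rule DERIV_cong[OF DERIV_cmult[OF DERIV_chain2[OF DERIV_bessel_E sq]]]) simp
qed

lemma jb_le_norm: "norm x >= 1 ==> jb x <= 2 * norm x"
 using jb_le[of x] by linarith

lemma powr_norm_le_jb: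
 assumes "norm x >= 1" "a >= 0"
 shows "norm x powr (-a) <= 2 powr a * jp x a"
proof -
 have "(2 * norm x) powr (-a) <= jp x a" using assms jb_le_norm[OF assms(1)] jb_pos[of x] by (intro powr_mono2') auto
 also have "(2 * norm x) powr (-a) = 2 powr (-a) * norm x powr (-a)" by (rule powr_mult)
 finally have "2 powr a * (2 powr (-a) * norm x powr (-a)) <= 2 powr a * jp x a" by (intro mult_left_mono) auto
 moreover have "2 powr a * (2 powr (-a) * norm x powr (-a)) = norm x powr (-a)" using powr_add[of 2 a "-a"] by simp
 ultimately show ?thesis by linarith
qed

lemma near_0_extend:
 fixes W :: "real => real"
 assumes bd: "ALL s:{0<..1}. abs (W s) <= C * s powr (-nu)" and nu: "nu >= 0" and cont: "!!s. s > 0 ==> isCont W s"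
 shows "EX C'>=0. ALL s:{0<..S}. abs (W s) <= C' * s powr (-nu)"
proof -
 define T where "T = max S 1"
 have "continuous_on {1..T} (%s. W s * s powr nu)"
  by (intro continuous_intros continuous_at_imp_continuous_on ballI cont) auto
 hence "bounded ((%s. W s * s powr nu) ` {1..T})" by (intro compact_imp_bounded compact_continuous_image) auto
 then obtain C1 where C1: "!!s. s : {1..T} ==> abs (W s * s powr nu) <= C1"
  unfolding bounded_iff by (metis image_eqI real_norm_def)
 have C0: "C >= 0" using bd[rule_format, of 1] by simp
 show ?thesis
 proof (intro exI[of _ "max C C1"] conjI ballI)
  fix s assume s: "s : {0<..S}"
  show "abs (W s) <= max C C1 * s powr (-nu)"
  proof (cases "s <= 1")
   case True
   hence "abs (W s) <= C * s powr (-nu)" using bd s by auto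
   also have "... <= max C C1 * s powr (-nu)" by (intro mult_right_mono) auto
   finally show ?thesis .
  next
   case False
   hence "abs (W s * s powr nu) <= C1" using s by (intro C1) (auto simp: T_def)
   hence "abs (W s) * s powr nu <= C1" by (simp add: abs_mult)
   hence "abs (W s) <= C1 * s powr (-nu)" using s by (simp add: powr_minus field_simps)
   also have "... <= max C C1 * s powr (-nu)" by (intro mult_right_mono) auto
   finally show ?thesis .
  qed
 qed (use C0 in auto)
qed

text \<open>As 2 nu = N - 2, the crude bound s^(-nu) near zero is exactly the Newtonian singularity,
  and only the range |x| > 1 is left to the oscillatory estimate.\<close>

lemma radial_kernel_bound:
 fixes W :: "real => real" and k a :: real
 assumes N: "CARD('n::finite) >= 3" and k: "k > 0" and a: "a >= 0"
  and near: "!!S. EX C>=0. ALL s:{0<..S}. abs (W s) <= C * s powr (- order_of TYPE('n))"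
  and far: "EX C. ALL x>=k. abs (W (x^2/4)) <= C * x powr (-a)"
 shows "EX C>=0. ALL x::real^'n. x ~= 0 --> abs (W (k^2 * (x *. x) / 4)) <= C * maj a x"
proof -
 define nu where "nu = order_of TYPE('n)"
 have nu: "nu > 0" using N by (simp add: nu_def)
 obtain C1 where C1: "C1 >= 0" "!!s. s : {0<..k^2/4} ==> abs (W s) <= C1 * s powr (-nu)"
  using near[of "k^2/4"] unfolding nu_def by blast
 obtain C2 where C2: "!!x. x >= k ==> abs (W (x^2/4)) <= C2 * x powr (-a)" using far by blast
 have C20: "C2 >= 0" using order_trans[OF abs_ge_zero C2[of k]] k by (simp add: zero_le_mult_iff)
 define C where "C = C1 * (k^2/4) powr (-nu) + C2 * k powr (-a) * 2 powr a"
 show ?thesis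
 proof (intro exI[of _ C] conjI allI impI)
  show "C >= 0" unfolding C_def using C1 C20 by simp
  fix x :: "real^'n" assume x: "x ~= 0"
  have e: "k^2 * (x *. x) / 4 = (k * norm x)^2 / 4" by (simp add: power_mult_distrib power2_norm_eq_inner)
  show "abs (W (k^2 * (x *. x) / 4)) <= C * maj a x"
  proof (cases "norm x <= 1")
   case True
   have "(k * norm x)^2 / 4 : {0<..k^2/4}" using True x k by (simp add: power_mult_distrib power_le_one mult_left_le)
   hence "abs (W ((k * norm x)^2 / 4)) <= C1 * ((k * norm x)^2 / 4) powr (-nu)" by (rule C1(2))
   also have "(k * norm x)^2 / 4 = k^2/4 * (norm x)^2" by (simp add: power_mult_distrib)
   also have "(k^2/4 * (norm x)^2) powr (-nu) = (k^2/4) powr (-nu) * ((norm x)^2) powr (-nu)" by (rule powr_mult)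
   also have "((norm x)^2) powr (-nu) = norm x powr (- (real CARD('n) - 2))"
   proof -
    have "2 * -nu = - (real CARD('n) - 2)" by (simp add: nu_def field_simps)
    thus ?thesis using x powr_powr[of "norm x" 2 "-nu"] by simp
   qed
   also have "... = loc_kernel x" using True by (simp add: loc_kernel_def)
   finally have "abs (W (k^2 * (x *. x) / 4)) <= (C1 * (k^2/4) powr (-nu)) * loc_kernel x" unfolding e by (simp add: mult.assoc power_mult_distrib)
   also have "... <= C * maj a x" unfolding C_def using C20 C1 loc_kernel_nonneg[of x] by (intro mult_mono) auto
   finally show ?thesis .
  next
   case False
   hence "k * 1 <= k * norm x" using k by (intro mult_left_mono) auto
   hence "abs (W ((k * norm x)^2 / 4)) <= C2 * (k * norm x) powr (-a)" by (intro C2) simp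
   also have "(k * norm x) powr (-a) = k powr (-a) * norm x powr (-a)" by (rule powr_mult)
   also have "C2 * (k powr (-a) * norm x powr (-a)) <= C2 * (k powr (-a) * (2 powr a * jp x a))"
    using False a C20 by (intro mult_left_mono powr_norm_le_jb) auto
   also have "... = (C2 * k powr (-a) * 2 powr a) * jp x a" by simp
   also have "... <= C * maj a x" unfolding C_def using C20 C1 loc_kernel_nonneg[of x] by (intro mult_mono) auto
   finally show ?thesis unfolding e .
  qed
 qed
qed

lemma bessel_E_near_0:
 assumes nu: "nu >= 0"
 shows "EX C>=0. ALL s:{0<..S}. abs (bessel_E mu s) <= C * s powr (-nu)"
proof -
 obtain C where C: "C >= 0" "!!s. s : {0..1} ==> abs (bessel_E mu s) <= C" using bounded_near_0[OF DERIV_bessel_E] by blast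
 have "ALL s:{0<..1}. abs (bessel_E mu s) <= C * s powr (-nu)"
 proof
  fix s :: real assume s: "s : {0<..1}"
  have "1 <= s powr (-nu)" using s nu powr_mono2'[of "-nu" s 1] by simp
  thus "abs (bessel_E mu s) <= C * s powr (-nu)" using C(2)[of s] s mult_left_mono[OF _ C(1)] by fastforce
 qed
 thus ?thesis by (rule near_0_extend[OF _ nu DERIV_isCont[OF DERIV_bessel_E]])
qed

lemma im_kernel_bounds:
 assumes N: "CARD('n::finite) >= 3" and k: "k > 0"
 shows "EX C>=0. ALL x::real^'n. abs (ImPhi k x) <= C * jp x ((real CARD('n) - 1) / 2)
   & abs (im_slope k x) * norm x <= C * jp x ((real CARD('n) - 1) / 2)"
proof -
 define nu where "nu = order_of TYPE('n)"
 define a where "a = (real CARD('n) - 1) / 2"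
 have a: "a > 0" "nu + 1/2 = a" using N by (auto simp: a_def nu_def field_simps)
 obtain C where C: "!!x. x >= k ==> abs (bessel_E nu (x^2/4)) <= C * x powr (-a)"
  "!!x. x >= k ==> abs (x / 2 * - bessel_E (nu + 1) (x^2/4)) <= C * x powr (-a)"
  using radial_ode_far[OF radial_ode_bessel_E[of nu] k] unfolding a by blast
 have C0: "C >= 0" using order_trans[OF abs_ge_zero C(1)[of k]] k by (simp add: zero_le_mult_iff)
 define c where "c = kernel_const nu k"
 have c: "c > 0" using k kernel_const_pos by (simp add: c_def)
 define g where "g x = abs (ImPhi k x) + abs (im_slope k x) * norm x" for x :: "real^'n"
 have "continuous_on (cball 0 1) (%x::real^'n. g x)"
  unfolding g_def by (intro continuous_intros continuous_on_subset[OF continuous_im_kernel] continuous_on_subset[OF continuous_im_slope]) auto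
 hence "bounded (g ` cball 0 1)" by (intro compact_imp_bounded compact_continuous_image) auto
 then obtain B where B: "!!x. norm x <= 1 ==> abs (g x) <= B"
  unfolding bounded_iff by (metis dist_0_norm image_eqI mem_cball real_norm_def)
 have B0: "B >= 0" using B[of 0] by simp
 define D where "D = B * 2 powr a + (c * C + c * k * C) * k powr (-a) * 2 powr a"
 show ?thesis
 proof (intro exI[of _ D] conjI allI)
  show "D >= 0" unfolding D_def using B0 C0 c k by simp
  fix x :: "real^'n"
  have "g x <= D * jp x a"
  proof (cases "norm x <= 1")
   case True
   have "2 powr (-a) <= jp x a" using True a jb_le[of x] jb_pos[of x] by (intro powr_mono2') auto
   hence "2 powr a * 2 powr (-a) <= 2 powr a * jp x a" by (intro mult_left_mono) auto
   hence "1 <= 2 powr a * jp x a" by (simp add: powr_add[symmetric])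
   hence "B * 1 <= B * (2 powr a * jp x a)" using B0 by (intro mult_left_mono) auto
   moreover have "0 <= (c * C + c * k * C) * k powr (-a) * 2 powr a * jp x a" using B0 C0 c k by simp
   ultimately show ?thesis using B[OF True] unfolding D_def distrib_right by linarith
  next
   case False
   define y where "y = k * norm x"
   have "k * 1 <= k * norm x" using False k by (intro mult_left_mono) auto
   hence y: "y >= k" by (simp add: y_def)
   have e: "k^2 * (x *. x) / 4 = y^2 / 4" by (simp add: y_def power_mult_distrib power2_norm_eq_inner)
   have i: "abs (ImPhi k x) = c * abs (bessel_E nu (y^2/4))" unfolding ImPhi_def e nu_def[symmetric] c_def[symmetric] using c by (simp add: abs_mult)
   have "abs (im_slope k x) * norm x = abs (im_slope k x * norm x)" by (simp add: abs_mult)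
   also have "im_slope k x * norm x = c * k * (y / 2 * - bessel_E (nu + 1) (y^2/4))"
    unfolding im_slope_def e nu_def[symmetric] c_def[symmetric] by (simp add: y_def power2_eq_square)
   also have "abs (...) = c * k * abs (y / 2 * - bessel_E (nu + 1) (y^2/4))" using c k by (simp add: abs_mult)
   finally have s: "abs (im_slope k x) * norm x = c * k * abs (y / 2 * - bessel_E (nu + 1) (y^2/4))" .
   have "g x <= c * (C * y powr (-a)) + c * k * (C * y powr (-a))"
    unfolding g_def i s using c k by (intro add_mono mult_left_mono C y) auto
   also have "... = (c * C + c * k * C) * (k powr (-a) * norm x powr (-a))" unfolding y_def powr_mult by (simp add: algebra_simps)
   also have "... <= (c * C + c * k * C) * (k powr (-a) * (2 powr a * jp x a))"
    using False a c k C0 by (intro mult_left_mono powr_norm_le_jb) auto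
   also have "... = ((c * C + c * k * C) * k powr (-a) * 2 powr a) * jp x a" by simp
   also have "... <= D * jp x a" unfolding D_def using B0 by (intro mult_right_mono) auto
   finally show ?thesis .
  qed
  moreover have "abs (im_slope k x) * norm x >= 0" by simp
  ultimately show "abs (ImPhi k x) <= D * jp x ((real CARD('n) - 1) / 2)"
   "abs (im_slope k x) * norm x <= D * jp x ((real CARD('n) - 1) / 2)" unfolding a_def[symmetric] g_def by linarith+
 qed
qed

text \<open>Everything needed later about Phi_k, after which the profile of Y can be forgotten. The
  third property drives the decay gain: modulo a kernel one order smaller, Re Phi_k is a combination
  of Im Phi_k and its radial derivative \<open>im_slope k x * norm x\<close>. The fifth keeps the
  profile in the variable |x|^2 for the distributional equation.\<close>

lemma fund_sol_facts:
 fixes k :: real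
 assumes N: "CARD('n::finite) >= 3" and k: "k > 0"
 shows "!!x::real^'n. x ~= 0 ==> Phi k x = Complex (RePhi k x) (ImPhi k x)"
  and "EX C>=0. ALL x::real^'n. abs (RePhi k x) <= C * (loc_kernel x + jp x ((real CARD('n) - 1) / 2))"
  and "EX A B C. 0 <= C & (ALL x::real^'n. x ~= 0 --> abs (RePhi k x - A * ImPhi k x - B * (im_slope k x * norm x))
      <= C * (loc_kernel x + jp x ((real CARD('n) + 1) / 2)))"
  and "continuous_on (- {0}) (Phi k :: real^'n => complex)"
  and "EX F F1 F2 l. (ALL x::real^'n. x ~= 0 --> RePhi k x = F (x *. x))
   & (ALL t>0. DERIV F t :> F1 t & DERIV F1 t :> F2 t
     & 4 * t * F2 t + 2 * real CARD('n) * F1 t + k^2 * F t = 0)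
   & (ALL S. EX C>=0. ALL t:{0<..S}. abs (F t) <= C * t powr (- order_of TYPE('n)))
   & ((%t. t powr (order_of TYPE('n) + 2) * F2 t) \<longlongrightarrow> l) (at_right 0)"
proof -
 define nu where "nu = order_of TYPE('n)"
 define a where "a = (real CARD('n) - 1) / 2"
 have a: "a > 0" "nu + 1/2 = a" "nu + 3/2 = a + 1" "(real CARD('n) + 1) / 2 = a + 1" "nu > 0" using N by (auto simp: a_def nu_def field_simps)
 define c where "c = kernel_const nu k"
 have c: "c > 0" using k kernel_const_pos by (simp add: c_def)
 obtain W W1 W2 C0 where ode: "radial_ode nu W W1 W2" and W0: "ALL s:{0<..1}. abs (W s) <= C0 * s powr (-nu)"
  and fs: "!!x::real^'n. x ~= 0 ==> Phi k x = Complex (- c * W (k^2 * (x *. x) / 4)) (ImPhi k x)"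
  using fund_sol_radial[OF N k] unfolding nu_def c_def by metis
 show "fund_sol k x = Complex (RePhi k x) (ImPhi k x)" if "x ~= 0" for x :: "real^'n"
  using fs[OF that] by (simp add: RePhi_def)
 have re: "RePhi k x = - c * W (k^2 * (x *. x) / 4)" if "x ~= 0" for x :: "real^'n"
  using fs[OF that] by (simp add: RePhi_def)
 have re0: "RePhi k (0::real^'n) = 0" using a(5) by (simp add: RePhi_def fund_sol_def Let_def nu_def[symmetric])
 have Wcont: "isCont W s" if "s > 0" for s using ode that unfolding radial_ode_def by (blast intro: DERIV_isCont)
 have near: "EX C>=0. ALL s:{0<..S}. abs (W s) <= C * s powr (- nu)" for S using near_0_extend[OF W0 _ Wcont] a(5) by auto
 have "EX C. ALL x>=k. abs (W (x^2/4)) <= C * x powr (-a)" using radial_ode_far[OF ode k] unfolding a(2) by blast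
 then obtain C1 where C1: "C1 >= 0" "!!x::real^'n. x ~= 0 ==> abs (W (k^2 * (x *. x) / 4)) <= C1 * maj a x"
  using radial_kernel_bound[OF N k _ near[unfolded nu_def], of a] a(1) by auto
 show "EX C>=0. ALL x::real^'n. abs (RePhi k x) <= C * (loc_kernel x + jp x ((real CARD('n) - 1) / 2))"
  unfolding a_def[symmetric]
 proof (intro exI[of _ "c * C1"] conjI allI)
  fix x :: "real^'n"
  show "abs (RePhi k x) <= c * C1 * maj a x"
  proof (cases "x = 0")
   case True thus ?thesis using re0 c C1 loc_kernel_nonneg[of x] by simp
  next
   case False thus ?thesis using re[OF False] C1(2)[OF False] c by (simp add: abs_mult mult.assoc mult_left_mono)
  qed
 qed (use c C1 in auto)
 show "EX A B C. 0 <= C & (ALL x::real^'n. x ~= 0 --> abs (RePhi k x - A * ImPhi k x - B * (im_slope k x * norm x))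
      <= C * (loc_kernel x + jp x ((real CARD('n) + 1) / 2)))"
 proof -
  define E where "E = bessel_E nu"
  define E1 where "E1 = (%s. - bessel_E (nu + 1) s)"
  \<comment> \<open>The comparison of solutions needs a point where the regular profile is nonzero.
    Its value at 0 is 1/Gamma(nu+1), so every sufficiently small point will do.\<close>
  have "rGamma (nu + 1) ~= 0" using a(5) by (auto simp: rGamma_eq_zero_iff elim!: nonpos_Ints_cases)
  moreover have "E 0 = rGamma (nu + 1)" unfolding E_def bessel_E_def fact_series_def by (subst suminf_finite[of "{0}"]) auto
  moreover have "isCont E 0" unfolding E_def by (rule DERIV_isCont[OF DERIV_bessel_E])
  ultimately have "eventually (%s. E s ~= 0) (at 0)" by (metis isCont_def tendsto_imp_eventually_ne)
  then obtain d where d: "d > 0" "!!s. s ~= 0 ==> abs s < d ==> E s ~= 0" unfolding eventually_at by (auto simp: dist_real_def)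
  define x0 where "x0 = min k (sqrt d)"
  have x0: "x0 > 0" "x0 <= k" using k d by (auto simp: x0_def)
  have "x0^2 <= d" using x0 d unfolding x0_def by (metis less_imp_le min.cobounded2 power_mono real_sqrt_pow2)
  hence nz: "E (x0^2/4) ~= 0" using x0 d(1) by (intro d(2)) auto
  obtain A B C where ABC: "!!x. x >= x0 ==> abs (W (x^2/4) - A * E (x^2/4) - B * (x / 2 * E1 (x^2/4))) <= C * x powr (-(a+1))"
   using radial_ode_combination[OF radial_ode_bessel_E ode x0(1)] nz unfolding E_def E1_def a(3) by blast
  \<comment> \<open>At s = x^2/4 the factor \<open>sqrt s\<close> is x/2, so V is the remainder of
    the comparison. Close to 0 each of its three terms satisfies the crude bound s^(-nu).\<close>
  define V where "V s = W s - A * E s - B * (sqrt s * E1 s)" for s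
  have VW: "EX C>=0. ALL s:{0<..S}. abs (V s) <= C * s powr (- nu)" for S
  proof -
   obtain CW where CW: "CW >= 0" "!!s. s : {0<..S} ==> abs (W s) <= CW * s powr (-nu)" using near[of S] by blast
   obtain CE where CE: "CE >= 0" "!!s. s : {0<..S} ==> abs (E s) <= CE * s powr (-nu)" using bessel_E_near_0[of nu S nu] a(5) unfolding E_def by auto
   obtain CF where CF: "CF >= 0" "!!s. s : {0<..S} ==> abs (E1 s) <= CF * s powr (-nu)" using bessel_E_near_0[of nu S "nu + 1"] a(5) unfolding E1_def by auto
   show ?thesis
   proof (intro exI[of _ "CW + abs A * CE + abs B * (sqrt (abs S) * CF)"] conjI ballI)
    fix s assume s: "s : {0<..S}"
    have "abs (A * E s) <= abs A * (CE * s powr (-nu))" unfolding abs_mult by (intro mult_left_mono CE s) auto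
    moreover have "abs (B * (sqrt s * E1 s)) <= abs B * (sqrt (abs S) * (CF * s powr (-nu)))"
     unfolding abs_mult using s by (intro mult_left_mono mult_mono CF) auto
    ultimately have "abs (V s) <= CW * s powr (-nu) + abs A * (CE * s powr (-nu)) + abs B * (sqrt (abs S) * (CF * s powr (-nu)))"
     unfolding V_def using CW(2)[OF s] by linarith
    also have "... = (CW + abs A * CE + abs B * (sqrt (abs S) * CF)) * s powr (-nu)" by (simp add: algebra_simps)
    finally show "abs (V s) <= (CW + abs A * CE + abs B * (sqrt (abs S) * CF)) * s powr (-nu)" .
   qed (use CW CE CF in auto)
  qed
  have "EX C. ALL x>=k. abs (V (x^2/4)) <= C * x powr (-(a+1))"
  proof (intro exI allI impI)
   fix x assume x: "x >= k"
   have "sqrt (x^2/4) = x / 2" using x k by (simp add: real_sqrt_divide)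
   hence V: "V (x^2/4) = W (x^2/4) - A * E (x^2/4) - B * (x / 2 * E1 (x^2/4))" by (simp only: V_def)
   have "x >= x0" using x x0 by simp
   thus "abs (V (x^2/4)) <= C * x powr (-(a+1))" unfolding V by (rule ABC)
  qed
  then obtain C2 where C2: "C2 >= 0" "!!x::real^'n. x ~= 0 ==> abs (V (k^2 * (x *. x) / 4)) <= C2 * maj (a+1) x"
   using radial_kernel_bound[OF N k _ VW[unfolded nu_def], of "a + 1"] a(1) by auto
  show ?thesis
  proof (rule exI[of _ "-A"], rule exI[of _ "- (B / k)"], rule exI[of _ "c * C2"], intro conjI allI impI)
   show "0 <= c * C2" using c C2 by simp
   fix x :: "real^'n" assume x: "x ~= 0"
   define s where "s = k^2 * (x *. x) / 4"
   have "sqrt (k^2 * (x *. x) / 4) = k * norm x / 2"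
    unfolding norm_eq_sqrt_inner using k by (simp add: real_sqrt_mult real_sqrt_divide)
   hence "im_slope k x * norm x = k * c * (sqrt s * E1 s)"
    unfolding im_slope_def s_def[symmetric] nu_def[symmetric] c_def[symmetric] E1_def by (simp add: power2_eq_square)
   moreover have "ImPhi k x = c * E s" unfolding ImPhi_def s_def[symmetric] nu_def[symmetric] c_def[symmetric] E_def ..
   ultimately have "RePhi k x - (-A) * ImPhi k x - (- (B / k)) * (im_slope k x * norm x) = - c * V s"
    using re[OF x, folded s_def] k unfolding V_def by (simp add: algebra_simps)
   moreover have "abs (- c * V s) <= c * (C2 * maj (a+1) x)"
    unfolding abs_mult using C2(2)[OF x, folded s_def] c by (simp add: mult_left_mono)
   ultimately show "abs (RePhi k x - (-A) * ImPhi k x - (- (B / k)) * (im_slope k x * norm x))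
      <= c * C2 * (loc_kernel x + jp x ((real CARD('n) + 1) / 2))"
    unfolding a(4) by (simp add: mult.assoc)
  qed
 qed
 show "continuous_on (- {0}) (Phi k :: real^'n => complex)"
 proof -
  have Wc: "continuous_on {0<..} W" using Wcont by (simp add: continuous_at_imp_continuous_on)
  have pos: "k^2 * (x *. x) > 0" if "x ~= 0" for x :: "real^'n" using that k by simp
  have "continuous_on (- {0}) (%x::real^'n. Complex (- c * W (k^2 * (x *. x) / 4)) (ImPhi k x))" unfolding Complex_eq
   by (intro continuous_intros continuous_on_compose2[OF Wc] continuous_on_subset[OF continuous_im_kernel]) (use pos in "auto intro: pos simp del: zero_less_mult_iff")
  thus ?thesis by (rule continuous_on_eq) (use fs in auto)
 qed
 show "EX F F1 F2 l. (ALL x::real^'n. x ~= 0 --> RePhi k x = F (x *. x))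
   & (ALL t>0. DERIV F t :> F1 t & DERIV F1 t :> F2 t
     & 4 * t * F2 t + 2 * real CARD('n) * F1 t + k^2 * F t = 0)
   & (ALL S. EX C>=0. ALL t:{0<..S}. abs (F t) <= C * t powr (- order_of TYPE('n)))
   & ((%t. t powr (order_of TYPE('n) + 2) * F2 t) \<longlongrightarrow> l) (at_right 0)"
 proof -
  define K where "K = k^2 / 4"
  have K: "K > 0" using k by (simp add: K_def)
  define F F1 F2 where "F t = - c * W (K * t)" and "F1 t = - c * (W1 (K * t) * K)" and "F2 t = - c * (W2 (K * t) * K * K)" for t
  have Kt: "DERIV (%t. K * t) t :> K" for t by (auto intro!: derivative_eq_intros)
  have d: "DERIV F t :> F1 t & DERIV F1 t :> F2 t
     & 4 * t * F2 t + 2 * real CARD('n) * F1 t + k^2 * F t = 0" if t: "t > 0" for t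
  proof (intro conjI)
   have o: "DERIV W (K * t) :> W1 (K * t)" "DERIV W1 (K * t) :> W2 (K * t)"
    "(K * t) * W2 (K * t) + (nu + 1) * W1 (K * t) + W (K * t) = 0" using ode K t unfolding radial_ode_def by auto
   show "DERIV F t :> F1 t" unfolding F_def F1_def by (rule DERIV_cmult[OF DERIV_chain2[OF o(1) Kt]])
   show "DERIV F1 t :> F2 t" unfolding F1_def F2_def by (rule DERIV_cmult[OF DERIV_cmult_right[OF DERIV_chain2[OF o(2) Kt]]])
   have "k^2 = 4 * K" "2 * real CARD('n) = 4 * (nu + 1)" by (simp_all add: K_def nu_def field_simps)
   hence "4 * t * F2 t + 2 * real CARD('n) * F1 t + k^2 * F t = - (4 * c * K) * ((K * t) * W2 (K * t) + (nu + 1) * W1 (K * t) + W (K * t))"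
    unfolding F_def F1_def F2_def by (simp add: algebra_simps)
   thus "4 * t * F2 t + 2 * real CARD('n) * F1 t + k^2 * F t = 0" unfolding o(3) by simp
  qed
  have r: "RePhi k x = F (x *. x)" if "x ~= 0" for x :: "real^'n" using re[OF that] by (simp add: F_def K_def mult.commute)
  have n: "EX C>=0. ALL t:{0<..S}. abs (F t) <= C * t powr (- nu)" for S
  proof -
   obtain CW where CW: "CW >= 0" "!!s. s : {0<..K * S} ==> abs (W s) <= CW * s powr (-nu)" using near[of "K * S"] by blast
   show ?thesis
   proof (intro exI[of _ "c * (CW * K powr (-nu))"] conjI ballI)
    fix t assume t: "t : {0<..S}"
    have "abs (F t) = c * abs (W (K * t))" using c by (simp add: F_def abs_mult)
    also have "... <= c * (CW * (K * t) powr (-nu))" using c t K by (intro mult_left_mono CW) auto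
    also have "... = c * (CW * K powr (-nu)) * t powr (-nu)" unfolding powr_mult by simp
    finally show "abs (F t) <= c * (CW * K powr (-nu)) * t powr (-nu)" .
   qed (use c CW in auto)
  qed
  obtain l where l: "((%s. s powr (nu + 2) * W2 s) \<longlongrightarrow> l) (at_right 0)"
   using radial_ode_near_0[OF ode] W0 by blast
  have "filterlim (%t. K * t) (at_right 0) (at_right 0)"
   unfolding filterlim_at using K by (auto intro!: tendsto_eq_intros simp: eventually_at_right_less eventually_at_topological intro: exI[of _ UNIV])
  hence "((%t. (K * t) powr (nu + 2) * W2 (K * t)) \<longlongrightarrow> l) (at_right 0)"
   using filterlim_compose[OF l] by blast
  hence "((%t. (- c * K * K * K powr (-(nu+2))) * ((K * t) powr (nu + 2) * W2 (K * t))) \<longlongrightarrow> (- c * K * K * K powr (-(nu+2))) * l) (at_right 0)"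
   by (intro tendsto_intros)
  moreover have "(- c * K * K * K powr (-(nu+2))) * ((K * t) powr (nu + 2) * W2 (K * t)) = t powr (nu + 2) * F2 t" for t
  proof -
   have "K powr (-(nu+2)) * K powr (nu+2) = 1" using K by (simp add: powr_add[symmetric])
   hence "K powr (-(nu+2)) * (K * t) powr (nu + 2) = t powr (nu+2)" unfolding powr_mult by (simp add: mult.assoc[symmetric])
   moreover have "(- c * K * K * K powr (-(nu+2))) * ((K * t) powr (nu + 2) * W2 (K * t)) = (K powr (-(nu+2)) * (K * t) powr (nu + 2)) * (- c * K * K * W2 (K * t))"
    by simp
   ultimately show ?thesis unfolding F2_def by simp
  qed
  ultimately have "EX l. ((%t. t powr (nu + 2) * F2 t) \<longlongrightarrow> l) (at_right 0)" by auto
  thus ?thesis using r d n unfolding nu_def by blast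
 qed
qed

section \<open>Plane wave representation of the imaginary part\<close>

definition householder :: "'a::euclidean_space => 'a => 'a" where
 "householder n x = x - (2 * (x *. n)) *R n"

lemma householder:
 assumes "norm n = 1"
 shows "householder n (householder n x) = x" "householder n (x + y) = householder n x + householder n y"
  "householder n (c *R x) = c *R householder n x" "norm (householder n x) = norm x"
  "householder n x *. y = x *. householder n y"
proof -
 have n: "n *. n = 1" using assms by (simp add: norm_eq_1)
 show "householder n (householder n x) = x" by (simp add: householder_def inner_diff_left n scaleR_left_diff_distrib)
 show "householder n (x + y) = householder n x + householder n y"
  by (simp add: householder_def inner_add_left scaleR_left_distrib algebra_simps)
 show "householder n (c *R x) = c *R householder n x" by (simp add: householder_def algebra_simps)
 show "norm (householder n x) = norm x"
  unfolding norm_eq_sqrt_inner by (simp add: householder_def inner_diff_left inner_diff_right n inner_commute algebra_simps)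
 show "householder n x *. y = x *. householder n y"
  by (simp add: householder_def inner_diff_left inner_diff_right inner_commute)
qed

text \<open>A single explicit reflection carries a vector to any other of equal length; this is all
  the rotation invariance that the sphere averages need.\<close>

lemma householder_swap:
 fixes a b :: "'a::euclidean_space"
 assumes "norm a = norm b" "a ~= b"
 shows "householder (sgn (a - b)) a = b" "norm (sgn (a - b)) = 1"
proof -
 define d where "d = a - b"
 have d: "norm d ~= 0" using assms by (simp add: d_def)
 have "a *. a = b *. b" using assms by (simp add: dot_square_norm)
 hence "d *. d = 2 * (a *. d)" by (simp add: d_def inner_diff_left inner_diff_right inner_commute)
 hence "2 * (a *. d) = (norm d)^2" by (simp add: power2_norm_eq_inner)
 moreover have "(2 * (a *. sgn d)) *R sgn d = (2 * (a *. d) / (norm d)^2) *R d"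
  by (simp add: sgn_div_norm power2_eq_square field_simps)
 ultimately have "(2 * (a *. sgn d)) *R sgn d = d" using d by simp
 thus "householder (sgn (a - b)) a = b" by (simp add: householder_def d_def)
 show "norm (sgn (a - b)) = 1" using assms by (simp add: norm_sgn)
qed

lemma nn_integral_reflect:
 fixes f :: "'a::euclidean_space => ennreal"
 assumes [measurable]: "f : bmeas"
 shows "(\<integral>\<^sup>+y. f (x - y) \<partial>lborel) = (\<integral>\<^sup>+y. f y \<partial>lborel)" "(\<integral>\<^sup>+y. f (y + x) \<partial>lborel) = (\<integral>\<^sup>+y. f y \<partial>lborel)"
proof -
 have "lborel = distr lborel borel (%y::'a. x - y)" using lborel_affine[of "-1" x] by (simp add: density_1)
 thus "(\<integral>\<^sup>+y. f (x - y) \<partial>lborel) = (\<integral>\<^sup>+y. f y \<partial>lborel)"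
  using nn_integral_distr[of "%y. x - y" lborel borel f] by simp
 have "lborel = distr lborel borel (%y::'a. y + x)" using lborel_affine[of "1" x] by (simp add: density_1 add.commute)
 thus "(\<integral>\<^sup>+y. f (y + x) \<partial>lborel) = (\<integral>\<^sup>+y. f y \<partial>lborel)"
  using nn_integral_distr[of "%y. y + x" lborel borel f] by simp
qed

lemma continuous_on_householder: "continuous_on A (householder n)"
 unfolding householder_def by (intro continuous_intros)

text \<open>Uniqueness of Haar measure: averaging over translates of the unit ball compares
  both integrals, since reflections preserve the ball.\<close>

lemma nn_integral_householder:
 fixes f :: "'a::euclidean_space => ennreal"
 assumes n: "norm n = 1" and [measurable]: "f : bmeas"
 shows "(\<integral>\<^sup>+x. f (householder n x) \<partial>lborel) = (\<integral>\<^sup>+x. f x \<partial>lborel)"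
proof -
 let ?T = "householder n"
 have [measurable]: "?T : bmeas" by (intro borel_measurable_continuous_onI continuous_on_householder)
 define B where "B = (%x::'a. indicator (cball 0 1) x :: ennreal)"
 have [measurable]: "B : bmeas" unfolding B_def by (intro borel_measurable_indicator) simp
 have BT: "B (?T x) = B x" for x unfolding B_def using householder(4)[OF n, of x] by (simp add: indicator_def)
 define V where "V = (\<integral>\<^sup>+x. B x \<partial>lborel)"
 have V: "V ~= 0" "V ~= \<infinity>" unfolding V_def B_def
  using less_imp_neq[OF unit_ball_vol_pos[of "real DIM('a)"], THEN not_sym] by (simp_all add: emeasure_cball)
 have "(\<integral>\<^sup>+x. f (?T x) \<partial>lborel) * V = (\<integral>\<^sup>+x. (\<integral>\<^sup>+y. f (?T x) * B y \<partial>lborel) \<partial>lborel)"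
  unfolding V_def by (simp add: nn_integral_cmult nn_integral_multc)
 also have "... = (\<integral>\<^sup>+x. (\<integral>\<^sup>+y. f (?T x) * B (?T x - y) \<partial>lborel) \<partial>lborel)"
 proof (rule nn_integral_cong)
  fix x
  have "(\<integral>\<^sup>+y. f (?T x) * B (?T x - y) \<partial>lborel) = (\<integral>\<^sup>+y. f (?T x) * B y \<partial>lborel)"
   by (rule nn_integral_reflect(1)[of "%y. f (?T x) * B y"]) measurable
  thus "(\<integral>\<^sup>+y. f (?T x) * B y \<partial>lborel) = (\<integral>\<^sup>+y. f (?T x) * B (?T x - y) \<partial>lborel)" ..
 qed
 also have "... = (\<integral>\<^sup>+y. (\<integral>\<^sup>+x. f (?T x) * B (?T x - y) \<partial>lborel) \<partial>lborel)"
  by (rule lborel_pair.Fubini') simp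
 also have "... = (\<integral>\<^sup>+y. (\<integral>\<^sup>+x. f (?T x + y) * B (?T x) \<partial>lborel) \<partial>lborel)"
 proof (rule nn_integral_cong)
  fix y
  have "(\<integral>\<^sup>+x. f (?T x) * B (?T x - y) \<partial>lborel) = (\<integral>\<^sup>+x. f (?T (x + ?T y)) * B (?T (x + ?T y) - y) \<partial>lborel)"
   by (rule nn_integral_reflect(2)[symmetric, of "%x. f (?T x) * B (?T x - y)"]) measurable
  thus "(\<integral>\<^sup>+x. f (?T x) * B (?T x - y) \<partial>lborel) = (\<integral>\<^sup>+x. f (?T x + y) * B (?T x) \<partial>lborel)"
   by (simp add: householder[OF n])
 qed
 also have "... = (\<integral>\<^sup>+x. (\<integral>\<^sup>+y. f (?T x + y) * B (?T x) \<partial>lborel) \<partial>lborel)"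
  by (rule lborel_pair.Fubini') simp
 also have "... = (\<integral>\<^sup>+x. (\<integral>\<^sup>+y. f (y + ?T x) \<partial>lborel) * B x \<partial>lborel)"
  by (simp add: nn_integral_multc BT add.commute)
 also have "... = (\<integral>\<^sup>+y. f y \<partial>lborel) * V"
  unfolding V_def by (simp add: nn_integral_reflect nn_integral_cmult)
 finally have "(\<integral>\<^sup>+x. f (?T x) \<partial>lborel) * V / V = (\<integral>\<^sup>+y. f y \<partial>lborel) * V / V" by (simp only:)
 thus ?thesis using V by (simp add: ennreal_mult_divide_eq)
qed

lemma integral_householder:
 fixes f :: "'a::euclidean_space => real"
 assumes n: "norm n = 1" and f: "f : bmeas"
 shows "(LBINT x. f (householder n x)) = (LBINT x. f x)"
proof -
 have T: "householder n : measurable lborel borel" by (simp add: borel_measurable_continuous_onI continuous_on_householder)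
 have "distr lborel borel (householder n) = lborel"
 proof (rule measure_eqI)
  fix A assume "A : sets (distr lborel borel (householder n))"
  hence A: "A : sets borel" by simp
  have "emeasure (distr lborel borel (householder n)) A = (\<integral>\<^sup>+x. indicator A (householder n x) \<partial>lborel)"
   using A T by (simp add: nn_integral_distr[symmetric] del: nn_integral_distr)
  also have "... = emeasure lborel A" using A by (subst nn_integral_householder[OF n]) auto
  finally show "emeasure (distr lborel borel (householder n)) A = emeasure lborel A" .
 qed simp
 thus ?thesis using integral_distr[OF T f] by simp
qed

lemma measurable_sgn [measurable]: "(sgn :: 'a::euclidean_space => 'a) : bmeas"
 unfolding sgn_div_norm by measurable

lemma inner_sgn_le: "abs (x *. sgn y) <= norm x"
 using Cauchy_Schwarz_ineq2[of x "sgn y"] by (auto simp: norm_sgn split: if_splits)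

text \<open>Integration over the unit sphere without a surface measure: a function of the direction
  is integrated over the unit ball. The integral is not normalised, since later only ratios and
  positivity matter.\<close>

definition ball_avg :: "('a::euclidean_space => real) => real" where
 "ball_avg g = (LBINT z. indicator (cball 0 1) z * g (sgn z))"

lemma ball_avg_integrable:
 fixes g :: "'a::euclidean_space => real"
 assumes "g : bmeas" "!!z. abs (g (sgn z)) <= B"
 shows "intble (%z. indicator (cball 0 1) z * g (sgn z))"
proof (rule L1_bound)
 show "intble (%z::'a. B * indicator (cball 0 1) z)" by (simp add: emeasure_cball)
 have "(%z. g (sgn z)) : bmeas" using measurable_compose[OF measurable_sgn assms(1)] .
 thus "(%z. indicator (cball 0 1) z * g (sgn z)) : lmeas" by (intro borel_measurable_times borel_measurable_indicator) auto
 show "AE z in lborel. norm (indicator (cball 0 1) z * g (sgn z)) <= norm (B * indicator (cball 0 1) z)"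
  using assms(2) by (intro AE_I2) (force simp: indicator_def intro: order_trans)
qed

lemma ball_avg_poly_integrable:
 "intble (%z::'a::euclidean_space. indicator (cball 0 1) z * ((a *. sgn z) ^ i * (b *. sgn z) ^ j))"
proof (rule ball_avg_integrable[of "%z. (a *. z) ^ i * (b *. z) ^ j"])
 show "abs ((a *. sgn z) ^ i * (b *. sgn z) ^ j) <= norm a ^ i * norm b ^ j" for z
  unfolding abs_mult power_abs using inner_sgn_le[of a z] inner_sgn_le[of b z] by (intro mult_mono power_mono) auto
qed simp

text \<open>The even moments of one coordinate on the sphere; the basis vector may be arbitrary by
  reflection invariance.\<close>

definition sphere_moment :: "'a::euclidean_space itself => nat => real" where
 "sphere_moment _ m = ball_avg (%z::'a. ((SOME e. e : Basis) *. z) ^ (2 * m))"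

lemma ball_avg_rotate:
 fixes a b :: "'a::euclidean_space"
 assumes "norm a = norm b"
 shows "ball_avg (%z. (a *. z) ^ i) = ball_avg (%z. (b *. z) ^ i)"
proof (cases "a = b")
 case False
 define n where "n = sgn (a - b)"
 have n: "norm n = 1" "householder n a = b" using householder_swap[OF assms False] by (auto simp: n_def)
 have s: "sgn (householder n z) = householder n (sgn z)" for z by (simp add: sgn_div_norm householder[OF n(1)])
 define F where "F = (%z. indicator (cball 0 1) z * (a *. sgn z) ^ i)"
 have "F : bmeas" unfolding F_def
  by (intro borel_measurable_times borel_measurable_indicator borel_measurable_power borel_measurable_inner measurable_sgn) auto
 from integral_householder[OF n(1) this] have "ball_avg (%z. (a *. z) ^ i) = (LBINT z. F (householder n z))"
  by (simp add: ball_avg_def F_def)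
 also have "... = ball_avg (%z. (b *. z) ^ i)" unfolding ball_avg_def F_def s by (intro Lint_cong)
   (auto simp: indicator_def householder(4)[OF n(1)] householder(5)[OF n(1), symmetric] n(2))
 finally show ?thesis .
qed simp

lemma ball_avg_moment:
 fixes x :: "'a::euclidean_space"
 shows "ball_avg (%z. (x *. z) ^ (2 * m)) = (x *. x) ^ m * sphere_moment TYPE('a) m"
proof -
 let ?e = "SOME e::'a. e : Basis"
 have "ball_avg (%z. (x *. z) ^ (2 * m)) = ball_avg (%z. ((norm x *R ?e) *. z) ^ (2 * m))"
  by (rule ball_avg_rotate) (simp add: norm_Basis[OF SOME_Basis])
 also have "... = norm x ^ (2 * m) * sphere_moment TYPE('a) m" unfolding ball_avg_def sphere_moment_def
  by (subst integral_mult_right_zero[symmetric]) (simp add: power_mult_distrib mult_ac)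
 finally show ?thesis by (simp add: power_mult power2_norm_eq_inner)
qed

lemma coeff_power_1_0_1: "coeff ([:1, 0, 1:] ^ n) 0 = (1::real)" "coeff ([:1, 0, 1:] ^ n) 2 = real n"
proof -
 show 0: "coeff ([:1, 0, 1:] ^ n) 0 = (1::real)" for n by (simp add: coeff_0_power)
 show "coeff ([:1, 0, 1:] ^ n) 2 = real n"
 proof (induction n)
  case (Suc n)
  have "coeff ([:1, 0, 1:] * p) 2 = coeff p 2 + coeff p 0" for p :: "real poly" by (simp add: numeral_2_eq_2)
  thus ?case using Suc 0 by simp
 qed (simp add: numeral_2_eq_2)
qed

text \<open>By invariance the average of ((a + h b) . z)^(2m+2) is (1 + h^2)^(m+1) times a pure
  moment, while its binomial expansion has the mixed moment at h^2. Comparing the coefficients of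
  h^2 takes the place of polar coordinates.\<close>

lemma sphere_moment_mixed:
 fixes a b :: "'a::euclidean_space"
 assumes ab: "a *. a = 1" "b *. b = 1" "a *. b = 0"
 shows "(2 * real m + 1) * ball_avg (%z. (a *. z) ^ (2 * m) * (b *. z)^2) = sphere_moment TYPE('a) (Suc m)"
proof -
 let ?n = "2 * Suc m"
 define d where "d j = ball_avg (%z. (a *. z) ^ (?n - j) * (b *. z) ^ j)" for j
 have 1: "ball_avg (%z. ((a + h *R b) *. z) ^ ?n) = (SUM j<=?n. (real (?n choose j) * d j) * h ^ j)" for h
 proof -
  have e: "indicator (cball 0 1) z * ((a + h *R b) *. sgn z) ^ ?n
    = (SUM j<=?n. (real (?n choose j) * h ^ j) * (indicator (cball 0 1) z * ((a *. sgn z) ^ (?n - j) * (b *. sgn z) ^ j)))" for z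
  proof -
   have "((a + h *R b) *. sgn z) ^ ?n = (h * (b *. sgn z) + a *. sgn z) ^ ?n" by (simp add: inner_add_left add.commute)
   also have "... = (SUM j<=?n. real (?n choose j) * (h * (b *. sgn z)) ^ j * (a *. sgn z) ^ (?n - j))"
    by (rule binomial_ring)
   finally show ?thesis by (simp only: sum_distrib_left power_mult_distrib mult_ac)
  qed
  have "(LBINT z. (SUM j<=?n. C j * G j z)) = (SUM j<=?n. C j * (LBINT z. G j z))"
   if "!!j. intble (G j)" for C :: "nat => real" and G :: "nat => 'a => real" using that by (subst Lint_sum) auto
  note this[of "%j z. indicator (cball 0 1) z * ((a *. sgn z) ^ (?n - j) * (b *. sgn z) ^ j)" "%j. real (?n choose j) * h ^ j", OF ball_avg_poly_integrable]
  thus ?thesis unfolding ball_avg_def e d_def by (simp only: mult_ac)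
 qed
 have 2: "ball_avg (%z. ((a + h *R b) *. z) ^ ?n) = (1 + h^2) ^ Suc m * sphere_moment TYPE('a) (Suc m)" for h
 proof -
  have "(a + h *R b) *. (a + h *R b) = 1 + h^2"
   using ab by (simp add: inner_add_left inner_add_right inner_commute power2_eq_square)
  thus ?thesis using ball_avg_moment[of "a + h *R b" "Suc m"] by simp
 qed
 define p where "p = (SUM j<=?n. monom (real (?n choose j) * d j) j)"
 define q where "q = smult (sphere_moment TYPE('a) (Suc m)) ([:1, 0, 1:] ^ Suc m)"
 have "poly p h = poly q h" for h
 proof -
  have "poly p h = (SUM j<=?n. (real (?n choose j) * d j) * h ^ j)" by (simp only: p_def poly_sum poly_monom)
  moreover have "poly q h = (1 + h^2) ^ Suc m * sphere_moment TYPE('a) (Suc m)"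
   by (simp only: q_def poly_smult poly_power) (simp add: power2_eq_square)
  ultimately show ?thesis using 1[of h] 2[of h] by (simp only:)
 qed
 hence "p = q" by (simp add: poly_eq_poly_eq_iff[symmetric] fun_eq_iff)
 hence "coeff p 2 = coeff q 2" by simp
 moreover have "coeff p 2 = real (?n choose 2) * d 2" unfolding p_def coeff_sum coeff_monom by (subst sum.delta) auto
 moreover have "real (?n choose 2) = real (Suc m) * (2 * real m + 1)"
 proof -
  have "?n choose 2 = Suc m * (2 * m + 1)" by (simp add: choose_two)
  thus ?thesis by (simp add: algebra_simps)
 qed
 moreover have "coeff q 2 = real (Suc m) * sphere_moment TYPE('a) (Suc m)"
  unfolding q_def coeff_smult coeff_power_1_0_1 by simp
 ultimately have "real (Suc m) * ((2 * real m + 1) * d 2) = real (Suc m) * sphere_moment TYPE('a) (Suc m)" by simp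
 hence "(2 * real m + 1) * d 2 = sphere_moment TYPE('a) (Suc m)" by (metis mult_cancel_left of_nat_neq_0)
 moreover have "d 2 = ball_avg (%z. (a *. z) ^ (2 * m) * (b *. z)^2)" by (simp add: d_def)
 ultimately show ?thesis by simp
qed

text \<open>The squares of the coordinates of a unit vector sum to 1. Multiplying this by the 2m-th
  power of one coordinate and averaging gives one pure moment and N - 1 equal mixed ones.\<close>

lemma sphere_moment_rec:
 "(2 * real m + real DIM('a)) * sphere_moment TYPE('a::euclidean_space) (Suc m) = (2 * real m + 1) * sphere_moment TYPE('a) m"
proof -
 let ?e = "SOME e::'a. e : Basis"
 let ?c = "sphere_moment TYPE('a)"
 have e: "?e : Basis" by (rule SOME_Basis)
 have 1: "(SUM b:Basis. ball_avg (%z. (?e *. z) ^ (2 * m) * (b *. z)^2)) = ?c m"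
 proof -
  have "(SUM b:Basis. ball_avg (%z. (?e *. z) ^ (2 * m) * (b *. z)^2))
   = (LBINT z. (SUM b:Basis. indicator (cball 0 1) z * ((?e *. sgn z) ^ (2 * m) * (b *. sgn z)^2)))"
   unfolding ball_avg_def by (intro Lint_sum[symmetric] ball_avg_poly_integrable)
  also have "... = (LBINT z. indicator (cball 0 1) z * ((?e *. sgn z) ^ (2 * m)))"
  proof (rule integral_cong_AE)
   show "AE z in lborel. (SUM b:Basis. indicator (cball 0 1) z * ((?e *. sgn z) ^ (2 * m) * (b *. sgn z)^2)) = indicator (cball 0 1) z * ((?e *. sgn z) ^ (2 * m))"
    using AE_lborel_singleton[of "0::'a"]
   proof eventually_elim
    case (elim z)
    have "(SUM b:Basis. (b *. sgn z)^2) = sgn z *. sgn z"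
     by (subst (2) euclidean_inner) (simp add: power2_eq_square inner_commute)
    also have "... = 1" using elim by (simp add: dot_square_norm norm_sgn)
    finally show ?case by (simp add: sum_distrib_left[symmetric])
   qed
   show "(%z. SUM b:Basis. indicator (cball 0 1) z * ((?e *. sgn z) ^ (2 * m) * (b *. sgn z)^2)) : lmeas"
    by (intro borel_measurable_sum borel_measurable_integrable[OF ball_avg_poly_integrable])
   show "(%z. indicator (cball 0 1) z * ((?e *. sgn z) ^ (2 * m))) : lmeas"
    using borel_measurable_integrable[OF ball_avg_poly_integrable[of ?e "2 * m" ?e 0]] by simp
  qed
  finally show ?thesis by (simp add: sphere_moment_def ball_avg_def)
 qed
 have "(SUM b:Basis. ball_avg (%z. (?e *. z) ^ (2 * m) * (b *. z)^2))
   = ball_avg (%z. (?e *. z) ^ (2 * m) * (?e *. z)^2) + (SUM b:Basis - {?e}. ball_avg (%z. (?e *. z) ^ (2 * m) * (b *. z)^2))"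
  by (rule sum.remove) (use e in auto)
 also have "ball_avg (%z. (?e *. z) ^ (2 * m) * (?e *. z)^2) = ?c (Suc m)"
  unfolding sphere_moment_def power_add[symmetric] by (simp add: add.commute)
 finally have "(2 * real m + 1) * ?c m = (2 * real m + 1) * ?c (Suc m) + (SUM b:Basis - {?e}. (2 * real m + 1) * ball_avg (%z. (?e *. z) ^ (2 * m) * (b *. z)^2))"
  unfolding 1 by (simp add: distrib_left sum_distrib_left)
 also have "(SUM b:Basis - {?e}. (2 * real m + 1) * ball_avg (%z. (?e *. z) ^ (2 * m) * (b *. z)^2)) = (SUM b:(Basis::'a set) - {?e}. ?c (Suc m))"
  using e by (intro sum.cong refl sphere_moment_mixed) (auto simp: inner_Basis)
 also have "... = (real DIM('a) - 1) * ?c (Suc m)" using e by (simp add: card_Diff_singleton of_nat_diff)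
 finally show ?thesis by (simp add: algebra_simps)
qed

lemma sphere_moment_0: "sphere_moment TYPE('a::euclidean_space) 0 > 0"
 using unit_ball_vol_pos[of "real DIM('a)"] by (simp add: sphere_moment_def ball_avg_def content_cball)

text \<open>The recursion for the moments has the factor 2m + N = 2 (m + nu + 1), the very factor by
  which 1/Gamma changes from m to m + 1.\<close>

lemma sphere_moment_closed_form:
 fixes nu :: real
 defines "nu == (real DIM('a::euclidean_space) - 2) / 2"
 shows "sphere_moment TYPE('a) m / fact (2 * m) * rGamma (nu + 1) = sphere_moment TYPE('a) 0 * (rGamma (real m + nu + 1) / (fact m * 4 ^ m))"
proof (induction m)
 case (Suc m)
 let ?c = "sphere_moment TYPE('a)"
 have N: "2 * real m + real DIM('a) = 2 * (real m + nu + 1)" by (simp add: nu_def field_simps)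
 have "real DIM('a) > 0" by simp
 hence pos: "real m + nu + 1 > 0" unfolding nu_def using of_nat_0_le_iff[of m, where 'a=real] by argo
 have "?c (Suc m) * (2 * (real m + nu + 1)) = (2 * real m + 1) * ?c m"
  using sphere_moment_rec[of m, where 'a='a] unfolding N by (simp add: mult.commute)
 hence c: "?c (Suc m) = (2 * real m + 1) * ?c m / (2 * (real m + nu + 1))" using pos by (simp add: field_simps)
 have g: "rGamma (real (Suc m) + nu + 1) = rGamma (real m + nu + 1) / (real m + nu + 1)"
  using rGamma_plus1[of "real m + nu + 1"] pos by (simp add: field_simps add_ac)
 have f: "fact (2 * Suc m) = (2 * real m + 2) * (2 * real m + 1) * fact (2 * m)" by (simp add: algebra_simps)
 have "?c (Suc m) / fact (2 * Suc m) * rGamma (nu + 1)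
   = (?c m / fact (2 * m) * rGamma (nu + 1)) * ((2 * real m + 1) / ((2 * (real m + nu + 1)) * ((2 * real m + 2) * (2 * real m + 1))))"
  unfolding c f by simp
 also have "(2 * real m + 1) / ((2 * (real m + nu + 1)) * ((2 * real m + 2) * (2 * real m + 1))) = 1 / (4 * ((real m + nu + 1) * (real m + 1)))"
 proof -
  have "2 * real m + 1 ~= 0" by (metis of_nat_0_le_iff add_nonneg_eq_0_iff mult_nonneg_nonneg zero_le_numeral zero_le_one zero_neq_one)
  thus ?thesis using pos by (simp add: divide_simps) (simp add: algebra_simps)
 qed
 also have "(?c m / fact (2 * m) * rGamma (nu + 1)) * (1 / (4 * ((real m + nu + 1) * (real m + 1))))
   = ?c 0 * ((rGamma (real m + nu + 1) / (real m + nu + 1)) / (((real m + 1) * fact m) * (4 * 4 ^ m)))"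
  unfolding Suc by simp
 also have "... = ?c 0 * (rGamma (real (Suc m) + nu + 1) / (fact (Suc m) * 4 ^ Suc m))"
  unfolding g by (simp add: algebra_simps)
 finally show ?case .
qed simp

text \<open>The cosine series is averaged term by term; only even moments occur, and their closed
  form turns the result into the series of \<open>bessel_E\<close>.\<close>

lemma ball_avg_cos:
 fixes x :: "'a::euclidean_space"
 defines "nu == (real DIM('a) - 2) / 2"
 shows "ball_avg (%z. cos (k * (x *. z))) * rGamma (nu + 1) = sphere_moment TYPE('a) 0 * bessel_E nu (k^2 * (x *. x) / 4)"
proof -
 define f where "f m z = indicator (cball 0 1) z * ((-1) ^ m / fact (2 * m) * (k * (x *. sgn z)) ^ (2 * m))" for m and z :: 'a
 have pint: "intble (%z::'a. indicator (cball 0 1) z * (x *. sgn z) ^ i)" for i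
  using ball_avg_poly_integrable[of x i x 0] by simp
 have fe: "f m = (%z. ((-1) ^ m / fact (2 * m) * k ^ (2 * m)) * (indicator (cball 0 1) z * (x *. sgn z) ^ (2 * m)))" for m
  by (simp add: f_def fun_eq_iff power_mult_distrib)
 have fint: "intble (f m)" for m unfolding fe by (intro integrable_mult_right pint)
 have fI: "(LBINT z. f m z) = (- (k^2 * (x *. x))) ^ m * (sphere_moment TYPE('a) m / fact (2 * m))" for m
  unfolding fe using ball_avg_moment[of x m] by (simp add: ball_avg_def power_mult_distrib power_mult power_minus[of "k^2 * _"])
 have sums: "(%m. f m z) sums (indicator (cball 0 1) z * cos (k * (x *. sgn z)))" for z
  unfolding f_def using sums_mult[OF cos_paired] by simp
 define M where "M = abs k * norm x"
 have bnd: "norm (f m z) <= M ^ (2 * m) / fact (2 * m) * indicator (cball 0 1) z" for m z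
 proof -
  have "abs (k * (x *. sgn z)) ^ (2 * m) <= M ^ (2 * m)"
   unfolding M_def abs_mult by (intro power_mono mult_left_mono inner_sgn_le) auto
  thus ?thesis by (simp add: f_def abs_mult power_abs divide_right_mono indicator_def)
 qed
 have sM: "summable (%m. M ^ (2 * m) / fact (2 * m))"
 proof -
  have "summable (%n. M ^ n / fact n)" using summable_exp[of M] by (simp add: divide_inverse mult.commute)
  hence "summable ((%n. M ^ n / fact n) o (%m. 2 * m))" by (rule summable_reindex) (auto simp: inj_on_def M_def)
  thus ?thesis by (simp add: comp_def)
 qed
 have "(%m. LBINT z. f m z) sums (LBINT z. (\<Sum>m. f m z))"
 proof (rule sums_integral[OF fint])
  show "AE z in lborel. summable (%m. norm (f m z))"
  proof (intro AE_I2 summable_comparison_test'[OF summable_mult2[OF sM]])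
   show "norm (norm (f m z)) <= M ^ (2 * m) / fact (2 * m) * indicator (cball 0 1) z" for m z using bnd[of m z] by simp
  qed
  show "summable (%m. LBINT z. norm (f m z))"
  proof (rule summable_comparison_test')
   show "summable (%m. M ^ (2 * m) / fact (2 * m) * measure lborel (cball (0::'a) 1))" by (rule summable_mult2[OF sM])
   fix m :: nat
   have "(LBINT z. norm (f m z)) <= (LBINT z. M ^ (2 * m) / fact (2 * m) * indicator (cball (0::'a) 1) z)"
    by (intro integral_mono integrable_norm fint integrable_mult_right bnd) (simp add: emeasure_cball)
   thus "norm (LBINT z. norm (f m z)) <= M ^ (2 * m) / fact (2 * m) * measure lborel (cball (0::'a) 1)" by simp
  qed
 qed
 also have "(LBINT z. (\<Sum>m. f m z)) = ball_avg (%z. cos (k * (x *. z)))"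
  unfolding ball_avg_def using sums by (simp add: sums_iff)
 finally have "(%m. (LBINT z. f m z) * rGamma (nu + 1)) sums (ball_avg (%z. cos (k * (x *. z))) * rGamma (nu + 1))"
  by (rule sums_mult2)
 moreover have "(LBINT z. f m z) * rGamma (nu + 1) = sphere_moment TYPE('a) 0 * (rGamma (real m + nu + 1) / fact m * (- (k^2 * (x *. x) / 4)) ^ m)" for m
 proof -
  have "(LBINT z. f m z) * rGamma (nu + 1) = (- (k^2 * (x *. x))) ^ m * (sphere_moment TYPE('a) m / fact (2 * m) * rGamma (nu + 1))"
   unfolding fI by simp
  also have "... = sphere_moment TYPE('a) 0 * (rGamma (real m + nu + 1) / fact m * ((- (k^2 * (x *. x))) ^ m / 4 ^ m))"
   unfolding nu_def sphere_moment_closed_form by simp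
  also have "(- (k^2 * (x *. x))) ^ m / 4 ^ m = (- (k^2 * (x *. x) / 4)) ^ m"
   by (simp only: power_divide[symmetric] minus_divide_left)
  finally show ?thesis .
 qed
 ultimately have "(%m. sphere_moment TYPE('a) 0 * (rGamma (real m + nu + 1) / fact m * (- (k^2 * (x *. x) / 4)) ^ m)) sums (ball_avg (%z. cos (k * (x *. z))) * rGamma (nu + 1))"
  by simp
 moreover obtain B where B: "!!m. abs (rGamma (real m + nu + 1)) <= B" using rGamma_shift_bounded[of nu] by blast
 have "(%m. sphere_moment TYPE('a) 0 * (rGamma (real m + nu + 1) / fact m * (- (k^2 * (x *. x) / 4)) ^ m)) sums (sphere_moment TYPE('a) 0 * bessel_E nu (k^2 * (x *. x) / 4))"
  unfolding bessel_E_def fact_series_def by (intro sums_mult summable_sums summable_fact_series_abs[OF B])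
 ultimately show ?thesis using sums_unique2 by blast
qed

lemma im_kernel_ball_avg:
 assumes "CARD('n::finite) >= 3" "k > 0"
 shows "EX C>0. ALL x::real^'n. ImPhi k x = C * ball_avg (%z. cos (k * (x *. z)))"
proof -
 define nu where "nu = order_of TYPE('n)"
 let ?c = "sphere_moment TYPE(real^'n) 0"
 have nu: "nu > 0" using assms by (simp add: nu_def)
 hence r: "rGamma (nu + 1) > 0" by (simp add: rGamma_inverse_Gamma Gamma_real_pos)
 have "ImPhi k x = (kernel_const nu k * rGamma (nu + 1) / ?c) * ball_avg (%z. cos (k * (x *. z)))" for x :: "real^'n"
 proof -
  have "ball_avg (%z. cos (k * (x *. z))) * rGamma (nu + 1) = ?c * bessel_E nu (k^2 * (x *. x) / 4)"
   using ball_avg_cos[of k x] by (simp add: nu_def)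
  hence "bessel_E nu (k^2 * (x *. x) / 4) = ball_avg (%z. cos (k * (x *. z))) * rGamma (nu + 1) / ?c"
   using sphere_moment_0[where 'a="real^'n"] by (simp add: field_simps)
  thus ?thesis unfolding ImPhi_def nu_def[symmetric] by simp
 qed
 moreover have "kernel_const nu k * rGamma (nu + 1) / ?c > 0"
  using r kernel_const_pos[OF assms(2)] sphere_moment_0[where 'a="real^'n"] by simp
 ultimately show ?thesis by blast
qed

lemma integrable_pair_product:
 fixes a b :: "'a::euclidean_space => real"
 assumes a: "intble a" and b: "intble b"
 shows "integrable (lborel \<Otimes>\<^sub>M lborel) (%(x, y). a x * b y)"
proof (rule lborel_pair.Fubini_integrable)
 have [measurable]: "a : bmeas" "b : bmeas" using a b by auto
 show "(%(x, y). a x * b y) : borel_measurable (lborel \<Otimes>\<^sub>M lborel)" by measurable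
 show "intble (%x. LBINT y. norm (case (x, y) of (x, y) => a x * b y))" using a by (simp add: abs_mult)
qed (use b in auto)

text \<open>The addition theorem for the cosine separates x from y. The quadratic form of Im Phi_k
  thereby becomes an integral of squares of cosine and sine transforms at frequencies of length k,
  and the convolution is built from the same transforms.\<close>

lemma im_kernel_form:
 fixes w :: "real^'n::finite => real"
 assumes N: "CARD('n) >= 3" and k: "k > 0" and w: "intble w"
  and C: "!!x::real^'n. ImPhi k x = C * ball_avg (%z. cos (k * (x *. z)))"
 defines "Wc == %z. LBINT y. w y * cos (k * (y *. sgn z))"
  and "Ws == %z. LBINT y. w y * sin (k * (y *. sgn z))"
 shows "(Im_conv k w x)
   = C * (LBINT z. indicator (cball 0 1) z * (cos (k * (x *. sgn z)) * Wc z + sin (k * (x *. sgn z)) * Ws z))"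
  and "(LBINT x. w x * (Im_conv k w x))
   = C * (LBINT z. indicator (cball 0 1) z * ((Wc z)^2 + (Ws z)^2))"
  and "intble (%z. indicator (cball 0 1) z * ((Wc z)^2 + (Ws z)^2))"
proof -
 let ?B = "%z::real^'n. indicator (cball 0 1) z :: real"
 let ?S = "%x z. cos (k * (x *. sgn z)) * Wc z + sin (k * (x *. sgn z)) * Ws z"
 have [measurable]: "w : bmeas" using w by auto
 have [measurable]: "?B : bmeas" by (intro borel_measurable_indicator) simp
 have Bi: "intble ?B" by (simp add: emeasure_cball)
 have wabs: "intble (%x. abs (w x))" using w by simp
 have wt: "intble (%y. w y * h y)" if [measurable]: "h : bmeas" and "!!y. abs (h y) <= 1" for h
  by (rule L1_bound[OF wabs]) (use that(2) in "auto simp: abs_mult mult_left_le")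
 have [measurable]: "Wc : bmeas" "Ws : bmeas" unfolding Wc_def Ws_def by measurable
 define n where "n = (LBINT x. abs (w x))"
 have wb: "abs (LBINT y. w y * h y) <= n" if "h : bmeas" and h: "!!y. abs (h y) <= 1" for h
 proof -
  have "abs (LBINT y. w y * h y) <= (LBINT y. abs (w y * h y))" by (rule integral_abs_bound)
  also have "... <= n" unfolding n_def
   by (intro integral_mono wabs integrable_abs wt that) (use h in "simp add: abs_mult mult_left_le")
  finally show ?thesis .
 qed
 have Wb: "abs (Wc z) <= n" "abs (Ws z) <= n" for z unfolding Wc_def Ws_def by (intro wb; simp)+
 have pair: "integrable (lborel \<Otimes>\<^sub>M lborel) (%(y, z). w y * (?B z * h y z))"
  if [measurable]: "(%(y, z). h y z) : borel_measurable (borel \<Otimes>\<^sub>M borel)" and h: "!!y z. abs (h y z) <= c" for h c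
 proof (rule L1_bound)
  show "integrable (lborel \<Otimes>\<^sub>M lborel) (%(y, z). abs (w y) * (?B z * c))"
   by (rule integrable_pair_product) (use wabs Bi in auto)
  show "(%(y, z). w y * (?B z * h y z)) : borel_measurable (lborel \<Otimes>\<^sub>M lborel)" by measurable
  show "AE yz in lborel \<Otimes>\<^sub>M lborel. norm (case yz of (y, z) => w y * (?B z * h y z)) <= norm (case yz of (y, z) => abs (w y) * (?B z * c))"
  proof (intro AE_I2, clarify)
   fix y z
   have "c >= 0" using order_trans[OF abs_ge_zero h] .
   thus "norm (w y * (?B z * h y z)) <= norm (abs (w y) * (?B z * c))"
    using h[of y z] by (auto simp: abs_mult indicator_def intro: mult_left_mono)
  qed
 qed
 have swap: "(LBINT y. w y * (LBINT z. ?B z * h y z)) = (LBINT z. ?B z * (LBINT y. w y * h y z))"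
  if m: "(%(y, z). h y z) : borel_measurable (borel \<Otimes>\<^sub>M borel)" and h: "!!y z. abs (h y z) <= c" for h c
 proof -
  have "(LBINT y. w y * (LBINT z. ?B z * h y z)) = (LBINT y. (LBINT z. w y * (?B z * h y z)))" by simp
  also have "... = (LBINT z. (LBINT y. w y * (?B z * h y z)))" using lborel_pair.Fubini_integral[OF pair[OF m h]] by simp
  also have "... = (LBINT z. ?B z * (LBINT y. w y * h y z))"
  proof (rule Lint_cong[OF refl])
   fix z
   have "(LBINT y. ?B z * (w y * h y z)) = ?B z * (LBINT y. w y * h y z)" by simp
   thus "(LBINT y. w y * (?B z * h y z)) = ?B z * (LBINT y. w y * h y z)" by (simp only: mult.left_commute)
  qed
  finally show ?thesis .
 qed
 have 1: "(Im_conv k w x)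
   = C * (LBINT z. ?B z * ?S x z)" for x
 proof -
  have "(Im_conv k w x) = (LBINT y. C * (w y * (LBINT z. ?B z * cos (k * ((x - y) *. sgn z)))))"
   unfolding C ball_avg_def by (simp add: mult_ac)
  also have "... = C * (LBINT y. w y * (LBINT z. ?B z * cos (k * ((x - y) *. sgn z))))" by simp
  also have "(LBINT y. w y * (LBINT z. ?B z * cos (k * ((x - y) *. sgn z))))
    = (LBINT z. ?B z * (LBINT y. w y * cos (k * ((x - y) *. sgn z))))"
  proof (rule swap[where c = 1])
   show "(%(y, z). cos (k * ((x - y) *. sgn z))) : borel_measurable (borel \<Otimes>\<^sub>M borel)" by measurable
  qed simp
  also have "(%z. LBINT y. w y * cos (k * ((x - y) *. sgn z))) = (%z. cos (k * (x *. sgn z)) * Wc z + sin (k * (x *. sgn z)) * Ws z)"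
  proof
   fix z
   have "(%y. w y * cos (k * ((x - y) *. sgn z))) = (%y. cos (k * (x *. sgn z)) * (w y * cos (k * (y *. sgn z))) + sin (k * (x *. sgn z)) * (w y * sin (k * (y *. sgn z))))"
    by (simp add: fun_eq_iff inner_diff_left right_diff_distrib cos_diff algebra_simps)
   thus "(LBINT y. w y * cos (k * ((x - y) *. sgn z))) = cos (k * (x *. sgn z)) * Wc z + sin (k * (x *. sgn z)) * Ws z"
    unfolding Wc_def Ws_def by (simp add: wt)
  qed
  finally show ?thesis .
 qed
 show "(Im_conv k w x)
   = C * (LBINT z. ?B z * ?S x z)" by (rule 1)
 have "(LBINT x. w x * (Im_conv k w x))
   = C * (LBINT x. w x * (LBINT z. ?B z * ?S x z))"
  unfolding 1 by (simp add: mult.left_commute)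
 also have "(LBINT x. w x * (LBINT z. ?B z * ?S x z))
   = (LBINT z. ?B z * (LBINT x. w x * ?S x z))"
 proof (rule swap[where c = "n + n"])
  show "abs (cos (k * (x *. sgn z)) * Wc z + sin (k * (x *. sgn z)) * Ws z) <= n + n" for x z :: "real^'n"
  proof -
   have "abs (cos (k * (x *. sgn z)) * Wc z) <= 1 * n" "abs (sin (k * (x *. sgn z)) * Ws z) <= 1 * n"
    unfolding abs_mult by (intro mult_mono Wb; simp)+
   thus ?thesis by linarith
  qed
 qed measurable
 also have "(%z. LBINT x. w x * ?S x z) = (%z. (Wc z)^2 + (Ws z)^2)"
 proof
  fix z
  have "(%x. w x * ?S x z) = (%x. Wc z * (w x * cos (k * (x *. sgn z))) + Ws z * (w x * sin (k * (x *. sgn z))))"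
   by (simp add: fun_eq_iff algebra_simps)
  hence "(LBINT x. w x * ?S x z)
    = Wc z * (LBINT x. w x * cos (k * (x *. sgn z))) + Ws z * (LBINT x. w x * sin (k * (x *. sgn z)))"
   by (simp add: wt)
  thus "(LBINT x. w x * ?S x z) = (Wc z)^2 + (Ws z)^2" by (simp add: Wc_def Ws_def power2_eq_square)
 qed
 finally show "(LBINT x. w x * (Im_conv k w x)) = C * (LBINT z. ?B z * ((Wc z)^2 + (Ws z)^2))" .
 show "intble (%z. ?B z * ((Wc z)^2 + (Ws z)^2))"
 proof (rule L1_bound)
  show "intble (%z. ?B z * (n^2 + n^2))" using Bi by simp
  have "(Wc z)^2 <= n^2" "(Ws z)^2 <= n^2" for z using Wb[of z] by (auto intro!: abs_le_square_iff[THEN iffD1] order_trans[OF _ abs_ge_self])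
  hence "(Wc z)^2 + (Ws z)^2 <= n^2 + n^2" for z by (rule add_mono)
  thus "AE z in lborel. norm (?B z * ((Wc z)^2 + (Ws z)^2)) <= norm (?B z * (n^2 + n^2))"
   by (intro AE_I2) (auto simp: indicator_def)
 qed measurable
qed

text \<open>Two densities are treated together because only the sum of the forms for a real and an
  imaginary part will be known to vanish. Both forms being nonnegative, all transforms vanish almost
  everywhere, and so do the convolutions built from them.\<close>

lemma im_kernel_conv_zero:
 fixes w1 w2 :: "real^'n::finite => real"
 assumes N: "CARD('n) >= 3" and k: "k > 0" and w: "intble w1" "intble w2" and z: "(LBINT x. w1 x * (Im_conv k w1 x))
   + (LBINT x. w2 x * (Im_conv k w2 x)) = 0"
 shows "(Im_conv k w1 x) = 0" "(Im_conv k w2 x) = 0"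
proof -
 let ?B = "%z::real^'n. indicator (cball 0 1) z :: real"
 obtain C where C0: "C > 0" and C: "!!x::real^'n. ImPhi k x = C * ball_avg (%z. cos (k * (x *. z)))"
  using im_kernel_ball_avg[OF N k] by blast
 define c where "c w z = (LBINT y. w y * cos (k * (y *. sgn z)))" for w :: "real^'n => real" and z :: "real^'n"
 define s where "s w z = (LBINT y. w y * sin (k * (y *. sgn z)))" for w :: "real^'n => real" and z :: "real^'n"
 note form = im_kernel_form[OF N k _ C, folded c_def s_def]
 have nn: "(LBINT z. ?B z * ((c w z)^2 + (s w z)^2)) >= 0" for w by (intro Lint_nonneg) auto
 have "C * ((LBINT z. ?B z * ((c w1 z)^2 + (s w1 z)^2)) + (LBINT z. ?B z * ((c w2 z)^2 + (s w2 z)^2))) = 0"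
  using z unfolding form(2)[OF w(1)] form(2)[OF w(2)] by (simp add: distrib_left)
 hence zz: "(LBINT z. ?B z * ((c w1 z)^2 + (s w1 z)^2)) = 0" "(LBINT z. ?B z * ((c w2 z)^2 + (s w2 z)^2)) = 0"
  using C0 nn[of w1] nn[of w2] by (simp_all add: add_nonneg_eq_0_iff)
 have main: "(Im_conv k w x) = 0"
  if w: "intble w" and z: "(LBINT z. ?B z * ((c w z)^2 + (s w z)^2)) = 0" for w
 proof -
  have "AE z in lborel. ?B z * ((c w z)^2 + (s w z)^2) = 0" using integral_nonneg_eq_0_iff_AE[OF form(3)[OF w]] z by auto
  hence "AE z in lborel. ?B z * (cos (k * (x *. sgn z)) * c w z + sin (k * (x *. sgn z)) * s w z) = 0"
   by eventually_elim (auto simp: sum_power2_eq_zero_iff)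
  hence "(LBINT z. ?B z * (cos (k * (x *. sgn z)) * c w z + sin (k * (x *. sgn z)) * s w z)) = 0"
   by (rule integral_eq_zero_AE)
  thus ?thesis unfolding form(1)[OF w] by simp
 qed
 show "(Im_conv k w1 x) = 0" by (rule main[OF w(1) zz(1)])
 show "(Im_conv k w2 x) = 0" by (rule main[OF w(2) zz(2)])
qed

text \<open>Dominated convergence of difference quotients, with h as majorant by the mean value
  inequality. Only the point 0 is treated, since the parameter is always a translation and can be
  recentred.\<close>

lemma DERIV_integral:
 fixes f f' :: "real => 'a => real"
 assumes d: "!!t y. abs t <= 1 ==> y : space M ==> DERIV (%t. f t y) t :> f' t y"
  and bd: "!!t y. abs t <= 1 ==> y : space M ==> abs (f' t y) <= h y" and h: "integrable M h" and f0: "integrable M (f 0)"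
  and m: "!!t. f t : borel_measurable M"
 shows "DERIV (%t. LINT y|M. f t y) 0 :> (LINT y|M. f' 0 y)" "integrable M (f' 0)"
proof -
 have lip: "abs (f t y - f 0 y) <= abs t * h y" if t: "abs t <= 1" and y: "y : space M" for t y
 proof -
  have "norm (f t y - f 0 y) <= h y * norm (t - 0)"
  proof (rule field_differentiable_bound[of "{-1..1}" "%t. f t y" "%t. f' t y"])
   show "((%t. f t y) has_field_derivative f' z y) (at z within {-1..1})" if "z : {-1..1}" for z
    using d[OF _ y, of z] that by (auto intro: has_field_derivative_at_within)
   show "norm (f' z y) <= h y" if "z : {-1..1}" for z using bd[OF _ y, of z] that by auto
  qed (use t in auto)
  thus ?thesis by (simp add: mult.commute)
 qed
 have hn: "h y >= 0" if "y : space M" for y using bd[of 0 y] that by auto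
 have ft: "integrable M (f t)" if t: "abs t <= 1" for t
 proof (rule L1_bound)
  show "integrable M (%y. abs (f 0 y) + h y)" using f0 h by simp
  show "AE y in M. norm (f t y) <= norm (abs (f 0 y) + h y)"
  proof (rule AE_I2)
   fix y assume y: "y : space M"
   have "abs t * h y <= 1 * h y" using t hn[OF y] by (intro mult_right_mono) auto
   thus "norm (f t y) <= norm (abs (f 0 y) + h y)" using lip[OF t y] by simp
  qed
 qed (rule m)
 have lim: "(%n. (f (X n) y - f 0 y) / X n) ----> f' 0 y" if X: "!!n. X n ~= 0" "X ----> 0" and y: "y : space M" for X y
 proof -
  have "((%t. (f t y - f 0 y) / (t - 0)) \<longlongrightarrow> f' 0 y) (at 0)"
   using d[of 0 y] y by (simp add: has_field_derivative_iff)
  thus ?thesis using X unfolding tendsto_at_iff_sequentially comp_def by auto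
 qed
 have m': "(%y. (f t y - f 0 y) / t) : borel_measurable M" for t using m by (intro borel_measurable_divide borel_measurable_diff) auto
 have X0: "(%n. 1 / real (Suc n)) ----> 0" using LIMSEQ_inverse_real_of_nat by (simp add: inverse_eq_divide)
 have mf': "f' 0 : borel_measurable M" by (rule borel_measurable_LIMSEQ_metric[OF m' lim[OF _ X0]]) auto
 show "integrable M (f' 0)" by (rule L1_bound[OF h mf']) (use bd[of 0] hn in "auto intro!: AE_I2")
 have "((%t. ((LINT y|M. f t y) - (LINT y|M. f 0 y)) / (t - 0)) \<longlongrightarrow> (LINT y|M. f' 0 y)) (at 0)"
  unfolding tendsto_at_iff_sequentially
 proof (intro allI impI)
  fix X :: "nat => real" assume X: "ALL i. X i : UNIV - {0}" "X ----> 0"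
  have "eventually (%n. abs (X n) < 1) sequentially" using tendstoD[OF X(2), of 1] by (simp add: dist_real_def)
  then obtain n0 where n0: "!!n. n >= n0 ==> abs (X n) <= 1" unfolding eventually_sequentially by (meson less_imp_le)
  have "(%n. LINT y|M. (f (X (n + n0)) y - f 0 y) / X (n + n0)) ----> (LINT y|M. f' 0 y)"
  proof (rule integral_dominated_convergence[OF mf' m' h])
   show "AE y in M. (%n. (f (X (n + n0)) y - f 0 y) / X (n + n0)) ----> f' 0 y"
    using X by (intro AE_I2 lim LIMSEQ_ignore_initial_segment) auto
   show "AE y in M. norm ((f (X (n + n0)) y - f 0 y) / X (n + n0)) <= h y" for n
   proof (rule AE_I2)
    fix y assume y: "y : space M"
    show "norm ((f (X (n + n0)) y - f 0 y) / X (n + n0)) <= h y"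
     using lip[OF n0 y, of "n + n0"] X(1) by (simp add: divide_le_eq mult.commute)
   qed
  qed
  moreover have eq: "(LINT y|M. (f (X (n + n0)) y - f 0 y) / X (n + n0)) = ((LINT y|M. f (X (n + n0)) y) - (LINT y|M. f 0 y)) / X (n + n0)" for n
   using ft[OF n0, of "n + n0"] f0 by simp
  ultimately have "(%n. ((%t. ((LINT y|M. f t y) - (LINT y|M. f 0 y)) / (t - 0)) o X) (n + n0)) ----> (LINT y|M. f' 0 y)"
   by (simp only: eq comp_def diff_zero)
  thus "((%t. ((LINT y|M. f t y) - (LINT y|M. f 0 y)) / (t - 0)) o X) ----> (LINT y|M. f' 0 y)" by (rule LIMSEQ_offset)
 qed
 thus "DERIV (%t. LINT y|M. f t y) 0 :> (LINT y|M. f' 0 y)" by (simp add: has_field_derivative_iff)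
qed

section \<open>Convolution bounds and decay of solutions of the linear equation\<close>

lemma kernel_conv_decay:
 assumes dim: "DIM('a::euclidean_space) >= 3" and "0 <= g" "g <= p" "g <= b" "p + b - g > real DIM('a)"
 shows "EX C>=0. ALL x::'a. intble (%y. maj p (x - y) * jp y b)
   & (LBINT y. maj p (x - y) * jp y b) <= C * jp x g"
proof -
 obtain C1 where C1: "C1 >= 0" "!!x::'a. intble (%y. jp (x - y) p * jp y b)"
  "!!x::'a. (LBINT y. jp (x - y) p * jp y b) <= C1 * jp x g" using jb_conv_decay[OF assms(2-5)] by blast
 obtain C2 where C2: "C2 >= 0" "!!x::'a. intble (%y. loc_kernel (x - y) * jp y b)"
  "!!x::'a. (LBINT y. loc_kernel (x - y) * jp y b) <= C2 * jp x b" using loc_kernel_conv_decay[OF dim, of b] assms by auto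
 show ?thesis
 proof (intro exI[of _ "C1 + C2"] conjI allI)
  fix x :: 'a
  show "intble (%y. maj p (x - y) * jp y b)" unfolding distrib_right by (intro L1_add C1 C2)
  have "(LBINT y. maj p (x - y) * jp y b) <= C2 * jp x b + C1 * jp x g"
   unfolding distrib_right using C1 C2 by (simp add: add_mono)
  also have "... <= C2 * jp x g + C1 * jp x g" using jb_powr_antimono[OF assms(4), of x] C2(1) by (simp add: mult_left_mono)
  finally show "(LBINT y. maj p (x - y) * jp y b) <= (C1 + C2) * jp x g" by (simp add: algebra_simps)
 qed (use C1 C2 in auto)
qed

text \<open>Densities are only Lebesgue measurable, because they may involve the given solution,
  while the majorant is Borel. The comparison therefore takes place over \<open>lebesgue\<close> and
  its value is computed over \<open>lborel\<close>.\<close>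

lemma conv_bound:
 fixes K w :: "'a::euclidean_space => 'b::{real_normed_field, banach, second_countable_topology}"
 assumes maj: "intble (%y. maj p (x - y) * jp y b)" and K: "K : bmeas" "!!z. norm (K z) <= c * maj p z"
  and w: "w : Lmeas" "!!y. norm (w y) <= A * jp y b"
 shows "integrable lebesgue (%y. K (x - y) * w y)"
  and "norm (LINT y|lebesgue. K (x - y) * w y) <= c * A * (LBINT y. maj p (x - y) * jp y b)"
  and "integrable lebesgue (%y. norm (K (x - y)) * norm (w y))"
proof -
 have le: "norm (K (x - y)) * norm (w y) <= c * A * (maj p (x - y) * jp y b)" for y
 proof -
  have "0 <= c * maj p (x - y)" using norm_ge_zero K(2)[of "x - y"] by (rule order_trans)
  hence "norm (K (x - y)) * norm (w y) <= (c * maj p (x - y)) * (A * jp y b)" by (intro mult_mono K w) auto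
  thus ?thesis by (simp add: mult_ac)
 qed
 have M: "integrable lebesgue (%y. c * A * (maj p (x - y) * jp y b))"
  using maj borel_measurable_integrable[OF maj] by (intro integrable_mult_right) (simp add: integrable_completion)
 have "(%y. x - y) : bmeas" by simp
 hence Km: "(%y. K (x - y)) : bmeas" using measurable_compose[OF _ K(1)] by blast
 have Km: "(%y. K (x - y)) : Lmeas" by (rule measurable_completion) (use Km in simp)
 show i: "integrable lebesgue (%y. K (x - y) * w y)" by (rule L1_bound[OF M])
   (use Km w le in "auto simp: norm_mult intro!: AE_I2 order_trans[OF _ abs_ge_self]")
 show "integrable lebesgue (%y. norm (K (x - y)) * norm (w y))" using integrable_norm[OF i] by (simp add: norm_mult)
 have "norm (LINT y|lebesgue. K (x - y) * w y) <= (LINT y|lebesgue. norm (K (x - y) * w y))" by (rule integral_norm_bound)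
 also have "... <= (LINT y|lebesgue. c * A * (maj p (x - y) * jp y b))"
  by (intro integral_mono integrable_norm i M) (use le in "simp add: norm_mult")
 also have "... = c * A * (LBINT y. maj p (x - y) * jp y b)"
  using borel_measurable_integrable[OF maj] by (simp add: integral_completion)
 finally show "norm (LINT y|lebesgue. K (x - y) * w y) <= c * A * (LBINT y. maj p (x - y) * jp y b)" .
qed

lemma fund_sol_measurable:
 assumes "CARD('n::finite) >= 3" "k > 0"
 shows "(Phi k :: real^'n => complex) : bmeas"
 by (rule borel_measurable_continuous_countable_exceptions[of "{0}"]) (use fund_sol_facts(4)[OF assms] in auto)

lemma re_kernel_measurable:
 assumes "CARD('n::finite) >= 3" "k > 0"
 shows "(RePhi k :: real^'n => real) : bmeas" unfolding RePhi_def using fund_sol_measurable[OF assms] by simp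

lemma fund_sol_bound:
 assumes N: "CARD('n::finite) >= 3" and k: "k > 0"
 shows "EX C>=0. ALL x::real^'n. norm (Phi k x) <= C * (loc_kernel x + jp x ((real CARD('n) - 1) / 2))"
proof -
 let ?sg = "(real CARD('n) - 1) / 2"
 obtain C1 where C1: "C1 >= 0" "!!x::real^'n. abs (RePhi k x) <= C1 * maj ?sg x" using fund_sol_facts(2)[OF N k] by blast
 obtain C2 where C2: "C2 >= 0" "!!x::real^'n. abs (ImPhi k x) <= C2 * jp x ?sg" using im_kernel_bounds[OF N k] by blast
 show ?thesis
 proof (intro exI[of _ "C1 + C2"] conjI allI)
  fix x :: "real^'n"
  have l: "loc_kernel x >= 0" by (rule loc_kernel_nonneg)
  show "norm (Phi k x) <= (C1 + C2) * maj ?sg x"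
  proof (cases "x = 0")
   case True
   hence "fund_sol k x = 0" using N by (simp add: fund_sol_def Let_def)
   thus ?thesis using C1 C2 l by simp
  next
   case False
   have "norm (Phi k x) <= abs (RePhi k x) + abs (ImPhi k x)"
    unfolding fund_sol_facts(1)[OF N k False] using cmod_le by (metis complex.sel)
   also have "... <= C1 * maj ?sg x + C2 * maj ?sg x"
    using C1(2)[of x] C2(2)[of x] mult_nonneg_nonneg[OF C2(1) l] by (simp add: distrib_left)
   finally show ?thesis by (simp add: algebra_simps)
  qed
 qed (use C1 C2 in auto)
qed

lemma decay_iteration:
 fixes u :: "'a::real_normed_vector => 'b::real_normed_vector"
 assumes step: "!!g C. g0 <= g ==> g <= G ==> ALL x. norm (u x) <= C * jp x g ==> EX C. ALL x. norm (u x) <= C * jb x powr (- min G (g + d))"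
  and start: "EX C. ALL x. norm (u x) <= C * jp x g0" and d: "d > 0" "g0 <= G"
 shows "EX C. ALL x. norm (u x) <= C * jp x G"
proof -
 have "EX C. ALL x. norm (u x) <= C * jb x powr (- min G (g0 + real n * d))" for n
 proof (induction n)
  case 0 thus ?case using start d by (simp add: min_def)
 next
  case (Suc n)
  then obtain C where C: "ALL x. norm (u x) <= C * jb x powr (- min G (g0 + real n * d))" by blast
  have "EX C. ALL x. norm (u x) <= C * jb x powr (- min G (min G (g0 + real n * d) + d))"
   by (rule step[OF _ _ C]) (use d in auto)
  moreover have "min G (min G (g0 + real n * d) + d) = min G (g0 + real (Suc n) * d)"
   using d by (auto simp: min_def algebra_simps)
  ultimately show ?case by simp
 qed
 moreover obtain n where "(G - g0) / d <= real n" using real_arch_simple by blast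
 hence "min G (g0 + real n * d) = G" using d by (simp add: min_def divide_le_eq)
 ultimately show ?thesis by metis
qed

text \<open>Each use of the equation improves the decay by half the excess of the exponent of
  \<open>a\<close> over (N+1)/2, until the decay (N-1)/2 of the kernel itself is reached. Spending
  only half of the excess keeps the convolution integrals strictly convergent.\<close>

lemma resolvent_solution_decay:
 fixes a :: "real^'n::finite => real" and u :: "real^'n => complex"
 assumes N: "CARD('n) >= 3" and k: "k > 0" and aa: "aa > (real CARD('n) + 1) / 2"
  and a: "a : Lmeas" "!!x. abs (a x) <= Ca * jp x aa" and u: "u : Lmeas" "!!x. norm (u x) <= U"
  and eq: "!!x. u x = (LINT y|lebesgue. Phi k (x - y) * (cor (a y) * u y))"
 shows "EX C. ALL x. norm (u x) <= C * jp x ((real CARD('n) - 1) / 2)"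
proof (rule decay_iteration[where ?g0.0 = 0 and d = "(aa - (real CARD('n) + 1) / 2) / 2"])
 let ?sg = "(real CARD('n) - 1) / 2" and ?d = "(aa - (real CARD('n) + 1) / 2) / 2"
 show "EX C. ALL x. norm (u x) <= C * jp x 0" using u by auto
 show "?d > 0" "0 <= ?sg" using aa N by auto
 fix g C assume g: "0 <= g" "g <= ?sg" and C: "ALL x. norm (u x) <= C * jp x g"
 define g' where "g' = min ?sg (g + ?d)"
 have g': "0 <= g'" "g' <= ?sg" "g' <= aa + g" "?sg + (aa + g) - g' > real DIM(real^'n)"
  using g aa N by (auto simp: g'_def min_def field_simps)
 obtain D where D: "!!x::real^'n. intble (%y. maj ?sg (x - y) * jp y (aa + g))"
   "!!x::real^'n. (LBINT y. maj ?sg (x - y) * jp y (aa + g)) <= D * jp x g'" using kernel_conv_decay[OF _ g'] N by auto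
 obtain c where c: "c >= 0" "!!x::real^'n. norm (Phi k x) <= c * maj ?sg x" using fund_sol_bound[OF N k] by blast
 have Ca: "Ca >= 0" by (rule bnd0[OF a(2)[of 0]])
 have w: "norm (cor (a y) * u y) <= (Ca * C) * jp y (aa + g)" for y
 proof -
  have "norm (cor (a y) * u y) <= (Ca * jp y aa) * (C * jp y g)"
   unfolding norm_mult norm_of_real using a(2) C Ca by (intro mult_mono) auto
  also have "... = (Ca * C) * (jp y aa * jp y g)" by (simp add: mult_ac)
  also have "jp y aa * jp y g = jp y (aa + g)" by (simp add: powr_add[symmetric])
  finally show ?thesis .
 qed
 have C0: "C >= 0" by (rule nbnd0[OF C[rule_format, of 0]])
 show "EX C. ALL x. norm (u x) <= C * jb x powr (- min ?sg (g + ?d))"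
 proof (intro exI[of _ "c * (Ca * C) * D"] allI)
  fix x
  have "norm (u x) <= c * (Ca * C) * (LBINT y. maj ?sg (x - y) * jp y (aa + g))" unfolding eq[of x]
   by (rule conv_bound(2)[OF D(1) fund_sol_measurable[OF N k] c(2) _ w]) (use a u in "auto intro!: borel_measurable_times")
  also have "... <= c * (Ca * C) * (D * jp x g')" using c Ca C0 by (intro mult_left_mono D) auto
  finally show "norm (u x) <= c * (Ca * C) * D * jb x powr (- min ?sg (g + ?d))" by (simp add: g'_def mult.assoc)
 qed
qed

text \<open>For fixed x the radial derivative of the kernel at x - y is not a directional derivative
  of the convolution, but the derivative along \<open>sgn x\<close> is. The quantity estimated here
  is the defect between the two directions, small when y is small compared with x.\<close>

lemma norm_minus_inner_sgn:
 "norm (x - y) - (x - y) *. sgn x >= 0" "norm (x - y) - (x - y) *. sgn x <= 2 * norm y" "norm (x - y) - (x - y) *. sgn x <= 2 * norm (x - y)"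
 for x y :: "'a::euclidean_space"
proof -
 note c = inner_sgn_le[of "x - y" x]
 show "norm (x - y) - (x - y) *. sgn x >= 0" "norm (x - y) - (x - y) *. sgn x <= 2 * norm (x - y)" using c by linarith+
 have "x *. sgn x = norm x" by (cases "x = 0") (simp_all add: sgn_div_norm dot_square_norm power2_eq_square)
 hence "(x - y) *. sgn x = norm x - y *. sgn x" by (simp add: inner_diff_left)
 thus "norm (x - y) - (x - y) *. sgn x <= 2 * norm y" using norm_triangle_ineq4[of x y] inner_sgn_le[of y x] by linarith
qed

text \<open>Subtracting multiples of the two vanishing convolutions (with the imaginary part of the
  fundamental solution and with its gradient) replaces the kernel by one that decays faster.\<close>

lemma improved_kernel:
 fixes k te :: real
 assumes N: "CARD('n::finite) >= 3" and k: "k > 0" and te: "0 <= te" "te <= 1"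
 shows "EX A B C. 0 <= C & (ALL x y::real^'n. x ~= y -->
   abs (RePhi k (x - y) - A * ImPhi k (x - y) - B * (im_slope k (x - y) * ((x - y) *. sgn x)))
   <= C * (loc_kernel (x - y) + jp (x - y) ((real CARD('n) - 1) / 2 + te)) * jb y powr te)"
proof -
 let ?sg = "(real CARD('n) - 1) / 2"
 obtain A B C where C: "0 <= C" "!!x::real^'n. x ~= 0 ==> abs (RePhi k x - A * ImPhi k x - B * (im_slope k x * norm x))
      <= C * (loc_kernel x + jp x ((real CARD('n) + 1) / 2))"
  using fund_sol_facts(3)[OF N k] by blast
 obtain C2 where C2: "C2 >= 0" "!!x::real^'n. abs (im_slope k x) * norm x <= C2 * jp x ?sg"
  using im_kernel_bounds[OF N k] by blast
 show ?thesis
 proof (rule exI[of _ A], rule exI[of _ B], rule exI[of _ "C + abs B * (8 * C2)"], intro conjI allI impI)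
  show "0 <= C + abs B * (8 * C2)" using C C2 by simp
  fix x y :: "real^'n" assume xy: "x ~= y"
  define z where "z = x - y"
  define q where "q = norm z - z *. sgn x"
  have q: "q >= 0" "q <= 2 * norm y" "q <= 2 * norm z" using norm_minus_inner_sgn[of x y] by (auto simp: q_def z_def)
  have l: "loc_kernel z >= 0" by (rule loc_kernel_nonneg)
  have jy: "jb y powr te >= 1" using jb_ge_1[of y] te by (simp add: ge_one_powr_ge_zero)
  have "jp z ((real CARD('n) + 1) / 2) <= jp z (?sg + te)" by (rule jb_powr_antimono) (use te in "simp add: field_simps")
  hence "C * (loc_kernel z + jp z ((real CARD('n) + 1) / 2)) <= C * maj (?sg + te) z"
   using C(1) by (intro mult_left_mono) auto
  also have "... <= C * maj (?sg + te) z * jb y powr te"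
  proof -
   have "0 <= C * maj (?sg + te) z" using l C(1) by simp
   from mult_left_mono[OF jy this] show ?thesis by (simp only: mult_1_right)
  qed
  finally have 1: "abs (RePhi k z - A * ImPhi k z - B * (im_slope k z * norm z)) <= C * maj (?sg + te) z * jb y powr te"
   using C(2)[of z] xy by (simp add: z_def)
  have 2: "abs (im_slope k z * q) <= (8 * C2) * (jp z (?sg + te) * jb y powr te)"
  proof -
   \<comment> \<open>The bounds 2|z| and 2|y| for the defect q combine to 2|z| t. Since t <= 1, it
     is at most t^te, so te orders of decay in x - y are gained and paid for by a growth of order te
     in y.\<close>
   define t where "t = min 1 (4 * (jb y / jb z))"
   have qt: "q <= 2 * norm z * t"
   proof (cases "4 * (jb y / jb z) >= 1")
    case True thus ?thesis using q by (simp add: t_def)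
   next
    case False
    hence f: "4 * jb y < jb z" using jb_pos[of z] by (simp add: field_simps)
    hence "norm z >= 1" using jb_le[of z] jb_ge_1[of y] by linarith
    hence "jb z <= 2 * norm z" by (rule jb_le_norm)
    have "q <= 2 * jb y" using q(2) norm_le_jb[of y] by linarith
    also have "... <= 4 * (jb y / jb z) * (2 * norm z)"
    proof -
     have "2 * jb y * jb z <= 2 * jb y * (2 * norm z)" using `jb z <= 2 * norm z` jb_pos[of y] by (intro mult_left_mono) auto
     also have "... <= 4 * jb y * (2 * norm z)" using jb_pos[of y] by (intro mult_right_mono) auto
     finally show ?thesis using jb_pos[of z] by (simp add: field_simps)
    qed
    finally show ?thesis using False by (simp add: t_def mult_ac)
   qed
   have tt: "t <= 4 * (jb y powr te * jp z te)"
   proof -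
    have t0: "0 < t" "t <= 1" using jb_pos[of y] jb_pos[of z] by (auto simp: t_def)
    have "t = t powr 1" using t0 by simp
    also have "... <= t powr te" using t0 te by (intro powr_mono') auto
    also have "... <= (4 * (jb y / jb z)) powr te" using t0 te by (intro powr_mono2) (auto simp: t_def)
    also have "... = 4 powr te * (jb y powr te / jb z powr te)" by (simp only: powr_mult powr_divide)
    also have "... <= 4 powr 1 * (jb y powr te / jb z powr te)" using te by (intro mult_right_mono powr_mono) auto
    finally show ?thesis by (simp add: powr_minus divide_inverse)
   qed
   have "abs (im_slope k z * q) = abs (im_slope k z) * q" using q(1) by (simp add: abs_mult)
   also have "... <= abs (im_slope k z) * (2 * norm z * t)" by (intro mult_left_mono qt) auto
   also have "... = 2 * (abs (im_slope k z) * norm z) * t" by simp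
   also have "... <= 2 * (C2 * jp z ?sg) * (4 * (jb y powr te * jp z te))"
   proof (rule mult_mono[OF _ tt])
    show "2 * (abs (im_slope k z) * norm z) <= 2 * (C2 * jp z ?sg)" using C2(2)[of z] by simp
    show "0 <= 2 * (C2 * jp z ?sg)" using C2(1) by simp
    show "0 <= t" using jb_pos[of y] jb_pos[of z] by (simp add: t_def)
   qed
   also have "... = (8 * C2) * ((jp z ?sg * jp z te) * jb y powr te)" by simp
   also have "jp z ?sg * jp z te = jp z (?sg + te)" by (simp add: powr_add[symmetric])
   finally show ?thesis .
  qed
  have "RePhi k z - A * ImPhi k z - B * (im_slope k z * (z *. sgn x))
    = (RePhi k z - A * ImPhi k z - B * (im_slope k z * norm z)) + B * (im_slope k z * q)"
   by (simp add: q_def algebra_simps)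
  moreover have "abs (B * (im_slope k z * q)) <= abs B * ((8 * C2) * (jp z (?sg + te) * jb y powr te))"
   using 2 unfolding abs_mult[of B] by (intro mult_left_mono) auto
  moreover have "abs B * ((8 * C2) * (jp z (?sg + te) * jb y powr te)) <= abs B * (8 * C2) * maj (?sg + te) z * jb y powr te"
  proof -
   have "(abs B * (8 * C2) * jb y powr te) * jp z (?sg + te) <= (abs B * (8 * C2) * jb y powr te) * maj (?sg + te) z"
    using l C2 by (intro mult_left_mono) auto
   thus ?thesis by (simp add: mult_ac)
  qed
  ultimately have "abs (RePhi k z - A * ImPhi k z - B * (im_slope k z * (z *. sgn x)))
    <= C * maj (?sg + te) z * jb y powr te + abs B * (8 * C2) * maj (?sg + te) z * jb y powr te"
   using 1 by linarith
  also have "... = (C + abs B * (8 * C2)) * maj (?sg + te) z * jb y powr te" by (simp add: algebra_simps)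
  finally show "abs (RePhi k (x - y) - A * ImPhi k (x - y) - B * (im_slope k (x - y) * ((x - y) *. sgn x)))
   <= (C + abs B * (8 * C2)) * maj (?sg + te) (x - y) * jb y powr te" by (simp add: z_def)
 qed
qed

text \<open>The vanishing convolution is differentiated in the direction e. In the decay estimate e
  will be the direction of the very point x at which the integral is taken, held fixed during
  differentiation.\<close>

lemma slope_conv_zero:
 fixes w :: "real^'n::finite => real"
 assumes N: "CARD('n) >= 3" and k: "k > 0" and w: "intble w" and z: "!!x. (Im_conv k w x) = 0"
 shows "intble (%y. im_slope k (x - y) * ((x - y) *. e) * w y)" "(LBINT y. im_slope k (x - y) * ((x - y) *. e) * w y) = 0"
proof -
 obtain C where C: "C >= 0" "!!x::real^'n. abs (ImPhi k x) <= C * jp x ((real CARD('n) - 1) / 2)"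
   "!!x::real^'n. abs (im_slope k x) * norm x <= C * jp x ((real CARD('n) - 1) / 2)" using im_kernel_bounds[OF N k] by blast
 have j1: "jp x ((real CARD('n) - 1) / 2) <= 1" for x :: "real^'n"
  using jb_powr_antimono[of 0 "(real CARD('n) - 1) / 2" x] N by simp
 have C': "abs (ImPhi k x) <= C" "abs (im_slope k x) * norm x <= C" for x :: "real^'n"
  using C(2)[of x] C(3)[of x] mult_left_mono[OF j1[of x] C(1)] by linarith+
 have [measurable]: "w : bmeas" using w by auto
 have km: "(ImPhi k :: real^'n => real) : bmeas" by (intro borel_measurable_continuous_onI continuous_im_kernel)
 have [measurable]: "(%y. ImPhi k (v - y)) : bmeas" for v :: "real^'n"
  using measurable_compose[of "%y. v - y" borel borel "ImPhi k" borel, OF _ km] by simp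
 define f where "f t y = ImPhi k ((x - y) + t *R e) * w y" for t y
 define f' where "f' t y = im_slope k ((x - y) + t *R e) * (((x - y) + t *R e) *. e) * w y" for t y
 have d: "DERIV (%t. f t y) t :> f' t y" for t y unfolding f_def f'_def by (rule DERIV_cmult_right[OF im_kernel_DERIV])
 have f'b: "abs (f' t y) <= C * norm e * abs (w y)" for t y
 proof -
  define v where "v = (x - y) + t *R e"
  have "abs (im_slope k v * (v *. e)) <= abs (im_slope k v) * (norm v * norm e)"
   unfolding abs_mult by (intro mult_left_mono Cauchy_Schwarz_ineq2) auto
  also have "... <= C * norm e" using mult_right_mono[OF C'(2)[of v], of "norm e"] by (simp add: mult.assoc)
  finally show ?thesis unfolding f'_def v_def[symmetric] abs_mult[of "_ * _" "w y"] by (intro mult_right_mono) auto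
 qed
 have h: "intble (%y. C * norm e * abs (w y))" using w by simp
 have fe: "f t y = ImPhi k ((x + t *R e) - y) * w y" for t y by (simp add: f_def algebra_simps)
 have fm: "f t : lmeas" for t unfolding fe[abs_def] by measurable
 have f0: "intble (f 0)" by (rule L1_bound[of _ "%y. C * abs (w y)"])
   (use w fm C' C(1) in "auto simp: f_def abs_mult intro!: AE_I2 mult_right_mono")
 have "DERIV (%t. LBINT y. f t y) 0 :> (LBINT y. f' 0 y)" by (rule DERIV_integral(1)[OF d f'b h f0 fm])
 moreover have "(%t. LBINT y. f t y) = (%t. 0)" unfolding fe[abs_def] using z by simp
 ultimately have "(LBINT y. f' 0 y) = 0" using DERIV_unique[OF _ DERIV_const] by simp
 moreover have "intble (f' 0)" by (rule DERIV_integral(2)[OF d f'b h f0 fm])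
 moreover have "f' 0 = (%y. im_slope k (x - y) * ((x - y) *. e) * w y)" by (simp add: f'_def fun_eq_iff)
 ultimately show "intble (%y. im_slope k (x - y) * ((x - y) *. e) * w y)" "(LBINT y. im_slope k (x - y) * ((x - y) *. e) * w y) = 0"
  by simp_all
qed

text \<open>The exponent b > N makes the densities integrable. The convolutions are bounded, so the
  pairings converge, and Fubini's theorem with the evenness of \<open>RePhi\<close> makes the
  pairing with the real part symmetric.\<close>

lemma resolvent_real_parts:
 fixes w1 w2 :: "real^'n::finite => real"
 assumes N: "CARD('n) >= 3" and k: "k > 0" and b: "b > real CARD('n)" and w: "w1 : bmeas" "w2 : bmeas"
  and wb: "!!y. abs (w1 y) <= A * jp y b" "!!y. abs (w2 y) <= A * jp y b"
 shows "(LINT y|lebesgue. Phi k (x - y) * Complex (w1 y) (w2 y))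
   = Complex ((Re_conv k w1 x) - (Im_conv k w2 x)) ((Re_conv k w2 x) + (Im_conv k w1 x))"
  and "intble (%y. RePhi k (x - y) * w1 y)"
  and "intble (%y. ImPhi k (x - y) * w1 y)"
  and "intble w1"
  and "(LBINT x. w1 x * (Re_conv k w2 x)) = (LBINT x. w2 x * (Re_conv k w1 x))"
  and "intble (%x. w1 x * (Re_conv k w2 x))"
  and "intble (%x. w1 x * (Im_conv k w2 x))"
proof -
 let ?sg = "(real CARD('n) - 1) / 2"
 obtain D where D0: "D >= 0" and D: "!!x::real^'n. intble (%y. maj ?sg (x - y) * jp y b)"
   "!!x::real^'n. (LBINT y. maj ?sg (x - y) * jp y b) <= D * jp x 0"
 proof -
  have N3: "real CARD('n) >= 3" using N by simp
  have "?sg + b - 0 > real CARD('n)" "0 <= ?sg" "0 <= b" using N3 b by argo+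
  thus ?thesis using kernel_conv_decay[where 'a = "real^'n" and g = 0 and p = ?sg and b = b] N that by auto
 qed
 obtain C1 where C1: "C1 >= 0" "!!x::real^'n. abs (RePhi k x) <= C1 * maj ?sg x" using fund_sol_facts(2)[OF N k] by blast
 obtain C2 where C2: "C2 >= 0" "!!x::real^'n. abs (ImPhi k x) <= C2 * jp x ?sg" using im_kernel_bounds[OF N k] by blast
 have C2': "abs (ImPhi k x) <= C2 * maj ?sg x" for x :: "real^'n"
  using C2(2)[of x] mult_nonneg_nonneg[OF C2(1) loc_kernel_nonneg[of x]] by (simp add: distrib_left)
 have A0: "A >= 0" by (rule bnd0[OF wb(1)[of 0]])
 have Pm: "(RePhi k :: real^'n => real) : bmeas" by (rule re_kernel_measurable[OF N k])
 have Qm: "(ImPhi k :: real^'n => real) : bmeas" by (intro borel_measurable_continuous_onI continuous_im_kernel)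
 have shift: "(%y. K (v - y)) : bmeas" if "K : bmeas" for K :: "real^'n => real" and v
  using measurable_compose[of "%y. v - y" borel borel K borel, OF _ that] by simp
 have leb: "h : Lmeas" if "h : bmeas" for h :: "real^'n => real" by (rule measurable_completion) (use that in simp)
 have conv: "intble (%y. K (v - y) * h y)" "(LINT y|lebesgue. K (v - y) * h y) = (LBINT y. K (v - y) * h y)"
   "integrable lebesgue (%y. K (v - y) * h y)" "abs (LBINT y. K (v - y) * h y) <= c * A * D"
   "intble (%y. abs (K (v - y)) * abs (h y))" "(LBINT y. abs (K (v - y)) * abs (h y)) <= c * A * D"
  if K: "K : bmeas" "!!z. abs (K z) <= c * maj ?sg z" "c >= 0"
   and h: "h : bmeas" "!!y. abs (h y) <= A * jp y b" for K h :: "real^'n => real" and c v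
 proof -
  have m: "(%y. K (v - y) * h y) : bmeas" using shift[OF K(1)] h(1) by simp
  have m': "(%y. abs (K (v - y)) * abs (h y)) : bmeas" using shift[OF K(1)] h(1) by simp
  note cb = conv_bound[OF D(1), of K c h A v, unfolded real_norm_def, OF K(1,2) leb[OF h(1)] h(2)]
  have cb': "integrable lebesgue (%y. abs (K (v - y)) * abs (h y))"
   "norm (LINT y|lebesgue. abs (K (v - y)) * abs (h y)) <= c * A * (LBINT y. maj ?sg (v - y) * jp y b)"
   using conv_bound(1,2)[OF D(1), of "%z. abs (K z)" c "%y. abs (h y)" A v] K h leb[OF h(1)] by auto
  show "integrable lebesgue (%y. K (v - y) * h y)" by (rule cb(1))
  thus "intble (%y. K (v - y) * h y)" using m by (simp add: integrable_completion)
  show e: "(LINT y|lebesgue. K (v - y) * h y) = (LBINT y. K (v - y) * h y)" using m by (simp add: integral_completion)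
  have cA: "0 <= c * A" using K(3) A0 by simp
  have b: "c * A * (LBINT y. maj ?sg (v - y) * jp y b) <= c * A * D" using mult_left_mono[OF D(2)[of v] cA] by simp
  show "abs (LBINT y. K (v - y) * h y) <= c * A * D" using order_trans[OF cb(2) b] unfolding e .
  show "intble (%y. abs (K (v - y)) * abs (h y))" using cb'(1) m' by (simp add: integrable_completion)
  have "(LINT y|lebesgue. abs (K (v - y)) * abs (h y)) = (LBINT y. abs (K (v - y)) * abs (h y))" using m' by (simp add: integral_completion)
  thus "(LBINT y. abs (K (v - y)) * abs (h y)) <= c * A * D"
   using order_trans[OF abs_ge_self order_trans[OF cb'(2)[unfolded real_norm_def] b]] by simp
 qed
 note P1 = conv[OF Pm C1(2,1) w(1) wb(1)] and P2 = conv[OF Pm C1(2,1) w(2) wb(2)]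
 note Q1 = conv[OF Qm C2' C2(1) w(1) wb(1)] and Q2 = conv[OF Qm C2' C2(1) w(2) wb(2)]
 show "intble (%y. RePhi k (x - y) * w1 y)" by (rule P1)
 show "intble (%y. ImPhi k (x - y) * w1 y)" by (rule Q1)
 have jbi: "intble (%y::real^'n. A * jp y b)" using b by (intro integrable_mult_right integrable_jb_powr) simp
 have wi: "intble w1" "intble w2"
  by (rule L1_bound[OF jbi]; use w wb A0 in "auto intro!: AE_I2 order_trans[OF _ abs_ge_self]")+
 show "intble w1" by (rule wi)
 have cplx: "cor r * \<i> = Complex 0 r" "cor r = Complex r 0" for r by (auto simp: complex_eq_iff)
 show "(LINT y|lebesgue. Phi k (x - y) * Complex (w1 y) (w2 y))
   = Complex ((Re_conv k w1 x) - (Im_conv k w2 x)) ((Re_conv k w2 x) + (Im_conv k w1 x))"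
 proof -
  have lm: "(%y. RePhi k (x - y)) : Lmeas" "(%y. ImPhi k (x - y)) : Lmeas"
   "w1 : Lmeas" "w2 : Lmeas" using shift[OF Pm] shift[OF Qm] w by (auto intro: leb)
  have "(%y. Phi k (x - y)) : bmeas"
   using measurable_compose[of "%y. x - y" borel borel "fund_sol k" borel, OF _ fund_sol_measurable[OF N k]] by simp
  hence fm: "(%y. Phi k (x - y)) : Lmeas" by (intro measurable_completion) simp
  have ae: "AE y in lebesgue. y ~= x" using AE_completion[OF AE_lborel_singleton[of x]] .
  have "(LINT y|lebesgue. Phi k (x - y) * Complex (w1 y) (w2 y))
    = (LINT y|lebesgue. cor (RePhi k (x - y) * w1 y - ImPhi k (x - y) * w2 y) + cor (RePhi k (x - y) * w2 y + ImPhi k (x - y) * w1 y) * \<i>)"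
  proof (rule integral_cong_AE)
   show "AE y in lebesgue. Phi k (x - y) * Complex (w1 y) (w2 y) = cor (RePhi k (x - y) * w1 y - ImPhi k (x - y) * w2 y) + cor (RePhi k (x - y) * w2 y + ImPhi k (x - y) * w1 y) * \<i>"
    using ae
   proof eventually_elim
    case (elim y)
    hence "fund_sol k (x - y) = Complex (RePhi k (x - y)) (ImPhi k (x - y))" using fund_sol_facts(1)[OF N k, of "x - y"] by simp
    thus ?case by (simp add: complex_eq_iff)
   qed
   show "(%y. Phi k (x - y) * Complex (w1 y) (w2 y)) : Lmeas" unfolding Complex_eq using fm lm by simp
   show "(%y. cor (RePhi k (x - y) * w1 y - ImPhi k (x - y) * w2 y) + cor (RePhi k (x - y) * w2 y + ImPhi k (x - y) * w1 y) * \<i>) : Lmeas"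
    using lm by simp
  qed
  also have "... = cor (LINT y|lebesgue. RePhi k (x - y) * w1 y - ImPhi k (x - y) * w2 y) + cor (LINT y|lebesgue. RePhi k (x - y) * w2 y + ImPhi k (x - y) * w1 y) * \<i>"
   using P1(3) P2(3) Q1(3) Q2(3) by (subst Lint_add) (auto simp del: of_real_add of_real_diff of_real_mult)
  also have "... = cor ((Re_conv k w1 x) - (Im_conv k w2 x)) + cor ((Re_conv k w2 x) + (Im_conv k w1 x)) * \<i>"
   using P1(3) P2(3) Q1(3) Q2(3) by (simp only: Lint_add Lint_diff P1(2) P2(2) Q1(2) Q2(2))
  finally show ?thesis by (simp only: complex_eq_iff) simp
 qed
 have [measurable]: "w1 : bmeas" "w2 : bmeas" by (fact w)+
 have Km: "(%x. LBINT y. K (x - y) * h y) : bmeas"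
  if K: "K : bmeas" and [measurable]: "h : bmeas" for K h :: "real^'n => real"
 proof -
  have [measurable]: "(%(x, y). K (x - y)) : borel_measurable (borel \<Otimes>\<^sub>M borel)"
   using measurable_compose[of "%p. fst p - snd p" "borel \<Otimes>\<^sub>M borel" borel K borel, OF _ K] by (simp add: case_prod_unfold)
  show ?thesis by measurable
 qed
 have bi: "intble (%x. w1 x * h x)" if "h : bmeas" "!!x. abs (h x) <= c" for h c
 proof (rule L1_bound)
  show "intble (%x. abs (w1 x) * c)" using wi by simp
  show "AE x in lborel. norm (w1 x * h x) <= norm (abs (w1 x) * c)"
  proof (rule AE_I2)
   fix x
   have "abs (w1 x) * abs (h x) <= abs (w1 x) * c" by (intro mult_left_mono that) auto
   also have "... <= norm (abs (w1 x) * c)" by simp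
   finally show "norm (w1 x * h x) <= norm (abs (w1 x) * c)" by (simp only: real_norm_def abs_mult)
  qed
 qed (use that in simp)
 show "intble (%x. w1 x * (Re_conv k w2 x))" by (rule bi[OF Km[OF Pm w(2)] P2(4)])
 show "intble (%x. w1 x * (Im_conv k w2 x))" by (rule bi[OF Km[OF Qm w(2)] Q2(4)])
 show "(LBINT x. w1 x * (Re_conv k w2 x)) = (LBINT x. w2 x * (Re_conv k w1 x))"
 proof -
  let ?f = "%x y. w1 x * (RePhi k (x - y) * w2 y)"
  have [measurable]: "(%(x, y). RePhi k (x - y)) : borel_measurable (borel \<Otimes>\<^sub>M (borel :: (real^'n) measure))"
   using measurable_compose[of "%p. fst p - snd p" "borel \<Otimes>\<^sub>M borel" borel "RePhi k" borel, OF _ Pm] by (simp add: case_prod_unfold)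
  have "integrable (lborel \<Otimes>\<^sub>M lborel) (%(x, y). ?f x y)"
  proof (rule lborel_pair.Fubini_integrable)
   show "(%(x, y). ?f x y) : borel_measurable (lborel \<Otimes>\<^sub>M lborel)" by measurable
   have "intble (%x. w1 x * (LBINT y. abs (RePhi k (x - y)) * abs (w2 y)))"
   proof (rule bi[of _ "C1 * A * D"])
    show "(%x. LBINT y. abs (RePhi k (x - y)) * abs (w2 y)) : bmeas"
     using Km[of "%z. abs (RePhi k z)" "%y. abs (w2 y)"] Pm w by simp
    show "abs (LBINT y. abs (RePhi k (x - y)) * abs (w2 y)) <= C1 * A * D" for x
     using P2(6)[of x] by (subst abs_of_nonneg) (auto intro!: Lint_nonneg)
   qed
   hence "intble (%x. abs (w1 x * (LBINT y. abs (RePhi k (x - y)) * abs (w2 y))))" by (rule integrable_abs)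
   also have "(%x. abs (w1 x * (LBINT y. abs (RePhi k (x - y)) * abs (w2 y)))) = (%x. LBINT y. norm (case (x, y) of (x, y) => ?f x y))"
    by (auto simp: fun_eq_iff abs_mult abs_of_nonneg[OF Lint_nonneg])
   finally show "intble (%x. LBINT y. norm (case (x, y) of (x, y) => ?f x y))" .
   show "AE x in lborel. intble (%y. case (x, y) of (x, y) => ?f x y)" using P2(1) by (intro AE_I2) simp
  qed
  from lborel_pair.Fubini_integral[OF this]
  have 1: "(LBINT x. (LBINT y. ?f x y)) = (LBINT y. (LBINT x. ?f x y))" by simp
  have eq: "?f x y = w2 y * (RePhi k (y - x) * w1 x)" for x y using re_kernel_even[of k "x - y"] by simp
  have "(LBINT x. w1 x * (Re_conv k w2 x)) = (LBINT x. (LBINT y. ?f x y))" by simp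
  also have "... = (LBINT y. (LBINT x. w2 y * (RePhi k (y - x) * w1 x)))" unfolding 1 by (simp only: eq)
  also have "... = (LBINT y. w2 y * (LBINT x. RePhi k (y - x) * w1 x))" by simp
  finally show ?thesis .
 qed
qed

text \<open>Here it matters that \<open>a\<close> is real: for w = a u the expression w1 u2 - w2 u1
  is zero pointwise. In its integral the symmetric pairings with \<open>RePhi\<close> cancel, which
  leaves two nonnegative forms of \<open>ImPhi\<close> with sum zero. Both convolutions with
  \<open>ImPhi\<close> then vanish, each component of u solves the equation with kernel
  \<open>RePhi\<close>, and the improved kernel carries the decay beyond (N-1)/2.\<close>

lemma resolvent_solution_real:
 fixes a :: "real^'n::finite => real" and u :: "real^'n => complex"
 assumes N: "CARD('n) >= 3" and k: "k > 0" and aa: "aa > (real CARD('n) + 1) / 2"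
  and a: "cont a" "!!x. abs (a x) <= Ca * jp x aa" and u: "cont u" "!!x. norm (u x) <= U"
  and eq: "!!x. u x = (LINT y|lebesgue. Phi k (x - y) * (cor (a y) * u y))" and v: "v = (%x. Re (u x)) | v = (%x. Im (u x))"
 shows "!!x. v x = (LBINT y. RePhi k (x - y) * (a y * v y))"
  and "EX C. ALL x. abs (v x) <= C * jp x ((real CARD('n) + 1) / 2)"
proof -
 let ?sg = "(real CARD('n) - 1) / 2"
 have am: "a : bmeas" "u : bmeas" using a u by (auto intro: borel_measurable_continuous_onI)
 have al: "a : Lmeas" "u : Lmeas" using am by (auto intro!: measurable_completion)
 obtain C where C: "!!x. norm (u x) <= C * jp x ?sg"
  using resolvent_solution_decay[OF N k aa al(1) a(2) al(2) u(2) eq] by blast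
 define u1 u2 where "u1 = (%x. Re (u x))" and "u2 = (%x. Im (u x))"
 define w1 w2 where "w1 = (%x. a x * u1 x)" and "w2 = (%x. a x * u2 x)"
 have uc: "cont u1" "cont u2" unfolding u1_def u2_def using u by (auto intro: continuous_intros)
 have um: "u1 : bmeas" "u2 : bmeas" using uc by (auto intro: borel_measurable_continuous_onI)
 have wm: "w1 : bmeas" "w2 : bmeas" unfolding w1_def w2_def using um am by auto
 have Ca: "Ca >= 0" by (rule bnd0[OF a(2)[of 0]])
 have ab: "abs (a x * h x) <= (Ca * C') * jp x (aa + g)" if "abs (h x) <= C' * jp x g" for h :: "real^'n => real" and x g C'
 proof -
  have "abs (a x * h x) <= (Ca * jp x aa) * (C' * jp x g)" unfolding abs_mult
   using that a(2)[of x] Ca by (intro mult_mono) auto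
  also have "... = (Ca * C') * (jp x aa * jp x g)" by (simp add: mult_ac)
  also have "jp x aa * jp x g = jp x (aa + g)" by (simp add: powr_add[symmetric])
  finally show ?thesis .
 qed
 have ub: "abs (u1 x) <= C * jp x ?sg" "abs (u2 x) <= C * jp x ?sg" for x
  using C[of x] abs_Re_le_cmod[of "u x"] abs_Im_le_cmod[of "u x"] by (auto simp: u1_def u2_def)
 have wb: "abs (w1 x) <= (Ca * C) * jp x (aa + ?sg)" "abs (w2 x) <= (Ca * C) * jp x (aa + ?sg)" for x
  unfolding w1_def w2_def by (intro ab ub)+
 have b: "aa + ?sg > real CARD('n)" using aa by (simp add: field_simps)
 note R = resolvent_real_parts[OF N k b wm wb]
 note R' = resolvent_real_parts[OF N k b wm(2) wm(1) wb(2) wb(1)]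
 note R1 = resolvent_real_parts[OF N k b wm(1) wm(1) wb(1) wb(1)]
 note R2 = resolvent_real_parts[OF N k b wm(2) wm(2) wb(2) wb(2)]
 have "cor (a y) * u y = Complex (w1 y) (w2 y)" for y by (simp add: complex_eq_iff w1_def w2_def u1_def u2_def)
 hence ux: "u x = Complex ((Re_conv k w1 x) - (Im_conv k w2 x))
     ((Re_conv k w2 x) + (Im_conv k w1 x))" for x
  using eq[of x] R(1)[of x] by simp
 have ue: "u1 x = (Re_conv k w1 x) - (Im_conv k w2 x)"
  "u2 x = (Re_conv k w2 x) + (Im_conv k w1 x)" for x unfolding u1_def u2_def by (simp_all only: ux complex.sel)
 have "w1 x * u2 x - w2 x * u1 x = 0" for x by (simp add: w1_def w2_def)
 hence "(LBINT x. w1 x * u2 x - w2 x * u1 x) = 0" by simp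
 moreover have "w1 x * u2 x - w2 x * u1 x = (w1 x * (Re_conv k w2 x) + w1 x * (Im_conv k w1 x))
   - (w2 x * (Re_conv k w1 x) - w2 x * (Im_conv k w2 x))" for x
  unfolding ue by (simp only: distrib_left right_diff_distrib)
 ultimately have "(LBINT x. (w1 x * (Re_conv k w2 x) + w1 x * (Im_conv k w1 x))
   - (w2 x * (Re_conv k w1 x) - w2 x * (Im_conv k w2 x))) = 0" by simp
 hence form: "(LBINT x. w1 x * (Im_conv k w1 x)) + (LBINT x. w2 x * (Im_conv k w2 x)) = 0"
  using R(5,6) R'(6) R1(7) R2(7) by simp
 note Q0 = im_kernel_conv_zero[OF N k R(4) R'(4) form]
 define w where "w = (%x. a x * v x)"
 have vw: "(v = u1 & w = w1) | (v = u2 & w = w2)" using v unfolding w_def w1_def w2_def u1_def u2_def by auto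
 have ve: "v x = (Re_conv k w x)" for x using vw ue[of x] Q0[of x] by auto
 thus "v x = (LBINT y. RePhi k (x - y) * (a y * v y))" for x unfolding w_def .
 have wi: "intble w" using vw R(4) R'(4) by metis
 have Pi: "intble (%y. RePhi k (x - y) * w y)" and Qi: "intble (%y. ImPhi k (x - y) * w y)" for x
  using vw R(2,3)[of x] R'(2,3)[of x] by metis+
 have Qz: "(Im_conv k w x) = 0" for x using vw Q0[of x] by metis
 note S = slope_conv_zero[OF N k wi Qz]
 show "EX C. ALL x. abs (v x) <= C * jp x ((real CARD('n) + 1) / 2)" unfolding real_norm_def[symmetric]
 proof (rule decay_iteration[where ?g0.0 = ?sg and d = "(aa - (real CARD('n) + 1) / 2) / 2"])
  let ?d = "(aa - (real CARD('n) + 1) / 2) / 2" and ?G = "(real CARD('n) + 1) / 2"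
  show "EX C. ALL x. norm (v x) <= C * jp x ?sg" using vw ub unfolding real_norm_def by metis
  show "?d > 0" "?sg <= ?G" using aa N by auto
  fix g C assume g: "?sg <= g" "g <= ?G" and C: "ALL x. norm (v x) <= C * jp x g"
  define g' where "g' = min ?G (g + ?d)"
  \<comment> \<open>The part of the target decay that exceeds the decay of Phi_k. The improved
    kernel supplies it, and the density, of decay aa + g, gives up te orders in return.\<close>
  define te where "te = g' - ?sg"
  have N': "real CARD('n) >= 3" using N by simp
  have th: "0 <= te" "te <= 1"
  proof -
   have "g' <= ?G" unfolding g'_def by (rule min.cobounded1)
   thus "te <= 1" unfolding te_def by argo
   have "?sg <= g'" unfolding g'_def by (rule min.boundedI) (use g aa in argo)+
   thus "0 <= te" unfolding te_def by argo
  qed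
  have g': "0 <= g'" "g' <= ?sg + te" "g' <= aa + g - te" "(?sg + te) + (aa + g - te) - g' > real DIM(real^'n)"
  proof -
   have g1: "g' <= ?G" "g' <= g + ?d" unfolding g'_def by (rule min.cobounded1, rule min.cobounded2)
   show "0 <= g'" using g th N' unfolding te_def by argo
   show "g' <= ?sg + te" by (simp add: te_def)
   show "g' <= aa + g - te" using g1 aa N' unfolding te_def by argo
   have "(?sg + te) + (aa + g - te) - g' > real CARD('n)" using g1 aa by argo
   thus "(?sg + te) + (aa + g - te) - g' > real DIM(real^'n)" by simp
  qed
  obtain D where D: "!!x::real^'n. intble (%y. maj (?sg + te) (x - y) * jp y (aa + g - te))"
   "!!x::real^'n. (LBINT y. maj (?sg + te) (x - y) * jp y (aa + g - te)) <= D * jp x g'"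
   using kernel_conv_decay[OF _ g'] N by auto
  obtain A B E where E: "0 <= E" "!!x y::real^'n. x ~= y ==>
    abs (RePhi k (x - y) - A * ImPhi k (x - y) - B * (im_slope k (x - y) * ((x - y) *. sgn x)))
   <= E * maj (?sg + te) (x - y) * jb y powr te"
   using improved_kernel[OF N k th] by blast
  have C0: "C >= 0" by (rule nbnd0[OF C[rule_format, of 0]])
  have wg: "abs (w y) <= (Ca * C) * jp y (aa + g)" for y unfolding w_def using ab[of v y C g] C by simp
  show "EX C. ALL x. norm (v x) <= C * jb x powr (- min ?G (g + ?d))"
  proof (intro exI[of _ "E * (Ca * C) * D"] allI)
   fix x :: "real^'n"
   let ?K = "%y. RePhi k (x - y) - A * ImPhi k (x - y) - B * (im_slope k (x - y) * ((x - y) *. sgn x))"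
   have Ke: "?K y * w y = RePhi k (x - y) * w y - A * (ImPhi k (x - y) * w y) - B * (im_slope k (x - y) * ((x - y) *. sgn x) * w y)" for y
    by (simp add: algebra_simps)
   have Ki: "intble (%y. ?K y * w y)" unfolding Ke by (intro L1_diff integrable_mult_right Pi Qi S)
   have vx: "v x = (LBINT y. ?K y * w y)"
   proof -
    have "(LBINT y. ?K y * w y) = (Re_conv k w x) - A * (Im_conv k w x)
      - B * (LBINT y. im_slope k (x - y) * ((x - y) *. sgn x) * w y)"
     unfolding Ke by (simp only: Lint_diff L1_diff integrable_mult_right Pi Qi S(1) integral_mult_right_zero)
    thus ?thesis unfolding Qz S(2) ve[of x] by simp
   qed
   have "norm (v x) <= (LBINT y. abs (?K y * w y))" unfolding vx real_norm_def by (rule integral_abs_bound)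
   also have "... <= (LBINT y. E * (Ca * C) * (maj (?sg + te) (x - y) * jp y (aa + g - te)))"
   proof (rule integral_mono_AE)
    show "AE y in lborel. abs (?K y * w y) <= E * (Ca * C) * (maj (?sg + te) (x - y) * jp y (aa + g - te))"
     using AE_lborel_singleton[of x]
    proof eventually_elim
     case (elim y)
     have "abs (?K y * w y) <= (E * maj (?sg + te) (x - y) * jb y powr te) * ((Ca * C) * jp y (aa + g))"
      unfolding abs_mult[of "?K y"]
     proof (rule mult_mono[OF E(2) wg])
      show "x ~= y" using elim by simp
      show "0 <= E * maj (?sg + te) (x - y) * jb y powr te"
       by (intro mult_nonneg_nonneg add_nonneg_nonneg E(1) loc_kernel_nonneg powr_ge_zero)
     qed (rule abs_ge_zero)
     also have "... = E * (Ca * C) * (maj (?sg + te) (x - y) * (jb y powr te * jp y (aa + g)))" by (simp add: mult_ac)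
     also have "jb y powr te * jp y (aa + g) = jp y (aa + g - te)" by (simp add: powr_add[symmetric] algebra_simps)
     finally show ?case .
    qed
   qed (rule integrable_abs[OF Ki], rule integrable_mult_right[OF D(1)])
   also have "... <= E * (Ca * C) * (D * jp x g')" unfolding integral_mult_right_zero by (intro mult_left_mono D mult_nonneg_nonneg E(1) Ca C0)
   finally show "norm (v x) <= E * (Ca * C) * D * jb x powr (- min ?G (g + ?d))" by (simp add: g'_def mult.assoc)
  qed
 qed
qed

section \<open>The virial inequality\<close>

text \<open>Hiding the constant reduces estimates of sums and products to bookkeeping of exponents;
  a negative s allows growth, as for the coordinates.\<close>

definition decays :: "real => ('a::real_normed_vector => real) => bool" where
 "decays s F \<longleftrightarrow> (EX C. ALL x. abs (F x) <= C * jp x s)"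

lemma decaysI: "(!!x. abs (F x) <= C * jp x s) ==> decays s F"
 unfolding decays_def by blast

lemma decaysE:
 assumes "decays s F" obtains C where "C >= 0" "!!x. abs (F x) <= C * jp x s"
proof -
 obtain C where C: "!!x. abs (F x) <= C * jp x s" using assms unfolding decays_def by blast
 moreover have "C >= 0" by (rule bnd0[OF C[of 0]])
 ultimately show thesis by (intro that)
qed

lemma decays_le: "decays s G ==> (!!x. abs (F x) <= abs (G x)) ==> decays s F"
 unfolding decays_def by (meson order_trans)

lemma decays_mono: "decays t F ==> s <= t ==> decays s F"
proof -
 assume "decays t F" and st: "s <= t"
 then obtain C where C: "C >= 0" "!!x. abs (F x) <= C * jp x t" by (elim decaysE) blast
 hence "abs (F x) <= C * jp x s" for x by (intro order_trans[OF C(2) mult_left_mono] jb_powr_antimono st)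
 thus ?thesis by (rule decaysI)
qed

lemma decays_0: "decays 0 F \<longleftrightarrow> (EX B. ALL x. abs (F x) <= B)"
 unfolding decays_def by simp

lemma decays_bounded: "(!!x. abs (F x) <= B) ==> decays 0 F"
 unfolding decays_0 by blast

lemma decays_mult:
 assumes "decays s F" "decays t G" "r <= s + t"
 shows "decays r (%x. F x * G x)"
proof -
 obtain A B where A: "A >= 0" "!!x. abs (F x) <= A * jp x s" and B: "!!x. abs (G x) <= B * jp x t"
  using assms(1,2) by (elim decaysE) blast
 have "abs (F x * G x) <= (A * B) * jp x (s + t)" for x
  unfolding abs_mult minus_add_distrib powr_add using mult_mono[OF A(2) B, of x x] A(1) by (simp add: mult_ac)
 from decaysI[OF this] show ?thesis by (rule decays_mono) fact
qed

lemma decays_cmult: "decays s F ==> decays s (%x. c * F x)"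
 by (rule decays_mult[of 0]) (auto intro: decays_bounded)

lemma decays_add:
 assumes "decays s F" "decays s G" shows "decays s (%x. F x + G x)"
proof -
 obtain A B where "!!x. abs (F x) <= A * jp x s" "!!x. abs (G x) <= B * jp x s" using assms by (elim decaysE) blast
 hence "abs (F x + G x) <= (A + B) * jp x s" for x
  unfolding distrib_right by (rule order_trans[OF abs_triangle_ineq add_mono])
 thus ?thesis by (rule decaysI)
qed

lemma decays_diff: "decays s F ==> decays s G ==> decays s (%x. F x - G x)"
 using decays_add[of s F "%x. -1 * G x"] decays_cmult[of s G "-1"] by simp

lemma decays_sum: "finite I ==> (!!i. i : I ==> decays s (F i)) ==> decays s (%x. SUM i:I. F i x)"
 by (induction I rule: finite_induct) (auto intro: decays_add decaysI[of _ 0])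

lemma decays_inner:
 fixes b :: "'a::euclidean_space"
 assumes "b : Basis" shows "decays (-1) (%x. x *. b)"
proof -
 have "abs (x *. b) <= 1 * jp x (-1)" for x :: 'a using Basis_le_norm[OF assms, of x] norm_le_jb[of x] jb_pos[of x] by simp
 thus ?thesis by (rule decaysI)
qed

lemma decays_integrable:
 fixes F :: "'a::euclidean_space => real"
 assumes "decays s F" and s: "s > real DIM('a)" and m: "F : bmeas"
 shows "intble F"
proof -
 obtain C where "!!x. abs (F x) <= C * jp x s" using assms(1) by (elim decaysE) blast
 thus ?thesis by (intro L1_bound[OF integrable_mult_right[OF integrable_jb_powr[OF s]]])
    (use m in "auto intro: order_trans[OF _ abs_ge_self]")
qed

text \<open>Differentiability along lines, at every point, is the form in which all integrations by
  parts below use derivatives.\<close>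

definition has_pd :: "'a::real_normed_vector => ('a => real) => ('a => real) => bool" where
 "has_pd b g g' \<longleftrightarrow> (ALL x. DERIV (%t. g (x + t *R b)) 0 :> g' x)"

lemma has_pd_at: "has_pd b g g' ==> DERIV (%t. g (x + t *R b)) t :> g' (x + t *R b)"
proof -
 assume "has_pd b g g'"
 hence "DERIV (%s. g ((x + t *R b) + s *R b)) 0 :> g' (x + t *R b)" by (simp add: has_pd_def)
 moreover have "(%s. g ((x + t *R b) + s *R b)) = (%s. g (x + (s + t) *R b))"
  by (simp add: scaleR_add_left add.assoc add.commute[of "t *R b"])
 ultimately show ?thesis using DERIV_shift[of "%s. g (x + s *R b)" "g' (x + t *R b)" 0 t] by simp
qed

lemma has_pd_cong: "has_pd b g g' ==> (!!x. g' x = g'' x) ==> has_pd b g g''"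
 by (simp add: has_pd_def)

lemma has_pd_add: "has_pd b f f' ==> has_pd b g g' ==> has_pd b (%x. f x + g x) (%x. f' x + g' x)"
 by (auto simp: has_pd_def intro: DERIV_add)

lemma has_pd_diff: "has_pd b f f' ==> has_pd b g g' ==> has_pd b (%x. f x - g x) (%x. f' x - g' x)"
 by (auto simp: has_pd_def intro: DERIV_diff)

lemma has_pd_cmult: "has_pd b f f' ==> has_pd b (%x. c * f x) (%x. c * f' x)"
 by (auto simp: has_pd_def intro: DERIV_cmult)

lemma has_pd_mult: "has_pd b f f' ==> has_pd b g g' ==> has_pd b (%x. f x * g x) (%x. f' x * g x + g' x * f x)"
proof -
 assume "has_pd b f f'" "has_pd b g g'"
 thus ?thesis unfolding has_pd_def using DERIV_mult[of "%t. f (_ + t *R b)" _ 0 UNIV "%t. g (_ + t *R b)"] by simp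
qed

lemma has_pd_sum: "(!!i. i : I ==> has_pd b (f i) (f' i)) ==> has_pd b (%x. SUM i:I. f i x) (%x. SUM i:I. f' i x)"
 by (auto simp: has_pd_def intro: DERIV_sum)

lemma has_pd_chain: "has_pd b g g' ==> (!!x. DERIV F (g x) :> F' (g x)) ==> has_pd b (%x. F (g x)) (%x. F' (g x) * g' x)"
 unfolding has_pd_def using DERIV_chain2[of F _ "%t. g (_ + t *R b)" 0] by simp

lemma has_pd_inner: "has_pd b (%x::'a::euclidean_space. x *. c) (%x. b *. c)"
 unfolding has_pd_def inner_add_left inner_scaleR_left by (auto intro!: derivative_eq_intros)

lemma has_pd_square: "has_pd b (%x::'a::euclidean_space. x *. x) (%x. 2 * (x *. b))"
proof -
 have "(x + t *R b) *. (x + t *R b) = x *. x + t * (2 * (x *. b)) + t * t * (b *. b)" for x :: 'a and t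
  by (simp add: inner_add_left inner_add_right inner_commute algebra_simps)
 thus ?thesis unfolding has_pd_def by (auto intro!: derivative_eq_intros)
qed

lemma has_pd_radial:
 "(!!x::'a. DERIV F (x *. x) :> F' (x *. x)) ==> has_pd b (%x::'a::euclidean_space. F (x *. x)) (%x. F' (x *. x) * (2 * (x *. b)))"
 using has_pd_chain[OF has_pd_square, of F F'] by blast

lemma jb_shift_powr:
 fixes b y :: "'a::real_normed_vector"
 assumes "norm b <= 1" "abs t <= 1" "s >= 0"
 shows "jp (y + t *R b) s <= 4 powr s * jp y s"
proof -
 have "norm (t *R b) <= 1" using mult_mono[OF assms(2,1)] by simp
 hence "jb (t *R b) <= 2" using jb_le[of "t *R b"] by simp
 hence "jb (- (t *R b)) <= 2" by (simp add: jb_minus)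
 have "jb y <= 2 * jb (y + t *R b) * jb (- (t *R b))" using jb_peetre[of y "- (t *R b)"] by simp
 also have "... <= 2 * jb (y + t *R b) * 2"
  using `jb (- (t *R b)) <= 2` jb_pos[of "y + t *R b"] by (intro mult_left_mono) auto
 finally have "jb y <= 4 * jb (y + t *R b)" by simp
 hence "(4 * jb (y + t *R b)) powr (-s) <= jp y s" using assms jb_pos[of y] by (intro powr_mono2') auto
 hence "4 powr s * (4 powr (-s) * jp (y + t *R b) s) <= 4 powr s * jp y s" unfolding powr_mult by (intro mult_left_mono) auto
 moreover have "4 powr s * (4 powr (-s) * z) = z" for z :: real
  using powr_add[of 4 s "-s"] by (simp add: mult.assoc[symmetric])
 ultimately show ?thesis by simp
qed

text \<open>The integral of g(x + t b) does not depend on t by translation invariance, and its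
  derivative at t = 0 is the integral of g'.\<close>

lemma integral_pd_zero:
 fixes g g' :: "'a::euclidean_space => real"
 assumes pd: "has_pd b g g'" and b: "norm b <= 1" and g: "intble g" and bd: "decays s g'" and s: "s > real DIM('a)"
 shows "(LBINT x. g' x) = 0" "intble g'"
proof -
 define f f' where "f t y = g (y + t *R b)" and "f' t y = g' (y + t *R b)" for t y
 obtain C where C: "C >= 0" and bd: "!!x. abs (g' x) <= C * jp x s" using bd by (elim decaysE) blast
 define h where "h y = C * (4 powr s * jp y s)" for y :: 'a
 have s0: "s >= 0" using s of_nat_0_le_iff[of "DIM('a)", where 'a=real] by linarith
 have gm: "g : bmeas" using g by auto
 have 1: "DERIV (%t. f t y) t :> f' t y" for t y unfolding f_def f'_def by (rule has_pd_at[OF pd])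
 have 2: "abs (f' t y) <= h y" if "abs t <= 1" for t y
  unfolding f'_def h_def using bd[of "y + t *R b"] mult_left_mono[OF jb_shift_powr[OF b that s0, of y] C] by linarith
 have 3: "intble h" unfolding h_def by (intro integrable_mult_right integrable_jb_powr s)
 have 4: "f t : lmeas" for t
  using measurable_compose[of "%y. y + t *R b" borel borel g borel, OF _ gm] by (simp add: f_def[abs_def])
 have 5: "intble (f 0)" using g by (simp add: f_def[abs_def])
 note D = DERIV_integral[OF 1 2 3 5 4]
 show "intble g'" using D(2) by (simp add: f'_def[abs_def])
 have "(%t. LBINT y. f t y) = (%t. LBINT y. g y)" unfolding f_def using lborel_translate(2)[OF g] by auto
 thus "(LBINT x. g' x) = 0" using D(1) DERIV_unique[OF _ DERIV_const] by (simp add: f'_def)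
qed

section \<open>The divergence theorem for slowly decaying fields and the virial estimate\<close>

lemma cutoff_bounds:
 fixes x b :: "'a::euclidean_space" and e :: real
 assumes e: "0 < e" "e <= 1"
 defines "q == 1 / (1 + e * (x *. x))"
 shows "0 < q" "q <= 1" "q <= (1 / e) * jp x 2" "e * norm x * q^2 <= 1 / jb x"
proof -
 have d: "1 + e * (x *. x) >= 1" using e by simp
 show "0 < q" using d by (simp add: q_def)
 show q1: "q <= 1" using d by (simp add: q_def)
 have j: "(jb x)^2 = 1 + x *. x" by (simp add: jb_square power2_norm_eq_inner)
 have le: "e * (jb x)^2 <= 1 + e * (x *. x)" unfolding j using e by (simp add: distrib_left)
 have ejp: "e * (jb x)^2 > 0" using e jb_pos[of x] by simp
 have "q <= 1 / (e * (jb x)^2)" unfolding q_def by (rule divide_left_mono[OF le]) (use ejp d in auto)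
 also have "... = (1 / e) * jp x 2" using jb_pos[of x] by (simp add: powr_minus powr_numeral divide_inverse)
 finally show "q <= (1 / e) * jp x 2" .
 have "e * norm x * q^2 <= e * jb x * q" using e norm_le_jb[of x] q1 `0 < q` unfolding power2_eq_square mult.assoc[symmetric]
  by (intro order_trans[OF mult_left_le[of q]] mult_right_mono mult_left_mono) auto
 also have "... <= 1 / jb x"
 proof -
  have "e * jb x * jb x <= 1 + e * (x *. x)" using le by (simp add: power2_eq_square mult.assoc)
  thus ?thesis using jb_pos[of x] d by (simp add: q_def field_simps)
 qed
 finally show "e * norm x * q^2 <= 1 / jb x" .
qed

text \<open>At decay of order N the single partial derivatives need not be integrable; integrability
  is assumed of the divergence only. The cutoff 1/(1 + e|x|^2) adds terms bounded by the field times
  2 / \<open>jb x\<close>, uniformly in e; these are integrable and tend to 0 pointwise.\<close>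

lemma divergence_integral_zero:
 fixes Z Z' :: "'a::euclidean_space => 'a => real"
 assumes pd: "!!b. b : Basis ==> has_pd b (Z b) (Z' b)"
  and m: "!!b. b : Basis ==> Z b : bmeas" "!!b. b : Basis ==> Z' b : bmeas"
  and bd: "!!b. b : Basis ==> decays (real DIM('a)) (Z b)" "!!b. b : Basis ==> decays (real DIM('a)) (Z' b)"
  and div: "decays (real DIM('a) + 1) (%x. SUM b:Basis. Z' b x)"
 shows "(LBINT x. (SUM b:Basis. Z' b x)) = 0" "intble (%x. SUM b:Basis. Z' b x)"
proof -
 let ?N = "real DIM('a)"
 have dm: "(%x. SUM b:Basis. Z' b x) : bmeas" using m(2) by (intro borel_measurable_sum)
 show di: "intble (%x. SUM b:Basis. Z' b x)" by (rule decays_integrable[OF div _ dm]) simp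
 define e where "e n = 1 / real (Suc n)" for n
 have e: "0 < e n" "e n <= 1" for n by (auto simp: e_def)
 have e0: "e ----> 0" unfolding e_def using LIMSEQ_inverse_real_of_nat by (simp add: inverse_eq_divide)
 define q where "q n x = 1 / (1 + e n * (x *. x))" for n and x :: 'a
 have cut: "0 < q n x" "q n x <= 1" "q n x <= (1 / e n) * jp x 2" "e n * norm x * (q n x)^2 <= 1 / jb x" for n x
  using cutoff_bounds[OF e(1,2)[of n], of x] unfolding q_def by auto
 have q0: "(%n. q n x) ----> 1 / (1 + 0 * (x *. x))" for x unfolding q_def by (intro tendsto_intros e0) simp
 have qd: "decays 2 (q n)" for n by (rule decaysI[of _ "1 / e n"]) (use cut[of n] in "simp add: less_imp_le")
 have qm: "q n : bmeas" for n unfolding q_def[abs_def] by measurable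
 define r where "r n b x = Z b x * (2 * e n * (x *. b) * (q n x)^2)" for n b x
 define H where "H b x = Z b x * (2 * (1 / jb x))" for b x
 have rm: "r n b : bmeas" "H b : bmeas" if "b : Basis" for n b
  unfolding r_def[abs_def] H_def[abs_def] using m(1)[OF that] qm[of n] by measurable
 have rb: "abs (r n b x) <= abs (H b x)" if b: "b : Basis" for b n x
 proof -
  have "abs (2 * e n * (x *. b) * (q n x)^2) <= 2 * (e n * norm x * (q n x)^2)"
   using e[of n] Basis_le_norm[OF b, of x] by (simp add: abs_mult mult_right_mono)
  also have "... <= abs (2 * (1 / jb x))" using cut(4)[of n x] jb_pos[of x] by simp
  finally show ?thesis unfolding r_def H_def abs_mult[of "Z b x"] by (rule mult_left_mono) simp
 qed
 have jd: "decays 1 (%x::'a. 2 * (1 / jb x))"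
  by (rule decaysI[of _ 2]) (simp add: powr_minus divide_inverse abs_of_pos jb_pos)
 have Hd: "decays (?N + 1) (H b)" if "b : Basis" for b
  unfolding H_def[abs_def] by (rule decays_mult[OF bd(1)[OF that] jd]) simp
 have Hi: "intble (H b)" if "b : Basis" for b by (rule decays_integrable[OF Hd[OF that] _ rm(2)[OF that]]) simp
 have ri: "intble (r n b)" if "b : Basis" for n b
  by (rule decays_integrable[OF decays_le[OF Hd[OF that] rb[OF that]] _ rm(1)[OF that]]) simp
 have z: "(LBINT x. q n x * Z' b x - r n b x) = 0 & intble (%x. q n x * Z' b x - r n b x)" if b: "b : Basis" for b n
 proof -
  have pq: "has_pd b (q n) (%x. - (2 * e n * (x *. b) * (q n x)^2))"
  proof -
   have "has_pd b (%x. (%t. 1 / (1 + e n * t)) (x *. x)) (%x. (%t. - e n / (1 + e n * t)^2) (x *. x) * (2 * (x *. b)))"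
   proof (rule has_pd_radial)
    fix x :: 'a
    have "1 + e n * (x *. x) > 0" using e[of n] by (simp add: add_pos_nonneg)
    thus "DERIV (%t. 1 / (1 + e n * t)) (x *. x) :> - e n / (1 + e n * (x *. x))^2"
     by (auto intro!: derivative_eq_intros simp: power2_eq_square)
   qed
   thus ?thesis unfolding q_def[abs_def] by (rule has_pd_cong) (simp add: power_divide)
  qed
  have P: "has_pd b (%x. q n x * Z b x) (%x. q n x * Z' b x - r n b x)"
   by (rule has_pd_cong[OF has_pd_mult[OF pq pd[OF b]]]) (simp add: r_def)
  have "decays (?N + 1) (%x. q n x * Z b x)" by (rule decays_mult[OF qd bd(1)[OF b]]) simp
  hence qi: "intble (%x. q n x * Z b x)" by (rule decays_integrable) (use qm m(1)[OF b] in auto)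
  have "decays (?N + 1) (%x. q n x * Z' b x - r n b x)"
   by (intro decays_diff decays_mult[OF qd bd(2)[OF b]] decays_le[OF Hd[OF b] rb[OF b]]) simp
  from integral_pd_zero[OF P _ qi this] b show ?thesis by simp
 qed
 have eq: "(LBINT x. q n x * (SUM b:Basis. Z' b x)) = (LBINT x. (SUM b:Basis. r n b x))" for n
 proof -
  have "(LBINT x. (SUM b:Basis. q n x * Z' b x - r n b x)) = 0" using z by (subst Lint_sum) auto
  hence 1: "(LBINT x. q n x * (SUM b:Basis. Z' b x) - (SUM b:Basis. r n b x)) = 0"
   by (simp add: sum_subtractf sum_distrib_left)
  have "intble (%x. q n x * (SUM b:Basis. Z' b x))" by (rule L1_bound[OF di])
     (use cut(1,2)[of n] qm dm in "auto intro!: AE_I2 simp: abs_mult mult_left_le_one_le less_imp_le")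
  thus ?thesis using 1 ri by simp
 qed
 have "(%n. LBINT x. q n x * (SUM b:Basis. Z' b x)) ----> (LBINT x. (SUM b:Basis. Z' b x))"
 proof (rule integral_dominated_convergence[where w = "%x. abs (SUM b:Basis. Z' b x)"])
  show "AE x in lborel. (%n. q n x * (SUM b:Basis. Z' b x)) ----> (SUM b:Basis. Z' b x)"
   using tendsto_mult_right[OF q0] by (intro AE_I2) simp
  show "AE x in lborel. norm (q n x * (SUM b:Basis. Z' b x)) <= abs (SUM b:Basis. Z' b x)" for n
   using cut(1,2)[of n] by (intro AE_I2) (simp add: abs_mult mult_left_le_one_le less_imp_le)
 qed (use qm dm di in auto)
 moreover have "(%n. LBINT x. (SUM b:Basis. r n b x)) ----> (LINT x|(lborel::'a measure). 0)"
 proof (rule integral_dominated_convergence[where w = "%x. SUM b:Basis. abs (H b x)"])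
  show "(%x. SUM b:Basis. r n b x) : lmeas" for n using rm by (auto intro!: borel_measurable_sum)
  show "AE x in lborel. norm (SUM b:Basis. r n b x) <= (SUM b:Basis. abs (H b x))" for n
   using rb by (intro AE_I2 sum_norm_le) simp
  show "AE x in lborel. (%n. SUM b:Basis. r n b x) ----> 0"
  proof (rule AE_I2)
   fix x :: 'a
   have "(%n. SUM b:Basis. r n b x) ----> (SUM b:Basis. Z b x * (2 * 0 * (x *. b) * (1 / (1 + 0 * (x *. x)))^2))"
    unfolding r_def by (intro tendsto_intros e0 q0)
   thus "(%n. SUM b:Basis. r n b x) ----> 0" by simp
  qed
 qed (use Hi in auto)
 ultimately show "(LBINT x. (SUM b:Basis. Z' b x)) = 0" unfolding eq using LIMSEQ_unique by fastforce
qed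

text \<open>Pointwise algebra, with X for x, V1 for the gradient and V2 for the Hessian of v. The
  mixed terms of X, gradient and Hessian cancel by symmetry of the Hessian, so second derivatives
  survive only as the Laplacian times the multiplier D + c v.\<close>

lemma virial_divergence:
 fixes X V1 :: "'i => real" and V2 :: "'i => 'i => real" and v c h h1 :: real
 assumes sym: "!!a b. a : I ==> b : I ==> V2 a b = V2 b a"
 defines "D == SUM a:I. X a * V1 a" and "S == SUM a:I. (V1 a)^2" and "t == SUM a:I. (X a)^2"
 shows "(SUM b:I. V2 b b * (D + c * v) + ((V1 b + (SUM a:I. X a * V2 a b)) + c * V1 b) * V1 b
    - (1 / 2 * S + X b * (SUM a:I. V1 a * V2 a b))
    + ((h1 * (2 * X b) * X b + h) * v^2 + (h * X b) * (2 * v * V1 b)))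
   = (SUM b:I. V2 b b) * (D + c * v) + (1 + c - real (card I) / 2) * S + (2 * h1 * t + real (card I) * h) * v^2 + 2 * h * v * D"
proof -
 have sw: "(SUM b:I. V1 b * (SUM a:I. X a * V2 a b)) = (SUM b:I. X b * (SUM a:I. V1 a * V2 a b))"
 proof -
  have "(SUM b:I. V1 b * (SUM a:I. X a * V2 a b)) = (SUM b:I. SUM a:I. V1 b * X a * V2 a b)"
   by (simp add: sum_distrib_left mult.assoc)
  also have "... = (SUM a:I. SUM b:I. V1 b * X a * V2 a b)" by (rule sum.swap)
  also have "... = (SUM a:I. X a * (SUM b:I. V1 b * V2 b a))"
   by (intro sum.cong refl) (auto simp: sum_distrib_left sym mult_ac intro!: sum.cong)
  finally show ?thesis .
 qed
 have "(SUM b:I. V2 b b * (D + c * v) + ((V1 b + (SUM a:I. X a * V2 a b)) + c * V1 b) * V1 b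
    - (1 / 2 * S + X b * (SUM a:I. V1 a * V2 a b))
    + ((h1 * (2 * X b) * X b + h) * v^2 + (h * X b) * (2 * v * V1 b)))
  = (SUM b:I. V2 b b * (D + c * v) + (1 + c) * (V1 b)^2 + V1 b * (SUM a:I. X a * V2 a b)
    - 1 / 2 * S - X b * (SUM a:I. V1 a * V2 a b)
    + 2 * h1 * v^2 * (X b)^2 + h * v^2 + 2 * h * v * (X b * V1 b))"
  by (intro sum.cong refl) (simp add: algebra_simps power2_eq_square)
 also have "... = (SUM b:I. V2 b b) * (D + c * v) + (1 + c) * S + (SUM b:I. V1 b * (SUM a:I. X a * V2 a b))
    - real (card I) * (1 / 2 * S) - (SUM b:I. X b * (SUM a:I. V1 a * V2 a b))
    + 2 * h1 * v^2 * t + real (card I) * (h * v^2) + 2 * h * v * D"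
  by (simp only: sum.distrib sum_subtractf sum_distrib_right[symmetric] sum_distrib_left[symmetric] sum_constant D_def S_def t_def)
 finally show ?thesis unfolding sw by (simp add: algebra_simps)
qed

text \<open>Two squares are dropped. The one in D + c v + P / (4 g) absorbs P at the price P^2 / (8
  g), and \<open>cs\<close>, which is |grad v + lam g v x|^2, trades the gradient for a term of
  order zero. The choice of h makes all remaining terms v D cancel, so that only v^2 is
  left.\<close>

lemma virial_pointwise:
 fixes P D S v c g V h h1 t N lam :: real
 assumes g: "g > 0" and h: "h = V / 2 + (c + lam / 2) * g" and cs: "S + 2 * lam * g * v * D + lam^2 * g^2 * t * v^2 >= 0"
  and c: "c = (N - 1) / 2" and L: "L = P + 2 * g * D - V * v"
  and kap: "2 * t * h1 + N * h - c * V - 2 * c^2 * g - lam^2 / 2 * g^2 * t >= kap"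
 shows "kap * v^2 <= P^2 / (8 * g) + (L * (D + c * v) + (1 + c - N / 2) * S + (2 * h1 * t + N * h) * v^2 + 2 * h * v * D)"
proof -
 have sq: "0 <= 2 * g * (D + c * v + P / (4 * g))^2" using g by simp
 have e1: "2 * g * (D + c * v + P / (4 * g))^2 = 2 * g * (D + c * v)^2 + P * (D + c * v) + P^2 / (8 * g)"
  using g by (simp add: power2_eq_square field_simps)
 have e2: "L * (D + c * v) + (1 + c - N / 2) * S + (2 * h1 * t + N * h) * v^2 + 2 * h * v * D
   = P * (D + c * v) + 2 * g * (D + c * v)^2 + (S + 2 * lam * g * v * D + lam^2 * g^2 * t * v^2) / 2
    + (2 * t * h1 + N * h - c * V - 2 * c^2 * g - lam^2 / 2 * g^2 * t) * v^2"
  unfolding L h c by (simp add: power2_eq_square algebra_simps add_divide_distrib diff_divide_distrib)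
 have "kap * v^2 <= (2 * t * h1 + N * h - c * V - 2 * c^2 * g - lam^2 / 2 * g^2 * t) * v^2"
  by (intro mult_right_mono kap) simp
 moreover have "0 <= (S + 2 * lam * g * v * D + lam^2 * g^2 * t * v^2) / 2" using cs by simp
 moreover have "0 <= 2 * g * (D + c * v)^2 + P * (D + c * v) + P^2 / (8 * g)" using sq unfolding e1 .
 ultimately have "kap * v^2 + 0 + 0 <= (2 * t * h1 + N * h - c * V - 2 * c^2 * g - lam^2 / 2 * g^2 * t) * v^2
   + (S + 2 * lam * g * v * D + lam^2 * g^2 * t * v^2) / 2 + (2 * g * (D + c * v)^2 + P * (D + c * v) + P^2 / (8 * g))"
  by (intro add_mono)
 thus ?thesis unfolding e2 by (simp only: add_0_right add_ac)
qed

text \<open>The derivatives are part of the data, with \<open>U2 a b\<close> the derivative of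
  \<open>U1 a\<close> in direction b. One exponent for all orders is enough, as mollification
  preserves the decay of the function for its derivatives too.\<close>

definition C2_decays :: "real => ('a::euclidean_space => real) => ('a => 'a => real) => ('a => 'a => 'a => real) => bool" where
 "C2_decays s U U1 U2 \<longleftrightarrow> cont U & decays s U &
  (ALL b:Basis. has_pd b U (U1 b) & cont (U1 b) & decays s (U1 b)) &
  (ALL a:Basis. ALL b:Basis. has_pd b (U1 a) (U2 a b) & cont (U2 a b) & decays s (U2 a b) & (ALL x. U2 a b x = U2 b a x))"

lemma C2_decaysD:
 assumes "C2_decays s U U1 U2"
 shows "cont U" "decays s U"
  "b : Basis ==> has_pd b U (U1 b)" "b : Basis ==> cont (U1 b)" "b : Basis ==> decays s (U1 b)"
  "a : Basis ==> b : Basis ==> has_pd b (U1 a) (U2 a b)" "a : Basis ==> b : Basis ==> cont (U2 a b)"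
  "a : Basis ==> b : Basis ==> decays s (U2 a b)" "a : Basis ==> b : Basis ==> U2 a b x = U2 b a x"
 using assms unfolding C2_decays_def by blast+

lemma decays_radial:
 assumes "!!t. t >= 0 ==> abs (F t) <= B"
 shows "decays 0 (%x::'a::euclidean_space. F (x *. x))" by (rule decays_bounded) (rule assms, simp)

lemma decays_radial_2:
 assumes g: "!!t. t >= 0 ==> g t > 0" "!!t. t >= 0 ==> g t * (1 + t) <= B"
 shows "decays 2 (%x::'a::euclidean_space. g (x *. x))"
proof -
 have "abs (g (x *. x)) <= B * jp x 2" for x :: 'a
 proof -
  have "jp x 2 = 1 / (1 + x *. x)"
   using jb_pos[of x] by (simp add: powr_minus powr_numeral jb_square dot_square_norm divide_inverse)
  moreover have "g (x *. x) <= B / (1 + x *. x)" using g(2)[of "x *. x"] by (simp add: le_divide_eq add_pos_nonneg)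
  ultimately show ?thesis using g(1)[of "x *. x"] by simp
 qed
 thus ?thesis by (rule decaysI)
qed

lemma continuous_radial: "continuous_on {0..} F ==> cont (%x::'a::euclidean_space. F (x *. x))"
 by (rule continuous_on_compose2[of "{0..}" F]) (auto intro!: continuous_intros)

text \<open>P is the Helmholtz operator conjugated with the weight and applied to v. The pointwise
  inequality is integrated, and its divergence part contributes nothing.\<close>

lemma virial_estimate:
 fixes v :: "'a::euclidean_space => real" and v1 :: "'a => 'a => real" and v2 :: "'a => 'a => 'a => real"
  and g h h1 V :: "real => real" and lam kap B :: real
 defines "N == real DIM('a)" and "c == (real DIM('a) - 1) / 2"
 defines "D == %x. SUM b:Basis. (x *. b) * v1 b x"
 defines "P == %x. (SUM b:Basis. v2 b b x) - 2 * g (x *. x) * D x + V (x *. x) * v x"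
 assumes C2: "C2_decays ((N + 1) / 2) v v1 v2" and hd: "!!t. t >= 0 ==> DERIV h t :> h1 t" and h1c: "continuous_on {0..} h1"
  and hb: "!!t. t >= 0 ==> abs (h t) <= B" "!!t. t >= 0 ==> abs (t * h1 t) <= B" "!!t. t >= 0 ==> abs (V t) <= B"
  and gp: "!!t. t >= 0 ==> g t > 0" and gb: "!!t. t >= 0 ==> g t * (1 + t) <= B"
  and hV: "!!t. t >= 0 ==> h t = V t / 2 + (c + lam / 2) * g t" and Pb: "decays ((N + 3) / 2) P"
  and kap: "!!t. t >= 0 ==> kap <= 2 * t * h1 t + N * h t - c * V t - 2 * c^2 * g t - lam^2 / 2 * (g t)^2 * t"
  and Pi: "intble (%x. (P x)^2 / (8 * g (x *. x)))"
 shows "kap * (LBINT x. (v x)^2) <= (LBINT x. (P x)^2 / (8 * g (x *. x)))"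
proof -
 note cont = C2_decaysD(1,4,7)[OF C2] and bd = C2_decaysD(2,5,8)[OF C2] and pd1 = C2_decaysD(3)[OF C2] and pd2 = C2_decaysD(6)[OF C2] and sym = C2_decaysD(9)[OF C2]
 define S where "S x = (SUM b:Basis. (v1 b x)^2)" for x
 \<comment> \<open>The classical virial field of the multiplier x . grad v + c v, corrected by the
   radial field h x v^2.\<close>
 define Z where "Z b x = v1 b x * (D x + c * v x) - 1 / 2 * ((x *. b) * S x) + (h (x *. x) * (x *. b)) * (v x)^2" for b x
 define Z' where "Z' b x = v2 b b x * (D x + c * v x) + ((v1 b x + (SUM a:Basis. (x *. a) * v2 a b x)) + c * v1 b x) * v1 b x
    - (1 / 2 * S x + (x *. b) * (SUM a:Basis. v1 a x * v2 a b x))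
    + ((h1 (x *. x) * (2 * (x *. b)) * (x *. b) + h (x *. x)) * (v x)^2 + (h (x *. x) * (x *. b)) * (2 * v x * v1 b x))" for b x
 have xx: "x *. x >= 0" for x :: 'a by simp
 have pdD: "has_pd b D (%x. v1 b x + (SUM a:Basis. (x *. a) * v2 a b x))" if b: "b : Basis" for b
 proof -
  have "has_pd b D (%x. SUM a:Basis. (b *. a) * v1 a x + v2 a b x * (x *. a))"
   unfolding D_def by (intro has_pd_sum has_pd_mult has_pd_inner pd2 b)
  moreover have "(SUM a:Basis. (b *. a) * v1 a x + v2 a b x * (x *. a)) = v1 b x + (SUM a:Basis. (x *. a) * v2 a b x)" for x
  proof -
   have "(SUM a:Basis. (b *. a) * v1 a x) = (SUM a:Basis. if a = b then v1 a x else 0)"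
    using b by (intro sum.cong refl) (auto simp: inner_Basis)
   also have "... = v1 b x" using b by simp
   finally show ?thesis by (simp add: sum.distrib mult.commute)
  qed
  ultimately show ?thesis by (rule has_pd_cong)
 qed
 have pdS: "has_pd b S (%x. 2 * (SUM a:Basis. v1 a x * v2 a b x))" if b: "b : Basis" for b
 proof -
  have "has_pd b (%x. SUM a:Basis. v1 a x * v1 a x) (%x. SUM a:Basis. v2 a b x * v1 a x + v2 a b x * v1 a x)"
   by (intro has_pd_sum has_pd_mult pd2 b)
  thus ?thesis unfolding S_def power2_eq_square by (rule has_pd_cong) (simp add: sum_distrib_left mult_ac)
 qed
 have pdv2: "has_pd b (%x. (v x)^2) (%x. 2 * v x * v1 b x)" if b: "b : Basis" for b
  unfolding power2_eq_square by (rule has_pd_cong[OF has_pd_mult[OF pd1[OF b] pd1[OF b]]]) simp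
 have pdh: "has_pd b (%x. h (x *. x) * (x *. b)) (%x. h1 (x *. x) * (2 * (x *. b)) * (x *. b) + h (x *. x))" if b: "b : Basis" for b
  by (rule has_pd_cong[OF has_pd_mult[OF has_pd_radial[of h h1] has_pd_inner]]) (use b hd xx in "auto simp: inner_Basis")
 have pdZ: "has_pd b (Z b) (Z' b)" if b: "b : Basis" for b
 proof -
  have 1: "has_pd b (%x. v1 b x * (D x + c * v x)) (%x. v2 b b x * (D x + c * v x) + ((v1 b x + (SUM a:Basis. (x *. a) * v2 a b x)) + c * v1 b x) * v1 b x)"
   by (intro has_pd_mult has_pd_add has_pd_cmult pd1 pd2 pdD b)
  have 2: "has_pd b (%x. 1 / 2 * ((x *. b) * S x)) (%x. 1 / 2 * S x + (x *. b) * (SUM a:Basis. v1 a x * v2 a b x))"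
   by (rule has_pd_cong[OF has_pd_cmult[OF has_pd_mult[OF has_pd_inner pdS[OF b]]]]) (use b in "simp add: inner_Basis algebra_simps")
  have 3: "has_pd b (%x. (h (x *. x) * (x *. b)) * (v x)^2)
    (%x. (h1 (x *. x) * (2 * (x *. b)) * (x *. b) + h (x *. x)) * (v x)^2 + (h (x *. x) * (x *. b)) * (2 * v x * v1 b x))"
   by (rule has_pd_cong[OF has_pd_mult[OF pdh[OF b] pdv2[OF b]]]) simp
  show ?thesis unfolding Z_def[abs_def] Z'_def[abs_def] by (intro has_pd_add has_pd_diff 1 2 3)
 qed
 have sumZ': "(SUM b:Basis. Z' b x) = (SUM b:Basis. v2 b b x) * (D x + c * v x) + (1 + c - N / 2) * S x
   + (2 * h1 (x *. x) * (x *. x) + N * h (x *. x)) * (v x)^2 + 2 * h (x *. x) * v x * D x" for x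
 proof -
  have t: "(SUM a:Basis. (x *. a)^2) = x *. x" by (subst (2) euclidean_inner) (simp add: power2_eq_square)
  show ?thesis
   using virial_divergence[of Basis "%a b. v2 a b x" "%b. x *. b" "%b. v1 b x" c "v x" "h1 (x *. x)" "h (x *. x)", OF sym]
   unfolding Z'_def S_def D_def t N_def by simp
 qed
 have half: "1 + c - N / 2 = 1 / 2" by (simp add: c_def N_def field_simps)
 have pw: "kap * (v x)^2 <= (P x)^2 / (8 * g (x *. x)) + (SUM b:Basis. Z' b x)" for x unfolding sumZ'
 proof (rule virial_pointwise[where lam = lam and V = "V (x *. x)" and g = "g (x *. x)"])
  have "0 <= (SUM b:Basis. (v1 b x + lam * g (x *. x) * v x * (x *. b))^2)" by (intro sum_nonneg) simp
  also have "... = (SUM b:Basis. (v1 b x)^2 + (2 * lam * g (x *. x) * v x) * ((x *. b) * v1 b x) + (lam^2 * (g (x *. x))^2 * (v x)^2) * ((x *. b) * (x *. b)))"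
   by (intro sum.cong refl) (simp add: power2_eq_square algebra_simps)
  also have "... = S x + (2 * lam * g (x *. x) * v x) * D x + (lam^2 * (g (x *. x))^2 * (v x)^2) * (x *. x)"
   by (subst (5) euclidean_inner) (simp add: S_def D_def sum.distrib sum_distrib_left)
  finally show "0 <= S x + 2 * lam * g (x *. x) * v x * D x + lam^2 * (g (x *. x))^2 * (x *. x) * (v x)^2"
   by (simp add: mult_ac)
  show "(SUM b:Basis. v2 b b x) = P x + 2 * g (x *. x) * D x - V (x *. x) * v x" by (simp add: P_def)
  show "c = (N - 1) / 2" by (simp add: c_def N_def)
 qed (use gp hV kap xx in auto)
 \<comment> \<open>The factor x costs the multiplier one order, so its products with the gradient
   decay like 2 * ?s - 1 = N, which is exactly what the divergence theorem above admits.\<close>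
 let ?s = "(N + 1) / 2"
 have dD: "decays (?s - 1) D" unfolding D_def by (intro decays_sum decays_mult[OF decays_inner bd(2)]) auto
 have dA: "decays (?s - 1) (%x. D x + c * v x)" by (intro decays_add dD decays_cmult decays_mono[OF bd(1)]) simp
 have dS: "decays (N + 1) S" unfolding S_def power2_eq_square by (intro decays_sum decays_mult[OF bd(2) bd(2)]) auto
 have dv: "decays (N + 1) (%x. (v x)^2)" unfolding power2_eq_square by (intro decays_mult[OF bd(1) bd(1)]) simp
 have dh: "decays 0 (%x::'a. h (x *. x))" "decays 0 (%x::'a. (x *. x) * h1 (x *. x))" "decays 0 (%x::'a. V (x *. x))"
  using decays_radial[of h, OF hb(1)] decays_radial[of "%t. t * h1 t", OF hb(2)] decays_radial[of V, OF hb(3)] by auto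
 have dg: "decays 2 (%x::'a. g (x *. x))" by (rule decays_radial_2[OF gp gb])
 have dhx: "decays (-1) (%x. h (x *. x) * (x *. b))" if "b : Basis" for b :: 'a
  by (rule decays_mult[OF dh(1) decays_inner[OF that]]) simp
 have Zb: "decays N (Z b)" if b: "b : Basis" for b unfolding Z_def[abs_def]
  by (intro decays_add decays_diff decays_cmult decays_mult[OF bd(2)[OF b] dA] decays_mult[OF decays_inner[OF b] dS] decays_mult[OF dhx[OF b] dv]) (simp_all add: field_simps)
 have Z'b: "decays N (Z' b)" if b: "b : Basis" for b
 proof -
  have "decays (?s - 1) (%x. (v1 b x + (SUM a:Basis. (x *. a) * v2 a b x)) + c * v1 b x)"
   by (intro decays_add decays_cmult decays_mono[OF bd(2)[OF b]] decays_sum decays_mult[OF decays_inner bd(3)]) (use b in auto)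
  note 1 = decays_mult[OF this bd(2)[OF b]]
  have 2: "decays (N + 1) (%x. SUM a:Basis. v1 a x * v2 a b x)"
   by (intro decays_sum decays_mult[OF bd(2) bd(3)]) (use b in auto)
  have "decays 0 (%x. h1 (x *. x) * (2 * (x *. b)) * (x *. b))"
  proof (rule decays_le[OF decays_cmult[OF dh(2), of 2]])
   fix x :: 'a
   have "(x *. b) * (x *. b) <= x *. x" using Basis_le_norm[OF b, of x]
    by (metis abs_ge_zero abs_mult_self_eq mult_mono' power2_eq_square power2_norm_eq_inner)
   hence "abs (h1 (x *. x)) * ((x *. b) * (x *. b)) <= abs (h1 (x *. x)) * (x *. x)" by (intro mult_left_mono) auto
   thus "abs (h1 (x *. x) * (2 * (x *. b)) * (x *. b)) <= abs (2 * ((x *. x) * h1 (x *. x)))" by (simp add: abs_mult mult_ac)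
  qed
  note 3 = decays_mult[OF decays_add[OF this dh(1)] dv]
  have "decays (N + 1) (%x. 2 * v x * v1 b x)" by (intro decays_mult[OF decays_cmult[OF bd(1)] bd(2)[OF b]]) simp
  note 4 = decays_mult[OF dhx[OF b] this]
  show ?thesis unfolding Z'_def[abs_def]
   by (intro decays_add decays_diff decays_cmult decays_mult[OF bd(3)[OF b b] dA] 1 3 4 decays_mono[OF dS] decays_mult[OF decays_inner[OF b] 2]) (simp_all add: field_simps)
 qed
 \<comment> \<open>Term by term the divergence is only known to decay like N. Expressing the
   Laplacian through P lets the terms V v D cancel against 2 h v D up to a multiple of g, and the
   decay of P and g gives the missing order.\<close>
 have div: "decays (N + 1) (%x. SUM b:Basis. Z' b x)"
 proof -
  have e: "(SUM b:Basis. Z' b x) = P x * (D x + c * v x) + 2 * (g (x *. x) * (D x * (D x + c * v x))) + 1 / 2 * S x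
    + (2 * ((x *. x) * h1 (x *. x)) + N * h (x *. x) - c * V (x *. x)) * (v x)^2 + (2 * c + lam) * (g (x *. x) * (v x * D x))" for x
  proof -
   have Lx: "(SUM b:Basis. v2 b b x) = P x + 2 * g (x *. x) * D x - V (x *. x) * v x" by (simp add: P_def)
   show ?thesis unfolding sumZ' half Lx hV[OF xx] by (simp add: power2_eq_square algebra_simps add_divide_distrib)
  qed
  have 1: "decays (N - 1) (%x. D x * (D x + c * v x))" "decays (N - 1) (%x. v x * D x)"
   by (rule decays_mult[OF dD dA] decays_mult[OF bd(1) dD]; simp add: field_simps)+
  have 2: "decays 0 (%x::'a. 2 * ((x *. x) * h1 (x *. x)) + N * h (x *. x) - c * V (x *. x))"
   by (intro decays_add decays_diff decays_cmult dh)
  show ?thesis unfolding e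
   by (intro decays_add decays_cmult dS decays_mult[OF Pb dA] decays_mult[OF dg 1(1)] decays_mult[OF dg 1(2)] decays_mult[OF 2 dv]) (simp_all add: field_simps)
 qed
 have hc: "continuous_on {0..} h" using hd by (meson DERIV_isCont atLeast_iff continuous_at_imp_continuous_on)
 note hx = continuous_radial[OF hc] continuous_radial[OF h1c]
 have cD: "cont D" "cont S" unfolding D_def S_def using cont by (auto intro!: continuous_intros)
 have Zm: "Z b : bmeas" "Z' b : bmeas" if b: "b : Basis" for b unfolding Z_def[abs_def] Z'_def[abs_def]
  by (rule borel_measurable_continuous_onI; intro continuous_intros cD hx cont b; assumption)+
 note dz = divergence_integral_zero[of Z Z', OF pdZ Zm Zb[unfolded N_def] Z'b[unfolded N_def] div[unfolded N_def]]
 have vi: "intble (%x. (v x)^2)"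
  by (rule decays_integrable[OF dv]) (use borel_measurable_continuous_onI[OF cont(1)] in "auto simp: N_def")
 have "kap * (LBINT x. (v x)^2) = (LBINT x. kap * (v x)^2)" by simp
 also have "... <= (LBINT x. (P x)^2 / (8 * g (x *. x)) + (SUM b:Basis. Z' b x))"
  by (intro integral_mono integrable_mult_right vi L1_add Pi dz(2) pw)
 also have "... = (LBINT x. (P x)^2 / (8 * g (x *. x)))" using Pi dz by simp
 finally show ?thesis .
qed

section \<open>The weight of the Carleman inequality\<close>

lemma virial_weight_identity:
 fixes t l g K' n c k :: real
 assumes c: "c = (n - 1) / 2"
 defines "K == t * l" and "g1 == - (l * g)"
 defines "V == k^2 + g^2 * t - n * g + 2 * (K * g)" and "V1 == 2 * g * g1 * t + g^2 - n * g1 + 2 * (K' * g + K * g1)"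
 shows "2 * t * (V1 / 2 + (c + 1 / 4) * g1) + n * (V / 2 + (c + 1 / 4) * g) - c * V - 2 * c^2 * g - (1 / 2)^2 / 2 * g^2 * t
  = k^2 / 2 + g^2 * t * (11 / 8 - 2 * K) + g * (2 * (t * K') - 2 * K^2 + 3 / 2 * K + n / 4 - 1 / 2)"
 unfolding c K_def g1_def V_def V1_def by (simp add: field_simps power2_eq_square)

text \<open>K = -t g' / g is the logarithmic slope of g. The terms of the identity above have a
  favourable sign while K <= 11/16; the slope 5/8 respects this, and it exceeds 1/2, so that g^2 t
  stays bounded. A bounded weight needs an integrable g, hence a slope above 1 in the end: the
  second factor raises it to 5/8 + 11/8 = 2 beyond the scale 1/ep, where g is already so small that
  the loss stays below k^2/4.\<close>

lemma virial_weight: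
 fixes k ta n :: real
 assumes k: "k > 0" and ta: "ta > 0" and n: "n >= 2" obtains ps g g1 h h1 V :: "real => real" and M B :: real where
  "!!t. t >= 0 ==> DERIV (ps) t :> g t / 2"
  "!!t. t >= 0 ==> 0 <= ps t" "!!t. t >= 0 ==> ps t <= M"
  "!!t. t >= 0 ==> DERIV g t :> g1 t" "continuous_on {0..} g1"
  "!!t. t >= 0 ==> DERIV h t :> h1 t" "continuous_on {0..} h1"
  "!!t. t >= 0 ==> V t = k^2 + (g t)^2 * t - n * g t - 2 * t * g1 t"
  "!!t. t >= 0 ==> h t = V t / 2 + ((n - 1) / 2 + (1 / 2) / 2) * g t"
  "!!t. t >= 0 ==> ta <= g t * (1 + t)^2" "!!t. t >= 0 ==> g t * (1 + t) <= B"
  "!!t. t >= 0 ==> abs (t * g1 t) <= B" "!!t. t >= 0 ==> abs (h t) <= B" "!!t. t >= 0 ==> abs (t * h1 t) <= B" "!!t. t >= 0 ==> abs (V t) <= B"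
  "!!t. t >= 0 ==> k^2 / 4 <= 2 * t * h1 t + n * h t - (n - 1) / 2 * V t - 2 * ((n - 1) / 2)^2 * g t - (1 / 2)^2 / 2 * (g t)^2 * t"
proof -
 \<comment> \<open>The loss caused by the second factor will be 11/4 r ta^2 + 11/2 r ta, and this r
   makes it at most k^2/4. The power ep = r^4 matches the exponent 1/4 in the bound of that factor's
   slope.\<close>
 define r where "r = min (1 / 2) (k^2 / (24 * (ta^2 + ta)))"
 define ep where "ep = r ^ 4"
 have "0 < k^2 / (24 * (ta^2 + ta))" using k ta by (intro divide_pos_pos mult_pos_pos add_pos_pos) auto
 hence r0: "0 < r" "r <= 1 / 2" unfolding r_def by (auto simp only: min_less_iff_conj min.cobounded1)
 have rk: "r * (24 * (ta^2 + ta)) <= k^2"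
 proof -
  have "r <= k^2 / (24 * (ta^2 + ta))" by (simp add: r_def)
  thus ?thesis using ta by (subst (asm) pos_le_divide_eq) (auto simp: add_pos_pos)
 qed
 have eps: "0 < ep" "ep <= 1 / 2"
 proof -
  show "0 < ep" using r0 by (simp add: ep_def)
  have "r ^ 4 <= r ^ 1" using r0 by (intro power_decreasing) auto
  thus "ep <= 1 / 2" using r0 by (simp add: ep_def)
 qed
 define p q where "p t = 1 + t" and "q t = 1 + ep * t" for t :: real
 define g where "g t = ta * (p t powr (-(5/8)) * q t powr (-(11/8)))" for t
 define l where "l t = 5/8 / p t + 11/8 * ep / q t" for t
 define K' where "K' t = 5/8 / (p t)^2 + 11/8 * ep / (q t)^2" for t
 define K where "K t = t * l t" for t
 define g1 where "g1 t = - (l t * g t)" for t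
 define V where "V t = k^2 + (g t)^2 * t - n * g t + 2 * (K t * g t)" for t
 define V1 where "V1 t = 2 * g t * g1 t * t + (g t)^2 - n * g1 t + 2 * (K' t * g t + K t * g1 t)" for t
 define c where "c = (n - 1) / 2"
 define h where "h t = V t / 2 + (c + 1 / 4) * g t" for t
 define h1 where "h1 t = V1 t / 2 + (c + 1 / 4) * g1 t" for t
 \<comment> \<open>The antiderivative of g/2 in closed form, since p/q has derivative (1 - ep) /
   q^2; p/q <= 1/ep shows that it is bounded.\<close>
 define ps where "ps t = (4 / 3 * ta / (1 - ep)) * (p t / q t) powr (3/8)" for t
 have pq: "p t >= 1" "q t >= 1" "q t <= p t" "p t <= q t / ep" if "t >= 0" for t
  using that eps mult_left_le_one_le[of t ep] by (auto simp: p_def q_def field_simps)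
 have pq0: "p t > 0" "q t > 0" if "t >= 0" for t using pq[OF that] by auto
 have Dp: "DERIV p t :> 1" for t unfolding p_def[abs_def] by (auto intro!: derivative_eq_intros)
 have Dq: "DERIV q t :> ep" for t unfolding q_def[abs_def] by (auto intro!: derivative_eq_intros)
 have Dg: "DERIV g t :> g1 t" if t: "t >= 0" for t
 proof -
  have a: "DERIV (%t. p t powr (-(5/8))) t :> (-(5/8)) * p t powr (-(5/8) - 1) * 1"
   by (rule DERIV_fun_powr[OF Dp pq0(1)[OF t], unfolded of_nat_1])
  have b: "DERIV (%t. q t powr (-(11/8))) t :> (-(11/8)) * q t powr (-(11/8) - 1) * ep"
   by (rule DERIV_fun_powr[OF Dq pq0(2)[OF t], unfolded of_nat_1])
  have c: "p t powr (-(5/8) - 1) = p t powr (-(5/8)) / p t" "q t powr (-(11/8) - 1) = q t powr (-(11/8)) / q t"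
   using pq0[OF t] by (simp_all only: powr_diff powr_one)
  have d: "g1 t = ta * ((-(5/8)) * p t powr (-(5/8) - 1) * 1 * q t powr (-(11/8)) + (-(11/8)) * q t powr (-(11/8) - 1) * ep * p t powr (-(5/8)))"
   unfolding c g1_def l_def g_def by (simp add: algebra_simps)
  show ?thesis unfolding d unfolding g_def[abs_def] by (rule DERIV_cmult[OF DERIV_mult[OF a b]])
 qed
 have DK: "DERIV K t :> K' t" if t: "t >= 0" for t
 proof -
  have K: "K s = t * 0 + K s" for s by simp
  have "DERIV K t :> 1 * l t + ((0 * p t - 5/8 * 1) / (p t * p t) + (0 * q t - 11/8 * ep * ep) / (q t * q t)) * t"
   unfolding K_def[abs_def] l_def[abs_def]
   by (rule DERIV_mult[OF DERIV_ident DERIV_add[OF DERIV_divide[OF DERIV_const Dp] DERIV_divide[OF DERIV_const Dq]]])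
     (use pq0[OF t] in auto)
  moreover have "1 * l t + ((0 * p t - 5/8 * 1) / (p t * p t) + (0 * q t - 11/8 * ep * ep) / (q t * q t)) * t = K' t"
  proof -
   have frac: "a / P - a * d / P^2 = a / P^2" if "P = 1 + d" "P ~= 0" for a P d :: real
   proof -
    have "a / P = a * P / P^2" using that(2) by (simp add: power2_eq_square)
    thus ?thesis unfolding that(1) by (simp add: diff_divide_distrib[symmetric] algebra_simps)
   qed
   have "5/8 / p t - 5/8 * t / (p t)^2 = 5/8 / (p t)^2" by (rule frac) (use pq0(1)[OF t] in "auto simp: p_def")
   moreover have "11/8 * ep / q t - 11/8 * ep * (ep * t) / (q t)^2 = 11/8 * ep / (q t)^2"
    by (rule frac) (use pq0(2)[OF t] in "auto simp: q_def")
   ultimately show ?thesis unfolding l_def K'_def by (simp add: power2_eq_square algebra_simps)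
  qed
  ultimately show ?thesis by simp
 qed
 have DV: "DERIV V t :> V1 t" if t: "t >= 0" for t
 proof -
  have "DERIV V t :> 0 + ((g1 t * g t + g1 t * g t) * t + 1 * (g t * g t)) - n * g1 t + 2 * (K' t * g t + g1 t * K t)"
   unfolding V_def[abs_def] power2_eq_square
   by (intro DERIV_add DERIV_diff DERIV_const DERIV_mult DERIV_ident DERIV_cmult Dg DK t)
  thus ?thesis unfolding V1_def by (rule DERIV_cong) (simp add: power2_eq_square algebra_simps)
 qed
 have Dh: "DERIV h t :> h1 t" if t: "t >= 0" for t
  unfolding h_def[abs_def] h1_def by (intro DERIV_add DERIV_cdivide DERIV_cmult DV Dg t)
 have Dps: "DERIV (ps) t :> g t / 2" if t: "t >= 0" for t
 proof -
  have "DERIV (%t. (p t / q t) powr (3/8)) t :> (3/8) * (p t / q t) powr (3/8 - 1) * ((1 * q t - p t * ep) / (q t * q t))"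
   using pq0[OF t] by (intro DERIV_fun_powr[unfolded of_nat_1] DERIV_divide Dp Dq) auto
  hence "DERIV (ps) t :> (4 / 3 * ta / (1 - ep)) * ((3/8) * (p t / q t) powr (3/8 - 1) * ((1 * q t - p t * ep) / (q t * q t)))"
   unfolding ps_def[abs_def] by (rule DERIV_cmult)
  moreover have "(4 / 3 * ta / (1 - ep)) * ((3/8) * (p t / q t) powr (3/8 - 1) * ((1 * q t - p t * ep) / (q t * q t))) = g t / 2"
  proof -
   have e: "1 * q t - p t * ep = 1 - ep" by (simp add: p_def q_def algebra_simps)
   have a: "(p t / q t) powr (3/8 - 1) = p t powr (-(5/8)) / q t powr (-(5/8))" using pq0[OF t] by (simp add: powr_divide)
   have b: "q t powr (-(11/8)) * (q t powr (-(5/8)) * (q t * q t)) = 1"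
   proof -
    have "q t powr (-(11/8)) * (q t powr (-(5/8)) * (q t * q t)) = q t powr (-(11/8) + (-(5/8) + 2))"
     unfolding powr_add using pq0[OF t] by (simp add: power2_eq_square)
    thus ?thesis using pq0[OF t] by simp
   qed
   have "(p t / q t) powr (3/8 - 1) = p t powr (-(5/8)) / q t powr (-(5/8)) * (q t powr (-(11/8)) * (q t powr (-(5/8)) * (q t * q t)))"
    unfolding a b by simp
   also have "... = p t powr (-(5/8)) * q t powr (-(11/8)) * (q t * q t)" using pq0[OF t] by simp
   finally have "(p t / q t) powr (3/8 - 1) = p t powr (-(5/8)) * q t powr (-(11/8)) * (q t * q t)" .
   thus ?thesis unfolding e g_def using eps pq0[OF t] by (simp add: field_simps)
  qed
  ultimately show ?thesis by (rule DERIV_cong)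
 qed
 have psb: "0 <= ps t" "ps t <= (4 / 3 * ta / (1 - ep)) * (1 / ep) powr (3/8)" if t: "t >= 0" for t
 proof -
  have 0: "0 <= 4 / 3 * ta / (1 - ep)" using ta eps by simp
  show "0 <= ps t" unfolding ps_def by (intro mult_nonneg_nonneg 0) simp
  have "p t / q t <= 1 / ep" using pq[OF t] pq0[OF t] eps by (simp add: field_simps)
  thus "ps t <= (4 / 3 * ta / (1 - ep)) * (1 / ep) powr (3/8)"
   unfolding ps_def using pq0[OF t] by (intro mult_left_mono 0 powr_mono2) auto
 qed
 have g0: "g t > 0" if t: "t >= 0" for t using ta pq0[OF t] by (simp add: g_def)
 have gp: "g t <= ta * p t powr (-(5/8))" if t: "t >= 0" for t
 proof -
  have "q t powr (-(11/8)) <= 1" using powr_mono[of "-(11/8)" 0 "q t"] pq[OF t] by simp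
  hence "p t powr (-(5/8)) * q t powr (-(11/8)) <= p t powr (-(5/8)) * 1" by (intro mult_left_mono) auto
  thus ?thesis unfolding g_def using ta by simp
 qed
 have pp1: "p t powr (-(5/8)) <= 1" if t: "t >= 0" for t using powr_mono[of "-(5/8)" 0 "p t"] pq[OF t] by simp
 have gta: "g t <= ta" if t: "t >= 0" for t
  by (rule order_trans[OF gp[OF t]]) (use mult_left_mono[OF pp1[OF t], of ta] ta in simp)
 have gt: "ta <= g t * (1 + t)^2" "g t * (1 + t) <= ta * (1 / ep) powr (11/8)" if t: "t >= 0" for t
 proof -
  have "g t * (1 + t)^2 = ta * ((p t powr (-(5/8)) * p t powr 2) * q t powr (-(11/8)))"
   using pq0[OF t] by (simp add: g_def p_def)
  also have "p t powr (-(5/8)) * p t powr 2 = p t powr (11/8)" unfolding powr_add[symmetric] by simp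
  also have "p t powr (11/8) * q t powr (-(11/8)) = (p t / q t) powr (11/8)"
  proof -
   have "q t powr (-(11/8)) = inverse (q t powr (11/8))" by (rule powr_minus)
   moreover have "(p t / q t) powr (11/8) = p t powr (11/8) / q t powr (11/8)" by (rule powr_divide)
   ultimately show ?thesis by (simp only: divide_inverse)
  qed
  finally have e: "g t * (1 + t)^2 = ta * (p t / q t) powr (11/8)" .
  have "1 <= p t / q t" "p t / q t <= 1 / ep" using pq[OF t] pq0[OF t] eps by (auto simp: field_simps)
  hence b: "1 <= (p t / q t) powr (11/8)" "(p t / q t) powr (11/8) <= (1 / ep) powr (11/8)"
   by (auto intro!: powr_mono2 ge_one_powr_ge_zero)
  show "ta <= g t * (1 + t)^2" unfolding e using b(1) ta by simp
  have "g t * (1 + t) * 1 <= g t * (1 + t) * (1 + t)" using g0[OF t] t by (intro mult_left_mono) auto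
  also have "... = ta * (p t / q t) powr (11/8)" unfolding e[symmetric] by (simp add: power2_eq_square)
  also have "... <= ta * (1 / ep) powr (11/8)" using b(2) ta by simp
  finally show "g t * (1 + t) <= ta * (1 / ep) powr (11/8)" by simp
 qed
 \<comment> \<open>The part of the slope that is due to the second factor; only this part can push K
   above 5/8.\<close>
 define K2 where "K2 t = 11/8 * (ep * t / q t)" for t
 have K1: "K t - K2 t <= 5/8" "0 <= K t - K2 t" "0 <= K2 t" "K2 t <= 11/8" if t: "t >= 0" for t
 proof -
  have e: "K t - K2 t = 5/8 * (t / p t)" unfolding K_def K2_def l_def by (simp add: algebra_simps)
  have "t / p t <= 1" "0 <= t / p t" "ep * t / q t <= 1" "0 <= ep * t / q t"
   using t eps pq0[OF t] by (auto simp: p_def q_def)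
  thus "K t - K2 t <= 5/8" "0 <= K t - K2 t" "0 <= K2 t" "K2 t <= 11/8" using e K2_def[of t] by linarith+
 qed
 have K02: "0 <= K t" "K t <= 2" if t: "t >= 0" for t using K1[OF t] by linarith+
 have K'b: "0 <= t * K' t" "t * K' t <= 2" if t: "t >= 0" for t
 proof -
  have sq: "d / (1 + d)^2 <= 1" if "d >= 0" for d :: real
  proof -
   have "d <= (1 + d)^2" using that by (simp add: power2_eq_square algebra_simps add_increasing)
   moreover have "0 < (1 + d)^2" using that by simp
   ultimately show ?thesis by (simp only: divide_le_eq_1_pos)
  qed
  have "t / (p t)^2 <= 1" "ep * t / (q t)^2 <= 1" unfolding p_def q_def using t eps by (intro sq; simp)+
  moreover have "t * K' t = 5/8 * (t / (p t)^2) + 11/8 * (ep * t / (q t)^2)" by (simp add: K'_def algebra_simps)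
  ultimately show "t * K' t <= 2" by linarith
  show "0 <= t * K' t" using t eps by (simp add: K'_def)
 qed
 \<comment> \<open>Either the right side is at least 1, which the fraction never exceeds, or ep p =
   (r p^(1/4))^4 is at most its fourth root.\<close>
 have zr: "ep * t / q t <= r * p t powr (1/4)" if t: "t >= 0" for t
 proof (cases "r * p t powr (1/4) >= 1")
  case True
  have "ep * t / q t <= 1" using t eps pq0[OF t] by (auto simp: q_def)
  thus ?thesis using True by linarith
 next
  case False
  have "ep * t / q t <= ep * t / 1" using t eps pq[OF t] by (intro divide_left_mono) auto
  also have "... <= ep * p t" using eps by (simp add: p_def)
  also have "p t = (p t powr (1/4)) ^ 4" using pq0[OF t] by (simp add: powr_realpow[symmetric] powr_powr)
  also have "ep * (p t powr (1/4)) ^ 4 = (r * p t powr (1/4)) ^ 4" by (simp add: ep_def power_mult_distrib)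
  also have "... <= (r * p t powr (1/4)) ^ 1" using False r0 by (intro power_decreasing) auto
  finally show ?thesis by simp
 qed
 \<comment> \<open>The exponent 5/8 leaves room for the additional p^(1/4): for g^2 t the powers add
   up to -5/4 + 1 + 1/4 = 0.\<close>
 have g4: "g t * p t powr (1/4) <= ta" "(g t)^2 * t * p t powr (1/4) <= ta^2" if t: "t >= 0" for t
 proof -
  have "g t * p t powr (1/4) <= ta * p t powr (-(5/8)) * p t powr (1/4)" by (intro mult_right_mono gp t) simp
  also have "... = ta * p t powr (-(5/8) + 1/4)" unfolding powr_add by simp
  also have "p t powr (-(5/8) + 1/4) <= p t powr 0" using pq[OF t] by (intro powr_mono) auto
  finally show "g t * p t powr (1/4) <= ta" using ta pq0[OF t] by simp
  have "(g t)^2 * t * p t powr (1/4) <= (ta * p t powr (-(5/8)))^2 * p t powr 1 * p t powr (1/4)"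
   using g0[OF t] t gp[OF t] pq0[OF t] by (intro mult_mono power_mono) (auto simp: p_def)
  also have "... = ta^2 * p t powr (-(5/8) + (-(5/8) + (1 + 1/4)))" unfolding powr_add by (simp add: power2_eq_square)
  also have "... = ta^2" using pq0[OF t] by simp
  finally show "(g t)^2 * t * p t powr (1/4) <= ta^2" .
 qed
 have g2t: "0 <= (g t)^2 * t" "(g t)^2 * t <= ta^2" if t: "t >= 0" for t
 proof -
  show "0 <= (g t)^2 * t" using t by simp
  have "(g t)^2 * t * 1 <= (g t)^2 * t * p t powr (1/4)" using t pq[OF t] by (intro mult_left_mono ge_one_powr_ge_zero) auto
  thus "(g t)^2 * t <= ta^2" using g4(2)[OF t] by simp
 qed
 have K2g: "K2 t * g t <= 11/8 * (r * ta)" "K2 t * ((g t)^2 * t) <= 11/8 * (r * ta^2)" if t: "t >= 0" for t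
 proof -
  have K2: "K2 t <= 11/8 * (r * p t powr (1/4))" using zr[OF t] by (simp add: K2_def)
  have "K2 t * g t <= 11/8 * (r * p t powr (1/4)) * g t" using K2 g0[OF t] by (intro mult_right_mono) auto
  also have "... = 11/8 * (r * (g t * p t powr (1/4)))" by simp
  also have "... <= 11/8 * (r * ta)" using r0 by (intro mult_left_mono g4 t) auto
  finally show "K2 t * g t <= 11/8 * (r * ta)" .
  have "K2 t * ((g t)^2 * t) <= 11/8 * (r * p t powr (1/4)) * ((g t)^2 * t)" using K2 g2t[OF t] by (intro mult_right_mono) auto
  also have "... = 11/8 * (r * ((g t)^2 * t * p t powr (1/4)))" by simp
  also have "... <= 11/8 * (r * ta^2)" using r0 by (intro mult_left_mono g4 t) auto
  finally show "K2 t * ((g t)^2 * t) <= 11/8 * (r * ta^2)" .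
 qed
 have main: "k^2 / 4 <= k^2 / 2 + (g t)^2 * t * (11 / 8 - 2 * K t) + g t * (2 * (t * K' t) - 2 * (K t)^2 + 3 / 2 * K t + n / 4 - 1 / 2)"
  if t: "t >= 0" for t
 proof -
  have "- 2 * K2 t <= 11 / 8 - 2 * K t" using K1[OF t] by linarith
  hence a: "(g t)^2 * t * (- 2 * K2 t) <= (g t)^2 * t * (11 / 8 - 2 * K t)" using g2t[OF t] by (intro mult_left_mono)
  have "- 2 * (K t * K2 t) <= K t * (3 / 2 - 2 * K t)"
  proof -
   have "K t * (- 2 * K2 t) <= K t * (3 / 2 - 2 * K t)" using K1[OF t] K02[OF t] by (intro mult_left_mono) auto
   thus ?thesis by simp
  qed
  moreover have "K t * K2 t <= 2 * K2 t" using K02[OF t] K1[OF t] by (intro mult_right_mono) auto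
  moreover have "K t * (3 / 2 - 2 * K t) = 3 / 2 * K t - 2 * (K t)^2" by (simp add: power2_eq_square algebra_simps)
  ultimately have "- 4 * K2 t <= 2 * (t * K' t) - 2 * (K t)^2 + 3 / 2 * K t + n / 4 - 1 / 2" using K'b(1)[OF t] n by linarith
  hence b: "g t * (- 4 * K2 t) <= g t * (2 * (t * K' t) - 2 * (K t)^2 + 3 / 2 * K t + n / 4 - 1 / 2)"
   using g0[OF t] by (intro mult_left_mono) auto
  have c: "r * ta^2 * 24 + r * ta * 24 <= k^2" using rk by (simp add: algebra_simps)
  have d: "(g t)^2 * t * (- 2 * K2 t) = - 2 * (K2 t * ((g t)^2 * t))" "g t * (- 4 * K2 t) = - 4 * (K2 t * g t)" by simp_all
  have "0 <= r * ta^2" "0 <= r * ta" using r0 ta by auto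
  thus ?thesis using a[unfolded d] b[unfolded d] K2g[OF t] c by linarith
 qed
 have tg1: "t * g1 t = - (K t * g t)" for t by (simp add: g1_def K_def)
 have Kg: "0 <= K t * g t" "K t * g t <= 2 * ta" if t: "t >= 0" for t
  using mult_mono[of "K t" 2 "g t" ta] K02[OF t] g0[OF t] gta[OF t] by auto
 have n0: "0 <= n" using n by simp
 have ng: "0 <= n * g t" "n * g t <= n * ta" if t: "t >= 0" for t using n0 g0[OF t] gta[OF t] by (auto intro: mult_left_mono)
 have Vb: "abs (V t) <= k^2 + ta^2 + n * ta + 4 * ta" if t: "t >= 0" for t
  unfolding V_def using g2t[OF t] ng[OF t] Kg[OF t] ta by (intro abs_leI) (use zero_le_power2[of k] zero_le_power2[of ta] in linarith)+
 have cg: "0 <= (c + 1/4) * g t" "(c + 1/4) * g t <= n * ta" if t: "t >= 0" for t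
 proof -
  have c: "0 <= c + 1/4" "c + 1/4 <= n" using n by (auto simp: c_def field_simps)
  show "0 <= (c + 1/4) * g t" "(c + 1/4) * g t <= n * ta" using c g0[OF t] gta[OF t] n by (auto intro!: mult_mono)
 qed
 have hb: "abs (h t) <= k^2 + ta^2 + 2 * (n * ta) + 4 * ta" if t: "t >= 0" for t
  unfolding h_def using Vb[OF t] cg[OF t] zero_le_power2[of k] zero_le_power2[of ta] ta by linarith
 have h1b: "abs (t * h1 t) <= 10 * ta^2 + 10 * (n * ta) + 20 * ta" if t: "t >= 0" for t
 proof -
  have e: "t * h1 t = - ((g t)^2 * t * K t) + (g t)^2 * t / 2 + n * (K t * g t) / 2 + (t * K' t) * g t - K t * (K t * g t) - K t * ((c + 1/4) * g t)"
   unfolding h1_def V1_def g1_def K_def by (simp add: power2_eq_square field_simps)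
  have mm: "0 <= a * b" "a * b <= A * C" if "0 <= a" "a <= A" "0 <= b" "b <= C" for a b A C :: real
   using that by (auto intro: mult_mono)
  note 1 = mm[OF g2t[OF t] K02[OF t]]
  note 2 = mm[OF n0 order_refl Kg[OF t]]
  note 3 = mm[OF K'b[OF t] less_imp_le[OF g0[OF t]] gta[OF t]]
  note 4 = mm[OF K02[OF t] Kg[OF t]]
  note 5 = mm[OF K02[OF t] cg[OF t]]
  have 6: "n * (2 * ta) = 2 * (n * ta)" "0 <= n * ta" using n0 ta by auto
  show ?thesis unfolding e using 1 2 3 4 5 6 g2t[OF t] ta by linarith
 qed
 have contp: "continuous_on {0..} p" "continuous_on {0..} q" unfolding p_def[abs_def] q_def[abs_def] by (intro continuous_intros)+
 have contg: "continuous_on {0..} g" using Dg by (meson DERIV_isCont atLeast_iff continuous_at_imp_continuous_on)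
 have contl: "continuous_on {0..} l" "continuous_on {0..} K'" unfolding l_def[abs_def] K'_def[abs_def]
  using pq0 by (intro continuous_intros contp; force)+
 have contg1: "continuous_on {0..} g1" unfolding g1_def[abs_def] by (intro continuous_intros contg contl)
 have conth1: "continuous_on {0..} h1" unfolding h1_def[abs_def] V1_def[abs_def] K_def[abs_def]
  by (intro continuous_intros contg contl contg1) auto
 define B where "B = ta * (1 / ep) powr (11/8) + (k^2 + 10 * ta^2 + 10 * (n * ta) + 20 * ta)"
 have pos: "0 <= ta * (1 / ep) powr (11/8)" "0 <= n * ta" "0 <= k^2" "0 <= ta^2" using ta n0 by auto
 show thesis
 proof (rule that[OF Dps psb Dg contg1 Dh conth1 _ _ gt(1)])
  show "V t = k^2 + (g t)^2 * t - n * g t - 2 * t * g1 t" for t unfolding V_def mult.assoc tg1 by simp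
  show "h t = V t / 2 + ((n - 1) / 2 + (1 / 2) / 2) * g t" for t by (simp add: h_def c_def)
  fix t :: real assume t: "t >= 0"
  show "g t * (1 + t) <= B" using gt(2)[OF t] pos ta unfolding B_def by linarith
  show "abs (t * g1 t) <= B" unfolding tg1 using Kg[OF t] pos ta unfolding B_def by linarith
  show "abs (h t) <= B" using hb[OF t] pos ta unfolding B_def by linarith
  show "abs (t * h1 t) <= B" using h1b[OF t] pos ta unfolding B_def by linarith
  show "abs (V t) <= B" using Vb[OF t] pos ta unfolding B_def by linarith
  have "2 * t * h1 t + n * h t - c * V t - 2 * c^2 * g t - (1 / 2)^2 / 2 * (g t)^2 * t
    = k^2 / 2 + (g t)^2 * t * (11 / 8 - 2 * K t) + g t * (2 * (t * K' t) - 2 * (K t)^2 + 3 / 2 * K t + n / 4 - 1 / 2)"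
   unfolding h1_def h_def V_def V1_def K_def g1_def by (rule virial_weight_identity[OF c_def])
  thus "k^2 / 4 <= 2 * t * h1 t + n * h t - (n - 1) / 2 * V t - 2 * ((n - 1) / 2)^2 * g t - (1 / 2)^2 / 2 * (g t)^2 * t"
   using main[OF t] unfolding c_def by linarith
 qed
qed

lemma weighted_square_bound:
 fixes x :: "'a::euclidean_space"
 assumes ta: "ta > 0" and G: "!!t. t >= 0 ==> ta <= G t * (1 + t)^2" and y: "abs y <= Y * jp x s"
 shows "0 < G (x *. x)" "y^2 / (8 * G (x *. x)) <= Y^2 / (8 * ta) * jp x (2 * s - 4)"
proof -
 have "(1 + x *. x)^2 = ((jb x)^2)^2" by (simp add: jb_square dot_square_norm)
 also have "... = jb x powr 4" using jb_pos[of x] by (simp add: power_mult[symmetric])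
 finally have "ta <= G (x *. x) * jb x powr 4" using G[of "x *. x"] by simp
 thus G0: "0 < G (x *. x)" using ta jb_pos[of x] by (auto intro: ccontr simp: zero_less_mult_iff dest: less_le_trans)
 have 1: "1 / (8 * G (x *. x)) <= jb x powr 4 / (8 * ta)" using ta G0 `ta <= _` by (simp add: field_simps)
 have 2: "y^2 <= (Y * jp x s)^2" using y by (metis abs_le_square_iff abs_ge_self order_trans)
 have "y^2 * (1 / (8 * G (x *. x))) <= (Y * jp x s)^2 * (jb x powr 4 / (8 * ta))" using 1 2 G0 by (intro mult_mono) auto
 also have "... = Y^2 / (8 * ta) * (jp x s * (jp x s * jb x powr 4))" by (simp add: power2_eq_square)
 also have "jp x s * (jp x s * jb x powr 4) = jp x (2 * s - 4)" unfolding powr_add[symmetric] by simp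
 finally show "y^2 / (8 * G (x *. x)) <= Y^2 / (8 * ta) * jp x (2 * s - 4)" by simp
qed

lemma weighted_square_integrable:
 fixes f :: "'a::euclidean_space => real"
 assumes ta: "ta > 0" "!!t. t >= 0 ==> ta <= G t * (1 + t)^2" and c: "continuous_on {0..} G"
  and f: "decays s f" "f : bmeas" and s: "2 * s - 4 > real DIM('a)"
 shows "intble (%x. (f x)^2 / (8 * G (x *. x)))"
proof -
 obtain C where C: "!!x. abs (f x) <= C * jp x s" using f(1) by (elim decaysE) blast
 note w = weighted_square_bound[where G = G, OF ta C]
 have "decays (2 * s - 4) (%x. (f x)^2 / (8 * G (x *. x)))" by (rule decaysI[of _ "C^2 / (8 * ta)"]) (use w in "simp add: less_imp_le")
 moreover have "(%x::'a. G (x *. x)) : bmeas" by (intro borel_measurable_continuous_onI continuous_radial c)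
 ultimately show ?thesis by (intro decays_integrable[OF _ s]) (use f(2) in auto)
qed

text \<open>Conjugation with E = exp ps: the gradient of ps(|x|^2) is g x, so E U satisfies an
  equation with drift -2 g x . grad and potential V = k^2 + g^2 t - N g - 2 t g', to which the
  virial estimate applies. The weight is chosen before U, and large values of the free parameter ta
  make the right side small enough to absorb a zeroth-order term of any size and decay of order
  2.\<close>

lemma carleman:
 fixes k ta :: real
 assumes k: "k > 0" and ta: "ta > 0" and dim: "DIM('a::euclidean_space) >= 3"
 defines "N == real DIM('a)" obtains E :: "real => real" and M :: real and G :: "real => real" where
  "!!t. t >= 0 ==> 1 <= E t" "!!t. t >= 0 ==> E t <= M"
  "!!t. t >= 0 ==> ta <= G t * (1 + t)^2"
  "continuous_on {0..} E" "continuous_on {0..} G"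
  "!!(U :: 'a => real) U1 U2. C2_decays ((N + 1) / 2) U U1 U2 ==> decays (N + 1) (%x. (SUM b:Basis. U2 b b x) + k^2 * U x) ==>
    k^2 / 4 * (LBINT x. (E (x *. x) * U x)^2)
     <= (LBINT x. (E (x *. x) * ((SUM b:Basis. U2 b b x) + k^2 * U x))^2 / (8 * G (x *. x)))"
proof -
 have N3: "N >= 3" using dim by (simp add: N_def)
 hence N2: "N >= 2" by simp
 show thesis
 proof (cases rule: virial_weight[OF k ta N2, case_names weight])
 case w: (weight ps g g1 h h1 V M0 B)
 define E where "E t = exp (ps t)" for t
 define M where "M = exp M0"
 have E1: "1 <= E t" "E t <= M" if "t >= 0" for t using w(2,3)[OF that] by (auto simp: E_def M_def)
 have M1: "1 <= M" using E1[of 0] by simp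
 have B0: "0 <= B" using w(13)[of 0] by simp
 have g0: "0 < g t" if t: "t >= 0" for t
 proof -
  have "0 < g t * (1 + t)^2" using w(10)[OF t] ta by linarith
  thus ?thesis using t by (simp add: zero_less_mult_iff)
 qed
 have xx: "x *. x >= 0" for x :: 'a by simp
 have cg: "continuous_on {0..} g" using w(4) by (meson DERIV_isCont atLeast_iff continuous_at_imp_continuous_on)
 have cE: "continuous_on {0..} E" unfolding E_def[abs_def] using w(1)
  by (intro continuous_on_exp) (meson DERIV_isCont atLeast_iff continuous_at_imp_continuous_on)
 note cx = continuous_radial[OF cE, where 'a='a] continuous_radial[OF cg, where 'a='a] continuous_radial[OF w(5), where 'a='a]
 show thesis
 proof (rule that[OF E1 w(10) cE cg])
  fix U :: "'a => real" and U1 :: "'a => 'a => real" and U2 :: "'a => 'a => 'a => real"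
  assume C2: "C2_decays ((N + 1) / 2) U U1 U2" and dW: "decays (N + 1) (%x. (SUM b:Basis. U2 b b x) + k^2 * U x)"
  note cU = C2_decaysD(1,4,7)[OF C2] and bU = C2_decaysD(2,5,8)[OF C2] and pd1 = C2_decaysD(3)[OF C2] and pd2 = C2_decaysD(6)[OF C2] and sym = C2_decaysD(9)[OF C2]
  define W where "W x = (SUM b:Basis. U2 b b x) + k^2 * U x" for x
  let ?g = "%x::'a. g (x *. x)" and ?g1 = "%x::'a. g1 (x *. x)" and ?E = "%x::'a. E (x *. x)"
  define v where "v x = ?E x * U x" for x
  define v1 where "v1 b x = ?E x * (U1 b x + ?g x * (x *. b) * U x)" for b x
  define v2 where "v2 a b x = ?E x * (U2 a b x + ?g x * (x *. b) * U1 a x + ?g x * (x *. a) * U1 b x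
    + (?g x * (b *. a) + 2 * (?g1 x * ((x *. a) * (x *. b))) + ?g x * ?g x * ((x *. a) * (x *. b))) * U x)" for a b x
  have pdE: "has_pd b ?E (%x. E (x *. x) * ?g x * (x *. b))" for b
  proof -
   have "DERIV E t :> E t * (g t / 2)" if "t >= 0" for t
    unfolding E_def[abs_def] by (rule DERIV_chain2[OF DERIV_exp w(1)[OF that]])
   hence "has_pd b ?E (%x. (E (x *. x) * (?g x / 2)) * (2 * (x *. b)))"
    by (intro has_pd_radial[of E "%t. E t * (g t / 2)"]) simp
   thus ?thesis by (rule has_pd_cong) simp
  qed
  have pdg: "has_pd b ?g (%x. ?g1 x * (2 * (x *. b)))" for b by (rule has_pd_radial) (simp add: w(4))
  have pdv: "has_pd b v (v1 b)" if b: "b : Basis" for b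
   unfolding v_def[abs_def] by (rule has_pd_cong[OF has_pd_mult[OF pdE pd1[OF b]]]) (simp add: v1_def algebra_simps)
  have pdv1: "has_pd b (v1 a) (v2 a b)" if a: "a : Basis" and b: "b : Basis" for a b unfolding v1_def[abs_def]
   by (rule has_pd_cong[OF has_pd_mult[OF pdE has_pd_add[OF pd2[OF a b] has_pd_mult[OF has_pd_mult[OF pdg has_pd_inner] pd1[OF b]]]]])
     (simp add: v2_def algebra_simps)
  have symv: "v2 a b x = v2 b a x" if "a : Basis" "b : Basis" for a b x
   unfolding v2_def sym[OF that] by (simp add: inner_commute mult.commute[of "x *. a"])
  have e: "(SUM b:Basis. v2 b b x) - 2 * ?g x * (SUM b:Basis. (x *. b) * v1 b x) + V (x *. x) * v x = ?E x * W x" for x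
  proof -
   have t: "(SUM b:Basis. (x *. b) * (x *. b)) = x *. x" by (rule euclidean_inner[symmetric])
   define L where "L = (SUM b:Basis. (x *. b) * U1 b x)"
   have "(SUM b:Basis. (x *. b) * v1 b x) = (SUM b:Basis. ?E x * ((x *. b) * U1 b x) + ?E x * ?g x * U x * ((x *. b) * (x *. b)))"
    by (intro sum.cong refl) (simp add: v1_def algebra_simps)
   also have "... = ?E x * L + ?E x * ?g x * U x * (x *. x)" unfolding sum.distrib sum_distrib_left[symmetric] t L_def ..
   finally have 1: "(SUM b:Basis. (x *. b) * v1 b x) = ?E x * L + ?E x * ?g x * U x * (x *. x)" .
   have "(SUM b:Basis. v2 b b x) = (SUM b:Basis. ?E x * U2 b b x + 2 * ?E x * ?g x * ((x *. b) * U1 b x) + ?E x * ?g x * U x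
     + ?E x * (2 * ?g1 x + ?g x * ?g x) * U x * ((x *. b) * (x *. b)))"
    by (intro sum.cong refl) (simp add: v2_def inner_Basis algebra_simps)
   also have "... = ?E x * (SUM b:Basis. U2 b b x) + 2 * ?E x * ?g x * L + N * (?E x * ?g x * U x) + ?E x * (2 * ?g1 x + ?g x * ?g x) * U x * (x *. x)"
    unfolding sum.distrib sum_distrib_left[symmetric] t L_def[symmetric] sum_constant N_def by (simp only: mult_ac)
   finally have 2: "(SUM b:Basis. v2 b b x) = ?E x * (SUM b:Basis. U2 b b x) + 2 * ?E x * ?g x * L + N * (?E x * ?g x * U x) + ?E x * (2 * ?g1 x + ?g x * ?g x) * U x * (x *. x)" .
   show ?thesis unfolding 1 2 w(8)[OF xx] v_def W_def by (simp add: power2_eq_square algebra_simps)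
  qed
  have dE: "decays 0 ?E" by (rule decays_radial[of E M]) (use E1 in "force simp: abs_le_iff intro: order_trans")
  have dg: "decays 2 ?g" by (rule decays_radial_2[OF g0 w(11)])
  have dgx: "decays 0 (%x. ?g x * (x *. b))" "decays 0 (%x. ?g x * ((x *. a) * (x *. b)))" if "a : Basis" "b : Basis" for a b
   using decays_mult[OF dg decays_inner[OF that(2)], of 0] decays_mult[OF dg decays_mult[OF decays_inner[OF that(1)] decays_inner[OF that(2)], of "-2"], of 0]
   by simp_all
  have dg1: "decays 0 (%x. ?g1 x * ((x *. a) * (x *. b)))" if "a : Basis" "b : Basis" for a b
  proof (rule decays_le[OF decays_radial[of "%t. t * g1 t", OF w(12)]])
   fix x :: 'a
   have "abs (x *. a) * abs (x *. b) <= norm x * norm x" using that by (intro mult_mono Basis_le_norm) auto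
   hence "abs (?g1 x) * (abs (x *. a) * abs (x *. b)) <= abs (?g1 x) * (x *. x)"
    by (intro mult_left_mono) (auto simp: dot_square_norm power2_eq_square)
   thus "abs (?g1 x * ((x *. a) * (x *. b))) <= abs ((x *. x) * ?g1 x)" by (simp add: abs_mult mult_ac)
  qed
  let ?s = "(N + 1) / 2"
  have m0: "decays ?s (%x. F x * G x)" if "decays 0 F" "decays ?s G" for F G :: "'a => real"
   by (rule decays_mult[OF that]) simp
  have C2v: "C2_decays ?s v v1 v2" unfolding C2_decays_def
  proof (intro conjI ballI allI)
   show "cont v" unfolding v_def[abs_def] by (intro continuous_intros cx cU)
   show "decays ?s v" unfolding v_def[abs_def] by (intro m0 dE bU)
   fix b :: 'a assume b: "b : Basis"
   show "has_pd b v (v1 b)" by (rule pdv[OF b])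
   show "cont (v1 b)" unfolding v1_def[abs_def] by (intro continuous_intros cx cU b)
   show "decays ?s (v1 b)" unfolding v1_def[abs_def] by (intro m0[OF dE] decays_add bU m0[OF dgx(1)[OF b b]] b)
   fix a :: 'a assume a: "a : Basis"
   show "has_pd a (v1 b) (v2 b a)" by (rule pdv1[OF b a])
   show "cont (v2 b a)" unfolding v2_def[abs_def] by (intro continuous_intros cx cU a b)
   have "decays 0 (%x. ?g x * (a *. b) + 2 * (?g1 x * ((x *. b) * (x *. a))) + ?g x * ?g x * ((x *. b) * (x *. a)))"
    unfolding mult.assoc by (intro decays_add decays_cmult dg1[OF b a] decays_mult[OF dg dgx(2)[OF b a]] decays_mult[OF dg decays_bounded]) auto
   note q = m0[OF this bU(1)]
   show "decays ?s (v2 b a)" unfolding v2_def[abs_def] by (intro m0[OF dE] decays_add bU m0[OF dgx(1)[OF a a]] m0[OF dgx(1)[OF b b]] q a b)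
   show "v2 b a x = v2 a b x" for x by (rule symv[OF b a])
  qed
  have dP: "decays (N + 1) (%x. ?E x * W x)" unfolding W_def by (rule decays_mult[OF dE dW]) simp
  have Pi: "intble (%x. (?E x * W x)^2 / (8 * ?g x))" by (rule weighted_square_integrable[OF ta w(10) cg dP]) (use N3 cx cU in "auto simp: N_def W_def intro!: continuous_intros borel_measurable_continuous_onI")
  show "k^2 / 4 * (LBINT x. (E (x *. x) * U x)^2)
     <= (LBINT x. (E (x *. x) * ((SUM b:Basis. U2 b b x) + k^2 * U x))^2 / (8 * g (x *. x)))"
  proof -
   have "k^2 / 4 * (LBINT x. (v x)^2) <= (LBINT x. (?E x * W x)^2 / (8 * ?g x))"
    by (rule virial_estimate[of v v1 v2 h h1 B V g "1/2" "k^2 / 4", folded N_def, unfolded e, OF C2v w(6,7) w(13-15) g0 w(11) w(9) decays_mono[OF dP] w(16) Pi])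
      (use N3 in simp_all)
   thus ?thesis by (simp only: v_def W_def)
  qed
 qed
 qed
qed

section \<open>Uniqueness for the linear equation\<close>

lemma lborel_integral_scale:
 fixes f :: "'a::euclidean_space => real"
 assumes d: "d > 0" and f: "f : bmeas"
 shows "(LBINT x. f x) = d ^ DIM('a) * (LBINT x. f (d *R x))"
proof -
 have "(LBINT x. f x) = (LINT x|density (distr lborel borel (%x. 0 + d *R x)) (%_. abs d ^ DIM('a)). f x)"
  using lborel_affine[of d "0::'a"] d by simp
 also have "... = (LINT x|distr lborel borel (%x. 0 + d *R x). (abs d ^ DIM('a)) *R f x)"
  by (rule integral_density) (use f d in auto)
 also have "... = (LBINT x. (abs d ^ DIM('a)) *R f (0 + d *R x))" by (rule integral_distr) (use f in auto)
 finally show ?thesis using d by simp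
qed

lemma compact_support_bound:
 fixes f :: "'a::euclidean_space => real"
 assumes f: "cont f" and z: "!!x. norm x >= R ==> f x = 0" obtains C where "C >= 0" "!!x. abs (f x) <= C * jp x s"
proof -
 have "compact ((%x. f x * jb x powr s) ` cball 0 R)"
  by (intro compact_continuous_image continuous_intros continuous_on_subset[OF f]) auto
 hence "bounded ((%x. f x * jb x powr s) ` cball 0 R)" by (rule compact_imp_bounded)
 then obtain B where "ALL y:(%x. f x * jb x powr s) ` cball 0 R. norm y <= B" unfolding bounded_iff ..
 hence B: "abs (f x * jb x powr s) <= B" if "x : cball 0 R" for x using that by simp
 have "abs (f x) <= abs B * jp x s" for x
 proof (cases "norm x <= R")
  case True
  have e: "jb x powr s * jp x s = 1" unfolding powr_add[symmetric] by simp
  have "abs (f x) = abs (f x * (jb x powr s * jp x s))" unfolding e by simp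
  also have "... = abs (f x * jb x powr s) * jp x s" by (simp add: abs_mult)
  also have "... <= abs B * jp x s" using B[of x] True by (intro mult_right_mono) auto
  finally show ?thesis .
 next
  case False thus ?thesis using z[of x] by simp
 qed
 thus thesis using that[of "abs B"] by auto
qed

lemma compact_support_decays:
 fixes f :: "'a::euclidean_space => real"
 assumes "cont f" "!!x. norm x >= R ==> f x = 0"
 shows "decays s f" using compact_support_bound[OF assms, where s = s] by (meson decaysI)

text \<open>Two continuous derivatives suffice for every test function used below, so the mollifier
  can be an explicit piecewise polynomial.\<close>

definition C2_supp :: "real => ('a::euclidean_space => real) => ('a => 'a => real) => ('a => 'a => 'a => real) => bool" where
 "C2_supp R U U1 U2 \<longleftrightarrow> cont U & (ALL x. norm x >= R --> U x = 0) &
  (ALL b:Basis. has_pd b U (U1 b) & cont (U1 b) & (ALL x. norm x >= R --> U1 b x = 0)) &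
  (ALL a:Basis. ALL b:Basis. has_pd b (U1 a) (U2 a b) & cont (U2 a b) & (ALL x. norm x >= R --> U2 a b x = 0)
   & (ALL x. U2 a b x = U2 b a x))"

lemma C2_suppD:
 assumes "C2_supp R U U1 U2"
 shows "cont U" "norm x >= R ==> U x = 0"
  "b : Basis ==> has_pd b U (U1 b)" "b : Basis ==> cont (U1 b)" "b : Basis ==> norm x >= R ==> U1 b x = 0"
  "a : Basis ==> b : Basis ==> has_pd b (U1 a) (U2 a b)" "a : Basis ==> b : Basis ==> cont (U2 a b)"
  "a : Basis ==> b : Basis ==> norm x >= R ==> U2 a b x = 0" "a : Basis ==> b : Basis ==> U2 a b x = U2 b a x"
 using assms unfolding C2_supp_def by blast+

lemma compact_support_integrable:
 fixes f :: "'a::euclidean_space => real"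
 assumes f: "cont f" and z: "!!x. norm x >= R ==> f x = 0"
 shows "intble f" by (rule decays_integrable[OF compact_support_decays[OF assms, where s = "real DIM('a) + 1"]])
   (use borel_measurable_continuous_onI[OF f] in auto)

lemma bounded_near_limit:
 fixes H :: "real => real"
 assumes l: "(H \<longlongrightarrow> l) (at_right 0)" and c: "continuous_on {0<..} H"
 shows "EX C>=0. ALL s:{0<..S}. abs (H s) <= C"
proof -
 have "eventually (%s. dist (H s) l < 1) (at_right 0)" by (rule tendstoD[OF l]) simp
 then obtain e where e: "e > 0" "!!s. 0 < s ==> s < e ==> dist (H s) l < 1" unfolding eventually_at_right_field by blast
 have "compact (H ` {e..S})" by (intro compact_continuous_image continuous_on_subset[OF c]) (use e in auto)
 hence "bounded (H ` {e..S})" by (rule compact_imp_bounded)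
 then obtain B where "ALL y:H ` {e..S}. norm y <= B" unfolding bounded_iff ..
 hence B: "abs (H s) <= B" if "s : {e..S}" for s using that by simp
 show ?thesis
 proof (intro exI[of _ "abs l + 1 + abs B"] conjI ballI)
  fix s assume s: "s : {0<..S}"
  show "abs (H s) <= abs l + 1 + abs B"
  proof (cases "s < e")
   case True thus ?thesis using e(2)[of s] s unfolding dist_real_def by auto
  next
   case False thus ?thesis using B[of s] s by auto
  qed
 qed auto
qed

text \<open>Replacing |x|^2 by |x|^2 + de removes the singularity. The radial equation at t = |x|^2
  + de contains 4 t F2, whereas the Laplacian produces 4 |x|^2 F2; the Helmholtz operator thus
  leaves only -4 de F2, and two integrations by parts move it to the test function.\<close>

lemma kernel_distribution_regularised:
 fixes ps :: "real^'n::finite => real" and F F1 F2 :: "real => real"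
 assumes F: "!!t. t > 0 ==> DERIV F t :> F1 t" "!!t. t > 0 ==> DERIV F1 t :> F2 t"
  and ode: "!!t. t > 0 ==> 4 * t * F2 t + 2 * real CARD('n) * F1 t + k^2 * F t = 0" and F2c: "continuous_on {0<..} F2"
  and C2: "C2_supp R ps ps1 ps2" and de: "de > 0"
 shows "(LBINT x. ((SUM b:Basis. ps2 b b x) + k^2 * ps x) * F (x *. x + de)) = - 4 * (LBINT x. ps x * (de * F2 (x *. x + de)))"
proof -
 note pd = C2_suppD(3)[OF C2] C2_suppD(6)[OF C2] and c = C2_suppD(1,4,7)[OF C2] and z = C2_suppD(2,5,8)[OF C2]
 define G1 where "G1 b x = F1 (x *. x + de) * (2 * (x *. b))" for b x :: "real^'n"
 define G2 where "G2 b x = F2 (x *. x + de) * (2 * (x *. b)) * (2 * (x *. b)) + 2 * (b *. b) * F1 (x *. x + de)" for b x :: "real^'n"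
 have pos: "x *. x + de > 0" for x :: "real^'n" using de by (simp add: add_nonneg_pos)
 have sh: "DERIV (%t. F (t + de)) t :> F1 (t + de)" "DERIV (%t. F1 (t + de)) t :> F2 (t + de)" if "t + de > 0" for t
  using F[OF that] DERIV_shift by blast+
 have g1: "has_pd b (%x::real^'n. F (x *. x + de)) (G1 b)" for b
  unfolding G1_def[abs_def] by (rule has_pd_radial[of "%t. F (t + de)" "%t. F1 (t + de)"]) (rule sh(1)[OF pos])
 have g2: "has_pd b (G1 b) (G2 b)" for b unfolding G1_def[abs_def] G2_def[abs_def]
  by (rule has_pd_cong[OF has_pd_mult[OF has_pd_radial[of "%t. F1 (t + de)" "%t. F2 (t + de)"] has_pd_cmult[OF has_pd_inner]]])
    (use sh(2)[OF pos] in auto)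
 have Fc: "continuous_on {0<..} F" "continuous_on {0<..} F1"
  using F by (meson DERIV_isCont greaterThan_iff continuous_at_imp_continuous_on)+
 have sq: "cont (%x::real^'n. x *. x + de)" by (intro continuous_intros)
 have cF: "cont (%x::real^'n. F (x *. x + de))" "cont (%x::real^'n. F1 (x *. x + de))" "cont (%x::real^'n. F2 (x *. x + de))"
  by (rule continuous_on_compose2[OF Fc(1) sq] continuous_on_compose2[OF Fc(2) sq] continuous_on_compose2[OF F2c sq]; use pos in auto)+
 have cG: "cont (G1 b)" "cont (G2 b)" for b unfolding G1_def[abs_def] G2_def[abs_def] by (intro continuous_intros cF)+
 define J where "J b x = ps2 b b x * F (x *. x + de) - ps x * G2 b x" for b x
 have J: "(LBINT x. J b x) = 0" "intble (J b)" if b: "b : Basis" for b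
 proof -
  have p: "has_pd b (%x. ps1 b x * F (x *. x + de) - ps x * G1 b x) (J b)"
   by (rule has_pd_cong[OF has_pd_diff[OF has_pd_mult[OF pd(2)[OF b b] g1] has_pd_mult[OF pd(1)[OF b] g2]]])
     (simp add: J_def algebra_simps)
  have "intble (%x. ps1 b x * F (x *. x + de) - ps x * G1 b x)"
   by (rule compact_support_integrable[where R = R]) (use z b in "auto intro!: continuous_intros c cF cG")
  moreover have cJ: "cont (J b)" unfolding J_def[abs_def] by (intro continuous_intros c cF cG b)
  have zJ: "J b x = 0" if "norm x >= R" for x using z that b by (simp add: J_def)
  have "decays (real DIM(real^'n) + 1) (J b)" by (rule compact_support_decays[OF cJ zJ])
  ultimately show "(LBINT x. J b x) = 0" "intble (J b)" using integral_pd_zero[OF p, of "real DIM(real^'n) + 1"] b by auto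
 qed
 have G2s: "(SUM b:Basis. G2 b x) = - 4 * de * F2 (x *. x + de) - k^2 * F (x *. x + de)" for x
 proof -
  have "(SUM b:Basis. G2 b x) = (SUM b:Basis. 4 * F2 (x *. x + de) * ((x *. b) * (x *. b)) + 2 * F1 (x *. x + de))"
   by (intro sum.cong refl) (simp add: G2_def inner_Basis)
  also have "... = 4 * F2 (x *. x + de) * (x *. x) + real CARD('n) * (2 * F1 (x *. x + de))"
   unfolding sum.distrib sum_distrib_left[symmetric] euclidean_inner[symmetric] sum_constant by simp
  finally show ?thesis using ode[OF pos[of x]] by (simp add: algebra_simps)
 qed
 have "(LBINT x. ((SUM b:Basis. ps2 b b x) + k^2 * ps x) * F (x *. x + de)) = (LBINT x. (SUM b:Basis. J b x) + (- 4) * (ps x * (de * F2 (x *. x + de))))"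
 proof (rule Lint_cong[OF refl])
  fix x
  have "(SUM b:Basis. J b x) = (SUM b:Basis. ps2 b b x) * F (x *. x + de) - ps x * (SUM b:Basis. G2 b x)"
   by (simp add: J_def sum_subtractf sum_distrib_right sum_distrib_left)
  thus "((SUM b:Basis. ps2 b b x) + k^2 * ps x) * F (x *. x + de) = (SUM b:Basis. J b x) + (- 4) * (ps x * (de * F2 (x *. x + de)))"
   unfolding G2s by (simp add: algebra_simps)
 qed
 also have "... = (LBINT x. (SUM b:Basis. J b x)) + (LBINT x. (- 4) * (ps x * (de * F2 (x *. x + de))))"
  by (intro Lint_add L1_sum J integrable_mult_right compact_support_integrable[where R = R])
    (use z in "auto intro!: continuous_intros c cF")
 also have "(LBINT x. (SUM b:Basis. J b x)) = 0" using J by (subst Lint_sum) auto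
 finally show ?thesis by simp
qed

text \<open>Re Phi_k solves the Helmholtz equation with a multiple of the point mass as source.
  Under de = d^2 and x = d y the regularised sources scale, by the limit of t^(nu+2) F2(t) at 0, to
  l times \<open>jb y\<close> to the power -(N+2), an integrable profile that concentrates at the
  origin.\<close>

lemma kernel_distribution:
 fixes k :: real
 assumes N: "CARD('n::finite) >= 3" and k: "k > 0" obtains c :: real where
  "!!(ps :: real^'n => real) ps1 ps2 R. C2_supp R ps ps1 ps2 ==>
    (LBINT x. ((SUM b:Basis. ps2 b b x) + k^2 * ps x) * RePhi k x) = c * ps 0"
proof -
 define nu where "nu = order_of TYPE('n)"
 obtain F F1 F2 :: "real => real" and l where F: "ALL x::real^'n. x ~= 0 --> RePhi k x = F (x *. x)"
   "ALL t>0. DERIV F t :> F1 t & DERIV F1 t :> F2 t & 4 * t * F2 t + 2 * real CARD('n) * F1 t + k^2 * F t = 0"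
   "ALL S. EX C>=0. ALL t:{0<..S}. abs (F t) <= C * t powr (- nu)"
  and l: "((%t. t powr (nu + 2) * F2 t) \<longlongrightarrow> l) (at_right 0)"
  using fund_sol_facts(5)[OF N k, folded nu_def] by (elim exE conjE) (rule that)
 have FF: "RePhi k x = F (x *. x)" if "x ~= 0" for x :: "real^'n" using F(1) that by blast
 have D: "DERIV F t :> F1 t" "DERIV F1 t :> F2 t"
   "4 * t * F2 t + 2 * real CARD('n) * F1 t + k^2 * F t = 0" if "t > 0" for t using F(2) that by blast+
 have Fb: "EX C>=0. ALL t:{0<..S}. abs (F t) <= C * t powr (- nu)" for S using F(3) by blast
 have Fc: "continuous_on {0<..} F" "continuous_on {0<..} F1"
  using D by (meson DERIV_isCont greaterThan_iff continuous_at_imp_continuous_on)+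
 have F2c: "continuous_on {0<..} F2"
 proof -
  have "continuous_on {0<..} (%t. - (2 * real CARD('n) * F1 t + k^2 * F t) / (4 * t))" by (intro continuous_intros Fc) auto
  moreover have "- (2 * real CARD('n) * F1 t + k^2 * F t) / (4 * t) = F2 t" if "t : {0<..}" for t
   using D(3)[of t] that by (simp add: field_simps)
  ultimately show ?thesis by (rule continuous_on_eq)
 qed
 define H where "H t = t powr (nu + 2) * F2 t" for t
 have Hc: "continuous_on {0<..} H" unfolding H_def[abs_def] by (intro continuous_intros F2c) auto
 have Hl: "(H \<longlongrightarrow> l) (at_right 0)" using l by (simp add: H_def[abs_def])
 define I where "I = (LBINT y. jp (y::real^'n) (real CARD('n) + 2))"
 show thesis
 proof (rule that[of "- 4 * (l * I)"])
  fix ps :: "real^'n => real" and ps1 ps2 R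
  assume C2: "C2_supp R ps ps1 ps2"
  note pd = C2_suppD(3)[OF C2] C2_suppD(6)[OF C2] and c = C2_suppD(1,4,7)[OF C2] and z = C2_suppD(2,5,8)[OF C2]
  define L where "L x = (SUM b:Basis. ps2 b b x) + k^2 * ps x" for x
  have Lc: "cont L" unfolding L_def[abs_def] by (intro continuous_intros c)
  have Lz: "L x = 0" if "norm x >= R" for x using z that by (simp add: L_def)
  have Lm: "L : bmeas" by (rule borel_measurable_continuous_onI[OF Lc])
  have psm: "ps : bmeas" by (rule borel_measurable_continuous_onI[OF c(1)])
  define d where "d n = 1 / (real n + 1)" for n
  have d: "0 < d n" "d n <= 1" for n by (auto simp: d_def)
  have d0: "d ----> 0" unfolding d_def[abs_def] using LIMSEQ_inverse_real_of_nat by (simp add: inverse_eq_divide add.commute)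
  have d2: "(%n. (d n)^2) ----> 0" using tendsto_power[OF d0, of 2] by simp
  have d2': "0 < (d n)^2" "(d n)^2 <= 1" for n using d[of n] by (auto simp: power_le_one)
  have reg: "(LBINT x. L x * F (x *. x + (d n)^2)) = - 4 * (LBINT x. ps x * ((d n)^2 * F2 (x *. x + (d n)^2)))" for n
   unfolding L_def by (rule kernel_distribution_regularised[where R = R]) (fact D F2c C2 d2'(1))+
  define S where "S = R^2 + 1"
  have inS: "x *. x + (d n)^2 : {0<..S}" if "norm x < R" for x :: "real^'n" and n
  proof -
   have "(norm x)^2 <= R^2" using that by (intro power_mono) auto
   thus ?thesis using d2'[of n] unfolding S_def by (auto simp: dot_square_norm add_nonneg_pos intro: add_mono)
  qed
  have 1: "(%n. LBINT x. L x * F (x *. x + (d n)^2)) ----> (LBINT x. L x * RePhi k x)"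
  proof -
   obtain C where C: "C >= 0" "!!t. t : {0<..S} ==> abs (F t) <= C * t powr (- nu)" using Fb[of S] by blast
   obtain C2 where C2: "C2 >= 0" "!!x. abs (L x) <= C2 * jp x 0" using compact_support_bound[OF Lc Lz, where s = 0] by blast
   have nu0: "nu >= 0" using N by (simp add: nu_def)
   have ae: "AE x::real^'n in lborel. x ~= 0" by (rule AE_lborel_singleton)
   show ?thesis
   proof (rule integral_dominated_convergence[where w = "%x. C * (C2 * loc_kernel x + abs (L x))"])
    show "(%x. L x * RePhi k x) : lmeas" using Lm re_kernel_measurable[OF N k] by simp
    show "(%x. L x * F (x *. x + (d n)^2)) : lmeas" for n
    proof -
     have "cont (%x::real^'n. F (x *. x + (d n)^2))"
      by (rule continuous_on_compose2[OF Fc(1)]) (use d2'(1)[of n] in "auto intro!: continuous_intros simp: add_nonneg_pos")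
     thus ?thesis using Lm borel_measurable_continuous_onI by (auto intro!: borel_measurable_times)
    qed
    show "intble (%x. C * (C2 * loc_kernel x + abs (L x)))"
     by (intro integrable_mult_right L1_add integrable_abs integrable_loc_kernel compact_support_integrable[OF Lc Lz]) (use N in auto)
    show "AE x in lborel. (%n. L x * F (x *. x + (d n)^2)) ----> L x * RePhi k x" using ae
    proof eventually_elim
     fix x :: "real^'n" assume x: "x ~= 0"
     have "(%n. x *. x + (d n)^2) ----> x *. x + 0" by (intro tendsto_intros d2)
     moreover have "isCont F (x *. x)" using D(1)[of "x *. x"] x by (intro DERIV_isCont) auto
     ultimately have "(%n. F (x *. x + (d n)^2)) ----> F (x *. x)" by (intro isCont_tendsto_compose[of _ F]) auto
     thus "(%n. L x * F (x *. x + (d n)^2)) ----> L x * RePhi k x" unfolding FF[OF x] by (rule tendsto_mult_left)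
    qed
    show "AE x in lborel. norm (L x * F (x *. x + (d n)^2)) <= C * (C2 * loc_kernel x + abs (L x))" for n using ae
    proof eventually_elim
     fix x :: "real^'n" assume x: "x ~= 0"
     show "norm (L x * F (x *. x + (d n)^2)) <= C * (C2 * loc_kernel x + abs (L x))"
     proof (cases "norm x < R")
      case False thus ?thesis using Lz[of x] C C2 loc_kernel_nonneg[of x] by simp
     next
      case True
      have "abs (F (x *. x + (d n)^2)) <= C * (x *. x + (d n)^2) powr (- nu)" by (rule C(2)[OF inS[OF True]])
      also have "... <= C * (x *. x) powr (- nu)" using C(1) x nu0 d2'(1)[of n] by (intro mult_left_mono powr_mono2') auto
      also have "(x *. x) powr (- nu) = norm x powr (- (real CARD('n) - 2))"
      proof -
       have "x *. x = norm x powr 2" using x by (simp add: dot_square_norm)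
       moreover have "2 * (- nu) = - (real CARD('n) - 2)" by (simp add: nu_def field_simps)
       ultimately show ?thesis by (simp only: powr_powr)
      qed
      finally have Fx: "abs (F (x *. x + (d n)^2)) <= C * norm x powr (- (real CARD('n) - 2))" .
      have "abs (L x) * norm x powr (- (real CARD('n) - 2)) <= C2 * loc_kernel x + abs (L x)"
      proof (cases "norm x <= 1")
       case True
       hence "loc_kernel x = norm x powr (- (real CARD('n) - 2))" by (simp add: loc_kernel_def)
       moreover have "abs (L x) * norm x powr (- (real CARD('n) - 2)) <= C2 * norm x powr (- (real CARD('n) - 2))"
        using C2(2)[of x] by (intro mult_right_mono) auto
       ultimately show ?thesis by simp
      next
       case False
       hence "norm x powr (- (real CARD('n) - 2)) <= norm x powr 0" using N by (intro powr_mono) auto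
       also have "... = 1" using x by simp
       finally have "abs (L x) * norm x powr (- (real CARD('n) - 2)) <= abs (L x) * 1" by (intro mult_left_mono) auto
       moreover have "0 <= C2 * loc_kernel x" using C2(1) loc_kernel_nonneg[of x] by simp
       ultimately show ?thesis by linarith
      qed
      hence "C * (abs (L x) * norm x powr (- (real CARD('n) - 2))) <= C * (C2 * loc_kernel x + abs (L x))"
       by (rule mult_left_mono[OF _ C(1)])
      moreover have "abs (L x) * abs (F (x *. x + (d n)^2)) <= abs (L x) * (C * norm x powr (- (real CARD('n) - 2)))"
       by (intro mult_left_mono Fx) simp
      ultimately show ?thesis by (simp add: abs_mult mult_ac)
     qed
    qed
   qed
  qed
  \<comment> \<open>Since 2 (nu + 2) = N + 2, the power of t in H collects exactly the Jacobian d^N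
    and the factor d^2.\<close>
  have 2: "(LBINT x. ps x * ((d n)^2 * F2 (x *. x + (d n)^2)))
    = (LBINT y. ps (d n *R y) * H ((d n)^2 * (jb y)^2) * jp y (real CARD('n) + 2))" for n
  proof -
   have "cont (%x::real^'n. F2 (x *. x + (d n)^2))"
    by (rule continuous_on_compose2[OF F2c]) (use d2'(1)[of n] in "auto intro!: continuous_intros simp: add_nonneg_pos")
   hence m: "(%x. ps x * ((d n)^2 * F2 (x *. x + (d n)^2))) : bmeas"
    by (intro borel_measurable_continuous_onI continuous_intros c)
   have "(LBINT x. ps x * ((d n)^2 * F2 (x *. x + (d n)^2)))
    = d n ^ CARD('n) * (LBINT y. ps (d n *R y) * ((d n)^2 * F2 ((d n *R y) *. (d n *R y) + (d n)^2)))"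
    using lborel_integral_scale[OF d(1) m] by simp
   also have "... = (LBINT y. d n ^ CARD('n) * (ps (d n *R y) * ((d n)^2 * F2 ((d n *R y) *. (d n *R y) + (d n)^2))))"
    by simp
   also have "... = (LBINT y. ps (d n *R y) * H ((d n)^2 * (jb y)^2) * jp y (real CARD('n) + 2))"
   proof (rule Lint_cong[OF refl])
    fix y :: "real^'n"
    have a: "(d n *R y) *. (d n *R y) + (d n)^2 = (d n)^2 * (jb y)^2"
     unfolding jb_square dot_square_norm by (simp add: power_mult_distrib algebra_simps)
    have "((d n)^2 * (jb y)^2) powr (nu + 2) = (d n * jb y) powr (2 * (nu + 2))"
    proof -
     have "(d n)^2 * (jb y)^2 = (d n * jb y) powr 2" using d(1)[of n] jb_pos[of y] by (simp add: power_mult_distrib)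
     thus ?thesis by (simp only: powr_powr)
    qed
    also have "2 * (nu + 2) = real CARD('n) + 2" by (simp add: nu_def field_simps)
    also have "(d n * jb y) powr (real CARD('n) + 2) = d n ^ CARD('n) * (d n)^2 * jb y powr (real CARD('n) + 2)"
     unfolding powr_mult using d(1)[of n] by (simp add: powr_add powr_realpow)
    finally have b: "((d n)^2 * (jb y)^2) powr (nu + 2) = d n ^ CARD('n) * (d n)^2 * jb y powr (real CARD('n) + 2)" .
    have e: "jb y powr (real CARD('n) + 2) * jp y (real CARD('n) + 2) = 1" unfolding powr_add[symmetric] by simp
    have "ps (d n *R y) * H ((d n)^2 * (jb y)^2) * jp y (real CARD('n) + 2)
     = d n ^ CARD('n) * (ps (d n *R y) * ((d n)^2 * F2 ((d n)^2 * (jb y)^2))) * (jb y powr (real CARD('n) + 2) * jp y (real CARD('n) + 2))"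
     unfolding H_def b by (simp only: mult_ac)
    thus "d n ^ CARD('n) * (ps (d n *R y) * ((d n)^2 * F2 ((d n *R y) *. (d n *R y) + (d n)^2)))
      = ps (d n *R y) * H ((d n)^2 * (jb y)^2) * jp y (real CARD('n) + 2)"
     unfolding a e mult_1_right by (rule sym)
   qed
   finally show ?thesis .
  qed
  have 3: "(%n. LBINT y. ps (d n *R y) * H ((d n)^2 * (jb y)^2) * jp y (real CARD('n) + 2))
    ----> (LBINT y. ps 0 * l * jp (y::real^'n) (real CARD('n) + 2))"
  proof -
   obtain C where C: "C >= 0" "!!t. t : {0<..S} ==> abs (H t) <= C" using bounded_near_limit[OF Hl Hc, of S] by blast
   obtain C2 where C2: "C2 >= 0" "!!x. abs (ps x) <= C2 * jp x 0" using compact_support_bound[OF c(1) z(1), where s = 0] by blast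
   show ?thesis
   proof (rule integral_dominated_convergence[where w = "%y. C2 * C * jp y (real CARD('n) + 2)"])
    show "(%y. ps 0 * l * jp (y::real^'n) (real CARD('n) + 2)) : lmeas" by simp
    show "(%y. ps (d n *R y) * H ((d n)^2 * (jb y)^2) * jp y (real CARD('n) + 2)) : lmeas" for n
    proof -
     have "cont (%y::real^'n. H ((d n)^2 * (jb y)^2))"
      by (rule continuous_on_compose2[OF Hc]) (use d2'(1)[of n] jb_pos in "auto intro!: continuous_intros")
     moreover have "cont (%y. ps (d n *R y))" by (rule continuous_on_compose2[OF c(1)]) (auto intro!: continuous_intros)
     ultimately have "cont (%y. ps (d n *R y) * H ((d n)^2 * (jb y)^2) * jp y (real CARD('n) + 2))"
      by (intro continuous_intros)
     thus ?thesis using borel_measurable_continuous_onI by auto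
    qed
    show "intble (%y::real^'n. C2 * C * jp y (real CARD('n) + 2))" by (intro integrable_mult_right integrable_jb_powr) simp
    show "AE y in lborel. (%n. ps (d n *R y) * H ((d n)^2 * (jb y)^2) * jp y (real CARD('n) + 2)) ----> ps 0 * l * jp y (real CARD('n) + 2)"
    proof (intro AE_I2 tendsto_mult tendsto_const)
     fix y :: "real^'n"
     have "(%n. d n *R y) ----> 0 *R y" by (intro tendsto_intros d0)
     hence "(%n. d n *R y) ----> 0" by simp
     moreover have "isCont ps 0" using c(1) by (simp add: continuous_on_eq_continuous_at)
     ultimately show "(%n. ps (d n *R y)) ----> ps 0" by (rule isCont_tendsto_compose[rotated])
     have "(%n. (d n)^2 * (jb y)^2) ----> 0 * (jb y)^2" by (intro tendsto_intros d2)
     hence "filterlim (%n. (d n)^2 * (jb y)^2) (at_right 0) sequentially"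
      unfolding filterlim_at using d2'(1) jb_pos[of y] by (auto intro!: always_eventually)
     thus "(%n. H ((d n)^2 * (jb y)^2)) ----> l" by (rule filterlim_compose[OF Hl])
    qed
    show "AE y in lborel. norm (ps (d n *R y) * H ((d n)^2 * (jb y)^2) * jp y (real CARD('n) + 2)) <= C2 * C * jp y (real CARD('n) + 2)" for n
    proof (intro AE_I2)
     fix y :: "real^'n"
     have "abs (ps (d n *R y) * H ((d n)^2 * (jb y)^2)) <= C2 * C"
     proof (cases "norm (d n *R y) < R")
      case False thus ?thesis using z(1)[of "d n *R y"] C C2 by simp
     next
      case True
      have "(d n *R y) *. (d n *R y) + (d n)^2 = (d n)^2 * (jb y)^2"
       unfolding jb_square dot_square_norm by (simp add: power_mult_distrib algebra_simps)
      hence "abs (H ((d n)^2 * (jb y)^2)) <= C" using C(2)[OF inS[OF True, of n]] by simp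
      thus ?thesis unfolding abs_mult using C2(2)[of "d n *R y"] C2(1) by (intro mult_mono) auto
     qed
     thus "norm (ps (d n *R y) * H ((d n)^2 * (jb y)^2) * jp y (real CARD('n) + 2)) <= C2 * C * jp y (real CARD('n) + 2)"
      unfolding real_norm_def abs_mult[of _ "jb y powr _"] by (simp add: mult_right_mono)
    qed
   qed
  qed
  have "(%n. LBINT x. L x * F (x *. x + (d n)^2)) ----> - 4 * (LBINT y. ps 0 * l * jp (y::real^'n) (real CARD('n) + 2))"
   unfolding reg 2 by (intro tendsto_intros 3)
  hence "(LBINT x. L x * RePhi k x) = - 4 * (LBINT y. ps 0 * l * jp (y::real^'n) (real CARD('n) + 2))"
   using 1 LIMSEQ_unique by blast
  thus "(LBINT x. ((SUM b:Basis. ps2 b b x) + k^2 * ps x) * RePhi k x) = - 4 * (l * I) * ps 0" unfolding L_def I_def by simp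
 qed
qed

lemma continuous_AE_zero:
 fixes f :: "'a::euclidean_space => real"
 assumes f: "cont f" and ae: "AE x in lborel. f x = 0"
 shows "f x = 0"
proof (rule ccontr)
 assume x: "f x ~= 0"
 have o: "open {x. f x ~= 0}" using open_Collect_neq[OF f continuous_on_const] by simp
 hence "{x. f x ~= 0} : sets lborel" by simp
 hence "{x. f x ~= 0} : null_sets lborel" using ae AE_iff_null[of lborel "%x. f x = 0"] by simp
 hence "{x. f x ~= 0} : null_sets lebesgue" by (rule null_sets_completionI)
 hence "negligible {x. f x ~= 0}" by (simp add: negligible_iff_null_sets)
 thus False using open_not_negligible[OF o] x by auto
qed

section \<open>Mollification\<close>

lemma DERIV_pos_part_square: "DERIV (%s::real. (max 0 s)^2) s :> 2 * max 0 s"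
proof -
 have key: "abs ((max 0 (s + h))^2 - (max 0 s)^2 - 2 * max 0 s * h) <= abs h * abs h" for h
 proof (cases "s >= 0")
  case True
  show ?thesis
  proof (cases "s + h >= 0")
   case True
   thus ?thesis using `s >= 0` by (simp add: max_def power2_eq_square algebra_simps)
  next
   case False
   have "0 <= (s + h) * (s + h)" by simp
   moreover have "0 <= s * (- (s + 2 * h))" using True False by (intro mult_nonneg_nonneg) auto
   ultimately show ?thesis using True False by (simp add: max_def power2_eq_square algebra_simps)
  qed
 next
  case False
  show ?thesis
  proof (cases "s + h >= 0")
   case True
   hence "(s + h)^2 <= h^2" using False by (intro power_mono) auto
   thus ?thesis using False True by (simp add: max_def power2_eq_square)
  next
   case F: False thus ?thesis using False by (simp add: max_def)
  qed
 qed
 show ?thesis unfolding DERIV_def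
 proof (rule Lim_transform)
  show "(%h. 2 * max 0 s) \<midarrow>0\<rightarrow> 2 * max 0 s" by simp
  show "(%h. ((max 0 (s + h))^2 - (max 0 s)^2) / h - 2 * max 0 s) \<midarrow>0\<rightarrow> 0"
  proof (rule Lim_null_comparison)
   show "(%h. abs h) \<midarrow>0\<rightarrow> (0::real)" using tendsto_rabs[OF tendsto_ident_at, of "0::real"] by simp
   have "norm (((max 0 (s + h))^2 - (max 0 s)^2) / h - 2 * max 0 s) <= abs h" if h: "h ~= 0" for h
   proof -
    have "((max 0 (s + h))^2 - (max 0 s)^2) / h - 2 * max 0 s = ((max 0 (s + h))^2 - (max 0 s)^2 - 2 * max 0 s * h) / h"
     using h by (simp add: diff_divide_distrib)
    moreover have "abs (((max 0 (s + h))^2 - (max 0 s)^2 - 2 * max 0 s * h) / h) <= abs h"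
     using key[of h] h by (simp add: abs_divide divide_le_eq)
    ultimately show ?thesis by simp
   qed
   thus "\<forall>\<^sub>F h in at 0. norm (((max 0 (s + h))^2 - (max 0 s)^2) / h - 2 * max 0 s) <= abs h"
    unfolding eventually_at by (intro exI[of _ 1]) auto
  qed
 qed
qed

lemma DERIV_pos_part_cube: "DERIV (%s::real. (max 0 s) ^ 3) s :> 3 * (max 0 s)^2"
proof -
 have c: "(max 0 s) ^ 3 = s * (max 0 s)^2" "s * max 0 s = (max 0 s)^2" for s :: real by (auto simp: max_def power2_eq_square power3_eq_cube)
 have "DERIV (%s. s * (max 0 s)^2) s :> 1 * (max 0 s)^2 + 2 * max 0 s * s"
  by (rule DERIV_mult[OF DERIV_ident DERIV_pos_part_square])
 moreover have "1 * (max 0 s)^2 + 2 * max 0 s * s = 3 * (max 0 s)^2" using c(2)[of s] by (simp add: mult_ac)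
 ultimately show ?thesis unfolding c(1) by (rule DERIV_cong)
qed

text \<open>The normalised cube of the positive part of 1 - |x|^2/ep^2; the third power gives
  continuous second derivatives across the sphere |x| = ep.\<close>

lemma mollifier:
 fixes ep :: real
 assumes ep: "ep > 0" obtains et :: "'a::euclidean_space => real" and et1 et2 where
  "C2_supp ep et et1 et2" "!!x. et x >= 0" "(LBINT x. et x) = 1"
proof -
 define e where "e = 1 / ep^2"
 have e: "e > 0" using ep by (simp add: e_def)
 define m where "m t = max 0 (1 - e * t)" for t
 have m0: "m (x *. x) = 0" if "norm x >= ep" for x :: 'a
 proof -
  have "ep^2 <= x *. x" using that ep unfolding dot_square_norm by (intro power_mono) auto
  hence "1 <= e * (x *. x)" using ep by (simp add: e_def field_simps)
  thus ?thesis by (simp add: m_def)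
 qed
 have Dl: "DERIV (%t. 1 - e * t) t :> - e" for t by (auto intro!: derivative_eq_intros)
 have D3: "DERIV (%t. m t ^ 3) t :> 3 * (m t)^2 * - e" for t
  unfolding m_def[abs_def] by (rule DERIV_chain2[OF DERIV_pos_part_cube Dl])
 have D2: "DERIV (%t. (m t)^2) t :> 2 * m t * - e" for t
  unfolding m_def[abs_def] by (rule DERIV_chain2[OF DERIV_pos_part_square Dl])
 define B where "B x = m (x *. x) ^ 3" for x :: 'a
 define B1 where "B1 b x = (-6 * e) * ((m (x *. x))^2 * (x *. b))" for b x :: 'a
 define B2 where "B2 a b x = (-6 * e) * (2 * m (x *. x) * - e * (2 * (x *. b)) * (x *. a) + (b *. a) * (m (x *. x))^2)" for a b x :: 'a
 have mc: "cont (%x::'a. m (x *. x))" unfolding m_def[abs_def] by (intro continuous_intros)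
 have Bc: "cont B" "cont (B1 b)" "cont (B2 a b)" for a b
  unfolding B_def[abs_def] B1_def[abs_def] B2_def[abs_def] by (intro continuous_intros mc)+
 have pd1: "has_pd b B (B1 b)" for b
  unfolding B_def[abs_def] by (rule has_pd_cong[OF has_pd_radial[OF D3]]) (simp add: B1_def)
 have pd2: "has_pd b (B1 a) (B2 a b)" for a b unfolding B1_def[abs_def] B2_def[abs_def]
  by (rule has_pd_cmult[OF has_pd_mult[OF has_pd_radial[OF D2] has_pd_inner]])
 have sym: "B2 a b x = B2 b a x" for a b x unfolding B2_def by (simp add: inner_commute mult_ac)
 have z: "B x = 0" "B1 b x = 0" "B2 a b x = 0" if "norm x >= ep" for a b x
  using m0[OF that] by (simp_all add: B_def B1_def B2_def)
 have Bi: "intble B" by (rule compact_support_integrable[OF Bc(1) z(1)])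
 have B0: "B x >= 0" for x by (simp add: B_def m_def)
 define I where "I = (LBINT x. B x)"
 have "I ~= 0"
 proof
  assume "I = 0"
  hence "AE x in lborel. B x = 0" using integral_nonneg_eq_0_iff_AE[OF Bi] B0 by (simp add: I_def)
  hence "B 0 = 0" by (rule continuous_AE_zero[OF Bc(1)])
  thus False by (simp add: B_def m_def)
 qed
 moreover have "I >= 0" unfolding I_def by (rule Lint_nonneg) (rule B0)
 ultimately have I: "I > 0" by simp
 show thesis
 proof (rule that[of "%x. (1 / I) * B x" "%b x. (1 / I) * B1 b x" "%a b x. (1 / I) * B2 a b x"])
  show "C2_supp ep (%x. (1 / I) * B x) (%b x. (1 / I) * B1 b x) (%a b x. (1 / I) * B2 a b x)"
   unfolding C2_supp_def by (intro conjI ballI allI impI continuous_intros Bc has_pd_cmult pd1 pd2) (simp_all only: z sym mult_zero_right)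
  show "(1 / I) * B x >= 0" for x using B0[of x] I by simp
  show "(LBINT x. (1 / I) * B x) = 1" using I by (simp add: I_def)
 qed
qed

lemma has_pd_reflect:
 assumes "has_pd b g g'"
 shows "has_pd b (%s. g (c - s)) (%s. - g' (c - s))" unfolding has_pd_def
proof
 fix x
 have "DERIV (%t. g ((c - x) + t *R b)) (- 0) :> g' (c - x)" using assms by (simp add: has_pd_def)
 moreover have "DERIV (%t. - t) (0::real) :> (-1)" by (auto intro!: derivative_eq_intros)
 ultimately have "DERIV (%t. g ((c - x) + (- t) *R b)) 0 :> g' (c - x) * (-1)" by (rule DERIV_chain2)
 thus "DERIV (%t. g (c - (x + t *R b))) 0 :> - g' (c - x)" by (simp add: algebra_simps)
qed

context
 fixes ze u :: "'a::euclidean_space => real" and s :: real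
 assumes ze: "cont ze" "decays s ze" and s: "s > real DIM('a)" and u: "cont u" "decays 0 u"
begin

lemma conv_bound_mult:
 assumes "decays s xi"
 obtains K A where "K >= 0" "!!x. abs (xi x) <= K * jp x s" "!!x. abs (u x) <= A" "!!x y. abs (xi y * u x) <= (K * A) * jp y s"
proof -
 obtain K where K: "K >= 0" "!!x. abs (xi x) <= K * jp x s" using assms by (elim decaysE) blast
 obtain A where A: "!!x. abs (u x) <= A" using u(2) unfolding decays_0 by blast
 have "abs (xi y * u x) <= (K * A) * jp y s" for x y
  using mult_mono[OF K(2)[of y] A[of x]] K(1) by (simp add: abs_mult mult_ac)
 with K A show thesis by (rule that)
qed

lemma conv_integrable: "intble (%y. ze (x - y) * u y)" "intble (%y. ze y * u (x - y))"
proof -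
 have m: "ze : bmeas" "u : bmeas" using ze(1) u(1) borel_measurable_continuous_onI by auto
 obtain K A where b: "!!x y. abs (ze y * u x) <= (K * A) * jp y s" using conv_bound_mult[OF ze(2)] by metis
 show 2: "intble (%y. ze y * u (x - y))" for x by (rule decays_integrable[OF decaysI[OF b] s]) (use m in simp)
 show "intble (%y. ze (x - y) * u y)" using lborel_reflect(1)[OF 2[of x], of x] by simp
qed

lemma conv_reflect: "(LBINT y. ze (x - y) * u y) = (LBINT y. ze y * u (x - y))"
 using lborel_reflect(2)[OF conv_integrable(2)[of x], of x] by simp

text \<open>After reflection the variable x sits in the bounded continuous factor u, while ze
  supplies an integrable majorant.\<close>

lemma conv_continuous: "cont (%x. LBINT y. ze (x - y) * u y)"
 unfolding conv_reflect
proof (rule continuous_at_imp_continuous_on, rule ballI, rule continuous_at_sequentiallyI)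
 fix x :: 'a and X assume X: "X ----> x"
 have m: "ze : bmeas" "u : bmeas" using ze(1) u(1) borel_measurable_continuous_onI by auto
 obtain K A where b: "!!x y. abs (ze y * u x) <= (K * A) * jp y s" using conv_bound_mult[OF ze(2)] by metis
 show "(%n. LBINT y. ze y * u (X n - y)) ----> (LBINT y. ze y * u (x - y))"
 proof (rule integral_dominated_convergence[where w = "%y. (K * A) * jp y s"])
  show "intble (%y::'a. (K * A) * jp y s)" by (intro integrable_mult_right integrable_jb_powr s)
  show "(%y. ze y * u (x - y)) : lmeas" "(%y. ze y * u (X n - y)) : lmeas" for n using m by simp_all
  show "AE y in lborel. (%n. ze y * u (X n - y)) ----> ze y * u (x - y)"
  proof (intro AE_I2 tendsto_mult_left)
   fix y
   have "(%n. X n - y) ----> x - y" by (intro tendsto_intros X)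
   moreover have "isCont u (x - y)" using u(1) by (simp add: continuous_on_eq_continuous_at)
   ultimately show "(%n. u (X n - y)) ----> u (x - y)" by (rule isCont_tendsto_compose[rotated])
  qed
 qed (use b in simp)
qed

text \<open>The derivative falls on ze, so u need only be continuous and bounded; the bracket
  changes by a bounded factor under unit shifts, which gives a common majorant.\<close>

lemma conv_has_pd:
 assumes pd: "has_pd b ze ze'" and b: "norm b <= 1" and ze': "decays s ze'"
 shows "has_pd b (%x. LBINT y. ze (x - y) * u y) (%x. LBINT y. ze' (x - y) * u y)" unfolding has_pd_def
proof
 fix x
 have m: "ze : bmeas" "u : bmeas" using ze(1) u(1) borel_measurable_continuous_onI by auto
 have s0: "s >= 0" using s of_nat_0_le_iff[of "DIM('a)", where 'a=real] by linarith
 define f f' where "f t y = ze ((x - y) + t *R b) * u y" and "f' t y = ze' ((x - y) + t *R b) * u y" for t y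
 obtain K A where K0: "K >= 0" and K: "!!x. abs (ze' x) <= K * jp x s" and A: "!!x. abs (u x) <= A" using conv_bound_mult[OF ze'] by metis
 define h where "h y = K * (4 powr s * jp (x - y) s) * A" for y
 have 1: "DERIV (%t. f t y) t :> f' t y" for t y unfolding f_def f'_def by (rule DERIV_cmult_right[OF has_pd_at[OF pd]])
 have 2: "abs (f' t y) <= h y" if "abs t <= 1" for t y
 proof -
  have "abs (ze' ((x - y) + t *R b)) <= K * (4 powr s * jp (x - y) s)"
   by (rule order_trans[OF K]) (intro mult_left_mono jb_shift_powr b that s0 K0)
  thus ?thesis unfolding f'_def h_def abs_mult using K0 by (intro mult_mono A) auto
 qed
 have "intble (%y::'a. jp (x - y) s)" by (rule lborel_reflect(1)[OF integrable_jb_powr[OF s]])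
 hence 3: "intble h" unfolding h_def by (intro integrable_mult_right integrable_mult_left)
 have 4: "f t : lmeas" for t unfolding f_def[abs_def] using m by simp
 have 5: "intble (f 0)" using conv_integrable(1)[of x] by (simp add: f_def[abs_def])
 note D = DERIV_integral(1)[OF 1 2 3 5 4]
 have "f t y = ze (x + t *R b - y) * u y" for t y by (simp add: f_def algebra_simps)
 thus "DERIV (%t. LBINT y. ze (x + t *R b - y) * u y) 0 :> (LBINT y. ze' (x - y) * u y)" using D by (simp add: f'_def)
qed

end

context
 fixes et :: "'a::euclidean_space => real" and ep :: real
 assumes et: "cont et" "!!x. et x >= 0" "(LBINT x. et x) = 1" "!!x. norm x >= ep ==> et x = 0"
begin

lemma mollifier_reflect: "intble (%y. et (x - y))" "(LBINT y. et (x - y)) = 1"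
 using lborel_reflect[OF compact_support_integrable[OF et(1,4)]] et(3) by auto

lemma mollify_le:
 assumes u: "u : bmeas" and B: "!!y. norm (x - y) < ep ==> abs (u y) <= B"
 shows "intble (%y. et (x - y) * u y)" "abs (LBINT y. et (x - y) * u y) <= B"
proof -
 have bd: "norm (et (x - y) * u y) <= et (x - y) * B" for y
 proof (cases "norm (x - y) < ep")
  case True thus ?thesis using B[OF True] et(2)[of "x - y"] by (simp add: abs_mult mult_left_mono)
 next
  case False thus ?thesis using et(4)[of "x - y"] by simp
 qed
 have m: "et : bmeas" by (rule borel_measurable_continuous_onI[OF et(1)])
 have i: "intble (%y. et (x - y) * B)" by (intro integrable_mult_left mollifier_reflect)
 show 1: "intble (%y. et (x - y) * u y)" by (rule L1_bound[OF i]) (use m u bd in "auto intro: order_trans[OF _ abs_ge_self]")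
 have "abs (LBINT y. et (x - y) * u y) <= (LBINT y. et (x - y) * B)"
  unfolding real_norm_def[symmetric] by (rule Lint_norm_bound_integral[OF 1 i]) (rule bd)
 thus "abs (LBINT y. et (x - y) * u y) <= B" using mollifier_reflect(2)[of x] by simp
qed

text \<open>Points at distance below 1 have comparable brackets, so averaging preserves decay with a
  constant independent of the radius. This uniformity permits the passage to the limit
  later.\<close>

lemma mollify_decay:
 assumes ep: "ep <= 1" and u: "u : bmeas" "!!y. abs (u y) <= A * jp y s" and s: "s >= 0"
 shows "abs (LBINT y. et (x - y) * u y) <= A * 4 powr s * jp x s"
proof (rule mollify_le(2)[OF u(1)])
 fix y assume y: "norm (x - y) < ep"
 have A: "A >= 0" by (rule bnd0[OF u(2)[of 0]])
 have "jp (x + 1 *R (y - x)) s <= 4 powr s * jp x s" by (rule jb_shift_powr) (use y ep s in "auto simp: norm_minus_commute")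
 hence "A * jp y s <= A * (4 powr s * jp x s)" using A by (intro mult_left_mono) auto
 thus "abs (u y) <= A * 4 powr s * jp x s" using u(2)[of y] by simp
qed

lemma mollify_close:
 assumes u: "u : bmeas" and B: "!!y. norm (x - y) < ep ==> abs (u y - u x) <= B"
 shows "abs ((LBINT y. et (x - y) * u y) - u x) <= B"
proof -
 note d = mollify_le[of "%y. u y - u x", OF _ B]
 have m: "(%y. u y - u x) : bmeas" using u by simp
 have "(LBINT y. et (x - y) * u y) = (LBINT y. et (x - y) * (u y - u x) + et (x - y) * u x)" by (simp add: algebra_simps)
 also have "... = (LBINT y. et (x - y) * (u y - u x)) + u x"
  by (subst Lint_add) (use d(1)[OF m] mollifier_reflect[of x] in "auto intro!: integrable_mult_left")
 finally show ?thesis using d(2)[OF m] by simp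
qed

end

lemma mollify_tendsto:
 fixes et :: "nat => 'a::euclidean_space => real"
 assumes et: "!!n. cont (et n)" "!!n x. et n x >= 0" "!!n. (LBINT x. et n x) = 1" "!!n x. norm x >= ep n ==> et n x = 0"
  and ep: "ep ----> 0" and u: "cont u"
 shows "(%n. LBINT y. et n (x - y) * u y) ----> u x"
proof (rule tendstoI)
 fix e :: real assume e: "e > 0"
 have um: "u : bmeas" by (rule borel_measurable_continuous_onI[OF u])
 obtain d where d: "d > 0" "!!y. dist y x < d ==> dist (u y) (u x) < e / 2"
  using u e unfolding continuous_on_iff by (metis UNIV_I half_gt_zero)
 have "eventually (%n. ep n < d) sequentially" using ep d(1) by (rule order_tendstoD(2))
 thus "eventually (%n. dist (LBINT y. et n (x - y) * u y) (u x) < e) sequentially"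
 proof eventually_elim
  fix n assume n: "ep n < d"
  have "abs ((LBINT y. et n (x - y) * u y) - u x) <= e / 2"
  proof (rule mollify_close[OF et um])
   fix y assume "norm (x - y) < ep n"
   hence "dist y x < d" using n by (simp add: dist_norm norm_minus_commute)
   thus "abs (u y - u x) <= e / 2" using d(2)[of y] by (simp add: dist_real_def)
  qed
  thus "dist (LBINT y. et n (x - y) * u y) (u x) < e" using e by (simp add: dist_real_def)
 qed
qed

lemma conv_decay:
 fixes ze u :: "'a::euclidean_space => real"
 assumes b: "b >= 0" and p: "p >= b" "p > real DIM('a)" and m: "ze : bmeas" "u : bmeas"
  and ze: "decays p ze" and u: "decays b u"
 shows "decays b (%x. LBINT y. ze (x - y) * u y)"
proof -
 obtain C where C: "C >= 0" "!!x::'a. intble (%y. jp (x - y) p * jp y b)"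
   "!!x::'a. (LBINT y. jp (x - y) p * jp y b) <= C * jp x b" using jb_conv_decay[of b p b, where 'a='a] b p by auto
 obtain K where K: "K >= 0" "!!x. abs (ze x) <= K * jp x p" using ze by (elim decaysE) blast
 obtain A where A: "A >= 0" "!!x. abs (u x) <= A * jp x b" using u by (elim decaysE) blast
 have "abs (LBINT y. ze (x - y) * u y) <= (K * A * C) * jp x b" for x
 proof -
  have i: "intble (%y. K * A * (jp (x - y) p * jp y b))" by (intro integrable_mult_right C)
  have bd: "norm (ze (x - y) * u y) <= K * A * (jp (x - y) p * jp y b)" for y
   using mult_mono[OF K(2)[of "x - y"] A(2)[of y]] K(1) by (simp add: abs_mult mult_ac)
  have 1: "intble (%y. ze (x - y) * u y)" by (rule L1_bound[OF i]) (use m bd in "auto intro: order_trans[OF _ abs_ge_self]")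
  have "abs (LBINT y. ze (x - y) * u y) <= (LBINT y. K * A * (jp (x - y) p * jp y b))"
   unfolding real_norm_def[symmetric] by (rule Lint_norm_bound_integral[OF 1 i]) (rule bd)
  also have "... <= K * A * (C * jp x b)" unfolding integral_mult_right_zero using K A by (intro mult_left_mono C) auto
  finally show ?thesis by (simp add: mult.assoc)
 qed
 thus ?thesis by (rule decaysI)
qed

text \<open>Hypothesis \<open>id\<close> says that ze, the Helmholtz operator applied to the
  mollifier, gives back a multiple of the mollifier when convolved with the kernel. Fubini's theorem
  lets ze meet the kernel first, before the density w.\<close>

lemma conv_kernel_swap:
 fixes w :: "real^'n::finite => real" and ze :: "real^'n => real"
 assumes N: "CARD('n) >= 3" and k: "k > 0"
  and w: "w : bmeas" "!!y. abs (w y) <= A * jp y b" and b: "b > (real CARD('n) + 1) / 2"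
  and ze: "cont ze" "!!x. norm x >= R ==> ze x = 0" and id: "!!c. (LBINT s. ze (c - s) * RePhi k s) = c0 * et c"
 shows "(LBINT z. ze (x - z) * (LBINT y. RePhi k (z - y) * w y)) = c0 * (LBINT y. et (x - y) * w y)"
proof -
 let ?sg = "(real CARD('n) - 1) / 2"
 have Pm: "(RePhi k :: real^'n => real) : bmeas" by (rule re_kernel_measurable[OF N k])
 have zem: "ze : bmeas" by (rule borel_measurable_continuous_onI[OF ze(1)])
 obtain C1 where C1: "C1 >= 0" "!!x::real^'n. abs (RePhi k x) <= C1 * maj ?sg x" using fund_sol_facts(2)[OF N k] by blast
 obtain C2 where C2: "C2 >= 0" "!!x::real^'n. intble (%y. maj ?sg (x - y) * jp y b)"
   "!!x::real^'n. (LBINT y. maj ?sg (x - y) * jp y b) <= C2"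
  using kernel_conv_decay[of 0 ?sg b, where 'a="real^'n"] N b by (auto simp: field_simps)
 have A: "A >= 0" by (rule bnd0[OF w(2)[of 0]])
 define h where "h z y = C1 * A * (maj ?sg (z - y) * jp y b)" for z y :: "real^'n"
 have hb: "norm (RePhi k (z - y) * w y) <= h z y" for z y
 proof -
  have "abs (RePhi k (z - y)) * abs (w y) <= (C1 * maj ?sg (z - y)) * (A * jp y b)"
   by (intro mult_mono C1 w order_trans[OF abs_ge_zero C1(2)]) auto
  thus ?thesis by (simp add: h_def abs_mult mult_ac)
 qed
 have hi: "intble (h z)" for z unfolding h_def by (intro integrable_mult_right C2)
 have hI: "(LBINT y. h z y) <= C1 * A * C2" for z
  unfolding h_def integral_mult_right_zero using C1(1) A C2(3)[of z] by (intro mult_left_mono) auto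
 have Pi: "intble (%y. RePhi k (z - y) * w y)" for z
  by (rule L1_bound[OF hi[of z]]) (use Pm w(1) hb in "auto intro: order_trans[OF _ abs_ge_self]")
 define F where "F z y = ze (x - z) * (RePhi k (z - y) * w y)" for z y
 have Fm: "case_prod F : borel_measurable (lborel \<Otimes>\<^sub>M lborel)" unfolding F_def using zem Pm w(1) by measurable
 have zei: "intble (%z. ze (c - z))" for c by (rule lborel_reflect(1)[OF compact_support_integrable[OF ze]])
 have int: "integrable (lborel \<Otimes>\<^sub>M lborel) (case_prod F)"
 proof (rule lborel_pair.Fubini_integrable[OF Fm])
  show "AE z in lborel. intble (%y. case_prod F (z, y))"
   unfolding case_prod_conv F_def by (intro AE_I2 integrable_mult_right Pi)
  show "intble (%z. LBINT y. norm (case_prod F (z, y)))"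
  proof (rule L1_bound)
   show "intble (%z. abs (ze (x - z)) * (C1 * A * C2))" by (intro integrable_mult_left integrable_abs zei)
   show "(%z. LBINT y. norm (case_prod F (z, y))) : lmeas" using Fm by measurable
   show "AE z in lborel. norm (LBINT y. norm (case_prod F (z, y))) <= norm (abs (ze (x - z)) * (C1 * A * C2))"
   proof (intro AE_I2)
    fix z
    have "(LBINT y. norm (RePhi k (z - y) * w y)) <= (LBINT y. h z y)" by (intro integral_mono integrable_norm Pi hi hb)
    hence "abs (ze (x - z)) * (LBINT y. norm (RePhi k (z - y) * w y)) <= abs (ze (x - z)) * (C1 * A * C2)"
     using hI[of z] by (intro mult_left_mono) auto
    moreover have "(LBINT y. norm (case_prod F (z, y))) = abs (ze (x - z)) * (LBINT y. norm (RePhi k (z - y) * w y))"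
     by (simp add: F_def abs_mult)
    moreover have "0 <= (LBINT y. norm (case_prod F (z, y)))" by (rule Lint_nonneg) simp
    ultimately show "norm (LBINT y. norm (case_prod F (z, y))) <= norm (abs (ze (x - z)) * (C1 * A * C2))" by simp
   qed
  qed
 qed
 have tr: "(LBINT z. ze (x - z) * RePhi k (z - y)) = c0 * et (x - y)" for y
 proof -
  obtain K where K: "K >= 0" "!!x. abs (ze x) <= K * jp x 0" using compact_support_bound[OF ze, where s = 0] by blast
  have sg0: "0 <= ?sg" using N by simp
  define g where "g s = ze ((x - y) - s) * RePhi k s" for s
  have "intble (%s. C1 * (K * loc_kernel s + abs (ze ((x - y) - s))))"
   by (intro integrable_mult_right L1_add integrable_abs zei integrable_loc_kernel) (use N in auto)
  hence "intble g"
  proof (rule L1_bound)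
   show "g : lmeas" unfolding g_def[abs_def] using zem Pm by simp
   show "AE s in lborel. norm (g s) <= norm (C1 * (K * loc_kernel s + abs (ze ((x - y) - s))))"
   proof (intro AE_I2)
    fix s :: "real^'n"
    let ?z = "abs (ze ((x - y) - s))"
    have "norm (g s) <= ?z * (C1 * maj ?sg s)" unfolding g_def real_norm_def abs_mult by (intro mult_left_mono C1) auto
    also have "... <= ?z * (C1 * (loc_kernel s + 1))"
     using C1(1) jb_powr_antimono[OF sg0, of s] by (intro mult_left_mono) auto
    also have "... = C1 * (?z * loc_kernel s + ?z)" by (simp add: algebra_simps)
    also have "... <= C1 * (K * loc_kernel s + ?z)"
     using C1(1) K(2)[of "(x - y) - s"] loc_kernel_nonneg[of s] by (intro mult_left_mono add_mono mult_right_mono) auto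
    finally show "norm (g s) <= norm (C1 * (K * loc_kernel s + ?z))" unfolding real_norm_def by linarith
   qed
  qed
  hence "(LBINT z. g (z + (- y))) = (LBINT s. g s)" by (rule lborel_translate(2))
  thus ?thesis unfolding g_def id by simp
 qed
 have "(LBINT z. ze (x - z) * (LBINT y. RePhi k (z - y) * w y)) = (LBINT z. (LBINT y. F z y))" by (simp add: F_def)
 also have "... = (LBINT y. (LBINT z. F z y))" by (rule lborel_pair.Fubini_integral[OF int, symmetric])
 also have "... = (LBINT y. c0 * (et (x - y) * w y))"
 proof (rule Lint_cong[OF refl])
  fix y
  have "(LBINT z. F z y) = (LBINT z. (ze (x - z) * RePhi k (z - y)) * w y)" by (simp add: F_def mult.assoc)
  also have "... = (LBINT z. ze (x - z) * RePhi k (z - y)) * w y" by simp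
  finally show "(LBINT z. F z y) = c0 * (et (x - y) * w y)" unfolding tr by simp
 qed
 finally show ?thesis by simp
qed

text \<open>The reflected translate of the mollifier is an admissible test function, so the
  distributional equation yields the identity for ze; inserting the integral equation for v and
  exchanging the integrals gives the claim.\<close>

lemma mollified_equation:
 fixes w v :: "real^'n::finite => real" and et et1 et2
 assumes N: "CARD('n) >= 3" and k: "k > 0" and w: "w : bmeas" "!!y. abs (w y) <= A * jp y (real CARD('n) + 1)"
  and v: "cont v" "decays ((real CARD('n) + 1) / 2) v" and eq: "!!x. v x = (Re_conv k w x)"
  and c: "!!(ps :: real^'n => real) ps1 ps2 R. C2_supp R ps ps1 ps2 ==>
    (LBINT x. ((SUM b:Basis. ps2 b b x) + k^2 * ps x) * RePhi k x) = c0 * ps 0"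
  and et: "C2_supp ep et et1 et2"
 shows "(SUM b:Basis. (LBINT z. et2 b b (x - z) * v z)) + k^2 * (LBINT z. et (x - z) * v z)
   = c0 * (LBINT y. et (x - y) * w y)"
proof -
 note cet = C2_suppD(1,4,7)[OF et] and zet = C2_suppD(2,5,8)[OF et] and pd = C2_suppD(3,6)[OF et]
 define ze where "ze x = (SUM b:Basis. et2 b b x) + k^2 * et x" for x
 have zec: "cont ze" unfolding ze_def[abs_def] by (intro continuous_intros cet)
 have ze0: "ze x = 0" if "norm x >= ep" for x using zet(3)[OF _ _ that] zet(1)[OF that] by (simp add: ze_def)
 have s: "real CARD('n) + 1 > real DIM(real^'n)" by simp
 have v0: "decays 0 v" by (rule decays_mono[OF v(2)]) simp
 have ci: "intble (%z. xi (x - z) * v z)" if "cont xi" "!!x. norm x >= ep ==> xi x = 0" for xi :: "real^'n => real"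
  by (rule conv_integrable(1)[OF that(1) compact_support_decays[OF that] s v(1) v0])
 have id: "(LBINT s. ze (d - s) * RePhi k s) = c0 * et d" for d
 proof -
  have n: "norm (d - s) >= ep" if "norm s >= norm d + ep" for s using that norm_triangle_ineq2[of s d] by (simp add: norm_minus_commute)
  have r: "cont (%s. xi (d - s))" if "cont xi" for xi :: "real^'n => real"
   by (rule continuous_on_compose2[OF that]) (auto intro!: continuous_intros)
  have 1: "has_pd b (%s. et (d - s)) (%s. - et1 b (d - s))" if "b : Basis" for b by (rule has_pd_reflect[OF pd(1)[OF that]])
  have 2: "has_pd b (%s. - et1 a (d - s)) (%s. et2 a b (d - s))" if "a : Basis" "b : Basis" for a b
   using has_pd_cmult[OF has_pd_reflect[OF pd(2)[OF that], of d], of "-1"] by simp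
  have "C2_supp (norm d + ep) (%s. et (d - s)) (%b s. - et1 b (d - s)) (%a b s. et2 a b (d - s))"
   unfolding C2_supp_def by (intro conjI ballI allI impI r cet continuous_on_minus 1 2 C2_suppD(9)[OF et]) (simp_all add: zet n)
  from c[OF this] have "(LBINT s. ((SUM b:Basis. et2 b b (d - s)) + k^2 * et (d - s)) * RePhi k s) = c0 * et (d - 0)" .
  thus ?thesis by (simp add: ze_def)
 qed
 have "(SUM b:Basis. (LBINT z. et2 b b (x - z) * v z)) + k^2 * (LBINT z. et (x - z) * v z)
  = (LBINT z. (SUM b:Basis. et2 b b (x - z) * v z) + k^2 * (et (x - z) * v z))"
 proof -
  have "(LBINT z. (SUM b:Basis. et2 b b (x - z) * v z)) = (SUM b:Basis. (LBINT z. et2 b b (x - z) * v z))"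
   by (rule Lint_sum) (intro ci cet zet)
  moreover have "(LBINT z. k^2 * (et (x - z) * v z)) = k^2 * (LBINT z. et (x - z) * v z)" by simp
  ultimately show ?thesis by (subst Lint_add) (auto intro!: L1_sum integrable_mult_right ci cet zet)
 qed
 also have "... = (LBINT z. ze (x - z) * v z)" by (intro Lint_cong refl) (simp add: ze_def sum_distrib_right distrib_right)
 also have "... = (LBINT z. ze (x - z) * (LBINT y. RePhi k (z - y) * w y))" using eq by simp
 also have "... = c0 * (LBINT y. et (x - y) * w y)" by (rule conv_kernel_swap[OF N k w _ zec ze0 id]) simp
 finally show ?thesis .
qed

text \<open>The Carleman inequality holds for the mollifications of v, and both sides converge
  because the decay is uniform in the radius. In the limit the right side is at most half of the
  left one, so the weighted square of v integrates to zero.\<close>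

lemma kernel_equation_unique:
 fixes a v :: "real^'n::finite => real"
 assumes N: "CARD('n) >= 3" and k: "k > 0" and aa: "aa > (real CARD('n) + 1) / 2"
  and a: "cont a" "!!x. abs (a x) <= Ca * jp x aa" and v: "cont v" "!!x. abs (v x) <= C * jp x ((real CARD('n) + 1) / 2)"
  and eq: "!!x. v x = (LBINT y. RePhi k (x - y) * (a y * v y))"
 shows "v x = 0"
proof -
 let ?N = "real CARD('n)" and ?s = "(real CARD('n) + 1) / 2"
 obtain c0 where c0: "!!(ps :: real^'n => real) ps1 ps2 R. C2_supp R ps ps1 ps2 ==>
    (LBINT x. ((SUM b:Basis. ps2 b b x) + k^2 * ps x) * RePhi k x) = c0 * ps 0"
  using kernel_distribution[OF N k] by blast
 have Ca: "Ca >= 0" by (rule bnd0[OF a(2)[of 0]])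
 have C: "C >= 0" by (rule bnd0[OF v(2)[of 0]])
 define w where "w y = a y * v y" for y
 have wc: "cont w" unfolding w_def[abs_def] by (intro continuous_intros a v)
 have wm: "w : bmeas" and vm: "v : bmeas" using wc v(1) borel_measurable_continuous_onI by auto
 define A where "A = Ca * C"
 have wb: "abs (w y) <= A * jp y (?N + 1)" for y
 proof -
  have "abs (w y) <= (Ca * jp y aa) * (C * jp y ?s)" unfolding w_def abs_mult using a(2) v(2) Ca by (intro mult_mono) auto
  also have "... = A * jp y (aa + ?s)" unfolding A_def minus_add_distrib powr_add by simp
  also have "... <= A * jp y (?N + 1)"
   using aa Ca C unfolding A_def by (intro mult_left_mono jb_powr_antimono) (auto simp: field_simps)
  finally show ?thesis .
 qed
 have DIM_n: "DIM(real^'n) = CARD('n)" by simp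
 hence dim: "DIM(real^'n) >= 3" using N by simp
 \<comment> \<open>Chosen so that (c0 a)^2 / (8 G) <= k^2 / 8, half of the constant k^2 / 4 in the
   Carleman inequality. The factor 1/G grows at most like \<open>jb x\<close> to the fourth power,
   which a^2 outweighs since aa > (N+1)/2 >= 2.\<close>
 define ta where "ta = c0^2 * Ca^2 / k^2 + 1"
 have ta: "ta > 0" unfolding ta_def by (rule add_nonneg_pos) auto
 obtain E G :: "real => real" and M where E: "!!t. t >= 0 ==> 1 <= E t" "!!t. t >= 0 ==> E t <= M"
  and G: "!!t. t >= 0 ==> ta <= G t * (1 + t)^2" and EGc: "continuous_on {0..} E" "continuous_on {0..} G"
  and carl: "!!(U :: real^'n => real) U1 U2. C2_decays ?s U U1 U2 ==> decays (?N + 1) (%x. (SUM b:Basis. U2 b b x) + k^2 * U x) ==>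
    k^2 / 4 * (LBINT x. (E (x *. x) * U x)^2)
     <= (LBINT x. (E (x *. x) * ((SUM b:Basis. U2 b b x) + k^2 * U x))^2 / (8 * G (x *. x)))"
  using carleman[OF k ta dim, unfolded DIM_n] by blast
 have xx: "x *. x >= 0" for x :: "real^'n" by simp
 have M: "M >= 1" using E[of 0] by simp
 have Eb: "0 <= E (x *. x)" "E (x *. x) <= M" for x :: "real^'n" using E[OF xx[of x]] by auto
 have Ec: "cont (%x::real^'n. E (x *. x))" and Gc: "cont (%x::real^'n. G (x *. x))"
  by (rule continuous_radial[OF EGc(1)] continuous_radial[OF EGc(2)])+
 have Em: "(%x::real^'n. E (x *. x)) : bmeas" "(%x::real^'n. G (x *. x)) : bmeas"
  using Ec Gc borel_measurable_continuous_onI by auto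
 have dv: "decays ?s v" by (rule decaysI[OF v(2)])
 have v0: "decays 0 v" by (rule decays_mono[OF dv]) simp
 have key: "EX et :: real^'n => real. cont et & (ALL x. et x >= 0) & (LBINT x. et x) = 1 & (ALL x. norm x >= ep --> et x = 0)
   & k^2 / 4 * (LBINT x. (E (x *. x) * (LBINT y. et (x - y) * v y))^2)
     <= (LBINT x. (E (x *. x) * (c0 * (LBINT y. et (x - y) * w y)))^2 / (8 * G (x *. x)))"
  if ep: "0 < ep" "ep <= 1" for ep
 proof -
  obtain et :: "real^'n => real" and et1 et2 where C2: "C2_supp ep et et1 et2" and et: "!!x. et x >= 0" "(LBINT x. et x) = 1"
   using mollifier[OF ep(1)] by metis
  note cet = C2_suppD(1,4,7)[OF C2] and zet = C2_suppD(2,5,8)[OF C2] and pd = C2_suppD(3,6)[OF C2]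
  let ?p = "?N + 1"
  have p: "?p > real DIM(real^'n)" by simp
  have det: "decays ?p et" "b : Basis ==> decays ?p (et1 b)" "a : Basis ==> b : Basis ==> decays ?p (et2 a b)" for a b
   by (rule compact_support_decays; intro cet zet; assumption)+
  define U where "U x = (LBINT z. et (x - z) * v z)" for x
  define U1 where "U1 b x = (LBINT z. et1 b (x - z) * v z)" for b x
  define U2 where "U2 a b x = (LBINT z. et2 a b (x - z) * v z)" for a b x
  have eq': "v x = (Re_conv k w x)" for x using eq[of x] by (simp add: w_def)
  have W: "(SUM b:Basis. U2 b b x) + k^2 * U x = c0 * (LBINT y. et (x - y) * w y)" for x
   unfolding U2_def U_def by (rule mollified_equation[OF N k wm wb v(1) dv eq' _ C2]) (rule c0)
  have cd: "decays ?s (%x. LBINT z. ze (x - z) * v z)" if "cont ze" "decays ?p ze" for ze :: "real^'n => real"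
   by (rule conv_decay[OF _ _ p borel_measurable_continuous_onI[OF that(1)] vm that(2) dv]) simp_all
  have C2U: "C2_decays ?s U U1 U2" unfolding C2_decays_def U_def[abs_def] U1_def[abs_def] U2_def[abs_def]
   by (intro conjI ballI allI conv_continuous[OF _ _ p v(1) v0] conv_has_pd[OF _ _ p v(1) v0] cd cet det pd) (simp_all add: C2_suppD(9)[OF C2])
  have dW: "decays ?p (%x. (SUM b:Basis. U2 b b x) + k^2 * U x)" unfolding W
   by (intro decays_cmult decaysI[OF mollify_decay[OF cet(1) et zet(1) ep(2) wm wb]]) simp_all
  from carl[OF C2U dW] show ?thesis unfolding W unfolding U_def using cet(1) zet(1) et by blast
 qed
 define ep where "ep n = 1 / (real n + 1)" for n
 have ep: "0 < ep n" "ep n <= 1" for n by (auto simp: ep_def)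
 have ep0: "ep ----> 0" unfolding ep_def[abs_def] using LIMSEQ_inverse_real_of_nat by (simp add: inverse_eq_divide add.commute)
 have "ALL n. EX et :: real^'n => real. cont et & (ALL x. et x >= 0) & (LBINT x. et x) = 1 & (ALL x. norm x >= ep n --> et x = 0)
   & k^2 / 4 * (LBINT x. (E (x *. x) * (LBINT y. et (x - y) * v y))^2)
     <= (LBINT x. (E (x *. x) * (c0 * (LBINT y. et (x - y) * w y)))^2 / (8 * G (x *. x)))"
  using key[OF ep] by blast
 then obtain et :: "nat => real^'n => real" where et': "ALL n. cont (et n) & (ALL x. et n x >= 0) & (LBINT x. et n x) = 1 & (ALL x. norm x >= ep n --> et n x = 0)
   & k^2 / 4 * (LBINT x. (E (x *. x) * (LBINT y. et n (x - y) * v y))^2)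
     <= (LBINT x. (E (x *. x) * (c0 * (LBINT y. et n (x - y) * w y)))^2 / (8 * G (x *. x)))"
  by (rule choice[THEN exE])
 have et: "cont (et n)" "et n x >= 0" "(LBINT x. et n x) = 1" "norm x >= ep n ==> et n x = 0" for n x using et' by blast+
 define V where "V n x = (LBINT y. et n (x - y) * v y)" for n x
 define W where "W n x = (LBINT y. et n (x - y) * w y)" for n x
 have ineq: "k^2 / 4 * (LBINT x. (E (x *. x) * V n x)^2) <= (LBINT x. (E (x *. x) * (c0 * W n x))^2 / (8 * G (x *. x)))" for n
  using et' unfolding V_def W_def by blast
 have Vl: "(%n. V n x) ----> v x" "(%n. W n x) ----> w x" for x
  unfolding V_def W_def by (rule mollify_tendsto[OF et ep0 v(1)] mollify_tendsto[OF et ep0 wc]; assumption)+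
 have Vb: "abs (V n x) <= C * 4 powr ?s * jp x ?s" for n x
  unfolding V_def by (rule mollify_decay[OF et ep(2) vm v(2)]) simp_all
 have Wb: "abs (W n x) <= A * 4 powr (?N + 1) * jp x (?N + 1)" for n x
  unfolding W_def by (rule mollify_decay[OF et ep(2) wm wb]) simp_all
 have "?N + 1 > real DIM(real^'n)" by simp
 have VWm: "V n : bmeas" "W n : bmeas" for n
 proof -
  have m: "et n : bmeas" by (rule borel_measurable_continuous_onI[OF et(1)])
  have "(%x. LBINT y. et n (x - y) * v y) : lmeas" "(%x. LBINT y. et n (x - y) * w y) : lmeas"
   by (rule lborel.borel_measurable_lebesgue_integral; use m vm wm in measurable)+
  thus "V n : bmeas" "W n : bmeas" unfolding V_def[abs_def] W_def[abs_def] by simp_all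
 qed
 have js: "jp x ?s * jp x ?s = jp x (?N + 1)" for x :: "real^'n"
 proof -
  have e: "- ?s + - ?s = - (?N + 1)" by (simp add: field_simps)
  show ?thesis unfolding powr_add[symmetric] e ..
 qed
 have Ew: "abs (E (x *. x) * y) <= M * Y * jp x q" if "abs y <= Y * jp x q" for x :: "real^'n" and y Y q
  using mult_mono[OF Eb(2)[of x] that] Eb[of x] M by (simp add: abs_mult mult.assoc)
 have L1: "(%n. LBINT x. (E (x *. x) * V n x)^2) ----> (LBINT x. (E (x *. x) * v x)^2)"
 proof (rule integral_dominated_convergence[where w = "%x. (M * (C * 4 powr ?s))^2 * jp x (?N + 1)"])
  show "(%x. (E (x *. x) * v x)^2) : lmeas" "(%x. (E (x *. x) * V n x)^2) : lmeas" for n using Em vm VWm[of n] by simp_all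
  show "intble (%x::real^'n. (M * (C * 4 powr ?s))^2 * jp x (?N + 1))" by (intro integrable_mult_right integrable_jb_powr) simp
  show "AE x in lborel. (%n. (E (x *. x) * V n x)^2) ----> (E (x *. x) * v x)^2" by (intro AE_I2 tendsto_intros Vl)
  show "AE x in lborel. norm ((E (x *. x) * V n x)^2) <= (M * (C * 4 powr ?s))^2 * jp x (?N + 1)" for n
  proof (intro AE_I2)
   fix x :: "real^'n"
   have "(abs (E (x *. x) * V n x))^2 <= (M * (C * 4 powr ?s) * jp x ?s)^2" by (intro power_mono Ew Vb) simp
   also have "... = (M * (C * 4 powr ?s))^2 * (jp x ?s * jp x ?s)" by (simp add: power2_eq_square)
   finally show "norm ((E (x *. x) * V n x)^2) <= (M * (C * 4 powr ?s))^2 * jp x (?N + 1)" unfolding js by simp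
  qed
 qed
 let ?w = "%x. (E (x *. x) * (c0 * w x))^2 / (8 * G (x *. x))" and ?wn = "%n x. (E (x *. x) * (c0 * W n x))^2 / (8 * G (x *. x))"
 let ?Y = "M * (abs c0 * (A * 4 powr (?N + 1)))"
 note sq = weighted_square_bound[where G = G, OF ta G]
 have Gp: "0 < G (x *. x)" for x :: "real^'n" by (rule sq(1)[of 0 0 x 0]) simp_all
 have L2: "(%n. LBINT x. ?wn n x) ----> (LBINT x. ?w x)" and L2i: "intble ?w"
 proof -
  have m: "?w : lmeas" "?wn n : lmeas" for n using Em wm VWm[of n] by simp_all
  have i: "intble (%x::real^'n. ?Y^2 / (8 * ta) * jp x (2 * (?N + 1) - 4))" using N by (intro integrable_mult_right integrable_jb_powr) simp
  have l: "AE x in lborel. (%n. ?wn n x) ----> ?w x" using Gp by (intro AE_I2 tendsto_intros Vl) (auto simp: less_le)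
  have b: "AE x in lborel. norm (?wn n x) <= ?Y^2 / (8 * ta) * jp x (2 * (?N + 1) - 4)" for n
  proof (intro AE_I2)
   fix x :: "real^'n"
   have "abs (c0 * W n x) <= abs c0 * (A * 4 powr (?N + 1)) * jp x (?N + 1)"
    using mult_left_mono[OF Wb[of n x], of "abs c0"] by (simp add: abs_mult mult.assoc)
   from sq(2)[OF _ Ew[OF this]] show "norm (?wn n x) <= ?Y^2 / (8 * ta) * jp x (2 * (?N + 1) - 4)" using Gp[of x] by simp
  qed
  show "(%n. LBINT x. ?wn n x) ----> (LBINT x. ?w x)" by (rule integral_dominated_convergence[OF m i l b])
  show "intble ?w" by (rule integrable_dominated_convergence[OF m i l b])
 qed
 have vi: "intble (%x. (E (x *. x) * v x)^2)"
 proof (rule decays_integrable)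
  have d: "decays ?s (%x. E (x *. x) * v x)" by (rule decaysI[OF Ew[OF v(2)]])
  show "decays (?N + 1) (%x. (E (x *. x) * v x)^2)" unfolding power2_eq_square by (rule decays_mult[OF d d]) (simp add: field_simps)
 qed (use Em vm in simp_all)
 have pt: "(E (x *. x) * (c0 * w x))^2 / (8 * G (x *. x)) <= k^2 / 8 * (E (x *. x) * v x)^2" for x
 proof -
  have "abs (c0 * a x) <= abs c0 * Ca * jp x aa" using mult_left_mono[OF a(2)[of x], of "abs c0"] by (simp add: abs_mult mult.assoc)
  from sq(2)[OF _ this] have "(c0 * a x)^2 * (1 / (8 * G (x *. x))) <= c0^2 * Ca^2 / (8 * ta) * jp x (2 * aa - 4)" by (simp add: power_mult_distrib)
  also have "... <= c0^2 * Ca^2 / (8 * ta) * 1"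
   using jb_powr_antimono[of 0 "2 * aa - 4" x] aa N ta by (intro mult_left_mono) auto
  also have "... <= k^2 / 8"
  proof -
   have "c0^2 * Ca^2 = k^2 * (c0^2 * Ca^2 / k^2)" using k by simp
   also have "... <= k^2 * ta" by (intro mult_left_mono) (auto simp: ta_def)
   finally show ?thesis using ta by (simp add: field_simps)
  qed
  finally have "(c0 * a x)^2 * (1 / (8 * G (x *. x))) <= k^2 / 8" .
  hence "(c0 * a x)^2 * (1 / (8 * G (x *. x))) * (E (x *. x) * v x)^2 <= k^2 / 8 * (E (x *. x) * v x)^2"
   by (rule mult_right_mono) simp
  thus ?thesis unfolding w_def by (simp add: power_mult_distrib mult_ac)
 qed
 have "k^2 / 4 * (LBINT x. (E (x *. x) * v x)^2) <= (LBINT x. (E (x *. x) * (c0 * w x))^2 / (8 * G (x *. x)))"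
  by (rule LIMSEQ_le[OF tendsto_mult_left[OF L1] L2]) (use ineq in auto)
 also have "... <= (LBINT x. k^2 / 8 * (E (x *. x) * v x)^2)" by (intro integral_mono L2i integrable_mult_right vi pt)
 also have "... = k^2 / 8 * (LBINT x. (E (x *. x) * v x)^2)" by simp
 finally have "(k^2 / 8) * (LBINT x. (E (x *. x) * v x)^2) <= 0" by argo
 hence "(LBINT x. (E (x *. x) * v x)^2) <= 0" using k by (simp add: mult_le_0_iff)
 moreover have "(LBINT x. (E (x *. x) * v x)^2) >= 0" by (rule Lint_nonneg) simp
 ultimately have "(LBINT x. (E (x *. x) * v x)^2) = 0" by linarith
 hence "AE x in lborel. (E (x *. x) * v x)^2 = 0" using integral_nonneg_eq_0_iff_AE[OF vi] by simp
 hence "(E (x *. x) * v x)^2 = 0" by (rule continuous_AE_zero[rotated]) (intro continuous_intros Ec v)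
 thus "v x = 0" using E(1)[OF xx[of x]] by simp
qed

section \<open>Compactness of the resolvent\<close>

text \<open>At most half of the excess of the exponent over (N+1)/2 is spent on a positive decay
  rate g of the resolvent; this rate is what prevents loss of compactness at infinity.\<close>

lemma resolvent_bound:
 fixes k aa :: real
 assumes N: "CARD('n::finite) >= 3" and k: "k > 0" and aa: "aa > (real CARD('n) + 1) / 2"
 shows "EX g>0. EX C>=0. resolvent_decay TYPE('n) k aa g C"
proof -
 let ?sg = "(real CARD('n) - 1) / 2"
 define g where "g = min ?sg ((aa - (real CARD('n) + 1) / 2) / 2)"
 have g: "0 < g" "g <= ?sg" "2 * g <= aa - (real CARD('n) + 1) / 2" using N aa by (auto simp: g_def min_def field_simps)
 have g': "0 <= g" "g <= aa" "?sg + aa - g > real DIM(real^'n)" using g aa N by (auto simp: field_simps)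
 obtain c where c: "c >= 0" "!!x::real^'n. norm (Phi k x) <= c * maj ?sg x" using fund_sol_bound[OF N k] by blast
 obtain C where C: "C >= 0" "!!x::real^'n. intble (%y. maj ?sg (x - y) * jp y aa)"
   "!!x::real^'n. (LBINT y. maj ?sg (x - y) * jp y aa) <= C * jp x g"
  using kernel_conv_decay[OF _ g'(1) g(2) g'(2,3)] N by auto
 show ?thesis
 proof (rule exI[of _ g], intro conjI g(1), rule exI[of _ "c * C"], intro conjI allI impI)
  show "0 <= c * C" using c C by simp
  fix w :: "real^'n => complex" and A and x :: "real^'n"
  assume w: "w : Lmeas" "ALL y. norm (w y) <= A * jp y aa"
  have A: "A >= 0" by (rule nbnd0[OF w(2)[rule_format, of 0]])
  note cb = conv_bound[OF C(2)[of x] fund_sol_measurable[OF N k] c(2) w(1) w(2)[rule_format]]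
  show "integrable lebesgue (%y. Phi k (x - y) * w y)" by (rule cb(1))
  have "norm (resolvent k w x) <= c * A * (LBINT y. maj ?sg (x - y) * jp y aa)"
   unfolding resolvent_def convolution_def by (rule cb(2))
  also have "... <= c * A * (C * jp x g)" using c A by (intro mult_left_mono C) auto
  finally show "norm (resolvent k w x) <= c * C * A * jp x g" by (simp add: mult_ac)
 qed
qed

lemma loc_kernel_small_ball:
 fixes e :: real
 assumes "DIM('a::euclidean_space) >= 3" "e > 0"
 obtains de where "de > 0" "intble (%z::'a. indicator (ball 0 de) z * (loc_kernel z + 1))"
  "(LBINT z. indicator (ball (0::'a) de) z * (loc_kernel z + 1)) < e"
proof -
 define d where "d n = 1 / (real n + 1)" for n
 have d: "0 < d n" "d n <= 1" for n by (auto simp: d_def)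
 have d0: "d ----> 0" unfolding d_def[abs_def] using LIMSEQ_inverse_real_of_nat by (simp add: inverse_eq_divide add.commute)
 let ?f = "%n z::'a. indicator (ball 0 (d n)) z * (loc_kernel z + 1)"
 have i: "intble (%z::'a. indicator (cball 0 1) z * (loc_kernel z + 1))"
 proof -
  have "intble (indicator (cball 0 1) :: 'a => real)"
  proof (rule integrable_real_indicator)
   show "emeasure lborel (cball (0::'a) 1) < \<infinity>" by (rule emeasure_lborel_cball_finite)
  qed simp
  moreover have "intble (%z::'a. loc_kernel z * indicator (cball 0 1) z)"
   by (intro integrable_real_mult_indicator integrable_loc_kernel assms) simp
  ultimately have "intble (%z::'a. loc_kernel z * indicator (cball 0 1) z + indicator (cball 0 1) z)"
   by (rule L1_add[rotated])
  hence "intble (%z::'a. indicator (cball 0 1) z * loc_kernel z + indicator (cball 0 1) z)" by (simp only: mult.commute)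
  thus ?thesis by (simp add: distrib_left)
 qed
 have m: "?f n : lmeas" for n
  using measurable_loc_kernel[where 'a='a] by (auto intro!: borel_measurable_times borel_measurable_indicator borel_measurable_add)
 have ae: "AE z::'a in lborel. z ~= 0" by (rule AE_lborel_singleton)
 have l: "AE z in lborel. (%n. ?f n z) ----> 0" using ae
 proof eventually_elim
  fix z :: 'a assume z: "z ~= 0"
  have "eventually (%n. d n < norm z) sequentially" using d0 z by (intro order_tendstoD(2)) auto
  hence "eventually (%n. ?f n z = 0) sequentially" by eventually_elim auto
  thus "(%n. ?f n z) ----> 0" by (rule tendsto_eventually)
 qed
 have b: "AE z in lborel. norm (?f n z) <= indicator (cball 0 1) z * (loc_kernel z + 1)" for n
  using d(2)[of n] loc_kernel_nonneg[where 'a='a] by (intro AE_I2) (auto simp: indicator_def intro: add_nonneg_nonneg)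
 have "(%n. LBINT z. ?f n z) ----> (LINT z::'a|lborel. 0)" by (rule integral_dominated_convergence[OF _ m i l b]) simp
 hence "eventually (%n. (LBINT z. ?f n z) < e) sequentially" using assms(2) by (intro order_tendstoD(2)) auto
 then obtain n where n: "(LBINT z. ?f n z) < e" by (auto simp: eventually_sequentially)
 have "intble (?f n)" by (rule integrable_dominated_convergence2[OF _ m i l b]) simp
 thus thesis using that[OF d(1)[of n]] n by blast
qed

lemma kernel_away_from_zero:
 fixes k r :: real
 assumes N: "CARD('n::finite) >= 3" and k: "k > 0" and r: "r > 0"
 shows "EX K>=0. ALL z::real^'n. norm z >= r --> norm (Phi k z) <= K * jp z ((real CARD('n) - 1) / 2)"
proof -
 let ?sg = "(real CARD('n) - 1) / 2" and ?m = "real CARD('n) - 2"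
 obtain c where c: "c >= 0" "!!x::real^'n. norm (Phi k x) <= c * maj ?sg x" using fund_sol_bound[OF N k] by blast
 have "norm (Phi k z) <= c * (r powr (- ?m) * 2 powr ?sg + 1) * jp z ?sg" if z: "norm z >= r" for z :: "real^'n"
 proof -
  have "loc_kernel z <= r powr (- ?m) * 2 powr ?sg * jp z ?sg"
  proof (cases "norm z <= 1")
   case True
   hence "jb z <= 2" using jb_le[of z] by linarith
   hence "2 powr (- ?sg) <= jp z ?sg" using jb_pos[of z] N by (intro powr_mono2') auto
   hence "2 powr ?sg * 2 powr (- ?sg) <= 2 powr ?sg * jp z ?sg" by (intro mult_left_mono) auto
   moreover have "2 powr ?sg * 2 powr (- ?sg) = (1::real)" unfolding powr_add[symmetric] by simp
   ultimately have j: "1 <= 2 powr ?sg * jp z ?sg" by simp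
   have "loc_kernel z = norm z powr (- ?m)" using True by (simp add: loc_kernel_def)
   also have "... <= r powr (- ?m)" using z r N by (intro powr_mono2') auto
   also have "... <= r powr (- ?m) * (2 powr ?sg * jp z ?sg)" using mult_left_mono[OF j, of "r powr (- ?m)"] by simp
   finally show ?thesis by (simp add: mult.assoc)
  next
   case False
   hence "loc_kernel z = 0" by (simp add: loc_kernel_def)
   thus ?thesis by simp
  qed
  hence "c * maj ?sg z <= c * (r powr (- ?m) * 2 powr ?sg * jp z ?sg + jp z ?sg)"
   using c(1) by (intro mult_left_mono add_right_mono) auto
  thus ?thesis using c(2)[of z] by (simp add: algebra_simps)
 qed
 moreover have "0 <= c * (r powr (- ?m) * 2 powr ?sg + 1)" using c(1) by (intro mult_nonneg_nonneg add_nonneg_nonneg) auto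
 ultimately show ?thesis by blast
qed

text \<open>Near x both kernels have small integral by absolute continuity; away from x they depend
  continuously on the centre and share a majorant.\<close>

lemma kernel_L1_continuous:
 fixes k aa :: real and X :: "nat => real^'n::finite"
 assumes N: "CARD('n) >= 3" and k: "k > 0" and aa: "aa > (real CARD('n) + 1) / 2" and X: "X ----> x"
 shows "(%n. LBINT y. norm (Phi k (x - y) - Phi k (X n - y)) * jp y aa) ----> 0"
  and "intble (%y. norm (Phi k (x - y) - Phi k (x' - y)) * jp y aa)"
proof -
 let ?sg = "(real CARD('n) - 1) / 2"
 define D where "D z y = norm (Phi k (x - y) - Phi k (z - y)) * jp y aa" for z y :: "real^'n"
 obtain c where c: "c >= 0" "!!x::real^'n. norm (Phi k x) <= c * maj ?sg x" using fund_sol_bound[OF N k] by blast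
 have dim: "DIM(real^'n) >= 3" using N by simp
 have sg0: "0 <= ?sg" and aa0: "0 <= aa" and sgaa: "?sg + aa - 0 > real DIM(real^'n)" using N aa by (auto simp: field_simps)
 have j1: "jp y aa <= 1" "jp y ?sg <= 1" for y :: "real^'n"
  using jb_powr_antimono[OF aa0, of y] jb_powr_antimono[OF sg0, of y] by simp_all
 obtain C where C: "!!x::real^'n. intble (%y. maj ?sg (x - y) * jp y aa)"
  using kernel_conv_decay[OF dim order_refl sg0 aa0 sgaa] by blast
 have Fm: "(Phi k :: real^'n => complex) : bmeas" by (rule fund_sol_measurable[OF N k])
 have Dm: "D z : lmeas" for z unfolding D_def[abs_def] using Fm by measurable
 have Di: "intble (D z)" for z
 proof (rule L1_bound)
  show "intble (%y. c * (maj ?sg (x - y) * jp y aa) + c * (maj ?sg (z - y) * jp y aa))"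
   by (intro L1_add integrable_mult_right C)
  show "D z : lmeas" by (rule Dm)
  show "AE y in lborel. norm (D z y) <= norm (c * (maj ?sg (x - y) * jp y aa) + c * (maj ?sg (z - y) * jp y aa))"
  proof (intro AE_I2)
   fix y :: "real^'n"
   have "norm (Phi k (x - y) - Phi k (z - y)) <= c * maj ?sg (x - y) + c * maj ?sg (z - y)"
    using norm_triangle_ineq4[of "fund_sol k (x - y)" "fund_sol k (z - y)"] c(2)[of "x - y"] c(2)[of "z - y"] by linarith
   hence "D z y <= (c * maj ?sg (x - y) + c * maj ?sg (z - y)) * jp y aa" unfolding D_def by (intro mult_right_mono) auto
   moreover have "0 <= D z y" by (simp add: D_def)
   ultimately show "norm (D z y) <= norm (c * (maj ?sg (x - y) * jp y aa) + c * (maj ?sg (z - y) * jp y aa))"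
    unfolding real_norm_def distrib_right[of "c * _"] mult.assoc by linarith
  qed
 qed
 thus "intble (%y. norm (Phi k (x - y) - Phi k (x' - y)) * jp y aa)" by (simp add: D_def[abs_def])
 have "(%n. LBINT y. D (X n) y) ----> 0"
 proof (rule tendstoI)
  fix e :: real assume e: "e > 0"
  have "e / (4 * (c + 1)) > 0" using e c(1) by simp
  then obtain de where de: "de > 0" "intble (%z::real^'n. indicator (ball 0 de) z * (loc_kernel z + 1))"
   "(LBINT z. indicator (ball (0::real^'n) de) z * (loc_kernel z + 1)) < e / (4 * (c + 1))"
   by (rule loc_kernel_small_ball[OF dim])
  define I where "I z = indicator (ball 0 de) z * (loc_kernel z + 1)" for z :: "real^'n"
  have Ii: "intble (%y. I (z - y))" "(LBINT y. I (z - y)) < e / (4 * (c + 1))" for z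
   using lborel_reflect[OF de(2), of z] de(3) by (simp_all add: I_def)
  have I0: "I z >= 0" for z using loc_kernel_nonneg[of z] by (simp add: I_def)
  \<comment> \<open>With r = de/2 and rh <= r/2, a point y within r of x is within de of X n too,
    and a point at distance at least r from x keeps distance r/2 from X n.\<close>
  define r where "r = de / 2"
  define rh where "rh = min (r / 2) 1"
  have r: "r > 0" "rh > 0" "rh <= r / 2" "rh <= 1" using de(1) by (auto simp: r_def rh_def)
  obtain K where K: "K >= 0" "!!z::real^'n. norm z >= r / 2 ==> norm (Phi k z) <= K * jp z ?sg"
   using kernel_away_from_zero[OF N k, of "r / 2"] r by auto
  \<comment> \<open>Set to 0 also for those n where X n is not yet close to x, so that the majorant
    holds for every n.\<close>
  define Q where "Q n y = (if norm (X n - x) < rh & r <= norm (x - y) then D (X n) y else 0)" for n y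
  have Ql: "(%n. LBINT y. Q n y) ----> (LINT y::real^'n|lborel. 0)"
  proof (rule integral_dominated_convergence[where w = "%y. K * (1 + 4 powr ?sg) * (maj ?sg (x - y) * jp y aa)"])
   show "intble (%y. K * (1 + 4 powr ?sg) * (maj ?sg (x - y) * jp y aa))" by (intro integrable_mult_right C)
   show "Q n : lmeas" for n unfolding Q_def[abs_def] using Dm[of "X n"] by measurable
   have ae: "AE y::real^'n in lborel. y ~= x" by (rule AE_lborel_singleton)
   show "AE y in lborel. (%n. Q n y) ----> 0" using ae
   proof eventually_elim
    fix y assume y: "y ~= x"
    have "open (- {0::real^'n})" by (rule open_Compl) simp
    hence "isCont (Phi k) (x - y)" using fund_sol_facts(4)[OF N k] y by (simp add: continuous_on_eq_continuous_at)
    moreover have "(%n. X n - y) ----> x - y" by (intro tendsto_intros X)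
    ultimately have "(%n. Phi k (X n - y)) ----> Phi k (x - y)" by (rule isCont_tendsto_compose)
    hence "(%n. norm (Phi k (x - y) - Phi k (X n - y)) * jp y aa) ----> norm (Phi k (x - y) - Phi k (x - y)) * jp y aa"
     by (intro tendsto_intros)
    hence "(%n. D (X n) y) ----> 0" by (simp add: D_def)
    thus "(%n. Q n y) ----> 0" by (rule Lim_null_comparison[rotated]) (auto simp: Q_def D_def intro!: always_eventually)
   qed
   show "AE y in lborel. norm (Q n y) <= K * (1 + 4 powr ?sg) * (maj ?sg (x - y) * jp y aa)" for n
   proof (intro AE_I2)
    fix y :: "real^'n"
    have nn: "0 <= K * (1 + 4 powr ?sg) * (maj ?sg (x - y) * jp y aa)"
     using K(1) loc_kernel_nonneg[of "x - y"] by (intro mult_nonneg_nonneg add_nonneg_nonneg) auto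
    show "norm (Q n y) <= K * (1 + 4 powr ?sg) * (maj ?sg (x - y) * jp y aa)"
    proof (cases "norm (X n - x) < rh & r <= norm (x - y)")
     case False
     hence "Q n y = 0" by (simp only: Q_def if_False)
     thus ?thesis using nn by simp
    next
     case True
     have "norm (x - y) <= norm (X n - y) + norm (X n - x)" using norm_triangle_ineq4[of "X n - y" "X n - x"] by simp
     hence far: "r / 2 <= norm (X n - y)" "r / 2 <= norm (x - y)" using True r by linarith+
     have "jp ((x - y) + 1 *R (X n - x)) ?sg <= 4 powr ?sg * jp (x - y) ?sg" by (rule jb_shift_powr) (use True r sg0 in auto)
     hence sh: "jp (X n - y) ?sg <= 4 powr ?sg * jp (x - y) ?sg" by simp
     have "norm (Phi k (x - y) - Phi k (X n - y)) <= K * jp (x - y) ?sg + K * (4 powr ?sg * jp (x - y) ?sg)"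
      using norm_triangle_ineq4[of "fund_sol k (x - y)" "fund_sol k (X n - y)"] K(2)[OF far(2)] K(2)[OF far(1)] mult_left_mono[OF sh K(1)] by linarith
     also have "... = K * (1 + 4 powr ?sg) * jp (x - y) ?sg" by (simp add: algebra_simps)
     also have "... <= K * (1 + 4 powr ?sg) * maj ?sg (x - y)"
      using K(1) loc_kernel_nonneg[of "x - y"] by (intro mult_left_mono mult_nonneg_nonneg add_nonneg_nonneg) auto
     finally have "D (X n) y <= K * (1 + 4 powr ?sg) * maj ?sg (x - y) * jp y aa"
      unfolding D_def by (rule mult_right_mono) simp
     moreover have "norm (Q n y) = D (X n) y" using True by (simp add: Q_def D_def)
     ultimately show ?thesis by (simp only: mult.assoc)
    qed
   qed
  qed simp
  have Qi: "intble (Q n)" for n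
  proof (rule L1_bound[OF Di[of "X n"]])
   show "Q n : lmeas" unfolding Q_def[abs_def] using Dm[of "X n"] by measurable
   show "AE y in lborel. norm (Q n y) <= norm (D (X n) y)" by (intro AE_I2) (simp add: Q_def)
  qed
  have "eventually (%n. (LBINT y. Q n y) < e / 2) sequentially" using Ql e by (intro order_tendstoD(2)) auto
  moreover have "eventually (%n. norm (X n - x) < rh) sequentially" using tendstoD[OF X r(2)] by (simp add: dist_norm)
  ultimately show "eventually (%n. dist (LBINT y. D (X n) y) 0 < e) sequentially"
  proof eventually_elim
   fix n assume 1: "(LBINT y. Q n y) < e / 2" and 2: "norm (X n - x) < rh"
   have pt: "D (X n) y <= c * (I (x - y) + I (X n - y)) + Q n y" for y
   proof (cases "r <= norm (x - y)")
    case True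
    hence "Q n y = D (X n) y" using 2 by (simp add: Q_def)
    thus ?thesis using c(1) I0[of "x - y"] I0[of "X n - y"] by simp
   next
    case False
    have "norm (X n - y) <= norm (X n - x) + norm (x - y)" using norm_triangle_ineq[of "X n - x" "x - y"] by simp
    hence near: "norm (X n - y) < de" "norm (x - y) < de" using False 2 r de(1) by (auto simp: r_def)
    have b: "norm (Phi k z) <= c * I z" if "norm z < de" for z :: "real^'n"
    proof -
     have "c * maj ?sg z <= c * (loc_kernel z + 1)" using c(1) j1(2)[of z] by (intro mult_left_mono) auto
     thus ?thesis using c(2)[of z] that by (simp add: I_def)
    qed
    have "norm (Phi k (x - y) - Phi k (X n - y)) <= c * (I (x - y) + I (X n - y))"
     using norm_triangle_ineq4[of "fund_sol k (x - y)" "fund_sol k (X n - y)"] b[OF near(1)] b[OF near(2)] by (simp add: distrib_left)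
    hence "D (X n) y <= c * (I (x - y) + I (X n - y)) * 1" unfolding D_def
     using c(1) I0[of "x - y"] I0[of "X n - y"] by (intro mult_mono j1) auto
    moreover have "0 <= Q n y" by (simp add: Q_def D_def)
    ultimately show ?thesis by simp
   qed
   have "(LBINT y. D (X n) y) <= (LBINT y. c * (I (x - y) + I (X n - y)) + Q n y)"
    by (intro integral_mono Di Qi L1_add integrable_mult_right Ii pt)
   also have "... = c * ((LBINT y. I (x - y)) + (LBINT y. I (X n - y))) + (LBINT y. Q n y)" using Ii(1) Qi by simp
   also have "... <= c * (e / (4 * (c + 1)) + e / (4 * (c + 1))) + (LBINT y. Q n y)"
    using Ii(2)[of x] Ii(2)[of "X n"] c(1) by (intro add_right_mono mult_left_mono) auto
   also have "c * (e / (4 * (c + 1)) + e / (4 * (c + 1))) <= e / 2"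
   proof -
    have "c * (e / (4 * (c + 1)) + e / (4 * (c + 1))) = c / (c + 1) * (e / 2)" using c(1) by (simp add: divide_simps)
    also have "... <= 1 * (e / 2)" using c(1) e by (intro mult_right_mono) auto
    finally show ?thesis by simp
   qed
   finally have "(LBINT y. D (X n) y) < e" using 1 by linarith
   moreover have "0 <= (LBINT y. D (X n) y)" by (rule Lint_nonneg) (simp add: D_def)
   ultimately show "dist (LBINT y. D (X n) y) 0 < e" by simp
  qed
 qed
 thus "(%n. LBINT y. norm (Phi k (x - y) - Phi k (X n - y)) * jp y aa) ----> 0" by (simp add: D_def)
qed

text \<open>The radius d is found before w is fixed and depends on it only through A: the
  L1-distance of the translated kernels controls all densities at once.\<close>

lemma resolvent_equicontinuous:
 fixes k aa A e :: real and x :: "real^'n::finite"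
 assumes N: "CARD('n) >= 3" and k: "k > 0" and aa: "aa > (real CARD('n) + 1) / 2" and e: "e > 0"
 shows "EX d>0. ALL (w :: real^'n => complex) x'. w : Lmeas --> (ALL y. norm (w y) <= A * jp y aa) --> norm (x - x') < d -->
   norm (resolvent k w x - resolvent k w x') < e"
proof -
 define D where "D z = (LBINT y. norm (Phi k (x - y) - Phi k (z - y)) * jp y aa)" for z
 have "isCont D x"
 proof (rule continuous_at_sequentiallyI)
  fix X assume "X ----> x"
  hence "(%n. D (X n)) ----> 0" unfolding D_def by (rule kernel_L1_continuous(1)[OF N k aa])
  thus "(%n. D (X n)) ----> D x" by (simp add: D_def)
 qed
 moreover have "e / (abs A + 1) > 0" using e by simp
 ultimately obtain d where d: "d > 0" "!!z. dist z x < d ==> dist (D z) (D x) < e / (abs A + 1)"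
  unfolding continuous_at_eps_delta by blast
 obtain g C where "resolvent_decay TYPE('n) k aa g C" using resolvent_bound[OF N k aa] by blast
 hence wi: "integrable lebesgue (%y. Phi k (z - y) * w y)" if "w : Lmeas" "ALL y. norm (w y) <= A * jp y aa" for w :: "real^'n => complex" and z
  using that by blast
 show ?thesis
 proof (intro exI[of _ d] conjI d(1) allI impI)
  fix w :: "real^'n => complex" and x'
  assume w: "w : Lmeas" "ALL y. norm (w y) <= A * jp y aa" and x': "norm (x - x') < d"
  have A: "A >= 0" by (rule nbnd0[OF w(2)[rule_format, of 0]])
  have i: "intble (%y. A * (norm (Phi k (x - y) - Phi k (x' - y)) * jp y aa))"
   by (intro integrable_mult_right kernel_L1_continuous(2)[OF N k aa, of "%_. x"]) simp
  have "resolvent k w x - resolvent k w x' = (LINT y|lebesgue. Phi k (x - y) * w y - Phi k (x' - y) * w y)"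
   unfolding resolvent_def convolution_def using wi[OF w] by simp
  also have "norm ... <= (LINT y|lebesgue. A * (norm (Phi k (x - y) - Phi k (x' - y)) * jp y aa))"
  proof (rule Lint_norm_bound_integral)
   show "integrable lebesgue (%y. Phi k (x - y) * w y - Phi k (x' - y) * w y)" using wi[OF w] by simp
   show "integrable lebesgue (%y. A * (norm (Phi k (x - y) - Phi k (x' - y)) * jp y aa))"
    using i by (subst integrable_completion) auto
   fix y
   have "norm (Phi k (x - y) * w y - Phi k (x' - y) * w y) = norm (Phi k (x - y) - Phi k (x' - y)) * norm (w y)"
    by (simp add: norm_mult[symmetric] left_diff_distrib)
   also have "... <= norm (Phi k (x - y) - Phi k (x' - y)) * (A * jp y aa)" using w(2) by (intro mult_left_mono) auto
   finally show "norm (Phi k (x - y) * w y - Phi k (x' - y) * w y) <= A * (norm (Phi k (x - y) - Phi k (x' - y)) * jp y aa)"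
    by (simp add: mult_ac)
  qed
  also have "... = A * D x'" using i unfolding D_def by (subst integral_completion) auto
  also have "... <= abs A * (e / (abs A + 1))"
  proof -
   have "dist (D x') (D x) < e / (abs A + 1)" using d(2)[of x'] x' by (simp add: dist_norm norm_minus_commute)
   moreover have "D x = 0" by (simp add: D_def)
   ultimately have "D x' <= e / (abs A + 1)" by (simp add: dist_real_def)
   hence "A * D x' <= A * (e / (abs A + 1))" by (rule mult_left_mono[OF _ A])
   thus ?thesis by (simp only: abs_of_nonneg[OF A])
  qed
  also have "... < e" using e by (simp add: field_simps)
  finally show "norm (resolvent k w x - resolvent k w x') < e" .
 qed
qed

text \<open>The Arzela-Ascoli theorem on the whole space by compactification: p identifies the open
  unit ball with the space, and the uniform decay makes the extension by 0 equicontinuous at the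
  boundary sphere.\<close>

lemma uniform_subsequence:
 fixes G :: "nat => 'a::euclidean_space => 'b::{real_normed_vector,heine_borel}"
 assumes g: "g > 0" and dec: "!!n x. norm (G n x) <= C * jp x g"
  and eqc: "!!x e. e > 0 ==> EX d>0. ALL n y. norm (x - y) < d --> norm (G n x - G n y) < e"
 obtains r :: "nat => nat" and L where "strict_mono r" "cont L"
  "!!e. e > 0 ==> EX M. ALL n>=M. ALL x. norm (G (r n) x - L x) < e"
proof -
 have C: "C >= 0" by (rule nbnd0[OF dec[of 0 0]])
 define p where "p z = z /\<^sub>R (1 - norm z)" for z :: 'a
 define H where "H n z = (if norm z < 1 then G n (p z) else 0)" for n z
 have pc: "isCont p z" if "norm z < 1" for z unfolding p_def[abs_def] using that by (intro continuous_intros) auto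
 have np: "norm (p z) = norm z / (1 - norm z)" if "norm z < 1" for z
  using that by (simp add: p_def divide_inverse mult.commute)
 have CB: "norm (H n z) <= C" for n z
 proof -
  have "jp (p z) g <= 1" using jb_powr_antimono[of 0 g "p z"] g by simp
  hence "C * jp (p z) g <= C * 1" using C by (intro mult_left_mono)
  thus ?thesis using dec[of n "p z"] C by (simp add: H_def)
 qed
 have eq: "EX d. 0 < d & (ALL n y. y : cball 0 1 & norm (z - y) < d --> norm (H n z - H n y) < e)"
  if z: "z : cball 0 1" and e: "e > 0" for z e
 proof (cases "norm z < 1")
  case True
  obtain d1 where d1: "d1 > 0" "!!n y. norm (p z - y) < d1 ==> norm (G n (p z) - G n y) < e" using eqc[OF e, of "p z"] by blast
  obtain d2 where d2: "d2 > 0" "!!y. dist y z < d2 ==> dist (p y) (p z) < d1"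
   using pc[OF True] d1(1) unfolding continuous_at_eps_delta by blast
  show ?thesis
  proof (intro exI[of _ "min d2 (1 - norm z)"] conjI allI impI)
   show "0 < min d2 (1 - norm z)" using d2(1) True by simp
   fix n y assume y: "y : cball 0 1 & norm (z - y) < min d2 (1 - norm z)"
   have "norm y <= norm z + norm (z - y)" using norm_triangle_ineq4[of z "z - y"] by simp
   hence "norm y < 1" using y by linarith
   moreover have "norm (p z - p y) < d1" using d2(2)[of y] y by (simp add: dist_norm norm_minus_commute)
   ultimately show "norm (H n z - H n y) < e" using d1(2)[of "p y" n] True by (simp add: H_def)
  qed
 next
  case False
  \<comment> \<open>Beyond radius R the common bound C R^(-g) is below e; C + 1 in place of C makes
    the inequality strict.\<close>
  define R where "R = ((C + 1) / e) powr (1 / g)"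
  have R: "R > 0" "C * R powr (-g) < e"
  proof -
   show "R > 0" using C e by (simp add: R_def)
   have "R powr (-g) = ((C + 1) / e) powr (-1)" using g by (simp add: R_def powr_powr)
   also have "... = e / (C + 1)" using C e by (simp add: powr_minus_divide)
   finally have "C * R powr (-g) = C / (C + 1) * e" by simp
   also have "... < 1 * e" using C e by (intro mult_strict_right_mono) auto
   finally show "C * R powr (-g) < e" by simp
  qed
  have nz: "norm z = 1" using z False by simp
  show ?thesis
  proof (intro exI[of _ "1 / (1 + R)"] conjI allI impI)
   show "0 < 1 / (1 + R)" using R by simp
   fix n y assume y: "y : cball 0 1 & norm (z - y) < 1 / (1 + R)"
   have Hz: "H n z = 0" using False by (simp add: H_def)
   show "norm (H n z - H n y) < e"
   proof (cases "norm y < 1")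
    case False thus ?thesis using e Hz by (simp add: H_def)
   next
    case True
    have "1 - norm y <= norm (z - y)" using norm_triangle_ineq2[of z y] nz by simp
    hence "1 - norm y < 1 / (1 + R)" using y by linarith
    hence "(1 - norm y) * (1 + R) < 1" using R by (simp add: less_divide_eq)
    hence "R * (1 - norm y) <= norm y" by (simp add: algebra_simps)
    hence "R <= norm (p y)" unfolding np[OF True] using True by (simp add: le_divide_eq)
    hence "R <= jb (p y)" using norm_le_jb[of "p y"] by linarith
    hence "jp (p y) g <= R powr (-g)" using R g by (intro powr_mono2') auto
    hence "C * jp (p y) g <= C * R powr (-g)" by (rule mult_left_mono[OF _ C])
    thus ?thesis using dec[of n "p y"] R(2) True Hz by (simp add: H_def)
   qed
  qed
 qed
 obtain h r where hr: "continuous_on (cball 0 1) h" "strict_mono (r :: nat => nat)"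
   "!!e. 0 < e ==> EX N. ALL n x. n >= N & x : cball 0 1 --> norm (H (r n) x - h x) < e"
  using Arzela_Ascoli[OF compact_cball CB eq] by blast
 define q where "q x = x /\<^sub>R (1 + norm x)" for x :: 'a
 have nq: "norm (q x) = norm x / (1 + norm x)" for x by (simp add: q_def divide_inverse mult.commute)
 have q1: "norm (q x) < 1" for x unfolding nq by (simp add: divide_less_eq add_pos_nonneg)
 have pq: "p (q x) = x" for x
 proof -
  have n0: "1 + norm x > 0" using norm_ge_zero[of x] by linarith
  have "1 - norm (q x) = 1 / (1 + norm x)" unfolding nq using n0 by (simp add: field_simps)
  thus ?thesis using n0 unfolding p_def by (simp add: q_def)
 qed
 show thesis
 proof (rule that[OF hr(2)])
  have "cont q" unfolding q_def[abs_def]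
   by (intro continuous_intros) (metis add_pos_nonneg less_irrefl norm_ge_zero zero_less_one)
  thus "cont (%x. h (q x))" by (rule continuous_on_compose2[OF hr(1)]) (use q1[THEN less_imp_le] in auto)
  fix e :: real assume "e > 0"
  then obtain M where M: "ALL n x. n >= M & x : cball 0 1 --> norm (H (r n) x - h x) < e" using hr(3) by blast
  show "EX M. ALL n>=M. ALL x. norm (G (r n) x - h (q x)) < e"
  proof (intro exI[of _ M] allI impI)
   fix n x assume "n >= M"
   hence "norm (H (r n) (q x) - h (q x)) < e" using M q1[of x] by (simp add: less_imp_le)
   thus "norm (G (r n) x - h (q x)) < e" using q1[of x] by (simp add: H_def pq)
  qed
 qed
qed

lemma resolvent_continuous:
 fixes w :: "real^'n::finite => complex"
 assumes N: "CARD('n) >= 3" and k: "k > 0" and aa: "aa > (real CARD('n) + 1) / 2"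
  and w: "w : Lmeas" "!!y. norm (w y) <= A * jp y aa"
 shows "resolvent k w : bcontfun"
proof -
 obtain g C where g: "g > 0" "C >= 0" and gC: "resolvent_decay TYPE('n) k aa g C" using resolvent_bound[OF N k aa] by blast
 have A: "A >= 0" by (rule nbnd0[OF w(2)[of 0]])
 have "norm (resolvent k w x) <= C * A" for x
 proof -
  have "norm (resolvent k w x) <= C * A * jp x g" using gC w by blast
  also have "... <= C * A * 1" using jb_powr_antimono[of 0 g x] g A by (intro mult_left_mono) auto
  finally show ?thesis by simp
 qed
 hence "bounded (range (resolvent k w))" by (auto intro: boundedI)
 moreover have "cont (resolvent k w)"
 proof (intro continuous_at_imp_continuous_on ballI)
  fix x
  show "isCont (resolvent k w) x" unfolding continuous_at_eps_delta
  proof (intro allI impI)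
   fix e :: real assume "e > 0"
   then obtain d where "d > 0" and d: "ALL (w :: real^'n => complex) x'. w : Lmeas --> (ALL y. norm (w y) <= A * jp y aa) --> norm (x - x') < d -->
     norm (resolvent k w x - resolvent k w x') < e" using resolvent_equicontinuous[OF N k aa] by blast
   thus "EX d>0. ALL x'. dist x' x < d --> dist (resolvent k w x') (resolvent k w x) < e"
    using w by (intro exI[of _ d]) (auto simp: dist_norm norm_minus_commute)
  qed
 qed
 ultimately show ?thesis by (simp add: bcontfun_def)
qed

lemma resolvent_compact:
 fixes w :: "nat => real^'n::finite => complex" and V :: "nat => ((real^'n) \<Rightarrow>\<^sub>C complex)" and c :: "nat => real"
 assumes N: "CARD('n) >= 3" and k: "k > 0" and aa: "aa > (real CARD('n) + 1) / 2"
  and w: "!!n. w n : Lmeas" "!!n y. norm (w n y) <= A * jp y aa"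
  and c: "!!n. abs (c n) <= 1" and V: "!!n x. bcf (V n) x = c n *R resolvent k (w n) x"
 shows "EX r L. strict_mono (r :: nat => nat) & (%n. V (r n)) ----> L"
proof -
 obtain g C where g: "g > 0" "C >= 0" and gC: "resolvent_decay TYPE('n) k aa g C" using resolvent_bound[OF N k aa] by blast
 have cz: "norm (c n *R z) <= norm z" for n and z :: complex using c[of n] by (simp add: mult_left_le_one_le)
 have dec: "norm (bcf (V n) x) <= C * A * jp x g" for n x
 proof -
  have "norm (resolvent k (w n) x) <= C * A * jp x g" using gC w by blast
  thus ?thesis unfolding V using cz[of n "resolvent k (w n) x"] by linarith
 qed
 have eqc: "EX d>0. ALL n y. norm (x - y) < d --> norm (bcf (V n) x - bcf (V n) y) < e" if "e > 0" for x e
 proof -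
  obtain d where "d > 0" and d: "ALL (w :: real^'n => complex) x'. w : Lmeas --> (ALL y. norm (w y) <= A * jp y aa) --> norm (x - x') < d -->
     norm (resolvent k w x - resolvent k w x') < e" using resolvent_equicontinuous[OF N k aa `e > 0`] by blast
  show ?thesis
  proof (intro exI[of _ d] conjI `d > 0` allI impI)
   fix n y assume "norm (x - y) < d"
   hence "norm (resolvent k (w n) x - resolvent k (w n) y) < e" using d w by blast
   thus "norm (bcf (V n) x - bcf (V n) y) < e"
    unfolding V scaleR_diff_right[symmetric] using cz[of n "resolvent k (w n) x - resolvent k (w n) y"] by linarith
  qed
 qed
 obtain r :: "nat => nat" and L where r: "strict_mono r" and L: "cont L"
  "!!e. e > 0 ==> EX M. ALL n>=M. ALL x. norm (bcf (V (r n)) x - L x) < e"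
  by (rule uniform_subsequence[OF g(1) dec eqc], assumption, rule that; assumption)
 have "bounded (range L)"
 proof -
  obtain M where "ALL n>=M. ALL x. norm (bcf (V (r n)) x - L x) < 1" using L(2)[of 1] by auto
  hence M: "norm (bcf (V (r M)) x - L x) < 1" for x by blast
  have "norm (L x) <= norm (V (r M)) + 1" for x
   using M[of x] norm_bounded[of "V (r M)" x] norm_triangle_ineq4[of "bcf (V (r M)) x" "bcf (V (r M)) x - L x"] by simp
  thus ?thesis by (auto intro: boundedI)
 qed
 hence Lb: "L : bcontfun" using L(1) by (simp add: bcontfun_def)
 have ap: "bcf (Bcontfun L) x = L x" for x using Bcontfun_inverse[OF Lb] by simp
 have "(%n. V (r n)) ----> Bcontfun L"
 proof (rule metric_LIMSEQ_I)
  fix e :: real assume e: "e > 0"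
  then obtain M where M: "ALL n>=M. ALL x. norm (bcf (V (r n)) x - L x) < e / 2" using L(2)[of "e / 2"] by auto
  have "dist (V (r n)) (Bcontfun L) < e" if n: "n >= M" for n
  proof -
   have "dist (V (r n)) (Bcontfun L) <= e / 2" using M n by (intro dist_bound) (auto simp: ap dist_norm less_imp_le)
   thus ?thesis using e by linarith
  qed
  thus "EX M. ALL n>=M. dist (V (r n)) (Bcontfun L) < e" by blast
 qed
 thus ?thesis using r by blast
qed

section \<open>A priori bounds and existence\<close>

lemma growth_bound:
 assumes "growth aa g M < ereal r" "cmod u <= M"
 shows "cmod (g x u) <= r * jp x aa"
proof -
 have "ereal (jb x powr aa * cmod (g x u)) <= growth aa g M"
  unfolding growth_def by (rule SUP_upper2[of "(x, u)"]) (use assms in auto)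
 hence "ereal (jb x powr aa * cmod (g x u)) < ereal r" using assms(1) by (rule le_less_trans)
 hence "jb x powr aa * cmod (g x u) <= r" by simp
 hence "jp x aa * (jb x powr aa * cmod (g x u)) <= jp x aa * r" by (rule mult_left_mono) simp
 moreover have e: "jp x aa * jb x powr aa = 1" unfolding powr_add[symmetric] by simp
 ultimately have "cmod (g x u) <= jp x aa * r" unfolding mult.assoc[symmetric] e by simp
 thus ?thesis by (simp only: mult.commute)
qed

lemma growth_bound_exists:
 assumes "growth aa g M < \<infinity>"
 shows "EX A>=0. ALL x u. cmod u <= M --> cmod (g x u) <= A * jp x aa"
proof -
 obtain r where "growth aa g M < ereal r" using assms less_PInf_Ex_of_nat by auto
 hence "growth aa g M < ereal (max r 0)" by (rule less_le_trans) simp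
 from growth_bound[OF this] show ?thesis by (intro exI[of _ "max r 0"]) auto
qed

lemma superposition_measurable:
 fixes f :: "'a::euclidean_space => complex => complex"
 assumes f: "cont (%(x, u). f x u)" and u: "u : Lmeas"
 shows "(%y. f y (u y)) : Lmeas"
proof -
 have "(%(x, u). f x u) : borel_measurable (borel \<Otimes>\<^sub>M borel)"
  using borel_measurable_continuous_onI[OF f] by (simp add: borel_prod)
 moreover have "(%y. (y, u y)) : measurable lebesgue (borel \<Otimes>\<^sub>M borel)"
  by (intro measurable_Pair u measurable_completion) simp
 ultimately have "(%y. (%(x, u). f x u) (y, u y)) : Lmeas" by (rule measurable_compose[rotated])
 thus ?thesis by simp
qed

text \<open>Outside a large ball the spare decay aa - be makes the difference small; inside, f is
  uniformly continuous on a compact set. The function ph enters only through its bound, so it need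
  not be continuous.\<close>

lemma superposition_continuous:
 fixes f :: "'a::euclidean_space => complex => complex" and v :: "'a \<Rightarrow>\<^sub>C complex" and ph :: "'a => complex"
 assumes f: "cont (%(x, u). f x u)" and fb: "!!M. EX A>=0. ALL x u. cmod u <= M --> cmod (f x u) <= A * jp x aa"
  and ph: "!!x. cmod (ph x) <= B" and be: "be < aa" "0 <= be" and e: "e > 0"
 shows "EX d>0. ALL v'. dist v' v < d --> (ALL y. cmod (f y (bcf v' y + ph y) - f y (bcf v y + ph y)) <= e * jp y be)"
proof -
 define M where "M = norm v + 1 + B"
 obtain A where A: "A >= 0" "!!x u. cmod u <= M ==> cmod (f x u) <= A * jp x aa" using fb by blast
 define R where "R = ((2 * A + 1) / e) powr (1 / (aa - be))"
 have R: "R > 0" using A e by (simp add: R_def)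
 have AR: "2 * A * R powr (- (aa - be)) <= e"
 proof -
  have inv: "1 / d * (- d) = -1" if "d > 0" for d :: real using that by simp
  have "1 / (aa - be) * (- (aa - be)) = -1" by (rule inv) (use be(1) in simp)
  hence "R powr (- (aa - be)) = ((2 * A + 1) / e) powr (-1)" by (simp only: R_def powr_powr)
  also have "... = e / (2 * A + 1)" using A e by (simp add: powr_minus_divide)
  finally have "2 * A * R powr (- (aa - be)) = 2 * A / (2 * A + 1) * e" by simp
  also have "... <= 1 * e" using A e by (intro mult_right_mono) auto
  finally show ?thesis by simp
 qed
 let ?K = "cball (0::'a) R \<times> cball (0::complex) M"
 have "uniformly_continuous_on ?K (%(x, u). f x u)"
  by (intro compact_uniformly_continuous continuous_on_subset[OF f] compact_Times) auto
 moreover have pos: "e * (1 + R) powr (-be) > 0" using e R by simp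
 ultimately obtain d where d: "d > 0" "!!p p'. p : ?K ==> p' : ?K ==> dist p' p < d ==> dist (case_prod f p') (case_prod f p) < e * (1 + R) powr (-be)"
  unfolding uniformly_continuous_on_def by blast
 show ?thesis
 proof (intro exI[of _ "min d 1"] conjI allI impI)
  show "0 < min d 1" using d by simp
  fix v' y assume v': "dist v' v < min d 1"
  let ?u = "bcf v y + ph y" and ?u' = "bcf v' y + ph y"
  have dv: "dist (bcf v' y) (bcf v y) < min d 1" by (rule dist_fun_lt_imp_dist_val_lt[OF v'])
  have u: "cmod ?u <= M" "cmod ?u' <= M"
  proof -
   have "cmod ?u <= norm v + B" using norm_triangle_ineq[of "bcf v y" "ph y"] norm_bounded[of v y] ph[of y] by linarith
   thus "cmod ?u <= M" by (simp add: M_def)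
   have "cmod (bcf v' y) <= norm v + 1"
    using norm_triangle_ineq[of "bcf v y" "bcf v' y - bcf v y"] dv norm_bounded[of v y] by (simp add: dist_norm)
   thus "cmod ?u' <= M" unfolding M_def using norm_triangle_ineq[of "bcf v' y" "ph y"] ph[of y] by linarith
  qed
  show "cmod (f y ?u' - f y ?u) <= e * jp y be"
  proof (cases "norm y <= R")
   case True
   have "dist (case_prod f (y, ?u')) (case_prod f (y, ?u)) < e * (1 + R) powr (-be)"
    by (rule d(2)) (use True u dv in "auto simp: dist_Pair_Pair")
   moreover have "(1 + R) powr (-be) <= jp y be" using jb_le[of y] True R be(2) jb_pos[of y] by (intro powr_mono2') auto
   hence "e * (1 + R) powr (-be) <= e * jp y be" using e by (intro mult_left_mono) auto
   ultimately show ?thesis by (simp add: dist_norm)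
  next
   case False
   have "cmod (f y ?u' - f y ?u) <= 2 * A * jp y aa"
    using norm_triangle_ineq4[of "f y ?u'" "f y ?u"] A(2)[OF u(1), of y] A(2)[OF u(2), of y] by linarith
   also have "... = (2 * A * jp y (aa - be)) * jp y be" by (simp add: mult.assoc powr_add[symmetric])
   also have "... <= (2 * A * R powr (- (aa - be))) * jp y be"
    using False A(1) R be norm_le_jb[of y] by (intro mult_right_mono mult_left_mono powr_mono2') auto
   also have "... <= e * jp y be" by (intro mult_right_mono AR) simp
   finally show ?thesis .
  qed
 qed
qed

lemma resolvent_diff:
 fixes w1 w2 :: "real^'n::finite => complex"
 assumes N: "CARD('n) >= 3" and k: "k > 0" and aa: "aa > (real CARD('n) + 1) / 2"
  and w: "w1 : Lmeas" "!!y. norm (w1 y) <= A1 * jp y aa" "w2 : Lmeas" "!!y. norm (w2 y) <= A2 * jp y aa"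
 shows "resolvent k w1 x - resolvent k w2 x = resolvent k (%y. w1 y - w2 y) x"
proof -
 have "integrable lebesgue (%y. Phi k (x - y) * w1 y)" "integrable lebesgue (%y. Phi k (x - y) * w2 y)"
  using resolvent_bound[OF N k aa] w by blast+
 thus ?thesis unfolding resolvent_def convolution_def by (simp add: right_diff_distrib)
qed

text \<open>The given solution is absorbed into the nonlinearity, which leaves an unknown in the
  space of bounded continuous functions, where Schaefer's theorem applies.\<close>

theorem solution_of_apriori_bound:
 fixes f :: "real^'n::finite => complex => complex" and ph :: "real^'n => complex"
 assumes N: "CARD('n) >= 3" and k: "k > 0" and aa: "aa > (real CARD('n) + 1) / 2" and f: "cont (%(x, u). f x u)"
  and fb: "!!M. EX A>=0. ALL x u. cmod u <= M --> cmod (f x u) <= A * jp x aa" and ph: "ph : Lmeas" "!!x. cmod (ph x) <= B"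
  and apriori: "!!c (v :: (real^'n) \<Rightarrow>\<^sub>C complex). 0 <= c ==> c <= 1 ==>
   (!!x. bcf v x = c *R resolvent k (%y. f y (bcf v y + ph y)) x) ==> norm v < R"
 shows "EX v :: (real^'n) \<Rightarrow>\<^sub>C complex. ALL x. bcf v x = resolvent k (%y. f y (bcf v y + ph y)) x"
proof -
 define W where "W v y = f y (bcf v y + ph y)" for v :: "(real^'n) \<Rightarrow>\<^sub>C complex" and y
 have Wm: "W v : Lmeas" for v unfolding W_def[abs_def]
 proof (rule superposition_measurable[OF f])
  have "bcf v : bmeas" by (rule borel_measurable_continuous_onI) simp
  hence "bcf v : Lmeas" by (intro measurable_completion) simp
  thus "(%y. bcf v y + ph y) : Lmeas" using ph(1) by (rule borel_measurable_add)
 qed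
 have Wb: "EX A>=0. ALL v. norm v <= M --> (ALL y. norm (W v y) <= A * jp y aa)" for M
 proof -
  obtain A where A: "A >= 0" "ALL x u. cmod u <= M + B --> cmod (f x u) <= A * jp x aa" using fb by blast
  have "norm (W v y) <= A * jp y aa" if "norm v <= M" for v y
  proof -
   have "cmod (bcf v y + ph y) <= M + B"
    using norm_triangle_ineq[of "bcf v y" "ph y"] norm_bounded[of v y] ph(2)[of y] that by linarith
   thus ?thesis using A(2) by (simp add: W_def)
  qed
  thus ?thesis using A(1) by blast
 qed
 define T where "T v = Bcontfun (resolvent k (W v))" for v
 have Tap: "bcf (T v) x = resolvent k (W v) x" for v x
 proof -
  obtain A where "!!y. norm (W v y) <= A * jp y aa" using Wb[of "norm v"] by blast
  hence "resolvent k (W v) : bcontfun" by (rule resolvent_continuous[OF N k aa Wm])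
  thus ?thesis by (simp add: T_def Bcontfun_inverse)
 qed
 \<comment> \<open>An exponent strictly between (N+1)/2 and aa: the superposition operator is
   continuous into the corresponding weighted space, and the resolvent is still bounded on
   it.\<close>
 define be where "be = (aa + (real CARD('n) + 1) / 2) / 2"
 have be: "be < aa" "0 <= be" "be > (real CARD('n) + 1) / 2" using aa unfolding be_def by (auto simp: field_simps)
 obtain g C where g: "g > 0" "C >= 0" and gC: "ALL (w :: real^'n => complex) A x. w : Lmeas --> (ALL y. norm (w y) <= A * jp y be) -->
   integrable lebesgue (%y. Phi k (x - y) * w y) & norm (resolvent k w x) <= C * A * jp x g"
  using resolvent_bound[OF N k be(3)] by blast
 have "EX v. v = T v"
 proof (rule schaefer_fixpoint[where R = R])
  show "cont T" unfolding continuous_on_iff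
  proof (intro ballI allI impI)
   fix v and e :: real assume e: "e > 0"
   define e' where "e' = e / (2 * (C + 1))"
   have e': "e' > 0" using e g by (simp add: e'_def)
   obtain d where d: "d > 0" "ALL v'. dist v' v < d --> (ALL y. cmod (W v' y - W v y) <= e' * jp y be)"
    using superposition_continuous[where ph = ph and v = v, OF f fb ph(2) be(1,2) e', folded W_def] by (elim exE conjE)
   show "EX d>0. ALL v':UNIV. dist v' v < d --> dist (T v') (T v) < e"
   proof (intro exI[of _ d] conjI d(1) ballI impI)
    fix v' assume v': "dist v' v < d"
    obtain A where A: "!!u y. norm u <= max (norm v) (norm v') ==> norm (W u y) <= A * jp y aa" using Wb by blast
    have "dist (T v') (T v) <= C * e'"
    proof (rule dist_bound)
     fix x
     have "resolvent k (W v') x - resolvent k (W v) x = resolvent k (%y. W v' y - W v y) x"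
      by (rule resolvent_diff[OF N k aa Wm A Wm A]) auto
     also have "norm ... <= C * e' * jp x g"
      using gC[rule_format, of "%y. W v' y - W v y" e' x] d(2) v' Wm borel_measurable_diff[OF Wm Wm] by blast
     also have "... <= C * e' * 1" using jb_powr_antimono[of 0 g x] g e' by (intro mult_left_mono) auto
     finally show "dist (bcf (T v') x) (bcf (T v) x) <= C * e'" by (simp add: Tap dist_norm)
    qed
    also have "C * e' <= e / 2" using g(2) e by (simp add: e'_def field_simps)
    also have "... < e" using e by simp
    finally show "dist (T v') (T v) < e" .
   qed
  qed
  fix V :: "nat => (real^'n) \<Rightarrow>\<^sub>C complex" and M assume V: "ALL n. norm (V n) <= M"
  obtain A where A: "!!u y. norm u <= M ==> norm (W u y) <= A * jp y aa" using Wb by blast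
  show "EX r l. strict_mono r & (%n. T (V (r n))) ----> l"
   by (rule resolvent_compact[OF N k aa, where w = "%n. W (V n)" and c = "%_. 1" and A = A]) (use Wm A V Tap in auto)
 next
  fix v c assume c: "(0::real) <= c" "c <= 1" and v: "v = c *R T v"
  have "bcf v x = c *R resolvent k (W v) x" for x by (subst v) (simp add: Tap)
  thus "norm v < R" unfolding W_def[abs_def] by (rule apriori[OF c])
 qed
 then obtain v where "v = T v" by blast
 hence "bcf v x = resolvent k (W v) x" for x using Tap[of v x] by simp
 thus ?thesis unfolding W_def[abs_def] by blast
qed

lemma resolvent_equation_unique:
 fixes a :: "real^'n::finite => real" and z :: "real^'n => complex"
 assumes N: "CARD('n) >= 3" and k: "k > 0" and aa: "aa > (real CARD('n) + 1) / 2"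
  and a: "cont a" "!!x. abs (a x) <= Ca * jp x aa" and z: "cont z" "!!x. norm (z x) <= U"
  and eq: "!!x. z x = resolvent k (%y. cor (a y) * z y) x"
 shows "z x = 0"
proof -
 have eq': "z x = (LINT y|lebesgue. Phi k (x - y) * (cor (a y) * z y))" for x
  using eq[of x] unfolding resolvent_def convolution_def .
 have *: "v x = 0" if v: "v = (%x. Re (z x)) | v = (%x. Im (z x))" for v
 proof -
  note S = resolvent_solution_real[OF N k aa a z eq' v]
  obtain C where C: "!!x. abs (v x) <= C * jp x ((real CARD('n) + 1) / 2)" using S(2) by blast
  have "cont v" using v z(1) by (auto intro: continuous_intros)
  thus ?thesis by (rule kernel_equation_unique[OF N k aa a _ C S(1)])
 qed
 show ?thesis using *[of "%x. Re (z x)"] *[of "%x. Im (z x)"] by (simp add: complex_eq_iff)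
qed

section \<open>The a priori bound for a sublinear majorant\<close>

lemma AE_lebesgue_ex:
 assumes "AE x in (lebesgue :: 'a::euclidean_space measure). P x"
 shows "EX x. P x"
proof -
 have "emeasure (lebesgue :: 'a measure) UNIV ~= 0" by simp
 hence "ae_filter (lebesgue :: 'a measure) ~= bot" by (simp add: ae_filter_eq_bot_iff)
 thus ?thesis using assms eventually_happens by blast
qed

lemma continuous_AE_le:
 fixes f :: "'a::euclidean_space => real"
 assumes f: "cont f" and ae: "AE x in lebesgue. f x <= K"
 shows "f x <= K"
proof -
 have "AE x in lborel. max 0 (f x - K) = 0" using ae unfolding AE_completion_iff by eventually_elim simp
 hence "max 0 (f x - K) = 0" by (rule continuous_AE_zero[rotated]) (intro continuous_intros f)
 thus ?thesis by (simp add: max_def split: if_splits)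
qed

lemma abs_conv_bound:
 fixes k aa :: real
 assumes N: "CARD('n::finite) >= 3" and k: "k > 0" and aa: "aa > (real CARD('n) + 1) / 2"
 shows "EX C>=0. ALL (w :: real^'n => real) A x. w : Lmeas --> (ALL y. abs (w y) <= A * jp y aa) -->
   integrable lebesgue (%y. cmod (Phi k (x - y)) * w y) & abs (LINT y|lebesgue. cmod (Phi k (x - y)) * w y) <= C * A"
proof -
 let ?sg = "(real CARD('n) - 1) / 2"
 have g: "(0::real) <= 0" "0 <= ?sg" "0 <= aa" "?sg + aa - 0 > real DIM(real^'n)" using aa N by (auto simp: field_simps)
 obtain c where c: "c >= 0" "!!x::real^'n. norm (Phi k x) <= c * maj ?sg x" using fund_sol_bound[OF N k] by blast
 obtain C where C: "C >= 0" "!!x::real^'n. intble (%y. maj ?sg (x - y) * jp y aa)"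
   "!!x::real^'n. (LBINT y. maj ?sg (x - y) * jp y aa) <= C" using kernel_conv_decay[OF _ g] N by auto
 have m: "(%z::real^'n. cmod (Phi k z)) : bmeas" using fund_sol_measurable[OF N k] by simp
 show ?thesis
 proof (rule exI[of _ "c * C"], intro conjI allI impI)
  show "0 <= c * C" using c C by simp
  fix w :: "real^'n => real" and A and x :: "real^'n"
  assume w: "w : Lmeas" "ALL y. abs (w y) <= A * jp y aa"
  have A: "A >= 0" by (rule bnd0[OF w(2)[rule_format, of 0]])
  have b: "norm (cmod (Phi k z)) <= c * maj ?sg z" for z :: "real^'n" using c(2)[of z] by simp
  have w': "norm (w y) <= A * jp y aa" for y using w(2) by simp
  note cb = conv_bound[OF C(2)[of x] m b w(1) w']
  show "integrable lebesgue (%y. cmod (Phi k (x - y)) * w y)" by (rule cb(1))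
  have "abs (LINT y|lebesgue. cmod (Phi k (x - y)) * w y) <= c * A * (LBINT y. maj ?sg (x - y) * jp y aa)"
   using cb(2) by simp
  also have "... <= c * A * C" using c A by (intro mult_left_mono C) auto
  finally show "abs (LINT y|lebesgue. cmod (Phi k (x - y)) * w y) <= c * C * A" by (simp add: mult_ac)
 qed
qed

lemma wLinf_norm_nonneg:
 fixes w :: "real^'n::finite => 'b::real_normed_vector"
 shows "0 <= wLinf_norm aa w"
proof -
 have "AE x in lebesgue. ereal (norm ((jb x powr aa) *R w x)) <= wLinf_norm aa w"
  unfolding wLinf_norm_def Linf_norm_def by (rule esssup_AE)
 hence "EX x. ereal (norm ((jb x powr aa) *R w x)) <= wLinf_norm aa w" by (rule AE_lebesgue_ex)
 then obtain x where "ereal (norm ((jb x powr aa) *R w x)) <= wLinf_norm aa w" ..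
 thus ?thesis by (rule order_trans[rotated]) simp
qed

lemma wLinf_AE_bound:
 fixes w :: "real^'n::finite => real"
 assumes "w : wLinf aa" obtains q where "q >= 0" "wLinf_norm aa w = ereal q" "AE x in lebesgue. abs (w x) <= q * jp x aa"
proof -
 have "wLinf_norm aa w < \<infinity>" using assms by (simp add: wLinf_def)
 then obtain q where q: "wLinf_norm aa w = ereal q" using wLinf_norm_nonneg[of aa w] by (cases "wLinf_norm aa w") auto
 have "AE x in lebesgue. ereal (norm ((jb x powr aa) *R w x)) <= ereal q"
  unfolding q[symmetric] wLinf_norm_def Linf_norm_def by (rule esssup_AE)
 hence "AE x in lebesgue. abs (w x) <= q * jp x aa"
 proof eventually_elim
  fix x :: "real^'n" assume "ereal (norm ((jb x powr aa) *R w x)) <= ereal q"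
  hence "jb x powr aa * abs (w x) <= q" by (simp add: abs_mult)
  hence "jp x aa * (jb x powr aa * abs (w x)) <= jp x aa * q" by (rule mult_left_mono) simp
  moreover have e: "jp x aa * jb x powr aa = 1" unfolding powr_add[symmetric] by simp
  ultimately have "abs (w x) <= jp x aa * q" unfolding mult.assoc[symmetric] e by simp
  thus "abs (w x) <= q * jp x aa" by (simp only: mult.commute)
 qed
 moreover have "q >= 0" using wLinf_norm_nonneg[of aa w] unfolding q by simp
 ultimately show thesis using that q by blast
qed

text \<open>The supremum is tested with |Q| divided by its norm. As the exponent tau is nonnegative,
  the weight on the left may be dropped, which bounds |Phi_k| * |Q| almost everywhere by the norm of
  Q times kappa. The case of norm zero is separate, since Q cannot be normalised there.\<close>

lemma kappa_contraction:
 fixes Q :: "real^'n::finite => real"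
 assumes Q: "Q : wLinf aa" and lt: "wLinf_norm aa Q < 1 / kappa TYPE('n) k aa" and N: "CARD('n) >= 3" and aa: "aa > (real CARD('n) + 1) / 2"
 shows "EX te<1. AE x in lebesgue. (abs_conv k Q x) <= te"
proof -
 obtain q where q: "q >= 0" "wLinf_norm aa Q = ereal q" "AE x in lebesgue. abs (Q x) <= q * jp x aa"
  by (rule wLinf_AE_bound[OF Q])
 have Qm: "Q : Lmeas" using Q by (simp add: wLinf_def)
 define I where "I x = (abs_conv k Q x)" for x
 show ?thesis
 proof (cases "q = 0")
  case True
  have "I x = 0" for x
  proof -
   have "AE y in lebesgue. cmod (Phi k (x - y)) * abs (Q y) = 0" using q(3) by eventually_elim (simp add: True)
   thus ?thesis unfolding I_def by (rule integral_eq_zero_AE)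
  qed
  thus ?thesis by (intro exI[of _ 0]) (simp add: I_def)
 next
  case False
  hence q0: "q > 0" using q(1) by simp
  define w where "w y = cor (abs (Q y) / q)" for y
  have wm: "w : Lmeas" unfolding w_def[abs_def] using Qm by simp
  have "wLinf_norm aa w = esssup lebesgue (%x. ereal (1 / q) * ereal (norm ((jb x powr aa) *R Q x)))"
   unfolding wLinf_norm_def Linf_norm_def using q0 by (simp add: w_def norm_mult norm_divide abs_mult mult.commute)
  also have "... = ereal (1 / q) * wLinf_norm aa Q" unfolding wLinf_norm_def Linf_norm_def
   by (rule esssup_cmult) (use q0 in simp)
  also have "... = 1" using q0 unfolding q(2) by (simp add: one_ereal_def)
  finally have w1: "wLinf_norm aa w = 1" .
  hence "w : wLinf aa" using wm by (simp add: wLinf_def)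
  hence "wLinf_norm (tau CARD('n) aa) (convolution (%x. cor (cmod (Phi k x))) w) <= kappa TYPE('n) k aa"
   unfolding kappa_def using w1 by (intro SUP_upper) simp
  moreover have "AE x in lebesgue. ereal (norm ((jb x powr tau CARD('n) aa) *R convolution (%x. cor (cmod (Phi k x))) w x))
    <= wLinf_norm (tau CARD('n) aa) (convolution (%x. cor (cmod (Phi k x))) w)"
   unfolding wLinf_norm_def Linf_norm_def by (rule esssup_AE)
  ultimately have ae: "AE x in lebesgue. ereal (norm ((jb x powr tau CARD('n) aa) *R convolution (%x. cor (cmod (Phi k x))) w x)) <= kappa TYPE('n) k aa"
   by (auto elim!: eventually_mono intro: order_trans)
  have conv: "convolution (%x. cor (cmod (Phi k x))) w x = cor (I x / q)" for x
  proof -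
   have "convolution (%x. cor (cmod (Phi k x))) w x = (LINT y|lebesgue. cor (cmod (Phi k (x - y)) * abs (Q y) / q))"
    unfolding convolution_def w_def by simp
   also have "... = cor (LINT y|lebesgue. cmod (Phi k (x - y)) * abs (Q y) / q)" by (rule integral_complex_of_real)
   finally show ?thesis unfolding I_def by simp
  qed
  have I0: "I x >= 0" for x unfolding I_def by (rule Lint_nonneg) simp
  have t0: "tau CARD('n) aa >= 0" using aa N by (simp add: tau_def)
  have aeI: "AE x in lebesgue. ereal (I x / q) <= kappa TYPE('n) k aa" using ae
  proof eventually_elim
   fix x :: "real^'n"
   assume *: "ereal (norm ((jb x powr tau CARD('n) aa) *R convolution (%x. cor (cmod (Phi k x))) w x)) <= kappa TYPE('n) k aa"
   have "1 * (I x / q) <= jb x powr tau CARD('n) aa * (I x / q)"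
    using I0[of x] q0 jb_ge_1[of x] t0 by (intro mult_right_mono ge_one_powr_ge_zero) auto
   hence "ereal (I x / q) <= ereal (norm ((jb x powr tau CARD('n) aa) *R convolution (%x. cor (cmod (Phi k x))) w x))"
    unfolding conv norm_scaleR norm_of_real using I0[of x] q0 by simp
   thus "ereal (I x / q) <= kappa TYPE('n) k aa" using * by (rule order_trans)
  qed
  obtain x where x: "ereal (I x / q) <= kappa TYPE('n) k aa" using AE_lebesgue_ex[OF aeI] by blast
  have k0: "0 <= kappa TYPE('n) k aa" by (rule order_trans[OF _ x]) (use I0[of x] q0 in simp)
  \<comment> \<open>An infinite kappa would have reciprocal 0, which no norm undercuts. The value 0,
    whose reciprocal is infinite, is treated apart below.\<close>
  have kinf: "kappa TYPE('n) k aa ~= \<infinity>" using lt q(1) unfolding q(2) by auto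
  obtain ka where ka: "kappa TYPE('n) k aa = ereal ka" "ka >= 0" using k0 kinf by (cases "kappa TYPE('n) k aa") auto
  have "q * ka < 1"
  proof (cases "ka = 0")
   case False
   hence "ereal q < ereal (1 / ka)" using lt ka(2) unfolding q(2) ka(1) by (simp add: one_ereal_def)
   thus ?thesis using False ka(2) by (simp add: less_divide_eq split: if_splits)
  qed simp
  moreover have "AE x in lebesgue. I x <= q * ka"
   using aeI by eventually_elim (use q0 in "simp add: ka(1) divide_le_eq mult.commute")
  ultimately show ?thesis unfolding I_def by blast
 qed
qed

text \<open>At almost every point |v| is at most te times its norm plus a constant, with te < 1. By
  continuity of v this holds everywhere, so the norm itself can be absorbed on the left.\<close>

lemma apriori_bound_sublinear:
 fixes f :: "real^'n::finite => complex => complex" and ph :: "real^'n => complex" and Q b :: "real^'n => real"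
 assumes N: "CARD('n) >= 3" and k: "k > 0" and aa: "aa > (real CARD('n) + 1) / 2"
  and Q: "Q : wLinf aa" and b: "b : wLinf aa" and lt: "wLinf_norm aa Q < 1 / kappa TYPE('n) k aa"
  and f: "!!x u. cmod (f x u) <= Q x * cmod u + b x" and ph: "!!x. cmod (ph x) <= B"
 shows "EX R. ALL c (v :: (real^'n) \<Rightarrow>\<^sub>C complex). 0 <= c --> c <= 1 -->
   (ALL x. bcf v x = c *R resolvent k (%y. f y (bcf v y + ph y)) x) --> norm v < R"
proof -
 obtain q where q: "q >= 0" "AE x in lebesgue. abs (Q x) <= q * jp x aa" by (rule wLinf_AE_bound[OF Q])
 obtain p where p: "p >= 0" "AE x in lebesgue. abs (b x) <= p * jp x aa" by (rule wLinf_AE_bound[OF b])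
 have Qm: "Q : Lmeas" and bm: "b : Lmeas" using Q b by (simp_all add: wLinf_def)
 have B: "B >= 0" using order_trans[OF norm_ge_zero ph] .
 obtain te where te: "te < 1" "AE x in lebesgue. (abs_conv k Q x) <= te" using kappa_contraction[OF Q lt N aa] by blast
 have Fm: "(Phi k :: real^'n => complex) : bmeas" by (rule fund_sol_measurable[OF N k])
 have Fxm: "(%y. cmod (Phi k (x - y))) : Lmeas" for x :: "real^'n" using Fm by (intro measurable_completion) simp
 \<comment> \<open>The bounds on Q and b hold only almost everywhere; discarding the exceptional
   values gives functions bounded everywhere with the same integrals.\<close>
 define trunc where "trunc r w y = (if abs (w y) <= r * jp y aa then abs (w y) else 0)" for r and w :: "real^'n => real" and y
 have jm: "(%y::real^'n. jp y aa) : Lmeas" by (intro measurable_completion) simp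
 obtain C where C: "C >= 0" "!!(w :: real^'n => real) A x. w : Lmeas ==> (ALL y. abs (w y) <= A * jp y aa) ==>
   integrable lebesgue (%y. cmod (Phi k (x - y)) * w y) & abs (LINT y|lebesgue. cmod (Phi k (x - y)) * w y) <= C * A"
  using abs_conv_bound[OF N k aa] by blast
 have I: "integrable lebesgue (%y. cmod (Phi k (x - y)) * abs (w y))" "(abs_conv k w x) <= C * r"
  if w: "w : Lmeas" "AE x in lebesgue. abs (w x) <= r * jp x aa" "r >= 0" for w :: "real^'n => real" and r and x :: "real^'n"
 proof -
  have tm: "trunc r w : Lmeas" unfolding trunc_def[abs_def] using w(1) jm by measurable
  have tb: "ALL y. abs (trunc r w y) <= r * jp y aa" using w(3) by (simp add: trunc_def)
  have ae: "AE y in lebesgue. cmod (Phi k (x - y)) * trunc r w y = cmod (Phi k (x - y)) * abs (w y)"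
   using w(2) by eventually_elim (simp add: trunc_def)
  have m: "(%y. cmod (Phi k (x - y)) * trunc r w y) : Lmeas" "(%y. cmod (Phi k (x - y)) * abs (w y)) : Lmeas"
   using tm w(1) Fxm[of x] by simp_all
  note Cw = C(2)[OF tm tb, of x]
  show "integrable lebesgue (%y. cmod (Phi k (x - y)) * abs (w y))"
   using Cw by (subst integrable_cong_AE[OF m(2) m(1)]) (use ae in auto)
  have "(abs_conv k w x) = (LINT y|lebesgue. cmod (Phi k (x - y)) * trunc r w y)"
   by (rule integral_cong_AE[OF m(2) m(1)]) (use ae in auto)
  thus "(abs_conv k w x) <= C * r" using abs_le_D1[OF conjunct2[OF Cw]] by (simp only:)
 qed
 note IQ = I[OF Qm q(2,1)] and Ib = I[OF bm p(2,1)]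
 define K where "K = C * q * B + C * p"
 show ?thesis
 proof (intro exI[of _ "K / (1 - te) + 1"] allI impI)
  fix c and v :: "(real^'n) \<Rightarrow>\<^sub>C complex"
  assume c: "(0::real) <= c" "c <= 1" and v: "ALL x. bcf v x = c *R resolvent k (%y. f y (bcf v y + ph y)) x"
  have pt: "norm (bcf v x) <= norm v * (abs_conv k Q x) + K" for x
  proof -
   have i: "integrable lebesgue (%y. (norm v + B) * (cmod (Phi k (x - y)) * abs (Q y)) + cmod (Phi k (x - y)) * abs (b y))"
    by (intro L1_add integrable_mult_right IQ Ib)
   have le: "norm (Phi k (x - y) * f y (bcf v y + ph y)) <= (norm v + B) * (cmod (Phi k (x - y)) * abs (Q y)) + cmod (Phi k (x - y)) * abs (b y)" for y
   proof -
    have "cmod (bcf v y + ph y) <= norm v + B"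
     using norm_triangle_ineq[of "bcf v y" "ph y"] norm_bounded[of v y] ph[of y] by linarith
    hence "Q y * cmod (bcf v y + ph y) <= abs (Q y) * (norm v + B)" by (intro mult_mono) auto
    hence "cmod (f y (bcf v y + ph y)) <= abs (Q y) * (norm v + B) + abs (b y)" using f[of y "bcf v y + ph y"] by linarith
    hence "cmod (Phi k (x - y)) * cmod (f y (bcf v y + ph y)) <= cmod (Phi k (x - y)) * (abs (Q y) * (norm v + B) + abs (b y))"
     by (intro mult_left_mono) auto
    thus ?thesis by (simp add: norm_mult algebra_simps)
   qed
   have "norm (resolvent k (%y. f y (bcf v y + ph y)) x) <= (LINT y|lebesgue. (norm v + B) * (cmod (Phi k (x - y)) * abs (Q y)) + cmod (Phi k (x - y)) * abs (b y))"
   \<comment> \<open>For an integrand that is not integrable the integral is 0 by convention, so the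
     estimate holds in that case too.\<close>
   proof (cases "integrable lebesgue (%y. Phi k (x - y) * f y (bcf v y + ph y))")
    case True thus ?thesis unfolding resolvent_def convolution_def by (rule Lint_norm_bound_integral) (rule i, rule le)
   next
    case False
    hence "resolvent k (%y. f y (bcf v y + ph y)) x = 0" unfolding resolvent_def convolution_def by (rule not_integrable_integral_eq)
    moreover have "0 <= (LINT y|lebesgue. (norm v + B) * (cmod (Phi k (x - y)) * abs (Q y)) + cmod (Phi k (x - y)) * abs (b y))"
     using B by (intro Lint_nonneg add_nonneg_nonneg mult_nonneg_nonneg) auto
    ultimately show ?thesis by simp
   qed
   also have "... = (norm v + B) * (abs_conv k Q x) + (abs_conv k b x)" using IQ(1)[of x] Ib(1)[of x] by simp
   also have "... <= norm v * (abs_conv k Q x) + K"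
   proof -
    have "B * (abs_conv k Q x) <= B * (C * q)" by (intro mult_left_mono IQ B)
    thus ?thesis using Ib(2)[of x] unfolding K_def by (simp add: algebra_simps)
   qed
   finally have "norm (resolvent k (%y. f y (bcf v y + ph y)) x) <= norm v * (abs_conv k Q x) + K" .
   moreover have "norm (bcf v x) <= norm (resolvent k (%y. f y (bcf v y + ph y)) x)"
   proof -
    have "norm (bcf v x) = norm (c *R resolvent k (%y. f y (bcf v y + ph y)) x)" by (rule arg_cong[OF spec[OF v]])
    also have "... <= norm (resolvent k (%y. f y (bcf v y + ph y)) x)" using c by (simp add: mult_left_le_one_le)
    finally show ?thesis .
   qed
   ultimately show ?thesis by linarith
  qed
  have "norm v <= norm v * te + K"
  proof (rule norm_bound, rule continuous_AE_le[where f = "%x. norm (bcf v x)"])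
   show "cont (%x. norm (bcf v x))" by (intro continuous_intros) simp
   show "AE x in lebesgue. norm (bcf v x) <= norm v * te + K" using te(2)
   proof eventually_elim
    fix x :: "real^'n" assume "(abs_conv k Q x) <= te"
    hence "norm v * (abs_conv k Q x) <= norm v * te" by (intro mult_left_mono) auto
    thus "norm (bcf v x) <= norm v * te + K" using pt[of x] by linarith
   qed
  qed
  hence "norm v * (1 - te) <= K" by (simp add: algebra_simps)
  hence "norm v <= K / (1 - te)" using te(1) by (simp add: le_divide_eq)
  thus "norm v < K / (1 - te) + 1" by simp
 qed
qed

section \<open>The a priori bound for an asymptotically linear nonlinearity\<close>

lemma growth_sublinear:
 assumes "((%M. growth aa b M / ereal M) \<longlongrightarrow> 0) at_top" and e: "e > 0"
 shows "EX M0>0. ALL M>=M0. ALL x u. cmod u <= M --> cmod (b x u) <= e * M * jp x aa"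
proof -
 have "eventually (%M. growth aa b M / ereal M < ereal e) at_top"
  using assms by (intro order_tendstoD(2)) (auto simp: zero_ereal_def)
 then obtain M1 where M1: "!!M. M >= M1 ==> growth aa b M / ereal M < ereal e" by (auto simp: eventually_at_top_linorder)
 have "cmod (b x u) <= e * M * jp x aa" if M: "M >= max M1 1" and u: "cmod u <= M" for M x u
 proof (rule growth_bound[OF _ u])
  have "growth aa b M / ereal M < ereal e" using M1 M by simp
  hence "growth aa b M < ereal e * ereal M" using M by (subst (asm) ereal_divide_less_iff) auto
  thus "growth aa b M < ereal (e * M)" by simp
 qed
 thus ?thesis by (intro exI[of _ "max M1 1"]) auto
qed

text \<open>Dividing f(x,M) by M isolates \<open>a\<close> up to an error that is small uniformly in
  x. Thus \<open>a\<close> is a uniform limit of continuous functions, and a single large M gives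
  its decay at every point and not merely almost everywhere.\<close>

lemma asymptotic_slope:
 fixes f b :: "'a::euclidean_space => complex => complex" and a :: "'a => real"
 assumes f: "cont (%(x, u). f x u)" and fb: "!!M. EX A>=0. ALL x u. cmod u <= M --> cmod (f x u) <= A * jp x aa"
  and dec: "!!x u. f x u = cor (a x) * u + b x u"
  and b: "!!e. e > 0 ==> EX M0>0. ALL M>=M0. ALL x u. cmod u <= M --> cmod (b x u) <= e * M * jp x aa" and aa: "aa >= 0"
 shows "cont a" "EX Ca>=0. ALL x. abs (a x) <= Ca * jp x aa"
proof -
 have key: "cmod (f x (of_real M) / of_real M - of_real (a x)) <= e * jp x aa"
  if "M > 0" "ALL x u. cmod u <= M --> cmod (b x u) <= e * M * jp x aa" for e M x
 proof -
  have "f x (of_real M) / of_real M - of_real (a x) = b x (of_real M) / of_real M"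
   unfolding dec using that(1) by (simp add: field_simps)
  moreover have "cmod (b x (of_real M)) <= e * M * jp x aa" using that by simp
  ultimately show ?thesis using that(1) by (simp add: norm_divide divide_le_eq mult_ac)
 qed
 have "uniform_limit UNIV (%n x. f x (of_real (real n)) / of_real (real n)) (%x. cor (a x)) sequentially"
 proof (rule uniform_limitI)
  fix e :: real assume e: "e > 0"
  then obtain M0 where M0: "M0 > 0" "!!M. M >= M0 ==> ALL x u. cmod u <= M --> cmod (b x u) <= e / 2 * M * jp x aa" using b[of "e / 2"] by auto
  have "dist (f x (of_real (real n)) / of_real (real n)) (cor (a x)) < e" if n: "n >= nat \<lceil>M0\<rceil>" for n x
  proof -
   have "real n >= M0" using n by linarith
   hence "cmod (f x (of_real (real n)) / of_real (real n) - of_real (a x)) <= e / 2 * jp x aa" using M0 by (intro key) auto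
   also have "... <= e / 2 * 1" using jb_powr_antimono[OF aa, of x] e by (intro mult_left_mono) auto
   finally show ?thesis using e by (simp add: dist_norm)
  qed
  thus "\<forall>\<^sub>F n in sequentially. ALL x:UNIV. dist (f x (of_real (real n)) / of_real (real n)) (cor (a x)) < e"
   unfolding eventually_sequentially by blast
 qed
 moreover have "cont (%x. f x (of_real (real n)) / of_real (real n))" if "n > 0" for n
 proof -
  have "cont (%x::'a. (%(x, u). f x u) (x, of_real (real n)))"
   by (rule continuous_on_compose2[OF f]) (auto intro!: continuous_intros)
  thus ?thesis using that by (auto intro!: continuous_intros)
 qed
 hence "\<forall>\<^sub>F n in sequentially. cont (%x. f x (of_real (real n)) / of_real (real n))"
  by (intro eventually_sequentiallyI[of 1]) simp
 ultimately have "cont (%x. cor (a x))" by (intro uniform_limit_theorem) auto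
 hence "cont (%x. Re (cor (a x)))" by (rule continuous_on_Re)
 thus "cont a" by simp
 obtain M where M: "M > 0" "ALL x u. cmod u <= M --> cmod (b x u) <= 1 * M * jp x aa" using b[of 1] by auto
 obtain A where A: "A >= 0" "ALL x u. cmod u <= M --> cmod (f x u) <= A * jp x aa" using fb by blast
 have "abs (a x) <= (A / M + 1) * jp x aa" for x
 proof -
  have 1: "cmod (f x (of_real M) / of_real M - of_real (a x)) <= 1 * jp x aa" by (rule key[OF M])
  have "cmod (f x (of_real M)) <= A * jp x aa" using A(2) M(1) by simp
  hence 2: "cmod (f x (of_real M) / of_real M) <= A / M * jp x aa" using M(1) by (simp add: norm_divide divide_right_mono)
  have "cmod (of_real (a x)) <= cmod (f x (of_real M) / of_real M) + cmod (f x (of_real M) / of_real M - of_real (a x))"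
   using norm_triangle_ineq4[of "f x (of_real M) / of_real M" "f x (of_real M) / of_real M - of_real (a x)"] by simp
  thus ?thesis using 1 2 by (simp add: distrib_right)
 qed
 moreover have "0 <= A / M + 1" using A M by simp
 ultimately show "EX Ca>=0. ALL x. abs (a x) <= Ca * jp x aa" by blast
qed

lemma resolvent_scale: "resolvent k (%y. c *R w y) x = c *R resolvent k w x"
 unfolding resolvent_def convolution_def by simp

text \<open>Unbounded solutions are divided by their norms. Compactness of the resolvent gives a
  limit L of norm 1, in which the remainder b and the given solution no longer appear; L solves the
  linear equation with a real coefficient and must therefore vanish.\<close>

lemma apriori_bound_asymptotically_linear:
 fixes f b :: "real^'n::finite => complex => complex" and ph :: "real^'n => complex" and a :: "real^'n => real"
 assumes N: "CARD('n) >= 3" and k: "k > 0" and aa: "aa > (real CARD('n) + 1) / 2" and f: "cont (%(x, u). f x u)"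
  and fb: "!!M. EX A>=0. ALL x u. cmod u <= M --> cmod (f x u) <= A * jp x aa"
  and dec: "!!x u. f x u = cor (a x) * u + b x u"
  and b: "!!e. e > 0 ==> EX M0>0. ALL M>=M0. ALL x u. cmod u <= M --> cmod (b x u) <= e * M * jp x aa"
  and ph: "ph : Lmeas" "!!x. cmod (ph x) <= B"
 shows "EX R. ALL c (v :: (real^'n) \<Rightarrow>\<^sub>C complex). 0 <= c --> c <= 1 -->
   (ALL x. bcf v x = c *R resolvent k (%y. f y (bcf v y + ph y)) x) --> norm v < R"
proof (rule ccontr)
 assume neg: "~ ?thesis"
 have "(real CARD('n) + 1) / 2 >= 0" by simp
 hence aa0: "aa >= 0" using aa by linarith
 have B: "B >= 0" using order_trans[OF norm_ge_zero ph(2)] .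
 note slope = asymptotic_slope[where f = f and a = a and b = b and aa = aa]
 have ac: "cont a" by (rule slope(1)) (fact f fb dec b aa0)+
 have "EX Ca>=0. ALL x. abs (a x) <= Ca * jp x aa" by (rule slope(2)) (fact f fb dec b aa0)+
 then obtain Ca where Ca: "Ca >= 0" "!!x. abs (a x) <= Ca * jp x aa" by blast
 obtain M1 where M1: "M1 > 0" "!!M. M >= M1 ==> ALL x u. cmod u <= M --> cmod (b x u) <= 1 * M * jp x aa" using b[of 1] by auto
 \<comment> \<open>The lower bound makes the norms tend to infinity and, through M1, places all of
   them in the range where the remainder is controlled.\<close>
 have "ALL n. EX cv. 0 <= fst cv & fst cv <= 1 & (ALL x. bcf (snd cv) x = fst cv *R resolvent k (%y. f y (bcf (snd cv) y + ph y)) x) & real n + 1 + M1 <= norm (snd cv)"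
 proof
  fix n
  obtain c and v :: "(real^'n) \<Rightarrow>\<^sub>C complex" where cv: "0 <= c" "c <= 1"
    "ALL x. bcf v x = c *R resolvent k (%y. f y (bcf v y + ph y)) x" "~ norm v < real n + 1 + M1" using neg by blast
  show "EX cv. 0 <= fst cv & fst cv <= 1 & (ALL x. bcf (snd cv) x = fst cv *R resolvent k (%y. f y (bcf (snd cv) y + ph y)) x) & real n + 1 + M1 <= norm (snd cv)"
   by (rule exI[of _ "(c, v)"], unfold fst_conv snd_conv, intro conjI cv(1-3) cv(4)[unfolded not_less])
 qed
 then obtain cv :: "nat => real \<times> ((real^'n) \<Rightarrow>\<^sub>C complex)" where cv: "ALL n. 0 <= fst (cv n) & fst (cv n) <= 1 & (ALL x. bcf (snd (cv n)) x = fst (cv n) *R resolvent k (%y. f y (bcf (snd (cv n)) y + ph y)) x) & real n + 1 + M1 <= norm (snd (cv n))"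
  by (rule choice[THEN exE])
 define c v where "c n = fst (cv n)" and "v n = snd (cv n)" for n
 define m where "m n = norm (v n)" for n
 have c: "0 <= c n" "c n <= 1" and veq: "bcf (v n) x = c n *R resolvent k (%y. f y (bcf (v n) y + ph y)) x"
  and m: "real n + 1 + M1 <= m n" for n x using cv unfolding c_def v_def m_def by blast+
 have m1: "m n > 0" "m n >= 1" "m n >= M1" "m n >= real n" for n using m[of n] M1(1) by linarith+
 define z where "z n = (1 / m n) *R v n" for n
 define u where "u n y = bcf (v n) y + ph y" for n y
 define w where "w n y = (1 / m n) *R f y (u n y)" for n y
 have nz: "norm (z n) = 1" for n using m1(1)[of n] by (simp add: z_def m_def)
 have zeq: "bcf (z n) x = c n *R resolvent k (w n) x" for n x
 proof -
  have "bcf (z n) x = (1 / m n) *R bcf (v n) x" by (simp add: z_def)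
  also have "... = (1 / m n) *R (c n *R resolvent k (%y. f y (u n y)) x)" unfolding u_def by (rule arg_cong[OF veq])
  also have "... = c n *R resolvent k (w n) x" unfolding w_def[abs_def] resolvent_scale by simp
  finally show ?thesis .
 qed
 have um: "u n : Lmeas" for n
 proof -
  have "bcf (v n) : bmeas" by (rule borel_measurable_continuous_onI) simp
  hence "bcf (v n) : Lmeas" by (intro measurable_completion) simp
  thus ?thesis unfolding u_def[abs_def] using ph(1) by (rule borel_measurable_add)
 qed
 have wm: "w n : Lmeas" for n unfolding w_def[abs_def] using superposition_measurable[OF f um[of n]] by simp
 have ub: "cmod (u n y) <= m n * (1 + B)" for n y
 proof -
  have "cmod (u n y) <= m n + 1 * B"
   using norm_triangle_ineq[of "bcf (v n) y" "ph y"] norm_bounded[of "v n" y] ph(2)[of y] unfolding u_def m_def by linarith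
  also have "... <= m n + m n * B" using m1(2)[of n] B by (intro add_left_mono mult_right_mono) auto
  finally show ?thesis by (simp add: distrib_left)
 qed
 have uz: "(1 / m n) *R u n y = bcf (z n) y + (1 / m n) *R ph y" for n y by (simp add: u_def z_def scaleR_add_right)
 have wdec: "w n y = cor (a y) * ((1 / m n) *R u n y) + (1 / m n) *R b y (u n y)" for n y
  unfolding w_def dec by (simp add: scaleR_add_right)
 \<comment> \<open>The growth bound is used at m n * (1 + B), not at m n, because u n also contains
   ph; after division by m n the factor 1 + B remains.\<close>
 have bb: "cmod ((1 / m n) *R b y (u n y)) <= e * (1 + B) * jp y aa"
  if "!!M. M >= M0 ==> ALL x u. cmod u <= M --> cmod (b x u) <= e * M * jp x aa" "M0 <= m n" for M0 e n y
 proof -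
  have "m n * 1 <= m n * (1 + B)" using m1(1)[of n] B by (intro mult_left_mono) auto
  hence "M0 <= m n * (1 + B)" using that(2) by linarith
  hence "cmod (b y (u n y)) <= e * (m n * (1 + B)) * jp y aa" using that(1) ub by blast
  hence "(1 / m n) * cmod (b y (u n y)) <= (1 / m n) * (e * (m n * (1 + B)) * jp y aa)"
   using m1(1)[of n] by (intro mult_left_mono) auto
  also have "... = e * (1 + B) * jp y aa" using m1(1)[of n] by simp
  finally show ?thesis using m1(1)[of n] by simp
 qed
 have wb: "norm (w n y) <= (Ca * (1 + B) + 1 * (1 + B)) * jp y aa" for n y
 proof -
  have "cmod ((1 / m n) *R u n y) <= 1 + B" using ub[of n y] m1(1)[of n] by (simp add: divide_le_eq mult.commute)
  hence "abs (a y) * cmod ((1 / m n) *R u n y) <= (Ca * jp y aa) * (1 + B)" using Ca by (intro mult_mono) auto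
  hence "cmod (cor (a y) * ((1 / m n) *R u n y)) <= Ca * (1 + B) * jp y aa" by (simp only: norm_mult norm_of_real mult_ac)
  moreover have "cmod ((1 / m n) *R b y (u n y)) <= 1 * (1 + B) * jp y aa" by (rule bb[OF M1(2) m1(3)])
  ultimately show ?thesis unfolding wdec
   using norm_triangle_ineq[of "cor (a y) * ((1 / m n) *R u n y)" "(1 / m n) *R b y (u n y)"] unfolding distrib_right by linarith
 qed
 have "EX r L. strict_mono (r :: nat => nat) & (%n. z (r n)) ----> L"
  by (rule resolvent_compact[OF N k aa wm wb _ zeq]) (use c in "simp add: abs_of_nonneg")
 then obtain r L where r: "strict_mono (r :: nat => nat)" "(%n. z (r n)) ----> L" by blast
 have "bounded (range (%n. c (r n)))" using c by (intro boundedI[of _ 1]) (auto simp: abs_of_nonneg)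
 then obtain l s where s: "strict_mono (s :: nat => nat)" "((%n. c (r n)) o s) ----> l"
  using bounded_imp_convergent_subsequence by blast
 define t where "t n = r (s n)" for n
 have t: "strict_mono t" unfolding t_def[abs_def] using strict_mono_o[OF r(1) s(1)] by (simp add: o_def)
 have tn: "n <= t n" for n by (rule strict_mono_imp_increasing[OF t])
 have zl: "(%n. z (t n)) ----> L" using LIMSEQ_subseq_LIMSEQ[OF r(2) s(1)] by (simp add: o_def t_def)
 have cl: "(%n. c (t n)) ----> l" using s(2) by (simp add: o_def t_def)
 have nL: "norm L = 1" using tendsto_norm[OF zl] by (simp add: nz LIMSEQ_const_iff)
 define aL where "aL y = cor (a y) * bcf L y" for y
 have "cont aL" unfolding aL_def[abs_def] by (intro continuous_intros ac) simp
 hence "aL : bmeas" by (rule borel_measurable_continuous_onI)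
 hence aLm: "aL : Lmeas" by (intro measurable_completion) simp
 have aLb: "norm (aL y) <= Ca * jp y aa" for y
 proof -
  have "abs (a y) * cmod (bcf L y) <= (Ca * jp y aa) * 1" using Ca norm_bounded[of L y] nL by (intro mult_mono) auto
  thus ?thesis by (simp add: aL_def norm_mult)
 qed
 have close: "eventually (%n. ALL y. norm (w (t n) y - aL y) <= e * jp y aa) sequentially" if e: "e > 0" for e
 proof -
  \<comment> \<open>Three errors share e: the distance of z to L, the rescaled ph and the rescaled
    remainder. The first two are multiplied by \<open>a\<close>, which explains the constant
    Ca.\<close>
  define e1 where "e1 = e / (3 * (Ca + 1))"
  have e1: "e1 > 0" "Ca * e1 <= e / 3"
  proof -
   show "e1 > 0" using e Ca by (simp add: e1_def)
   have "Ca * e1 = Ca / (Ca + 1) * (e / 3)" using Ca by (simp add: e1_def divide_simps)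
   also have "... <= 1 * (e / 3)" using Ca e by (intro mult_right_mono) auto
   finally show "Ca * e1 <= e / 3" by simp
  qed
  have e2: "e / (3 * (1 + B)) > 0" using e B by simp
  obtain M0 where M0: "M0 > 0" "!!M. M >= M0 ==> ALL x u. cmod u <= M --> cmod (b x u) <= e / (3 * (1 + B)) * M * jp x aa" using b[OF e2] by auto
  have "eventually (%n. dist (z (t n)) L < e1) sequentially" by (rule tendstoD[OF zl e1(1)])
  moreover have "eventually (%n. real n >= max M0 (B / e1)) sequentially" using filterlim_real_sequentially unfolding filterlim_at_top by blast
  ultimately show ?thesis
  proof eventually_elim
   fix n assume d: "dist (z (t n)) L < e1" and n: "max M0 (B / e1) <= real n"
   have mt: "real n <= m (t n)" using m1(4)[of "t n"] tn[of n] by linarith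
   show "ALL y. norm (w (t n) y - aL y) <= e * jp y aa"
   proof
    fix y
    let ?z = "bcf (z (t n)) y - bcf L y"
    have "w (t n) y - aL y = cor (a y) * ?z + cor (a y) * ((1 / m (t n)) *R ph y) + (1 / m (t n)) *R b y (u (t n) y)"
     unfolding wdec uz aL_def by (simp add: algebra_simps)
    hence tri: "norm (w (t n) y - aL y) <= cmod (cor (a y) * ?z) + cmod (cor (a y) * ((1 / m (t n)) *R ph y)) + cmod ((1 / m (t n)) *R b y (u (t n) y))"
     using norm_triangle_ineq[of "cor (a y) * ?z + cor (a y) * ((1 / m (t n)) *R ph y)" "(1 / m (t n)) *R b y (u (t n) y)"]
      norm_triangle_ineq[of "cor (a y) * ?z" "cor (a y) * ((1 / m (t n)) *R ph y)"] by simp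
    have small: "cmod (cor (a y) * q) <= e / 3 * jp y aa" if q: "cmod q <= e1" for q
    proof -
     have "abs (a y) * cmod q <= (Ca * jp y aa) * e1" using Ca q by (intro mult_mono) auto
     also have "... = (Ca * e1) * jp y aa" by simp
     also have "... <= e / 3 * jp y aa" by (intro mult_right_mono e1) simp
     finally show ?thesis by (simp add: norm_mult)
    qed
    have "cmod ?z <= e1" using dist_fun_lt_imp_dist_val_lt[OF d, of y] by (simp add: dist_norm)
    note 1 = small[OF this]
    have "cmod ((1 / m (t n)) *R ph y) <= e1"
    proof -
     have "B <= e1 * real n" using n e1(1) by (simp add: divide_le_eq mult.commute)
     also have "... <= e1 * m (t n)" using mt e1(1) by (intro mult_left_mono) auto
     finally have "cmod (ph y) <= e1 * m (t n)" using ph(2)[of y] by linarith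
     thus ?thesis using m1(1)[of "t n"] by (simp add: divide_le_eq)
    qed
    note 2 = small[OF this]
    have "cmod ((1 / m (t n)) *R b y (u (t n) y)) <= e / (3 * (1 + B)) * (1 + B) * jp y aa"
    proof (rule bb)
     show "M0 <= m (t n)" using n mt by linarith
    qed (rule M0(2))
    also have "e / (3 * (1 + B)) * (1 + B) = e / 3" using B by (simp add: divide_simps)
    finally have 3: "cmod ((1 / m (t n)) *R b y (u (t n) y)) <= e / 3 * jp y aa" .
    show "norm (w (t n) y - aL y) <= e * jp y aa" using tri 1 2 3 by argo
   qed
  qed
 qed
 obtain g C where g: "g > 0" "C >= 0" and gC: "resolvent_decay TYPE('n) k aa g C" using resolvent_bound[OF N k aa] by blast
 have Leq: "bcf L x = l *R resolvent k aL x" for x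
 proof -
  have "(%n. resolvent k (w (t n)) x) ----> resolvent k aL x"
  proof (rule tendstoI)
   fix e :: real assume e: "e > 0"
   hence "e / (2 * (C + 1)) > 0" using g by simp
   from close[OF this] show "eventually (%n. dist (resolvent k (w (t n)) x) (resolvent k aL x) < e) sequentially"
   proof eventually_elim
    fix n assume n: "ALL y. norm (w (t n) y - aL y) <= e / (2 * (C + 1)) * jp y aa"
    have "resolvent k (w (t n)) x - resolvent k aL x = resolvent k (%y. w (t n) y - aL y) x"
     by (rule resolvent_diff[OF N k aa wm wb aLm aLb])
    also have "norm ... <= C * (e / (2 * (C + 1))) * jp x g"
     using gC[rule_format, of "%y. w (t n) y - aL y" "e / (2 * (C + 1))" x] n borel_measurable_diff[OF wm aLm] by blast
    also have "... <= C * (e / (2 * (C + 1))) * 1" using jb_powr_antimono[of 0 g x] g e by (intro mult_left_mono) auto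
    also have "... < e"
    proof -
     have "C * (e / (2 * (C + 1))) = C / (C + 1) * (e / 2)" using g by (simp add: divide_simps)
     also have "... <= 1 * (e / 2)" using g e by (intro mult_right_mono) auto
     also have "... < e" using e by simp
     finally show ?thesis by (simp only: mult_1_right)
    qed
    finally show "dist (resolvent k (w (t n)) x) (resolvent k aL x) < e" by (simp add: dist_norm)
   qed
  qed
  hence "(%n. c (t n) *R resolvent k (w (t n)) x) ----> l *R resolvent k aL x" by (intro tendsto_scaleR cl)
  hence "(%n. bcf (z (t n)) x) ----> l *R resolvent k aL x" unfolding zeq .
  moreover have "(%n. bcf (z (t n)) x) ----> bcf L x"
   using tendsto_uniform_limitI[OF tendsto_bcontfun_uniform_limit[OF zl], of x] by simp
  ultimately show ?thesis by (rule LIMSEQ_unique[rotated])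
 qed
 have "bcf L x = 0" for x
 \<comment> \<open>The limit l of the scalars moves into the coefficient; being real, it leaves
   \<open>l * a\<close> real, continuous and of the same decay.\<close>
 proof (rule resolvent_equation_unique[OF N k aa, where a = "%y. l * a y" and Ca = "abs l * Ca" and U = 1])
  show "cont (%y. l * a y)" by (intro continuous_intros ac)
  show "abs (l * a x) <= abs l * Ca * jp x aa" for x using mult_left_mono[OF Ca(2)[of x], of "abs l"] by (simp add: abs_mult mult.assoc)
  show "norm (bcf L x) <= 1" for x using norm_bounded[of L x] nL by simp
  show "bcf L x = resolvent k (%y. cor (l * a y) * bcf L y) x" for x
  proof -
   have "(%y. cor (l * a y) * bcf L y) = (%y. l *R aL y)" by (simp add: aL_def scaleR_conv_of_real mult.assoc)
   thus ?thesis using Leq[of x] by (simp only: resolvent_scale)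
  qed
 qed simp
 hence "norm L <= 0" by (intro norm_bound) simp
 thus False using nL by simp
qed

theorem theorem1p2:
  fixes k \<alpha> :: real
    and f :: "real^'n \<Rightarrow> complex \<Rightarrow> complex"
    and \<phi> :: "real^'n \<Rightarrow> complex"
  assumes "CARD('n) \<ge> 3"
    and "k > 0"
    and "\<alpha> > (real CARD('n) + 1) / 2"
    and "continuous_on UNIV (\<lambda>(x, u). f x u)"
    and "\<forall>M>0. growth \<alpha> f M < \<infinity>"
    and "(\<exists>(a :: real^'n \<Rightarrow> real) (b :: real^'n \<Rightarrow> complex \<Rightarrow> complex).
            a \<in> wLinf \<alpha> \<and>
            (\<forall>x u. f x u = complex_of_real (a x) * u + b x u) \<and>
            ((\<lambda>M. growth \<alpha> b M / ereal M) \<longlongrightarrow> 0) at_top)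
       \<or> (\<exists>(Q :: real^'n \<Rightarrow> real) (b :: real^'n \<Rightarrow> real).
            Q \<in> wLinf \<alpha> \<and> b \<in> wLinf \<alpha> \<and>
            wLinf_norm \<alpha> Q < 1 / kappa TYPE('n) k \<alpha> \<and>
            (\<forall>x u. cmod (f x u) \<le> Q x * cmod u + b x))"
    and "\<phi> \<in> Linf"
    and "helmholtz_solution k \<phi>"
  shows "\<exists>u \<in> Linf. AE x in lebesgue. u x = resolvent k (subst_op f u) x + \<phi> x"
proof -
 note N = assms(1) and k = assms(2) and \<alpha> = assms(3) and f = assms(4)
 have fb: "EX A>=0. ALL x u. cmod u <= M --> cmod (f x u) <= A * jb x powr (-\<alpha>)" for M
 proof -
  \<comment> \<open>The growth assumption concerns positive radii; a larger radius also serves all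
    smaller or negative ones.\<close>
  have "growth \<alpha> f (max M 1) < \<infinity>" using assms(5) by simp
  then obtain A where "A >= 0" "ALL x u. cmod u <= max M 1 --> cmod (f x u) <= A * jb x powr (-\<alpha>)" using growth_bound_exists by blast
  thus ?thesis by (intro exI[of _ A]) auto
 qed
 have \<phi>m: "\<phi> : Lmeas" and \<phi>n: "Linf_norm \<phi> < \<infinity>" using assms(7) by (auto simp: Linf_def)
 obtain B where B: "Linf_norm \<phi> <= ereal B" "B >= 0"
 proof -
  obtain B where "Linf_norm \<phi> < ereal B" using \<phi>n less_PInf_Ex_of_nat by auto
  hence "Linf_norm \<phi> <= ereal (max B 0)" by (metis ereal_less_eq(3) less_imp_le max.cobounded1 order_trans)
  thus ?thesis by (rule that) simp
 qed
 have "AE x in lebesgue. ereal (cmod (\<phi> x)) <= Linf_norm \<phi>" unfolding Linf_norm_def by (rule esssup_AE)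
 hence \<phi>ae: "AE x in lebesgue. cmod (\<phi> x) <= B" by eventually_elim (use B(1) in "auto dest: order_trans")
 \<comment> \<open>A representative that is bounded at every point. It differs from the given
   function on a null set only, so the final identity still holds almost everywhere.\<close>
 define \<phi>' where "\<phi>' x = (if cmod (\<phi> x) <= B then \<phi> x else 0)" for x
 have \<phi>': "\<phi>' : Lmeas" "!!x. cmod (\<phi>' x) <= B"
  unfolding \<phi>'_def[abs_def] using \<phi>m B(2) by (measurable, auto)
 have "EX R. ALL c (v :: (real^'n) \<Rightarrow>\<^sub>C complex). 0 <= c --> c <= 1 -->
   (ALL x. bcf v x = c *R resolvent k (%y. f y (bcf v y + \<phi>' y)) x) --> norm v < R"
  using assms(6)
 proof
  assume "EX (a :: real^'n => real) (b :: real^'n => complex => complex).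
      a : wLinf \<alpha> &
      (ALL x u. f x u = cor (a x) * u + b x u) &
      ((%M. growth \<alpha> b M / ereal M) \<longlongrightarrow> 0) at_top"
  then obtain a :: "real^'n => real" and b where dec: "!!x u. f x u = cor (a x) * u + b x u"
   and b: "((%M. growth \<alpha> b M / ereal M) \<longlongrightarrow> 0) at_top" by blast
  show ?thesis by (rule apriori_bound_asymptotically_linear[where f = f and a = a and b = b, OF N k \<alpha> f fb dec growth_sublinear[OF b] \<phi>'])
 next
  assume "EX (Q :: real^'n => real) (b :: real^'n => real).
      Q : wLinf \<alpha> & b : wLinf \<alpha> &
      wLinf_norm \<alpha> Q < 1 / kappa TYPE('n) k \<alpha> &
      (ALL x u. cmod (f x u) <= Q x * cmod u + b x)"
  then obtain Q b :: "real^'n => real" where Q: "Q : wLinf \<alpha>" and b: "b : wLinf \<alpha>"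
   and lt: "wLinf_norm \<alpha> Q < 1 / kappa TYPE('n) k \<alpha>" and le: "!!x u. cmod (f x u) <= Q x * cmod u + b x" by blast
  show ?thesis by (rule apriori_bound_sublinear[OF N k \<alpha> Q b lt le \<phi>'(2)])
 qed
 then obtain R where R: "!!c (v :: (real^'n) \<Rightarrow>\<^sub>C complex). 0 <= c ==> c <= 1 ==>
   (ALL x. bcf v x = c *R resolvent k (%y. f y (bcf v y + \<phi>' y)) x) ==> norm v < R" by blast
 have "EX v :: (real^'n) \<Rightarrow>\<^sub>C complex. ALL x. bcf v x = resolvent k (%y. f y (bcf v y + \<phi>' y)) x"
 proof (rule solution_of_apriori_bound[OF N k \<alpha> f fb \<phi>'])
  fix c and v :: "(real^'n) \<Rightarrow>\<^sub>C complex"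
  assume "0 <= c" "c <= 1" "!!x. bcf v x = c *R resolvent k (%y. f y (bcf v y + \<phi>' y)) x"
  thus "norm v < R" by (intro R allI)
 qed
 then obtain v :: "(real^'n) \<Rightarrow>\<^sub>C complex" where v: "!!x. bcf v x = resolvent k (%y. f y (bcf v y + \<phi>' y)) x" by blast
 define u where "u x = bcf v x + \<phi>' x" for x
 show ?thesis
 proof (rule bexI[of _ u])
  have "bcf v : bmeas" by (rule borel_measurable_continuous_onI) simp
  hence "bcf v : Lmeas" by (intro measurable_completion) simp
  hence um: "u : Lmeas" unfolding u_def[abs_def] using \<phi>'(1) by (rule borel_measurable_add)
  have "cmod (u x) <= norm v + B" for x
   using norm_triangle_ineq[of "bcf v x" "\<phi>' x"] norm_bounded[of v x] \<phi>'(2)[of x] unfolding u_def by linarith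
  hence "Linf_norm u <= ereal (norm v + B)" unfolding Linf_norm_def using um by (intro esssup_I) auto
  thus "u : Linf" using um by (auto simp: Linf_def intro: le_less_trans)
  have s: "subst_op f u = (%y. f y (bcf v y + \<phi>' y))" by (rule ext) (simp add: subst_op_def u_def)
  show "AE x in lebesgue. u x = resolvent k (subst_op f u) x + \<phi> x"
   using \<phi>ae
  proof eventually_elim
   fix x assume "cmod (\<phi> x) <= B"
   hence "\<phi>' x = \<phi> x" by (simp add: \<phi>'_def)
   thus "u x = resolvent k (subst_op f u) x + \<phi> x" unfolding s v[symmetric] u_def by simp
  qed
 qed
qed

end
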